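(* Suppose that the FBSDE $$ \begin{aligned} d\mathbf x^{\mathcal P}(t)&=\big(\mathbf A\mathbf x^{\mathcal P}(t)-\mathbf B^{\mathcal P}\mathbf p^{\mathcal P}(t)\big)dt+\mathbf\Sigma\, d\mathbf W(t),\\ -d\mathbf p^{\mathcal P}(t)&=\big(\mathbf C^{\mathcal P}\mathbf p^{\mathcal P}(t)+\mathbf D^{\mathcal P}\mathbf x^{\mathcal P}(t)+\mathbf M^{\mathcal P}\big)dt-\mathbf Z^{\mathcal P}(t)d\mathbf W(t),\\ \mathbf x^{\mathcal P}(0)&=\mathbf x_0,\qquad \mathbf p^{\mathcal P}(T)=\mathbf E^{\mathcal P}\mathbf x^{\mathcal P}(T)+\mathbf h^{\mathcal P} \end{aligned} $$ admits a unique solution, with components $\mathbf x^{\mathcal P}=(x_\alpha^{\mathcal P},x_\beta^{\mathcal P},z^{\mathcal P},s_\alpha^{\mathcal P},s_\beta^{\mathcal P})$ and $\mathbf p^{\mathcal P}=(p_\alpha^{\mathcal P},p_\beta^{\mathcal P},\zeta^{\mathcal P},r_\alpha^{\mathcal P},r_\beta^{\mathcal P})$. Then the pair of optimal controls of the Pareto game between the two leaders is given, for $0\le t\le T$, by $$(u_\alpha^{\mathcal P}(t),u_\beta^{\mathcal P}(t))=\big(-R_\alpha^{-1}D_\alpha^\top p_\alpha^{\mathcal P}(t),\,-R_\beta^{-1}D_\beta^\top p_\beta^{\mathcal P}(t)\big).$$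
   Context: **Coefficients.** All coefficients are constant: $A_\alpha\in\mathbb R^{n_\alpha\times n_\alpha}$, $B_\alpha,G_\alpha,\bar G_\alpha\in\mathbb R^{n_\alpha\times n_\beta}$, $C_\alpha,F_\alpha,\bar F_\alpha\in\mathbb R^{n_\alpha\times n_1}$, $D_\alpha\in\mathbb R^{n_\alpha\times m_\alpha}$, $A_\beta,G_\beta,\bar G_\beta\in\mathbb R^{n_\beta\times n_\alpha}$, $B_\beta\in\mathbb R^{n_\beta\times n_\beta}$, $C_\beta,F_\beta,\bar F_\beta\in\mathbb R^{n_\beta\times n_1}$, $D_\beta\in\mathbb R^{n_\beta\times m_\beta}$, $A_1,B_1,F_1,\bar F_1\in\mathbb R^{n_1\times n_1}$, $C_1,G_1,\bar G_1\in\mathbb R^{n_1\times n_\alpha}$, $D_1,H_1,\bar H_1\in\mathbb R^{n_1\times n_\beta}$, $E_1\in\mathbb R^{n_1\times m_1}$, vectors $M_\gamma,\bar M_\gamma\in\mathbb R^{n_\gamma}$ and $\sigma_\gamma\in\mathbb R^{n_\gamma\times d_\gamma}$ for $\gamma\in\{\alpha,\beta,1\}$. $D_\alpha,D_\beta,E_1$ have full column rank; $Q_\gamma\in\mathbb R^{n_\gamma\times n_\gamma}$, $R_\gamma\in\mathbb R^{m_\gamma\times m_\gamma}$ are (symmetric) positive definite and $\bar Q_\gamma\in\mathbb R^{n_\gamma\times n_\gamma}$ (symmetric) positive semi-definite. **Game.** On a complete probability space let $W^\alpha,W^\beta,W^1$ be independent Wiener processes in $\mathbb R^{d_\alpha},\mathbb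 R^{d_\beta},\mathbb R^{d_1}$, and $\eta_\alpha,\eta_\beta,\eta_1$ independent square-integrable random vectors in $\mathbb R^{n_\alpha},\mathbb R^{n_\beta},\mathbb R^{n_1}$, independent of the Wiener processes; $\mathcal F^\gamma_t=\sigma(\eta_\gamma,W^\gamma(s):s\le t)$; $T>0$ is fixed. Write $|x|^2_{\mathcal Q}=\langle x,\mathcal Qx\rangle$. For $\gamma=\alpha,\beta$ (the index $\alpha+\beta-\gamma$ denotes the other leader), the leaders' states and the representative follower's state are $$dx_\gamma=(A_\gamma x_\alpha+B_\gamma x_\beta+C_\gamma z+D_\gamma v_\gamma)dt+\sigma_\gamma dW^\gamma,\quad x_\gamma(0)=\eta_\gamma,$$ $$dx_1=(A_1x_1+B_1z+C_1x_\alpha+D_1x_\beta+E_1v_1)dt+\sigma_1dW^1,\quad x_1(0)=\eta_1,$$ with costs $$J_\gamma(v_\gamma;v_{\alpha+\beta-\gamma})=\mathbb E\Big[\int_0^T\big(|x_\gamma-F_\gamma z-G_\gamma x_{\alpha+\beta-\gamma}-M_\gamma|^2_{Q_\gamma}+|v_\gamma|^2_{R_\gamma}\big)dt+|x_\gamma(T)-\bar F_\gamma z(T)-\bar G_\gamma x_{\alpha+\beta-\gamma}(T)-\bar M_\gamma|^2_{\bar Q_\gamma}\Big],$$ $$J_1(v_1;x_\alpha,x_\beta,z)=\mathbb E\Big[\int_0^T\big(|x_1-F_1z-G_1x_\alpha-H_1x_\beta-M_1|^2_{Q_1}+|v_1|^2_{R_1}\big)dt+|x_1(T)-\bar F_1z(T)-\bar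 G_1x_\alpha(T)-\bar H_1x_\beta(T)-\bar M_1|^2_{\bar Q_1}\Big].$$ Follower's problem: given $x_\alpha,x_\beta,z$, minimize $J_1$ over square-integrable $v_1$ adapted to $\mathcal F^\alpha\vee\mathcal F^\beta\vee\mathcal F^1$. Mean field equilibrium: given $x_\alpha,x_\beta$, $z$ is the $\mathcal F^\alpha\vee\mathcal F^\beta$-adapted process with $z(t)=\mathbb E[x_1(t)\mid\mathcal F^\alpha_t\vee\mathcal F^\beta_t]$, where $x_1$ is the optimally controlled follower state. Leaders' game: admissible controls $v_\alpha,v_\beta$ are square-integrable, $\mathcal F^\alpha\vee\mathcal F^\beta$-adapted, with values in $\mathbb R^{m_\alpha},\mathbb R^{m_\beta}$; the process $z$ in $J_\alpha,J_\beta$ is endogenous, i.e. $(x_\alpha,x_\beta,z)$ is jointly determined by $(v_\alpha,v_\beta)$ through the leaders' state equations and the mean field equilibrium. Standing assumption: the follower and mean field problems are solvable, so that $(x_\alpha,x_\beta,z)$ is well defined (uniquely) for every admissible pair $(v_\alpha,v_\beta)$. **Pareto game.** The optimal controls are defined by $(u_\alpha^{\mathcal P},u_\beta^{\mathcal P})=\arg\min_{v_\alpha,v_\beta}\big(J_\alpha(v_\alpha;v_\beta)+J_\beta(v_\beta;v_\alpha)\big)$. **Matrices.** $0$ and $I$ denote zero and identity blocks of appropriate sizes. $$\mathbf A=\begin{pmatrix}A_\alpha&B_\alpha&C_\alpha&0&0\\ A_\beta&B_\beta&C_\beta&0&0\\ C_1&D_1&A_1+B_1&0&0\\ 0&0&0&A_1&0\\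 0&0&0&0&A_1\end{pmatrix},$$ $$\mathbf B^{\mathcal N}=\begin{pmatrix}D_\alpha R_\alpha^{-1}D_\alpha^\top&0&0&0&0&0&0\\ 0&D_\beta R_\beta^{-1}D_\beta^\top&0&0&0&0&0\\ 0&0&E_1R_1^{-1}E_1^\top&0&0&0&0\\ 0&0&0&E_1R_1^{-1}E_1^\top&0&0&0\\ 0&0&0&0&E_1R_1^{-1}E_1^\top&0&0\end{pmatrix},$$ $$\mathbf C^{\mathcal N}=\begin{pmatrix}A_\alpha^\top&0&0&C_1^\top&0&A_\beta^\top&0\\ 0&B_\beta^\top&0&0&D_1^\top&0&B_\alpha^\top\\ 0&0&A_1^\top&0&0&0&0\\ C_\alpha^\top&0&0&(A_1+B_1)^\top&0&C_\beta^\top&0\\ 0&C_\beta^\top&0&0&(A_1+B_1)^\top&0&C_\alpha^\top\\ B_\alpha^\top&0&0&D_1^\top&0&B_\beta^\top&0\\ 0&A_\beta^\top&0&0&C_1^\top&0&A_\alpha^\top\end{pmatrix},$$ $$\mathbf D^{\mathcal N}=\begin{pmatrix}Q_\alpha&-Q_\alpha G_\alpha&-Q_\alpha F_\alpha&-(Q_1G_1)^\top&0\\ -Q_\beta G_\beta&Q_\beta&-Q_\beta F_\beta&0&-(Q_1H_1)^\top\\ -Q_1G_1&-Q_1H_1&Q_1(I-F_1)&0&0\\ -(Q_\alpha F_\alpha)^\top&(Q_\alpha F_\alpha)^\top G_\alpha&(Q_\alpha F_\alpha)^\top F_\alpha&(Q_1(I-F_1))^\top&0\\ (Q_\beta F_\beta)^\top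 G_\beta&-(Q_\beta F_\beta)^\top&(Q_\beta F_\beta)^\top F_\beta&0&(Q_1(I-F_1))^\top\\ -(Q_\alpha G_\alpha)^\top&(Q_\alpha G_\alpha)^\top G_\alpha&(Q_\alpha G_\alpha)^\top F_\alpha&-(Q_1H_1)^\top&0\\ (Q_\beta G_\beta)^\top G_\beta&-(Q_\beta G_\beta)^\top&(Q_\beta G_\beta)^\top F_\beta&0&-(Q_1G_1)^\top\end{pmatrix},$$ $$\mathbf M^{\mathcal N}=\begin{pmatrix}-Q_\alpha M_\alpha\\ -Q_\beta M_\beta\\ -Q_1M_1\\ (Q_\alpha F_\alpha)^\top M_\alpha\\ (Q_\beta F_\beta)^\top M_\beta\\ (Q_\alpha G_\alpha)^\top M_\alpha\\ (Q_\beta G_\beta)^\top M_\beta\end{pmatrix},\quad\mathbf\Sigma=\begin{pmatrix}\sigma_\alpha&0\\ 0&\sigma_\beta\\ 0&0\\ 0&0\\ 0&0\end{pmatrix},\quad\mathbf W=\begin{pmatrix}W^\alpha\\ W^\beta\end{pmatrix},\quad\mathbf x_0=\begin{pmatrix}\eta_\alpha\\ \eta_\beta\\ \mathbb E[\eta_1]\\ 0\\ 0\end{pmatrix}.$$ $\mathbf E^{\mathcal N}$ and $\mathbf h^{\mathcal N}$ are obtained from $\mathbf D^{\mathcal N}$ and $\mathbf M^{\mathcal N}$, respectively, by replacing every $Q_\gamma,F_\gamma,G_\gamma,H_1,M_\gamma$ ($\gamma\in\{\alpha,\beta,1\}$) by its barred counterpart. With $$\mathbf I_1=\begin{pmatrix}I&0&0&0&0&0&I\\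 0&I&0&0&0&I&0\\ 0&0&I&0&0&0&0\\ 0&0&0&I&0&0&0\\ 0&0&0&0&I&0&0\end{pmatrix},\qquad \mathbf I_2=\begin{pmatrix}I&0&0&0&0\\ 0&I&0&0&0\\ 0&0&I&0&0\\ 0&0&0&I&0\\ 0&0&0&0&I\\ 0&0&0&0&0\\ 0&0&0&0&0\end{pmatrix}$$ (block sizes $n_\alpha,n_\beta,n_1,n_1,n_1$, and additionally $n_\beta,n_\alpha$ for the last two), set $$\mathbf B^{\mathcal P}=\mathbf B^{\mathcal N}\mathbf I_2,\ \mathbf C^{\mathcal P}=\mathbf I_1\mathbf C^{\mathcal N}\mathbf I_2,\ \mathbf D^{\mathcal P}=\mathbf I_1\mathbf D^{\mathcal N},\ \mathbf E^{\mathcal P}=\mathbf I_1\mathbf E^{\mathcal N},\ \mathbf M^{\mathcal P}=\mathbf I_1\mathbf M^{\mathcal N},\ \mathbf h^{\mathcal P}=\mathbf I_1\mathbf h^{\mathcal N}.$$ Solutions of the FBSDE are square-integrable $\mathcal F^\alpha\vee\mathcal F^\beta$-adapted. *)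

theory Defs
  imports "HOL-Probability.Probability"
begin

section \<open>Matrices\<close>

text \<open>
  Block rows and block columns: the index type of a block row (column) is the sum of the index
  types of the blocks. \<open>\<sslash>\<close> stacks vectors as well as matrices, a matrix being the vector
  of its rows.
\<close>

definition vstack :: "'e ^ 'p::finite \<Rightarrow> 'e ^ 'q::finite \<Rightarrow> 'e ^ ('p + 'q)"  (infixr \<open>\<sslash>\<close> 61) where
  "u \<sslash> v = (\<chi> i. case i of Inl a \<Rightarrow> u $ a | Inr b \<Rightarrow> v $ b)"

definition hstack :: "'e ^ 'p::finite ^ 'm \<Rightarrow> 'e ^ 'q::finite ^ 'm \<Rightarrow> 'e ^ ('p + 'q) ^ 'm"
    (infixr \<open>\<brokenbar>\<close> 62) where
  "A \<brokenbar> B = (\<chi> i. A $ i \<sslash> B $ i)"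

definition head_block :: "'e ^ ('p::finite + 'q::finite) \<Rightarrow> 'e ^ 'p" where
  "head_block v = (\<chi> i. v $ Inl i)"

definition tail_block :: "'e ^ ('p::finite + 'q::finite) \<Rightarrow> 'e ^ 'q" where
  "tail_block v = (\<chi> i. v $ Inr i)"

definition qform :: "real ^ 'n ^ 'n \<Rightarrow> real ^ 'n \<Rightarrow> real" where
  "qform Q x = x \<bullet> (Q *v x)"

definition pos_definite :: "real ^ 'n ^ 'n \<Rightarrow> bool" where
  "pos_definite Q \<longleftrightarrow> transpose Q = Q \<and> (\<forall>x. x \<noteq> 0 \<longrightarrow> qform Q x > 0)"

definition pos_semidefinite :: "real ^ 'n ^ 'n \<Rightarrow> bool" where
  "pos_semidefinite Q \<longleftrightarrow> transpose Q = Q \<and> (\<forall>x. qform Q x \<ge> 0)"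

definition full_column_rank :: "real ^ 'm ^ 'n \<Rightarrow> bool" where
  "full_column_rank D \<longleftrightarrow> rank D = CARD('m)"


section \<open>Processes\<close>

text \<open>Sigma-algebras generated by a random variable, by a process on \<open>[0, \<infinity>)\<close>, and the history
  \<open>\<sigma>(\<eta>, W(s) : s \<le> t)\<close> (not augmented by null sets).\<close>

definition sigma_of_rv :: "'w measure \<Rightarrow> ('w \<Rightarrow> 'e::topological_space) \<Rightarrow> 'w set set" where
  "sigma_of_rv M X = sigma_sets (space M) {X -` A \<inter> space M | A. A \<in> sets borel}"

definition sigma_of_process :: "'w measure \<Rightarrow> (real \<Rightarrow> 'w \<Rightarrow> 'e::topological_space) \<Rightarrow> 'w set set" where
  "sigma_of_process M W =
     sigma_sets (space M) {W s -` A \<inter> space M | s A. 0 \<le> s \<and> A \<in> sets borel}"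

definition history ::
    "'w measure \<Rightarrow> ('w \<Rightarrow> 'e::topological_space) \<Rightarrow> (real \<Rightarrow> 'w \<Rightarrow> 'f::topological_space)
      \<Rightarrow> real \<Rightarrow> 'w measure" where
  "history M \<eta> W t = sigma (space M)
     ({\<eta> -` A \<inter> space M | A. A \<in> sets borel} \<union>
      {W s -` A \<inter> space M | s A. 0 \<le> s \<and> s \<le> t \<and> A \<in> sets borel})"

definition join_filtration ::
    "(real \<Rightarrow> 'w measure) \<Rightarrow> (real \<Rightarrow> 'w measure) \<Rightarrow> real \<Rightarrow> 'w measure" where
  "join_filtration F H t = sigma (space (F t)) (sets (F t) \<union> sets (H t))"

definition brownian_motion :: "'w measure \<Rightarrow> (real \<Rightarrow> 'w \<Rightarrow> real) \<Rightarrow> bool" where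
  "brownian_motion M B \<longleftrightarrow>
     (\<forall>t\<ge>0. B t \<in> borel_measurable M) \<and>
     (AE \<omega> in M. B 0 \<omega> = 0) \<and>
     (AE \<omega> in M. continuous_on {0..} (\<lambda>t. B t \<omega>)) \<and>
     (\<forall>s t. 0 \<le> s \<and> s < t \<longrightarrow>
        distributed M lborel (\<lambda>\<omega>. B t \<omega> - B s \<omega>) (normal_density 0 (sqrt (t - s)))) \<and>
     (\<forall>n (\<tau> :: nat \<Rightarrow> real). 0 \<le> \<tau> 0 \<and> (\<forall>i<n. \<tau> i \<le> \<tau> (Suc i)) \<longrightarrow>
        prob_space.indep_vars M (\<lambda>_. borel) (\<lambda>i \<omega>. B (\<tau> (Suc i)) \<omega> - B (\<tau> i) \<omega>) {..<n})"

definition wiener_process :: "'w measure \<Rightarrow> (real \<Rightarrow> 'w \<Rightarrow> real ^ 'd) \<Rightarrow> bool" where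
  "wiener_process M W \<longleftrightarrow>
     (\<forall>i. brownian_motion M (\<lambda>t \<omega>. W t \<omega> $ i)) \<and>
     prob_space.indep_sets M (\<lambda>i. sigma_of_process M (\<lambda>t \<omega>. W t \<omega> $ i)) UNIV"

definition square_integrable_rv :: "'w measure \<Rightarrow> ('w \<Rightarrow> 'e::real_normed_vector) \<Rightarrow> bool" where
  "square_integrable_rv M X \<longleftrightarrow>
     X \<in> borel_measurable M \<and> integrable M (\<lambda>\<omega>. (norm (X \<omega>))\<^sup>2)"

text \<open>The measure \<open>dt \<otimes> dP\<close> on \<open>[0, T] \<times> \<Omega>\<close>.\<close>

definition time_prob :: "real \<Rightarrow> 'w measure \<Rightarrow> (real \<times> 'w) measure" where
  "time_prob T M = restrict_space lborel {0..T} \<Otimes>\<^sub>M M"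

definition L2_adapted ::
    "real \<Rightarrow> 'w measure \<Rightarrow> (real \<Rightarrow> 'w measure) \<Rightarrow> (real \<Rightarrow> 'w \<Rightarrow> 'e::real_normed_vector) \<Rightarrow> bool" where
  "L2_adapted T M F x \<longleftrightarrow>
     (\<lambda>(t, \<omega>). x t \<omega>) \<in> borel_measurable (time_prob T M) \<and>
     (\<forall>t\<in>{0..T}. x t \<in> borel_measurable (F t)) \<and>
     (\<integral>\<^sup>+(t, \<omega>). ennreal ((norm (x t \<omega>))\<^sup>2) \<partial>time_prob T M) < \<infinity>"

definition modification ::
    "real \<Rightarrow> 'w measure \<Rightarrow> (real \<Rightarrow> 'w \<Rightarrow> 'e) \<Rightarrow> (real \<Rightarrow> 'w \<Rightarrow> 'e) \<Rightarrow> bool" where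
  "modification T M x y \<longleftrightarrow> (\<forall>t\<in>{0..T}. AE \<omega> in M. x t \<omega> = y t \<omega>)"

definition conditional_expectation ::
    "'w measure \<Rightarrow> 'w measure \<Rightarrow> ('w \<Rightarrow> real ^ 'n) \<Rightarrow> 'w \<Rightarrow> real ^ 'n" where
  "conditional_expectation M F X \<omega> = (\<chi> i. real_cond_exp M F (\<lambda>\<omega>. X \<omega> $ i) \<omega>)"

text \<open>
  The Ito integral \<open>I(t) = \<integral>\<^sub>0\<^sup>t Z dW\<close> on \<open>[0, T]\<close> of a square-integrable adapted matrix-valued
  integrand, as the mean-square limit of the integrals of simple integrands
  \<open>\<Sum>i<n. 1\<^bsub>(\<tau> i, \<tau> (i+1)]\<^esub> \<xi> i\<close>, with \<open>\<xi> i\<close> bounded and measurable at time \<open>\<tau> i\<close>.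
  It is determined up to modification.
\<close>

definition simple_integrand ::
    "real \<Rightarrow> 'w measure \<Rightarrow> (real \<Rightarrow> 'w measure) \<Rightarrow> nat \<Rightarrow> (nat \<Rightarrow> real)
      \<Rightarrow> (nat \<Rightarrow> 'w \<Rightarrow> real ^ 'd ^ 'n) \<Rightarrow> bool" where
  "simple_integrand T M F n \<tau> \<xi> \<longleftrightarrow>
     \<tau> 0 = 0 \<and> \<tau> n = T \<and> (\<forall>i<n. \<tau> i < \<tau> (Suc i)) \<and>
     (\<forall>i<n. \<xi> i \<in> borel_measurable (F (\<tau> i)) \<and> (\<exists>K. \<forall>\<omega>\<in>space M. norm (\<xi> i \<omega>) \<le> K))"

definition simple_path ::
    "nat \<Rightarrow> (nat \<Rightarrow> real) \<Rightarrow> (nat \<Rightarrow> 'w \<Rightarrow> real ^ 'd ^ 'n) \<Rightarrow> real \<Rightarrow> 'w \<Rightarrow> real ^ 'd ^ 'n" where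
  "simple_path n \<tau> \<xi> t \<omega> = (\<Sum>i<n. indicator {\<tau> i<..\<tau> (Suc i)} t *\<^sub>R \<xi> i \<omega>)"

definition simple_ito ::
    "(real \<Rightarrow> 'w \<Rightarrow> real ^ 'd) \<Rightarrow> nat \<Rightarrow> (nat \<Rightarrow> real) \<Rightarrow> (nat \<Rightarrow> 'w \<Rightarrow> real ^ 'd ^ 'n)
      \<Rightarrow> real \<Rightarrow> 'w \<Rightarrow> real ^ 'n" where
  "simple_ito W n \<tau> \<xi> t \<omega> =
     (\<Sum>i<n. \<xi> i \<omega> *v (W (min t (\<tau> (Suc i))) \<omega> - W (min t (\<tau> i)) \<omega>))"

definition ito_integral ::
    "real \<Rightarrow> 'w measure \<Rightarrow> (real \<Rightarrow> 'w measure) \<Rightarrow> (real \<Rightarrow> 'w \<Rightarrow> real ^ 'd)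
      \<Rightarrow> (real \<Rightarrow> 'w \<Rightarrow> real ^ 'd ^ 'n) \<Rightarrow> (real \<Rightarrow> 'w \<Rightarrow> real ^ 'n) \<Rightarrow> bool" where
  "ito_integral T M F W Z I \<longleftrightarrow>
     L2_adapted T M F Z \<and> (\<forall>t\<in>{0..T}. I t \<in> borel_measurable M) \<and>
     (\<exists>N \<tau> \<xi>. (\<forall>k. simple_integrand T M F (N k) (\<tau> k) (\<xi> k)) \<and>
        ((\<lambda>k. \<integral>\<^sup>+(t, \<omega>). ennreal ((norm (Z t \<omega> - simple_path (N k) (\<tau> k) (\<xi> k) t \<omega>))\<^sup>2)
           \<partial>time_prob T M) \<longlonglongrightarrow> 0) \<and>
        (\<forall>t\<in>{0..T}.
          (\<lambda>k. \<integral>\<^sup>+\<omega>. ennreal ((norm (I t \<omega> - simple_ito W (N k) (\<tau> k) (\<xi> k) t \<omega>))\<^sup>2) \<partial>M)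
            \<longlonglongrightarrow> 0))"


section \<open>Data of the game\<close>

text \<open>The barred coefficients are the fields \<open>Fb\<close>, \<open>Gb\<close>, \<open>Hb\<close>, \<open>Qb\<close>, \<open>Mb\<close>.\<close>

record ('na, 'nb, 'n1, 'ma, 'mb, 'm1, 'da, 'db, 'd1) game =
  horizon :: real
  A\<^sub>\<alpha> :: "real ^ 'na::finite ^ 'na"
  B\<^sub>\<alpha> :: "real ^ 'nb::finite ^ 'na"
  C\<^sub>\<alpha> :: "real ^ 'n1::finite ^ 'na"
  D\<^sub>\<alpha> :: "real ^ 'ma::finite ^ 'na"
  \<sigma>\<^sub>\<alpha> :: "real ^ 'da::finite ^ 'na"
  F\<^sub>\<alpha> :: "real ^ 'n1 ^ 'na"
  G\<^sub>\<alpha> :: "real ^ 'nb ^ 'na"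
  M\<^sub>\<alpha> :: "real ^ 'na"
  Q\<^sub>\<alpha> :: "real ^ 'na ^ 'na"
  R\<^sub>\<alpha> :: "real ^ 'ma ^ 'ma"
  Fb\<^sub>\<alpha> :: "real ^ 'n1 ^ 'na"
  Gb\<^sub>\<alpha> :: "real ^ 'nb ^ 'na"
  Mb\<^sub>\<alpha> :: "real ^ 'na"
  Qb\<^sub>\<alpha> :: "real ^ 'na ^ 'na"
  A\<^sub>\<beta> :: "real ^ 'na ^ 'nb"
  B\<^sub>\<beta> :: "real ^ 'nb ^ 'nb"
  C\<^sub>\<beta> :: "real ^ 'n1 ^ 'nb"
  D\<^sub>\<beta> :: "real ^ 'mb::finite ^ 'nb"
  \<sigma>\<^sub>\<beta> :: "real ^ 'db::finite ^ 'nb"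
  F\<^sub>\<beta> :: "real ^ 'n1 ^ 'nb"
  G\<^sub>\<beta> :: "real ^ 'na ^ 'nb"
  M\<^sub>\<beta> :: "real ^ 'nb"
  Q\<^sub>\<beta> :: "real ^ 'nb ^ 'nb"
  R\<^sub>\<beta> :: "real ^ 'mb ^ 'mb"
  Fb\<^sub>\<beta> :: "real ^ 'n1 ^ 'nb"
  Gb\<^sub>\<beta> :: "real ^ 'na ^ 'nb"
  Mb\<^sub>\<beta> :: "real ^ 'nb"
  Qb\<^sub>\<beta> :: "real ^ 'nb ^ 'nb"
  A\<^sub>1 :: "real ^ 'n1 ^ 'n1"
  B\<^sub>1 :: "real ^ 'n1 ^ 'n1"
  C\<^sub>1 :: "real ^ 'na ^ 'n1"
  D\<^sub>1 :: "real ^ 'nb ^ 'n1"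
  E\<^sub>1 :: "real ^ 'm1::finite ^ 'n1"
  \<sigma>\<^sub>1 :: "real ^ 'd1::finite ^ 'n1"
  F\<^sub>1 :: "real ^ 'n1 ^ 'n1"
  G\<^sub>1 :: "real ^ 'na ^ 'n1"
  H\<^sub>1 :: "real ^ 'nb ^ 'n1"
  M\<^sub>1 :: "real ^ 'n1"
  Q\<^sub>1 :: "real ^ 'n1 ^ 'n1"
  R\<^sub>1 :: "real ^ 'm1 ^ 'm1"
  Fb\<^sub>1 :: "real ^ 'n1 ^ 'n1"
  Gb\<^sub>1 :: "real ^ 'na ^ 'n1"
  Hb\<^sub>1 :: "real ^ 'nb ^ 'n1"
  Mb\<^sub>1 :: "real ^ 'n1"
  Qb\<^sub>1 :: "real ^ 'n1 ^ 'n1"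

record ('w, 'na, 'nb, 'n1, 'da, 'db, 'd1) noise =
  prob_measure :: "'w measure"
  W\<^sub>\<alpha> :: "real \<Rightarrow> 'w \<Rightarrow> real ^ 'da::finite"
  W\<^sub>\<beta> :: "real \<Rightarrow> 'w \<Rightarrow> real ^ 'db::finite"
  W\<^sub>1 :: "real \<Rightarrow> 'w \<Rightarrow> real ^ 'd1::finite"
  \<eta>\<^sub>\<alpha> :: "'w \<Rightarrow> real ^ 'na::finite"
  \<eta>\<^sub>\<beta> :: "'w \<Rightarrow> real ^ 'nb::finite"
  \<eta>\<^sub>1 :: "'w \<Rightarrow> real ^ 'n1::finite"

type_synonym ('na, 'nb, 'n1) idx5 = "'na + 'nb + 'n1 + 'n1 + 'n1"
type_synonym ('na, 'nb, 'n1) idx7 = "'na + 'nb + 'n1 + 'n1 + 'n1 + 'nb + 'na"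

context
  fixes \<G> :: "('na::finite, 'nb::finite, 'n1::finite, 'ma::finite, 'mb::finite, 'm1::finite,
                'da::finite, 'db::finite, 'd1::finite) game"
begin

definition game_coefficients :: bool where
  "game_coefficients \<longleftrightarrow>
     0 < horizon \<G> \<and>
     full_column_rank (D\<^sub>\<alpha> \<G>) \<and> full_column_rank (D\<^sub>\<beta> \<G>) \<and> full_column_rank (E\<^sub>1 \<G>) \<and>
     pos_definite (Q\<^sub>\<alpha> \<G>) \<and> pos_definite (Q\<^sub>\<beta> \<G>) \<and> pos_definite (Q\<^sub>1 \<G>) \<and>
     pos_definite (R\<^sub>\<alpha> \<G>) \<and> pos_definite (R\<^sub>\<beta> \<G>) \<and> pos_definite (R\<^sub>1 \<G>) \<and>
     pos_semidefinite (Qb\<^sub>\<alpha> \<G>) \<and> pos_semidefinite (Qb\<^sub>\<beta> \<G>) \<and> pos_semidefinite (Qb\<^sub>1 \<G>)"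


section \<open>Matrices of the FBSDE\<close>

definition A_mat :: "real ^ ('na, 'nb, 'n1) idx5 ^ ('na, 'nb, 'n1) idx5" where
  "A_mat =
     (A\<^sub>\<alpha> \<G> \<brokenbar> B\<^sub>\<alpha> \<G> \<brokenbar> C\<^sub>\<alpha> \<G> \<brokenbar> 0 \<brokenbar> 0) \<sslash>
     (A\<^sub>\<beta> \<G> \<brokenbar> B\<^sub>\<beta> \<G> \<brokenbar> C\<^sub>\<beta> \<G> \<brokenbar> 0 \<brokenbar> 0) \<sslash>
     (C\<^sub>1 \<G> \<brokenbar> D\<^sub>1 \<G> \<brokenbar> A\<^sub>1 \<G> + B\<^sub>1 \<G> \<brokenbar> 0 \<brokenbar> 0) \<sslash>
     (0 \<brokenbar> 0 \<brokenbar> 0 \<brokenbar> A\<^sub>1 \<G> \<brokenbar> 0) \<sslash>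
     (0 \<brokenbar> 0 \<brokenbar> 0 \<brokenbar> 0 \<brokenbar> A\<^sub>1 \<G>)"

definition BN_mat :: "real ^ ('na, 'nb, 'n1) idx7 ^ ('na, 'nb, 'n1) idx5" where
  "BN_mat =
     (let S\<^sub>\<alpha> = D\<^sub>\<alpha> \<G> ** matrix_inv (R\<^sub>\<alpha> \<G>) ** transpose (D\<^sub>\<alpha> \<G>);
          S\<^sub>\<beta> = D\<^sub>\<beta> \<G> ** matrix_inv (R\<^sub>\<beta> \<G>) ** transpose (D\<^sub>\<beta> \<G>);
          S\<^sub>1 = E\<^sub>1 \<G> ** matrix_inv (R\<^sub>1 \<G>) ** transpose (E\<^sub>1 \<G>)
      in
        (S\<^sub>\<alpha> \<brokenbar> 0 \<brokenbar> 0 \<brokenbar> 0 \<brokenbar> 0 \<brokenbar> 0 \<brokenbar> 0) \<sslash>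
        (0 \<brokenbar> S\<^sub>\<beta> \<brokenbar> 0 \<brokenbar> 0 \<brokenbar> 0 \<brokenbar> 0 \<brokenbar> 0) \<sslash>
        (0 \<brokenbar> 0 \<brokenbar> S\<^sub>1 \<brokenbar> 0 \<brokenbar> 0 \<brokenbar> 0 \<brokenbar> 0) \<sslash>
        (0 \<brokenbar> 0 \<brokenbar> 0 \<brokenbar> S\<^sub>1 \<brokenbar> 0 \<brokenbar> 0 \<brokenbar> 0) \<sslash>
        (0 \<brokenbar> 0 \<brokenbar> 0 \<brokenbar> 0 \<brokenbar> S\<^sub>1 \<brokenbar> 0 \<brokenbar> 0))"

definition CN_mat :: "real ^ ('na, 'nb, 'n1) idx7 ^ ('na, 'nb, 'n1) idx7" where
  "CN_mat =
     (transpose (A\<^sub>\<alpha> \<G>) \<brokenbar> 0 \<brokenbar> 0 \<brokenbar> transpose (C\<^sub>1 \<G>) \<brokenbar> 0 \<brokenbar> transpose (A\<^sub>\<beta> \<G>) \<brokenbar> 0) \<sslash>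
     (0 \<brokenbar> transpose (B\<^sub>\<beta> \<G>) \<brokenbar> 0 \<brokenbar> 0 \<brokenbar> transpose (D\<^sub>1 \<G>) \<brokenbar> 0 \<brokenbar> transpose (B\<^sub>\<alpha> \<G>)) \<sslash>
     (0 \<brokenbar> 0 \<brokenbar> transpose (A\<^sub>1 \<G>) \<brokenbar> 0 \<brokenbar> 0 \<brokenbar> 0 \<brokenbar> 0) \<sslash>
     (transpose (C\<^sub>\<alpha> \<G>) \<brokenbar> 0 \<brokenbar> 0 \<brokenbar> transpose (A\<^sub>1 \<G> + B\<^sub>1 \<G>) \<brokenbar> 0 \<brokenbar> transpose (C\<^sub>\<beta> \<G>) \<brokenbar> 0) \<sslash>
     (0 \<brokenbar> transpose (C\<^sub>\<beta> \<G>) \<brokenbar> 0 \<brokenbar> 0 \<brokenbar> transpose (A\<^sub>1 \<G> + B\<^sub>1 \<G>) \<brokenbar> 0 \<brokenbar> transpose (C\<^sub>\<alpha> \<G>)) \<sslash>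
     (transpose (B\<^sub>\<alpha> \<G>) \<brokenbar> 0 \<brokenbar> 0 \<brokenbar> transpose (D\<^sub>1 \<G>) \<brokenbar> 0 \<brokenbar> transpose (B\<^sub>\<beta> \<G>) \<brokenbar> 0) \<sslash>
     (0 \<brokenbar> transpose (A\<^sub>\<beta> \<G>) \<brokenbar> 0 \<brokenbar> 0 \<brokenbar> transpose (C\<^sub>1 \<G>) \<brokenbar> 0 \<brokenbar> transpose (A\<^sub>\<alpha> \<G>))"

end

text \<open>\<open>D\<^sup>N\<close>, \<open>E\<^sup>N\<close> (resp. \<open>M\<^sup>N\<close>, \<open>h\<^sup>N\<close>) are one and the same function of the unbarred and of the
  barred coefficients.\<close>

definition weight_mat ::
    "real ^ 'na ^ 'na \<Rightarrow> real ^ 'n1 ^ 'na \<Rightarrow> real ^ 'nb ^ 'na \<Rightarrow>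
     real ^ 'nb ^ 'nb \<Rightarrow> real ^ 'n1 ^ 'nb \<Rightarrow> real ^ 'na ^ 'nb \<Rightarrow>
     real ^ 'n1 ^ 'n1 \<Rightarrow> real ^ 'n1 ^ 'n1 \<Rightarrow> real ^ 'na ^ 'n1 \<Rightarrow> real ^ 'nb ^ 'n1 \<Rightarrow>
     real ^ ('na::finite, 'nb::finite, 'n1::finite) idx5 ^ ('na, 'nb, 'n1) idx7" where
  "weight_mat Qa Fa Ga Qb Fb Gb Q1 F1 G1 H1 =
     (Qa \<brokenbar> - (Qa ** Ga) \<brokenbar> - (Qa ** Fa) \<brokenbar> - transpose (Q1 ** G1) \<brokenbar> 0) \<sslash>
     (- (Qb ** Gb) \<brokenbar> Qb \<brokenbar> - (Qb ** Fb) \<brokenbar> 0 \<brokenbar> - transpose (Q1 ** H1)) \<sslash>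
     (- (Q1 ** G1) \<brokenbar> - (Q1 ** H1) \<brokenbar> Q1 ** (mat 1 - F1) \<brokenbar> 0 \<brokenbar> 0) \<sslash>
     (- transpose (Qa ** Fa) \<brokenbar> transpose (Qa ** Fa) ** Ga \<brokenbar> transpose (Qa ** Fa) ** Fa
        \<brokenbar> transpose (Q1 ** (mat 1 - F1)) \<brokenbar> 0) \<sslash>
     (transpose (Qb ** Fb) ** Gb \<brokenbar> - transpose (Qb ** Fb) \<brokenbar> transpose (Qb ** Fb) ** Fb
        \<brokenbar> 0 \<brokenbar> transpose (Q1 ** (mat 1 - F1))) \<sslash>
     (- transpose (Qa ** Ga) \<brokenbar> transpose (Qa ** Ga) ** Ga \<brokenbar> transpose (Qa ** Ga) ** Fa
        \<brokenbar> - transpose (Q1 ** H1) \<brokenbar> 0) \<sslash>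
     (transpose (Qb ** Gb) ** Gb \<brokenbar> - transpose (Qb ** Gb) \<brokenbar> transpose (Qb ** Gb) ** Fb
        \<brokenbar> 0 \<brokenbar> - transpose (Q1 ** G1))"

definition weight_vec ::
    "real ^ 'na ^ 'na \<Rightarrow> real ^ 'n1 ^ 'na \<Rightarrow> real ^ 'nb ^ 'na \<Rightarrow> real ^ 'na \<Rightarrow>
     real ^ 'nb ^ 'nb \<Rightarrow> real ^ 'n1 ^ 'nb \<Rightarrow> real ^ 'na ^ 'nb \<Rightarrow> real ^ 'nb \<Rightarrow>
     real ^ 'n1 ^ 'n1 \<Rightarrow> real ^ 'n1 \<Rightarrow>
     real ^ ('na::finite, 'nb::finite, 'n1::finite) idx7" where
  "weight_vec Qa Fa Ga Ma Qb Fb Gb Mb Q1 M1 =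
     - (Qa *v Ma) \<sslash> - (Qb *v Mb) \<sslash> - (Q1 *v M1) \<sslash>
     transpose (Qa ** Fa) *v Ma \<sslash> transpose (Qb ** Fb) *v Mb \<sslash>
     transpose (Qa ** Ga) *v Ma \<sslash> transpose (Qb ** Gb) *v Mb"

definition I1_mat ::
    "real ^ ('na::finite, 'nb::finite, 'n1::finite) idx7 ^ ('na, 'nb, 'n1) idx5" where
  "I1_mat =
     (mat 1 \<brokenbar> 0 \<brokenbar> 0 \<brokenbar> 0 \<brokenbar> 0 \<brokenbar> 0 \<brokenbar> mat 1) \<sslash>
     (0 \<brokenbar> mat 1 \<brokenbar> 0 \<brokenbar> 0 \<brokenbar> 0 \<brokenbar> mat 1 \<brokenbar> 0) \<sslash>
     (0 \<brokenbar> 0 \<brokenbar> mat 1 \<brokenbar> 0 \<brokenbar> 0 \<brokenbar> 0 \<brokenbar> 0) \<sslash>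
     (0 \<brokenbar> 0 \<brokenbar> 0 \<brokenbar> mat 1 \<brokenbar> 0 \<brokenbar> 0 \<brokenbar> 0) \<sslash>
     (0 \<brokenbar> 0 \<brokenbar> 0 \<brokenbar> 0 \<brokenbar> mat 1 \<brokenbar> 0 \<brokenbar> 0)"

definition I2_mat ::
    "real ^ ('na::finite, 'nb::finite, 'n1::finite) idx5 ^ ('na, 'nb, 'n1) idx7" where
  "I2_mat =
     (mat 1 \<brokenbar> 0 \<brokenbar> 0 \<brokenbar> 0 \<brokenbar> 0) \<sslash>
     (0 \<brokenbar> mat 1 \<brokenbar> 0 \<brokenbar> 0 \<brokenbar> 0) \<sslash>
     (0 \<brokenbar> 0 \<brokenbar> mat 1 \<brokenbar> 0 \<brokenbar> 0) \<sslash>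
     (0 \<brokenbar> 0 \<brokenbar> 0 \<brokenbar> mat 1 \<brokenbar> 0) \<sslash>
     (0 \<brokenbar> 0 \<brokenbar> 0 \<brokenbar> 0 \<brokenbar> mat 1) \<sslash>
     (0 \<brokenbar> 0 \<brokenbar> 0 \<brokenbar> 0 \<brokenbar> 0) \<sslash>
     (0 \<brokenbar> 0 \<brokenbar> 0 \<brokenbar> 0 \<brokenbar> 0)"

context
  fixes \<G> :: "('na::finite, 'nb::finite, 'n1::finite, 'ma::finite, 'mb::finite, 'm1::finite,
                'da::finite, 'db::finite, 'd1::finite) game"
begin

definition DN_mat :: "real ^ ('na, 'nb, 'n1) idx5 ^ ('na, 'nb, 'n1) idx7" where
  "DN_mat = weight_mat (Q\<^sub>\<alpha> \<G>) (F\<^sub>\<alpha> \<G>) (G\<^sub>\<alpha> \<G>) (Q\<^sub>\<beta> \<G>) (F\<^sub>\<beta> \<G>) (G\<^sub>\<beta> \<G>)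
     (Q\<^sub>1 \<G>) (F\<^sub>1 \<G>) (G\<^sub>1 \<G>) (H\<^sub>1 \<G>)"

definition EN_mat :: "real ^ ('na, 'nb, 'n1) idx5 ^ ('na, 'nb, 'n1) idx7" where
  "EN_mat = weight_mat (Qb\<^sub>\<alpha> \<G>) (Fb\<^sub>\<alpha> \<G>) (Gb\<^sub>\<alpha> \<G>) (Qb\<^sub>\<beta> \<G>) (Fb\<^sub>\<beta> \<G>) (Gb\<^sub>\<beta> \<G>)
     (Qb\<^sub>1 \<G>) (Fb\<^sub>1 \<G>) (Gb\<^sub>1 \<G>) (Hb\<^sub>1 \<G>)"

definition MN_vec :: "real ^ ('na, 'nb, 'n1) idx7" where
  "MN_vec = weight_vec (Q\<^sub>\<alpha> \<G>) (F\<^sub>\<alpha> \<G>) (G\<^sub>\<alpha> \<G>) (M\<^sub>\<alpha> \<G>) (Q\<^sub>\<beta> \<G>) (F\<^sub>\<beta> \<G>) (G\<^sub>\<beta> \<G>) (M\<^sub>\<beta> \<G>)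
     (Q\<^sub>1 \<G>) (M\<^sub>1 \<G>)"

definition hN_vec :: "real ^ ('na, 'nb, 'n1) idx7" where
  "hN_vec = weight_vec (Qb\<^sub>\<alpha> \<G>) (Fb\<^sub>\<alpha> \<G>) (Gb\<^sub>\<alpha> \<G>) (Mb\<^sub>\<alpha> \<G>) (Qb\<^sub>\<beta> \<G>) (Fb\<^sub>\<beta> \<G>) (Gb\<^sub>\<beta> \<G>) (Mb\<^sub>\<beta> \<G>)
     (Qb\<^sub>1 \<G>) (Mb\<^sub>1 \<G>)"

definition Sigma_mat :: "real ^ ('da + 'db) ^ ('na, 'nb, 'n1) idx5" where
  "Sigma_mat =
     (\<sigma>\<^sub>\<alpha> \<G> \<brokenbar> 0) \<sslash> (0 \<brokenbar> \<sigma>\<^sub>\<beta> \<G>) \<sslash> (0 \<brokenbar> 0) \<sslash> (0 \<brokenbar> 0) \<sslash> (0 \<brokenbar> 0)"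

definition BP_mat :: "real ^ ('na, 'nb, 'n1) idx5 ^ ('na, 'nb, 'n1) idx5" where
  "BP_mat = BN_mat \<G> ** I2_mat"

definition CP_mat :: "real ^ ('na, 'nb, 'n1) idx5 ^ ('na, 'nb, 'n1) idx5" where
  "CP_mat = I1_mat ** CN_mat \<G> ** I2_mat"

definition DP_mat :: "real ^ ('na, 'nb, 'n1) idx5 ^ ('na, 'nb, 'n1) idx5" where
  "DP_mat = I1_mat ** DN_mat"

definition EP_mat :: "real ^ ('na, 'nb, 'n1) idx5 ^ ('na, 'nb, 'n1) idx5" where
  "EP_mat = I1_mat ** EN_mat"

definition MP_vec :: "real ^ ('na, 'nb, 'n1) idx5" where
  "MP_vec = I1_mat *v MN_vec"

definition hP_vec :: "real ^ ('na, 'nb, 'n1) idx5" where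
  "hP_vec = I1_mat *v hN_vec"

end


section \<open>Filtrations and the driving noise\<close>

context
  fixes \<N> :: "('w, 'na::finite, 'nb::finite, 'n1::finite,
                'da::finite, 'db::finite, 'd1::finite) noise"
begin

definition driving_noise :: bool where
  "driving_noise \<longleftrightarrow>
     (let M = prob_measure \<N> in
        prob_space M \<and> complete_measure M \<and>
        wiener_process M (W\<^sub>\<alpha> \<N>) \<and> wiener_process M (W\<^sub>\<beta> \<N>) \<and> wiener_process M (W\<^sub>1 \<N>) \<and>
        square_integrable_rv M (\<eta>\<^sub>\<alpha> \<N>) \<and> square_integrable_rv M (\<eta>\<^sub>\<beta> \<N>) \<and>
        square_integrable_rv M (\<eta>\<^sub>1 \<N>) \<and>
        prob_space.indep_sets M
          (\<lambda>k. [sigma_of_process M (W\<^sub>\<alpha> \<N>), sigma_of_process M (W\<^sub>\<beta> \<N>), sigma_of_process M (W\<^sub>1 \<N>),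
                sigma_of_rv M (\<eta>\<^sub>\<alpha> \<N>), sigma_of_rv M (\<eta>\<^sub>\<beta> \<N>), sigma_of_rv M (\<eta>\<^sub>1 \<N>)] ! k) {..<6})"

definition leader_filtration :: "real \<Rightarrow> 'w measure" where
  "leader_filtration = join_filtration
     (history (prob_measure \<N>) (\<eta>\<^sub>\<alpha> \<N>) (W\<^sub>\<alpha> \<N>)) (history (prob_measure \<N>) (\<eta>\<^sub>\<beta> \<N>) (W\<^sub>\<beta> \<N>))"

definition follower_filtration :: "real \<Rightarrow> 'w measure" where
  "follower_filtration = join_filtration
     leader_filtration (history (prob_measure \<N>) (\<eta>\<^sub>1 \<N>) (W\<^sub>1 \<N>))"

definition W_vec :: "real \<Rightarrow> 'w \<Rightarrow> real ^ ('da + 'db)" where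
  "W_vec t \<omega> = W\<^sub>\<alpha> \<N> t \<omega> \<sslash> W\<^sub>\<beta> \<N> t \<omega>"

definition x0_vec :: "'w \<Rightarrow> real ^ ('na, 'nb, 'n1) idx5" where
  "x0_vec \<omega> = \<eta>\<^sub>\<alpha> \<N> \<omega> \<sslash> \<eta>\<^sub>\<beta> \<N> \<omega> \<sslash> integral\<^sup>L (prob_measure \<N>) (\<eta>\<^sub>1 \<N>) \<sslash> 0 \<sslash> 0"

end


section \<open>The game\<close>

text \<open>
  The functional \<open>E[\<integral>\<^sub>0\<^sup>T (|e|\<^sup>2\<^bsub>Q\<^esub> + |v|\<^sup>2\<^bsub>R\<^esub>) dt + |eT|\<^sup>2\<^bsub>Q'\<^esub>]\<close>, as an extended nonnegative number; \<open>e\<close> is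
  the running and \<open>eT\<close> the terminal tracking error. The weights of the game are positive (semi-)definite, so
  \<open>ennreal\<close> truncates nothing.
\<close>

definition lq_cost ::
    "real \<Rightarrow> 'w measure \<Rightarrow> real ^ 'n ^ 'n \<Rightarrow> real ^ 'm ^ 'm \<Rightarrow> real ^ 'n ^ 'n \<Rightarrow>
     (real \<Rightarrow> 'w \<Rightarrow> real ^ 'n) \<Rightarrow> (real \<Rightarrow> 'w \<Rightarrow> real ^ 'm) \<Rightarrow> ('w \<Rightarrow> real ^ 'n) \<Rightarrow> ennreal" where
  "lq_cost T M Q R Q' e v eT =
     (\<integral>\<^sup>+\<omega>. ((\<integral>\<^sup>+t\<in>{0..T}. ennreal (qform Q (e t \<omega>) + qform R (v t \<omega>)) \<partial>lborel)
             + ennreal (qform Q' (eT \<omega>))) \<partial>M)"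

context
  fixes \<G> :: "('na::finite, 'nb::finite, 'n1::finite, 'ma::finite, 'mb::finite, 'm1::finite,
                'da::finite, 'db::finite, 'd1::finite) game"
    and \<N> :: "('w, 'na, 'nb, 'n1, 'da, 'db, 'd1) noise"
begin

text \<open>
  Since the diffusion coefficients are constant, the stochastic integral \<open>\<integral>\<^sub>0\<^sup>t \<sigma> dW\<close> is \<open>\<sigma> W(t)\<close>.
  State equations are integral equations holding almost surely at each time of \<open>[0, T]\<close>.
\<close>

definition leader_states ::
    "(real \<Rightarrow> 'w \<Rightarrow> real ^ 'ma) \<Rightarrow> (real \<Rightarrow> 'w \<Rightarrow> real ^ 'mb) \<Rightarrow> (real \<Rightarrow> 'w \<Rightarrow> real ^ 'na) \<Rightarrow>
     (real \<Rightarrow> 'w \<Rightarrow> real ^ 'nb) \<Rightarrow> (real \<Rightarrow> 'w \<Rightarrow> real ^ 'n1) \<Rightarrow> bool" where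
  "leader_states va vb xa xb z \<longleftrightarrow>
     L2_adapted (horizon \<G>) (prob_measure \<N>) (leader_filtration \<N>) xa \<and>
     L2_adapted (horizon \<G>) (prob_measure \<N>) (leader_filtration \<N>) xb \<and>
     (\<forall>t\<in>{0..horizon \<G>}. AE \<omega> in prob_measure \<N>.
        xa t \<omega> = \<eta>\<^sub>\<alpha> \<N> \<omega>
          + (LINT s:{0..t}|lborel. A\<^sub>\<alpha> \<G> *v xa s \<omega> + B\<^sub>\<alpha> \<G> *v xb s \<omega> + C\<^sub>\<alpha> \<G> *v z s \<omega> + D\<^sub>\<alpha> \<G> *v va s \<omega>)
          + \<sigma>\<^sub>\<alpha> \<G> *v W\<^sub>\<alpha> \<N> t \<omega>) \<and>
     (\<forall>t\<in>{0..horizon \<G>}. AE \<omega> in prob_measure \<N>.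
        xb t \<omega> = \<eta>\<^sub>\<beta> \<N> \<omega>
          + (LINT s:{0..t}|lborel. A\<^sub>\<beta> \<G> *v xa s \<omega> + B\<^sub>\<beta> \<G> *v xb s \<omega> + C\<^sub>\<beta> \<G> *v z s \<omega> + D\<^sub>\<beta> \<G> *v vb s \<omega>)
          + \<sigma>\<^sub>\<beta> \<G> *v W\<^sub>\<beta> \<N> t \<omega>)"

definition follower_state ::
    "(real \<Rightarrow> 'w \<Rightarrow> real ^ 'm1) \<Rightarrow> (real \<Rightarrow> 'w \<Rightarrow> real ^ 'na) \<Rightarrow> (real \<Rightarrow> 'w \<Rightarrow> real ^ 'nb) \<Rightarrow>
     (real \<Rightarrow> 'w \<Rightarrow> real ^ 'n1) \<Rightarrow> (real \<Rightarrow> 'w \<Rightarrow> real ^ 'n1) \<Rightarrow> bool" where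
  "follower_state v1 xa xb z x1 \<longleftrightarrow>
     L2_adapted (horizon \<G>) (prob_measure \<N>) (follower_filtration \<N>) x1 \<and>
     (\<forall>t\<in>{0..horizon \<G>}. AE \<omega> in prob_measure \<N>.
        x1 t \<omega> = \<eta>\<^sub>1 \<N> \<omega>
          + (LINT s:{0..t}|lborel. A\<^sub>1 \<G> *v x1 s \<omega> + B\<^sub>1 \<G> *v z s \<omega> + C\<^sub>1 \<G> *v xa s \<omega>
               + D\<^sub>1 \<G> *v xb s \<omega> + E\<^sub>1 \<G> *v v1 s \<omega>)
          + \<sigma>\<^sub>1 \<G> *v W\<^sub>1 \<N> t \<omega>)"

definition follower_cost ::
    "(real \<Rightarrow> 'w \<Rightarrow> real ^ 'm1) \<Rightarrow> (real \<Rightarrow> 'w \<Rightarrow> real ^ 'n1) \<Rightarrow> (real \<Rightarrow> 'w \<Rightarrow> real ^ 'na) \<Rightarrow>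
     (real \<Rightarrow> 'w \<Rightarrow> real ^ 'nb) \<Rightarrow> (real \<Rightarrow> 'w \<Rightarrow> real ^ 'n1) \<Rightarrow> ennreal" where
  "follower_cost v1 x1 xa xb z =
     lq_cost (horizon \<G>) (prob_measure \<N>) (Q\<^sub>1 \<G>) (R\<^sub>1 \<G>) (Qb\<^sub>1 \<G>)
       (\<lambda>t \<omega>. x1 t \<omega> - F\<^sub>1 \<G> *v z t \<omega> - G\<^sub>1 \<G> *v xa t \<omega> - H\<^sub>1 \<G> *v xb t \<omega> - M\<^sub>1 \<G>)
       v1
       (\<lambda>\<omega>. x1 (horizon \<G>) \<omega> - Fb\<^sub>1 \<G> *v z (horizon \<G>) \<omega> - Gb\<^sub>1 \<G> *v xa (horizon \<G>) \<omega>
              - Hb\<^sub>1 \<G> *v xb (horizon \<G>) \<omega> - Mb\<^sub>1 \<G>)"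

definition follower_admissible :: "(real \<Rightarrow> 'w \<Rightarrow> real ^ 'm1) \<Rightarrow> bool" where
  "follower_admissible v1 \<longleftrightarrow>
     L2_adapted (horizon \<G>) (prob_measure \<N>) (follower_filtration \<N>) v1"

definition follower_optimal ::
    "(real \<Rightarrow> 'w \<Rightarrow> real ^ 'na) \<Rightarrow> (real \<Rightarrow> 'w \<Rightarrow> real ^ 'nb) \<Rightarrow> (real \<Rightarrow> 'w \<Rightarrow> real ^ 'n1) \<Rightarrow>
     (real \<Rightarrow> 'w \<Rightarrow> real ^ 'm1) \<Rightarrow> (real \<Rightarrow> 'w \<Rightarrow> real ^ 'n1) \<Rightarrow> bool" where
  "follower_optimal xa xb z u1 x1 \<longleftrightarrow>
     follower_admissible u1 \<and> follower_state u1 xa xb z x1 \<and>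
     (\<forall>v1 y1. follower_admissible v1 \<and> follower_state v1 xa xb z y1 \<longrightarrow>
        follower_cost u1 x1 xa xb z \<le> follower_cost v1 y1 xa xb z)"

definition mean_field_equilibrium ::
    "(real \<Rightarrow> 'w \<Rightarrow> real ^ 'na) \<Rightarrow> (real \<Rightarrow> 'w \<Rightarrow> real ^ 'nb) \<Rightarrow> (real \<Rightarrow> 'w \<Rightarrow> real ^ 'n1) \<Rightarrow> bool" where
  "mean_field_equilibrium xa xb z \<longleftrightarrow>
     L2_adapted (horizon \<G>) (prob_measure \<N>) (leader_filtration \<N>) z \<and>
     (\<exists>u1 x1. follower_optimal xa xb z u1 x1 \<and>
        (\<forall>t\<in>{0..horizon \<G>}. AE \<omega> in prob_measure \<N>.
           z t \<omega> = conditional_expectation (prob_measure \<N>) (leader_filtration \<N> t) (x1 t) \<omega>))"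

definition admissible_pair ::
    "(real \<Rightarrow> 'w \<Rightarrow> real ^ 'ma) \<Rightarrow> (real \<Rightarrow> 'w \<Rightarrow> real ^ 'mb) \<Rightarrow> bool" where
  "admissible_pair va vb \<longleftrightarrow>
     L2_adapted (horizon \<G>) (prob_measure \<N>) (leader_filtration \<N>) va \<and>
     L2_adapted (horizon \<G>) (prob_measure \<N>) (leader_filtration \<N>) vb"

definition response ::
    "(real \<Rightarrow> 'w \<Rightarrow> real ^ 'ma) \<Rightarrow> (real \<Rightarrow> 'w \<Rightarrow> real ^ 'mb) \<Rightarrow> (real \<Rightarrow> 'w \<Rightarrow> real ^ 'na) \<Rightarrow>
     (real \<Rightarrow> 'w \<Rightarrow> real ^ 'nb) \<Rightarrow> (real \<Rightarrow> 'w \<Rightarrow> real ^ 'n1) \<Rightarrow> bool" where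
  "response va vb xa xb z \<longleftrightarrow> leader_states va vb xa xb z \<and> mean_field_equilibrium xa xb z"

definition well_posed :: bool where
  "well_posed \<longleftrightarrow>
     (\<forall>va vb. admissible_pair va vb \<longrightarrow>
        (\<exists>xa xb z. response va vb xa xb z \<and>
           (\<forall>xa' xb' z'. response va vb xa' xb' z' \<longrightarrow>
              modification (horizon \<G>) (prob_measure \<N>) xa' xa \<and>
              modification (horizon \<G>) (prob_measure \<N>) xb' xb \<and>
              modification (horizon \<G>) (prob_measure \<N>) z' z)))"

text \<open>A version of the states determined by the leaders' controls. Under \<open>well_posed\<close> any two
  versions are modifications of each other, so that the costs do not depend on the choice.\<close>

definition the_response ::
    "(real \<Rightarrow> 'w \<Rightarrow> real ^ 'ma) \<Rightarrow> (real \<Rightarrow> 'w \<Rightarrow> real ^ 'mb) \<Rightarrow>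
     (real \<Rightarrow> 'w \<Rightarrow> real ^ 'na) \<times> (real \<Rightarrow> 'w \<Rightarrow> real ^ 'nb) \<times> (real \<Rightarrow> 'w \<Rightarrow> real ^ 'n1)" where
  "the_response va vb = (SOME (xa, xb, z). response va vb xa xb z)"

definition J\<^sub>\<alpha> :: "(real \<Rightarrow> 'w \<Rightarrow> real ^ 'ma) \<Rightarrow> (real \<Rightarrow> 'w \<Rightarrow> real ^ 'mb) \<Rightarrow> ennreal" where
  "J\<^sub>\<alpha> va vb =
     (let (xa, xb, z) = the_response va vb in
        lq_cost (horizon \<G>) (prob_measure \<N>) (Q\<^sub>\<alpha> \<G>) (R\<^sub>\<alpha> \<G>) (Qb\<^sub>\<alpha> \<G>)
          (\<lambda>t \<omega>. xa t \<omega> - F\<^sub>\<alpha> \<G> *v z t \<omega> - G\<^sub>\<alpha> \<G> *v xb t \<omega> - M\<^sub>\<alpha> \<G>)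
          va
          (\<lambda>\<omega>. xa (horizon \<G>) \<omega> - Fb\<^sub>\<alpha> \<G> *v z (horizon \<G>) \<omega> - Gb\<^sub>\<alpha> \<G> *v xb (horizon \<G>) \<omega> - Mb\<^sub>\<alpha> \<G>))"

definition J\<^sub>\<beta> :: "(real \<Rightarrow> 'w \<Rightarrow> real ^ 'mb) \<Rightarrow> (real \<Rightarrow> 'w \<Rightarrow> real ^ 'ma) \<Rightarrow> ennreal" where
  "J\<^sub>\<beta> vb va =
     (let (xa, xb, z) = the_response va vb in
        lq_cost (horizon \<G>) (prob_measure \<N>) (Q\<^sub>\<beta> \<G>) (R\<^sub>\<beta> \<G>) (Qb\<^sub>\<beta> \<G>)
          (\<lambda>t \<omega>. xb t \<omega> - F\<^sub>\<beta> \<G> *v z t \<omega> - G\<^sub>\<beta> \<G> *v xa t \<omega> - M\<^sub>\<beta> \<G>)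
          vb
          (\<lambda>\<omega>. xb (horizon \<G>) \<omega> - Fb\<^sub>\<beta> \<G> *v z (horizon \<G>) \<omega> - Gb\<^sub>\<beta> \<G> *v xa (horizon \<G>) \<omega> - Mb\<^sub>\<beta> \<G>))"

definition pareto_optimal ::
    "(real \<Rightarrow> 'w \<Rightarrow> real ^ 'ma) \<Rightarrow> (real \<Rightarrow> 'w \<Rightarrow> real ^ 'mb) \<Rightarrow> bool" where
  "pareto_optimal ua ub \<longleftrightarrow>
     admissible_pair ua ub \<and>
     (\<forall>va vb. admissible_pair va vb \<longrightarrow> J\<^sub>\<alpha> ua ub + J\<^sub>\<beta> ub ua \<le> J\<^sub>\<alpha> va vb + J\<^sub>\<beta> vb va)"


section \<open>The FBSDE of the Pareto game\<close>

definition pareto_fbsde ::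
    "(real \<Rightarrow> 'w \<Rightarrow> real ^ ('na, 'nb, 'n1) idx5) \<Rightarrow> (real \<Rightarrow> 'w \<Rightarrow> real ^ ('na, 'nb, 'n1) idx5) \<Rightarrow>
     (real \<Rightarrow> 'w \<Rightarrow> real ^ ('da + 'db) ^ ('na, 'nb, 'n1) idx5) \<Rightarrow> bool" where
  "pareto_fbsde x p Z \<longleftrightarrow>
     (let T = horizon \<G>; M = prob_measure \<N>; F = leader_filtration \<N> in
        L2_adapted T M F x \<and> L2_adapted T M F p \<and> L2_adapted T M F Z \<and>
        (\<forall>t\<in>{0..T}. AE \<omega> in M.
           x t \<omega> = x0_vec \<N> \<omega>
             + (LINT s:{0..t}|lborel. A_mat \<G> *v x s \<omega> - BP_mat \<G> *v p s \<omega>)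
             + Sigma_mat \<G> *v W_vec \<N> t \<omega>) \<and>
        (\<exists>I. ito_integral T M F (W_vec \<N>) Z I \<and>
           (\<forall>t\<in>{0..T}. AE \<omega> in M.
              p t \<omega> = EP_mat \<G> *v x T \<omega> + hP_vec \<G>
                + (LINT s:{t..T}|lborel. CP_mat \<G> *v p s \<omega> + DP_mat \<G> *v x s \<omega> + MP_vec \<G>)
                - (I T \<omega> - I t \<omega>))))"

end

end

theory Submission
  imports Defs
begin

text \<open>
  Everything is done with first-order conditions in \<open>L\<^sup>2\<close>; neither Ito's formula nor Riccati equations nor
  martingale representation is needed.

  Optimality of the follower is equivalent to an orthogonality condition against all solutions \<open>(w, y)\<close> of
  \<open>dy = (A\<^sub>1 y + E\<^sub>1 w) dt\<close>, \<open>y(0) = 0\<close>. If \<open>p\<close> solves the backward equation and \<open>y\<close> is absolutely continuous with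
  \<open>y(0) = 0\<close>, then Fubini and the vanishing conditional mean of \<open>\<integral> Z dW\<close> after time \<open>t\<close> give the duality between
  \<open>E<y(T), p(T)>\<close> and the running terms. For two responses with differences \<open>\<delta>x\<^sub>\<alpha>, \<delta>x\<^sub>\<beta>, \<delta>z, \<delta>x\<^sub>1\<close> it is applied to
  \<open>y = (\<delta>x\<^sub>\<alpha>, \<delta>x\<^sub>\<beta>, 0, \<delta>x\<^sub>1, \<delta>x\<^sub>1)\<close>; here \<open>\<delta>x\<^sub>1\<close> may be exchanged for \<open>\<delta>z\<close> against leader-adapted processes, and
  \<open>s = s\<^sub>\<alpha> + s\<^sub>\<beta>\<close> is itself a test process of the follower, with control \<open>- R\<^sub>1\<^sup>-\<^sup>1 E\<^sub>1\<^sup>T (r\<^sub>\<alpha> + r\<^sub>\<beta>)\<close>. So the first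
  variation of the total cost vanishes at the given controls, and the remaining quadratic term dominates
  \<open>E \<integral> |\<delta>v|\<^sup>2\<^bsub>R\<^esub> dt\<close>.

  That \<open>(x\<^sub>\<alpha>, x\<^sub>\<beta>, z)\<close> of the FBSDE is the response to these controls follows by taking any response, which exists by
  well-posedness, and transplanting its fluctuation \<open>x\<^sub>1 - E[x\<^sub>1 | F]\<close> to the solution of the FBSDE. Projecting
  processes onto the leaders' filtration amounts to a conditional expectation on \<open>[0, T] \<times> \<Omega>\<close> given the sigma-algebra of
  sets with adapted sections; it commutes with time integration because the leaders' noise is independent of the
  follower's.
\<close>

section \<open>Square-integrable functions\<close>

text \<open>The leaders minimise under the constraint that the follower reacts optimally. This
  constraint is linear, being his first-order condition, and \<open>s\<close> acts as its
  multiplier: once \<open>p\<close> is paired with the perturbation, what remains beside the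
  leaders' first variation is, up to a term of zero mean, the follower's bilinear form between
  \<open>s\<close> and the change of his tracking error. The difference of his two first-order
  conditions, tested with \<open>s\<close>, removes it. The third entry of the test process is 0
  because \<open>\<zeta>\<close> belongs to the condition itself; it serves separately, to show that
  the FBSDE satisfies it.

  The obstacle is measurability. Equations hold almost surely at each single time and an adapted
  process need not be progressive, so paths cannot be manipulated freely. Conditional expectations
  and adjoints therefore enter through identities tested against square-integrable variables. The
  bridge between the two filtrations is immersion: the follower's information at \<open>t\<close>
  says no more about the leaders' future than their own does.\<close>

lemma sqi_D:
  assumes "square_integrable_rv N f"
  shows "f \<in> borel_measurable N" "integrable N (\<lambda>x. (norm (f x))\<^sup>2)"
  using assms unfolding square_integrable_rv_def by auto

lemma sqi_bound:
  fixes f :: "'a \<Rightarrow> 'e::euclidean_space"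
  assumes "f \<in> borel_measurable N" "integrable N g" "AE x in N. (norm (f x))\<^sup>2 \<le> g x"
  shows "square_integrable_rv N f"
  unfolding square_integrable_rv_def
proof
  show "integrable N (\<lambda>x. (norm (f x))\<^sup>2)"
    by (rule Bochner_Integration.integrable_bound[OF assms(2)]) (use assms in \<open>auto elim!: AE_mp\<close>)
qed (fact assms(1))

lemma sqi_cong_AE:
  fixes f :: "'a \<Rightarrow> 'e::euclidean_space"
  assumes "f \<in> borel_measurable N" "square_integrable_rv N g" "AE x in N. f x = g x"
  shows "square_integrable_rv N f"
  by (rule sqi_bound[OF assms(1) sqi_D(2)[OF assms(2)]]) (use assms(3) in auto)

lemma sqi_add:
  fixes f g :: "'a \<Rightarrow> 'e::euclidean_space"
  assumes "square_integrable_rv N f" "square_integrable_rv N g"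
  shows "square_integrable_rv N (\<lambda>x. f x + g x)"
proof (rule sqi_bound)
  show "integrable N (\<lambda>x. 2 * (norm (f x))\<^sup>2 + 2 * (norm (g x))\<^sup>2)"
    using sqi_D[OF assms(1)] sqi_D[OF assms(2)] by auto
  have "(norm (a + b))\<^sup>2 \<le> 2 * (norm a)\<^sup>2 + 2 * (norm b)\<^sup>2" for a b :: 'e
  proof -
    have "(norm (a + b))\<^sup>2 \<le> (norm a + norm b)\<^sup>2" by (simp add: norm_triangle_ineq power_mono)
    also have "\<dots> \<le> 2 * (norm a)\<^sup>2 + 2 * (norm b)\<^sup>2"
      using zero_le_power2[of "norm a - norm b"] by (simp add: power2_eq_square algebra_simps)
    finally show ?thesis .
  qed
  then show "AE x in N. (norm (f x + g x))\<^sup>2 \<le> 2 * (norm (f x))\<^sup>2 + 2 * (norm (g x))\<^sup>2" by simp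
qed (use sqi_D[OF assms(1)] sqi_D[OF assms(2)] in simp)

lemma sqi_bounded_linear:
  fixes f :: "'a \<Rightarrow> 'e::euclidean_space" and h :: "'e \<Rightarrow> 'f::euclidean_space"
  assumes "bounded_linear h" "square_integrable_rv N f"
  shows "square_integrable_rv N (\<lambda>x. h (f x))"
proof -
  obtain K where K: "\<And>x. norm (h x) \<le> norm x * K" using bounded_linear.bounded[OF assms(1)] by blast
  show ?thesis
  proof (rule sqi_bound)
    show "(\<lambda>x. h (f x)) \<in> borel_measurable N"
      using measurable_compose[OF sqi_D(1)[OF assms(2)]
          borel_measurable_continuous_onI[OF linear_continuous_on[OF assms(1)]]] .
    show "integrable N (\<lambda>x. K\<^sup>2 * (norm (f x))\<^sup>2)" using sqi_D[OF assms(2)] by auto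
    have "(norm (h a))\<^sup>2 \<le> K\<^sup>2 * (norm a)\<^sup>2" for a
      using power_mono[OF K[of a] norm_ge_zero, of 2] by (simp add: power_mult_distrib mult.commute)
    then show "AE x in N. (norm (h (f x)))\<^sup>2 \<le> K\<^sup>2 * (norm (f x))\<^sup>2" by simp
  qed
qed

lemma sqi_uminus:
  fixes f :: "'a \<Rightarrow> 'e::euclidean_space"
  shows "square_integrable_rv N f \<Longrightarrow> square_integrable_rv N (\<lambda>x. - f x)"
  by (rule sqi_bounded_linear[OF bounded_linear_minus[OF bounded_linear_ident]])

lemma sqi_scaleR:
  fixes f :: "'a \<Rightarrow> 'e::euclidean_space"
  shows "square_integrable_rv N f \<Longrightarrow> square_integrable_rv N (\<lambda>x. c *\<^sub>R f x)"
  by (rule sqi_bounded_linear[OF bounded_linear_scaleR_right])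

lemma sqi_mult_vec:
  fixes f :: "'a \<Rightarrow> real ^ 'n" and A :: "real ^ 'n ^ 'm"
  shows "square_integrable_rv N f \<Longrightarrow> square_integrable_rv N (\<lambda>x. A *v f x)"
  by (rule sqi_bounded_linear[OF matrix_vector_mul_bounded_linear])

lemma sqi_nth:
  fixes f :: "'a \<Rightarrow> real ^ 'n"
  shows "square_integrable_rv N f \<Longrightarrow> square_integrable_rv N (\<lambda>x. f x $ i)"
  by (rule sqi_bounded_linear[OF bounded_linear_vec_nth])

lemma sqi_diff:
  fixes f g :: "'a \<Rightarrow> 'e::euclidean_space"
  assumes "square_integrable_rv N f" "square_integrable_rv N g"
  shows "square_integrable_rv N (\<lambda>x. f x - g x)"
  using sqi_add[OF assms(1) sqi_uminus[OF assms(2)]] by simp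

lemma sqi_const:
  assumes "finite_measure N"
  shows "square_integrable_rv N (\<lambda>x. c)"
proof -
  interpret finite_measure N by fact
  show ?thesis unfolding square_integrable_rv_def by simp
qed

lemma sqi_indicator:
  fixes f :: "'a \<Rightarrow> 'e::euclidean_space"
  assumes "square_integrable_rv N f" "A \<in> sets N"
  shows "square_integrable_rv N (\<lambda>x. indicator A x *\<^sub>R f x)"
  by (rule sqi_bound[OF _ sqi_D(2)[OF assms(1)]])
     (use sqi_D[OF assms(1)] assms(2) in \<open>auto simp: indicator_def power_mult_distrib\<close>)

lemma sqi_inner_integrable:
  fixes f g :: "'a \<Rightarrow> 'e::euclidean_space"
  assumes "square_integrable_rv N f" "square_integrable_rv N g"
  shows "integrable N (\<lambda>x. f x \<bullet> g x)"
proof (rule Bochner_Integration.integrable_bound)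
  show "integrable N (\<lambda>x. (norm (f x))\<^sup>2 + (norm (g x))\<^sup>2)"
    using sqi_D[OF assms(1)] sqi_D[OF assms(2)] by auto
  have "\<bar>a \<bullet> b\<bar> \<le> (norm a)\<^sup>2 + (norm b)\<^sup>2" for a b :: 'e
  proof -
    have "\<bar>a \<bullet> b\<bar> \<le> norm a * norm b" by (rule Cauchy_Schwarz_ineq2)
    also have "\<dots> \<le> (norm a)\<^sup>2 + (norm b)\<^sup>2"
      using zero_le_power2[of "norm a - norm b"] zero_le_power2[of "norm a"] zero_le_power2[of "norm b"]
      unfolding power2_diff by linarith
    finally show ?thesis .
  qed
  then show "AE x in N. norm (f x \<bullet> g x) \<le> norm ((norm (f x))\<^sup>2 + (norm (g x))\<^sup>2)" by simp
qed (use sqi_D[OF assms(1)] sqi_D[OF assms(2)] in simp)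

lemma sqi_integrable:
  fixes f :: "'a \<Rightarrow> 'e::euclidean_space"
  assumes "finite_measure N" "square_integrable_rv N f"
  shows "integrable N f"
proof (rule Bochner_Integration.integrable_bound)
  interpret finite_measure N by fact
  show "integrable N (\<lambda>x. 1 + (norm (f x))\<^sup>2)" using sqi_D[OF assms(2)] by auto
  have "norm a \<le> 1 + (norm a)\<^sup>2" for a :: 'e
    using zero_le_power2[of "norm a - 1"] norm_ge_zero[of a] unfolding power2_diff by (simp, linarith)
  then show "AE x in N. norm (f x) \<le> norm (1 + (norm (f x))\<^sup>2)" by simp
qed (rule sqi_D[OF assms(2)])

lemma borel_measurable_vec_lambda:
  fixes f :: "'a \<Rightarrow> 'i::finite \<Rightarrow> real"
  assumes "\<And>i. (\<lambda>x. f x i) \<in> borel_measurable N"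
  shows "(\<lambda>x. \<chi> i. f x i) \<in> borel_measurable N"
  by (subst borel_measurable_euclidean_space)
     (use assms in \<open>auto simp: Basis_vec_def inner_axis\<close>)

lemma borel_measurable_vec_nth:
  fixes f :: "'a \<Rightarrow> real ^ 'n"
  shows "f \<in> borel_measurable N \<Longrightarrow> (\<lambda>x. f x $ i) \<in> borel_measurable N"
  by (rule measurable_compose[of f N borel "\<lambda>v. v $ i"])
     (auto intro!: borel_measurable_continuous_onI linear_continuous_on bounded_linear_vec_nth)

lemma inner_diff_self: "(a - b) \<bullet> (a - b) = a \<bullet> a - 2 * (b \<bullet> a) + b \<bullet> (b :: 'e::real_inner)"
  by (simp add: inner_diff_left inner_diff_right inner_commute[of a b])

lemma inner_lincomb_self:
  "(u *\<^sub>R a + v *\<^sub>R b) \<bullet> (u *\<^sub>R a + v *\<^sub>R b)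
    = u * u * (a \<bullet> a) + 2 * u * v * (a \<bullet> b) + v * v * (b \<bullet> (b :: 'e::real_inner))"
  unfolding inner_add_left inner_add_right inner_scaleR_left inner_scaleR_right inner_commute[of b a]
  by algebra

lemma sqi_vec:
  fixes f :: "'a \<Rightarrow> real ^ 'n"
  assumes "\<And>i. square_integrable_rv N (\<lambda>x. f x $ i)"
  shows "square_integrable_rv N f"
proof (rule sqi_bound)
  have "(\<lambda>x. \<chi> i. f x $ i) \<in> borel_measurable N"
    by (rule borel_measurable_vec_lambda) (rule sqi_D[OF assms])
  then show "f \<in> borel_measurable N" by simp
  show "integrable N (\<lambda>x. \<Sum>i\<in>UNIV. (norm (f x $ i))\<^sup>2)" using sqi_D[OF assms] by auto
  show "AE x in N. (norm (f x))\<^sup>2 \<le> (\<Sum>i\<in>UNIV. (norm (f x $ i))\<^sup>2)"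
    by (simp add: norm_vec_def L2_set_def sum_nonneg)
qed

lemma sqi_zero_AE:
  fixes f :: "'a \<Rightarrow> 'e::euclidean_space"
  assumes "square_integrable_rv N f" "(\<integral>x. f x \<bullet> f x \<partial>N) = 0"
  shows "AE x in N. f x = 0"
  using integral_nonneg_eq_0_iff_AE[OF sqi_inner_integrable[OF assms(1) assms(1)]] assms(2) by simp

text \<open>The Gram matrix of \<open>f\<close> and \<open>g\<close> is positive semi-definite, so
  its determinant is nonnegative. The degenerate case, where \<open>g\<close> has norm zero, is
  settled by \<open>g\<close> vanishing almost everywhere.\<close>

lemma sqi_Cauchy_Schwarz:
  fixes f g :: "'a \<Rightarrow> 'e::euclidean_space"
  assumes f: "square_integrable_rv N f" and g: "square_integrable_rv N g"
  shows "(\<integral>x. f x \<bullet> g x \<partial>N)\<^sup>2 \<le> (\<integral>x. f x \<bullet> f x \<partial>N) * (\<integral>x. g x \<bullet> g x \<partial>N)"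
proof -
  note [simp] = sqi_inner_integrable[OF f f] sqi_inner_integrable[OF f g] sqi_inner_integrable[OF g g]
  define a b c where "a = (\<integral>x. f x \<bullet> f x \<partial>N)" and "b = (\<integral>x. f x \<bullet> g x \<partial>N)" and "c = (\<integral>x. g x \<bullet> g x \<partial>N)"
  have q: "0 \<le> u * u * a + 2 * u * v * b + v * v * c" for u v :: real
  proof -
    have "0 \<le> (\<integral>x. (u *\<^sub>R f x + v *\<^sub>R g x) \<bullet> (u *\<^sub>R f x + v *\<^sub>R g x) \<partial>N)" by simp
    also have "\<dots> = (\<integral>x. u * u * (f x \<bullet> f x) + 2 * u * v * (f x \<bullet> g x) + v * v * (g x \<bullet> g x) \<partial>N)"
      by (rule Bochner_Integration.integral_cong)
         (simp_all add: inner_lincomb_self)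
    also have "\<dots> = u * u * a + 2 * u * v * b + v * v * c" unfolding a_def b_def c_def by simp
    finally show ?thesis .
  qed
  have "0 \<le> c" unfolding c_def by simp
  have "0 \<le> a" unfolding a_def by simp
  \<comment> \<open>At the pair (c, -b) the quadratic form factors as c times the
    determinant.\<close>
  have "0 \<le> c * (a * c - b * b)" using q[of c "-b"] by (simp add: algebra_simps)
  moreover have "b = 0" if "c = 0"
  proof -
    have "AE x in N. g x = 0" using sqi_zero_AE[OF g] that c_def by simp
    then have "AE x in N. f x \<bullet> g x = 0" by auto
    then show ?thesis unfolding b_def by (rule integral_eq_zero_AE)
  qed
  ultimately have "b * b \<le> a * c" using \<open>0 \<le> c\<close> by (cases "c = 0") (auto simp: zero_le_mult_iff)
  then show ?thesis unfolding a_def b_def c_def by (simp add: power2_eq_square)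
qed

section \<open>Conditional expectation as orthogonal projection\<close>

context
  fixes N :: "'a measure" and S :: "'a measure"
  assumes fin: "finite_measure N" and sub: "subalgebra N S"
begin

interpretation sigma_finite_subalgebra N S
  by (rule finite_measure_subalgebra_is_sigma_finite)
     (simp add: fin finite_measure_subalgebra.intro finite_measure_subalgebra_axioms.intro sub)

lemma cexp_measurable [measurable]: "conditional_expectation N S X \<in> borel_measurable S"
  unfolding conditional_expectation_def by (rule borel_measurable_vec_lambda) simp

text \<open>Conditional Jensen inequality for the square, in each coordinate.\<close>

lemma cexp_sqi:
  fixes X :: "'a \<Rightarrow> real ^ 'n"
  assumes "square_integrable_rv N X"
  shows "square_integrable_rv N (conditional_expectation N S X)"
proof (rule sqi_vec)
  fix i
  have "integrable N (\<lambda>x. (real_cond_exp N S (\<lambda>\<omega>. X \<omega> $ i) x)\<^sup>2)"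
    by (rule integrable_convex_cond_exp[where I = UNIV])
       (use sqi_integrable[OF fin sqi_nth[OF assms, of i]] sqi_D(2)[OF sqi_nth[OF assms, of i]]
         in \<open>auto simp: convex_power2\<close>)
  then show "square_integrable_rv N (\<lambda>x. conditional_expectation N S X x $ i)"
    unfolding square_integrable_rv_def conditional_expectation_def by simp
qed

text \<open>Coordinates reduce this to the characteristic property of \<open>real_cond_exp\<close>.
  The form serves variables, with \<open>N\<close> the probability measure, as well as processes,
  with \<open>N\<close> its product with Lebesgue measure.\<close>

lemma cexp_inner:
  fixes X :: "'a \<Rightarrow> real ^ 'n"
  assumes X: "square_integrable_rv N X" and V: "square_integrable_rv N V" "V \<in> borel_measurable S"
  shows "(\<integral>x. V x \<bullet> conditional_expectation N S X x \<partial>N) = (\<integral>x. V x \<bullet> X x \<partial>N)"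
proof -
  have i: "integrable N (\<lambda>x. V x $ i * X x $ i)" for i
    using sqi_inner_integrable[OF sqi_nth[OF V(1)] sqi_nth[OF X]] by simp
  have mV: "(\<lambda>x. V x $ i) \<in> borel_measurable S" for i
    by (rule borel_measurable_vec_nth[OF V(2)])
  have mX: "(\<lambda>x. X x $ i) \<in> borel_measurable N" for i
    by (rule borel_measurable_vec_nth[OF sqi_D(1)[OF X]])
  note r = real_cond_exp_intg[OF i mV mX]
  have "(\<integral>x. V x \<bullet> conditional_expectation N S X x \<partial>N)
      = (\<Sum>i\<in>UNIV. \<integral>x. V x $ i * real_cond_exp N S (\<lambda>x. X x $ i) x \<partial>N)"
    unfolding inner_vec_def conditional_expectation_def by (simp add: r)
  also have "\<dots> = (\<integral>x. V x \<bullet> X x \<partial>N)" unfolding inner_vec_def r(2) by (simp add: i)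
  finally show ?thesis .
qed

text \<open>The difference of the two candidates is itself an admissible test variable, and tested
  with itself it has norm zero.\<close>

lemma cexp_unique:
  fixes X Y :: "'a \<Rightarrow> real ^ 'n"
  assumes X: "square_integrable_rv N X" and Y: "square_integrable_rv N Y" "Y \<in> borel_measurable S"
    and eq: "\<And>V. V \<in> borel_measurable S \<Longrightarrow> square_integrable_rv N V \<Longrightarrow>
               (\<integral>x. V x \<bullet> X x \<partial>N) = (\<integral>x. V x \<bullet> Y x \<partial>N)"
  shows "AE x in N. conditional_expectation N S X x = Y x"
proof -
  let ?C = "conditional_expectation N S X"
  define D where "D = (\<lambda>x. ?C x - Y x)"
  have D: "square_integrable_rv N D" "D \<in> borel_measurable S"
    unfolding D_def using sqi_diff[OF cexp_sqi[OF X] Y(1)] cexp_measurable Y(2) by auto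
  have "(\<integral>x. D x \<bullet> D x \<partial>N) = (\<integral>x. D x \<bullet> ?C x \<partial>N) - (\<integral>x. D x \<bullet> Y x \<partial>N)"
    by (subst Bochner_Integration.integral_diff[symmetric])
       (use sqi_inner_integrable D cexp_sqi[OF X] Y in \<open>auto simp: D_def inner_diff_right\<close>)
  also have "\<dots> = 0" using cexp_inner[OF X D] eq[OF D(2,1)] by simp
  finally have "AE x in N. D x = 0" by (rule sqi_zero_AE[OF D(1)])
  then show ?thesis unfolding D_def by simp
qed

text \<open>Pythagoras. It supplies the bound of the second moments of a martingale by that of its
  terminal value.\<close>

lemma cexp_norm_self:
  fixes X :: "'a \<Rightarrow> real ^ 'n"
  assumes X: "square_integrable_rv N X"
  shows "(\<integral>x. (X x - conditional_expectation N S X x) \<bullet> (X x - conditional_expectation N S X x) \<partial>N) =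
    (\<integral>x. X x \<bullet> X x \<partial>N) - (\<integral>x. conditional_expectation N S X x \<bullet> conditional_expectation N S X x \<partial>N)"
proof -
  let ?C = "conditional_expectation N S X"
  note C = cexp_sqi[OF X]
  note ii = sqi_inner_integrable
  have "(\<integral>x. (X x - ?C x) \<bullet> (X x - ?C x) \<partial>N) = (\<integral>x. X x \<bullet> X x - 2 * (?C x \<bullet> X x) + ?C x \<bullet> ?C x \<partial>N)"
    by (simp add: inner_diff_self)
  also have "\<dots> = (\<integral>x. X x \<bullet> X x \<partial>N) - 2 * (\<integral>x. ?C x \<bullet> X x \<partial>N) + (\<integral>x. ?C x \<bullet> ?C x \<partial>N)"
    using ii[OF C C] ii[OF C X] ii[OF X X] by simp
  finally show ?thesis using cexp_inner[OF X C cexp_measurable] by simp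
qed

end

section \<open>Processes on [0, T] x \<Omega> and their time integrals\<close>

definition running_integral :: "(real \<Rightarrow> 'w \<Rightarrow> 'e::euclidean_space) \<Rightarrow> real \<Rightarrow> 'w \<Rightarrow> 'e" where
  "running_integral f t \<omega> = (LINT s:{0..t}|lborel. f s \<omega>)"

abbreviation square_integrable_process ::
    "real \<Rightarrow> 'w measure \<Rightarrow> (real \<Rightarrow> 'w \<Rightarrow> 'e::real_normed_vector) \<Rightarrow> bool" where
  "square_integrable_process T M f \<equiv> square_integrable_rv (time_prob T M) (\<lambda>z. f (fst z) (snd z))"

text \<open>Replaces the bound on a nonnegative integral by Bochner integrability, so that processes
  become square-integrable functions for the product measure and all closure lemmas carry
  over.\<close>

lemma L2_adapted_iff:
  "L2_adapted T M F x \<longleftrightarrow>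
     square_integrable_process T M x \<and> (\<forall>t\<in>{0..T}. x t \<in> borel_measurable (F t))"
proof -
  have "(\<integral>\<^sup>+z. ennreal ((norm (x (fst z) (snd z)))\<^sup>2) \<partial>time_prob T M) < \<infinity>
      \<longleftrightarrow> integrable (time_prob T M) (\<lambda>z. (norm (x (fst z) (snd z)))\<^sup>2)"
    if "(\<lambda>z. x (fst z) (snd z)) \<in> borel_measurable (time_prob T M)"
    using that by (subst integrable_iff_bounded) (simp add: borel_measurable_power)
  then show ?thesis unfolding L2_adapted_def square_integrable_rv_def case_prod_beta' by blast
qed

locale time_prob_space = prob_space M for M :: "'w measure" +
  fixes T :: real
  assumes T_pos: "0 < T"
begin

abbreviation "TL \<equiv> restrict_space lborel {0..T}"
abbreviation "N \<equiv> time_prob T M"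

lemma space_TL: "space TL = {0..T}" by (simp add: space_restrict_space)

lemma space_N: "space N = {0..T} \<times> space M"
  by (simp add: time_prob_def space_pair_measure space_restrict_space)

lemma finite_TL: "finite_measure TL"
  by (rule finite_measureI) (use T_pos in \<open>simp add: emeasure_restrict_space space_restrict_space\<close>)

lemma measure_TL: "measure TL {0..T} = T"
  using T_pos by (simp add: measure_restrict_space)

sublocale TL: finite_measure TL by (rule finite_TL)
sublocale NP: pair_sigma_finite TL M ..

lemma finite_N: "finite_measure N"
proof (rule finite_measureI)
  have "emeasure N ({0..T} \<times> space M) = emeasure TL {0..T} * emeasure M (space M)"
    unfolding time_prob_def by (rule emeasure_pair_measure_Times) (auto simp: sets_restrict_space)
  then show "emeasure N (space N) \<noteq> \<infinity>"
    unfolding space_N using TL.emeasure_finite[of "{0..T}"] by (simp add: emeasure_space_1)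
qed

lemma integral_N:
  fixes f :: "real \<Rightarrow> 'w \<Rightarrow> 'e::euclidean_space"
  assumes "integrable N (\<lambda>z. f (fst z) (snd z))"
  shows integral_N_fst: "(\<integral>z. f (fst z) (snd z) \<partial>N) = (\<integral>t. \<integral>\<omega>. f t \<omega> \<partial>M \<partial>TL)"
    and integral_N_snd: "(\<integral>z. f (fst z) (snd z) \<partial>N) = (\<integral>\<omega>. \<integral>t. f t \<omega> \<partial>TL \<partial>M)"
    and integrable_N_fst: "integrable TL (\<lambda>t. \<integral>\<omega>. f t \<omega> \<partial>M)"
    and integrable_N_snd: "integrable M (\<lambda>\<omega>. \<integral>t. f t \<omega> \<partial>TL)"
    and AE_integrable_N_fst: "AE t in TL. integrable M (f t)"
    and AE_integrable_N_snd: "AE \<omega> in M. integrable TL (\<lambda>t. f t \<omega>)"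
proof -
  have f: "integrable (TL \<Otimes>\<^sub>M M) (case_prod f)"
    using assms by (simp add: time_prob_def case_prod_beta')
  show "(\<integral>z. f (fst z) (snd z) \<partial>N) = (\<integral>t. \<integral>\<omega>. f t \<omega> \<partial>M \<partial>TL)"
    using NP.integral_fst[OF f] by (simp add: time_prob_def case_prod_beta')
  show "(\<integral>z. f (fst z) (snd z) \<partial>N) = (\<integral>\<omega>. \<integral>t. f t \<omega> \<partial>TL \<partial>M)"
    using NP.integral_snd[OF f] by (simp add: time_prob_def case_prod_beta')
  show "integrable TL (\<lambda>t. \<integral>\<omega>. f t \<omega> \<partial>M)" by (rule NP.integrable_fst[OF f])
  show "integrable M (\<lambda>\<omega>. \<integral>t. f t \<omega> \<partial>TL)" by (rule NP.integrable_snd[OF f])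
  show "AE t in TL. integrable M (f t)" by (rule NP.AE_integrable_fst[OF f])
  show "AE \<omega> in M. integrable TL (\<lambda>t. f t \<omega>)" by (rule NP.AE_integrable_snd[OF f])
qed

lemma AE_N_iff:
  assumes "{z \<in> space N. P (fst z) (snd z)} \<in> sets N"
  shows "(AE z in N. P (fst z) (snd z)) \<longleftrightarrow> (AE t in TL. AE \<omega> in M. P t \<omega>)"
  using NP.AE_pair_iff[of P] assms unfolding time_prob_def by simp

lemma measurable_section_fst:
  "(\<lambda>z. f (fst z) (snd z)) \<in> measurable N R \<Longrightarrow> t \<in> {0..T} \<Longrightarrow> f t \<in> measurable M R"
  using measurable_compose[OF measurable_Pair1'[of t TL M], of "\<lambda>z. f (fst z) (snd z)" R]
  by (simp add: time_prob_def space_TL)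

lemma measurable_section_snd:
  "(\<lambda>z. f (fst z) (snd z)) \<in> measurable N R \<Longrightarrow> \<omega> \<in> space M \<Longrightarrow> (\<lambda>t. f t \<omega>) \<in> measurable TL R"
  using measurable_compose[OF measurable_Pair2'[of \<omega> M TL], of "\<lambda>z. f (fst z) (snd z)" R]
  by (simp add: time_prob_def)

lemma sqi_sections:
  fixes f :: "real \<Rightarrow> 'w \<Rightarrow> 'e::euclidean_space"
  assumes f: "square_integrable_process T M f"
  shows sqi_section_fst: "AE t in TL. square_integrable_rv M (f t)"
    and sqi_section_snd: "AE \<omega> in M. square_integrable_rv TL (\<lambda>t. f t \<omega>)"
proof -
  note i = AE_integrable_N_fst[OF sqi_D(2)[OF f]] AE_integrable_N_snd[OF sqi_D(2)[OF f]]
  show "AE t in TL. square_integrable_rv M (f t)"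
    using i(1) AE_space[of TL] by eventually_elim
      (auto simp: square_integrable_rv_def space_TL intro!: measurable_section_fst sqi_D[OF f])
  show "AE \<omega> in M. square_integrable_rv TL (\<lambda>t. f t \<omega>)"
    using i(2) AE_space[of M] by eventually_elim
      (auto simp: square_integrable_rv_def intro!: measurable_section_snd sqi_D[OF f])
qed

text \<open>Time integrals are moved to the finite measure \<open>TL\<close>, where Cauchy-Schwarz
  against constants and Fubini with \<open>M\<close> are available.\<close>

lemma running_integral_eq:
  assumes "t \<in> {0..T}"
  shows "running_integral f t \<omega> = (\<integral>s. indicator {0..t} s *\<^sub>R f s \<omega> \<partial>TL)"
proof -
  have "(\<integral>s. indicator {0..t} s *\<^sub>R f s \<omega> \<partial>TL) = (\<integral>s. indicator {0..T} s *\<^sub>R indicator {0..t} s *\<^sub>R f s \<omega> \<partial>lborel)"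
    by (rule integral_restrict_space) simp
  also have "\<dots> = running_integral f t \<omega>"
    unfolding running_integral_def set_lebesgue_integral_def
    by (rule Bochner_Integration.integral_cong) (use assms in \<open>auto simp: indicator_def\<close>)
  finally show ?thesis by simp
qed

lemma set_integral_interval:
  fixes f :: "real \<Rightarrow> 'w \<Rightarrow> 'e::euclidean_space"
  assumes "t \<in> {0..T}" "integrable TL (\<lambda>s. f s \<omega>)"
  shows "(LINT s:{t..T}|lborel. f s \<omega>) = running_integral f T \<omega> - running_integral f t \<omega>"
proof -
  have i: "set_integrable lborel {0..T} (\<lambda>s. f s \<omega>)"
    using assms(2) unfolding set_integrable_def by (subst (asm) integrable_restrict_space) auto
  have "(LINT s:{0..T}|lborel. f s \<omega>) = (LINT s:{0..t}|lborel. f s \<omega>) + (LINT s:{t..T}|lborel. f s \<omega>)"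
  proof (subst set_integral_Un_AE[symmetric])
    show "AE x in lborel. \<not> (x \<in> {0..t} \<and> x \<in> {t..T})"
      using AE_lborel_singleton[of t] by eventually_elim auto
    show "set_integrable lborel {0..t} (\<lambda>s. f s \<omega>)" "set_integrable lborel {t..T} (\<lambda>s. f s \<omega>)"
      using assms(1) by (auto intro!: set_integrable_subset[OF i])
    have "{0..t} \<union> {t..T} = {0..T}" using assms(1) by auto
    then show "(LINT s:{0..T}|lborel. f s \<omega>) = (LINT s:{0..t} \<union> {t..T}|lborel. f s \<omega>)" by simp
  qed auto
  then show ?thesis unfolding running_integral_def by simp
qed

lemma measurable_indicator_le [measurable]:
  "(\<lambda>z. indicator {0..g z} (h z) :: real) \<in> borel_measurable R"
  if [measurable]: "(g :: _ \<Rightarrow> real) \<in> borel_measurable R" "h \<in> borel_measurable R"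
proof -
  have "(\<lambda>z. indicator {0..g z} (h z) :: real) = (\<lambda>z. if 0 \<le> h z \<and> h z \<le> g z then 1 else 0)"
    by (auto simp: indicator_def fun_eq_iff)
  also have "\<dots> \<in> borel_measurable R" by measurable
  finally show ?thesis .
qed

lemma borel_measurable_ident_TL [measurable]: "(\<lambda>s. s) \<in> borel_measurable TL"
  by (rule measurable_restrict_space1) simp

lemma borel_measurable_fst_N [measurable]: "fst \<in> borel_measurable N"
  unfolding time_prob_def using measurable_compose[OF measurable_fst borel_measurable_ident_TL] by simp

lemma measurable_snd_N [measurable]: "snd \<in> measurable N M"
  unfolding time_prob_def by simp

text \<open>Measurability of parameter integrals with (t, \<omega>) as the parameter: the upper
  limit is hidden in an indicator that is measurable in both times together.\<close>

lemma running_integral_measurable: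
  fixes f :: "real \<Rightarrow> 'w \<Rightarrow> 'e::euclidean_space"
  assumes f: "(\<lambda>z. f (fst z) (snd z)) \<in> borel_measurable N"
  shows "(\<lambda>z. running_integral f (fst z) (snd z)) \<in> borel_measurable N"
proof -
  have [measurable]: "(\<lambda>(z, s). (s, snd z)) \<in> measurable (N \<Otimes>\<^sub>M TL) N"
    unfolding time_prob_def by measurable
  have [measurable]: "(\<lambda>zs. f (snd zs) (snd (fst zs))) \<in> borel_measurable (N \<Otimes>\<^sub>M TL)"
    using measurable_compose[OF \<open>(\<lambda>(z, s). (s, snd z)) \<in> measurable (N \<Otimes>\<^sub>M TL) N\<close> f]
    by (simp add: case_prod_beta')
  have [measurable]: "(\<lambda>zs. fst (fst zs)) \<in> borel_measurable (N \<Otimes>\<^sub>M TL)"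
    by (rule measurable_compose[OF measurable_fst borel_measurable_fst_N])
  have [measurable]: "(\<lambda>zs. snd zs) \<in> borel_measurable (N \<Otimes>\<^sub>M TL)"
    by (rule measurable_compose[OF measurable_snd borel_measurable_ident_TL])
  have "(\<lambda>z. \<integral>s. indicator {0..fst z} s *\<^sub>R f s (snd z) \<partial>TL) \<in> borel_measurable N"
    by (rule TL.borel_measurable_lebesgue_integral) (simp add: case_prod_beta')
  then show ?thesis
    by (rule measurable_cong[THEN iffD1, rotated]) (auto simp: space_N running_integral_eq)
qed

text \<open>Cauchy-Schwarz against the constant 1, whose squared norm in \<open>TL\<close> is T. The
  bound does not involve \<open>t\<close>, so one null set of \<omega> will serve all times.\<close>

lemma integral_norm_sq_le:
  fixes g :: "real \<Rightarrow> 'e::euclidean_space"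
  assumes g: "square_integrable_rv TL g" and t: "t \<in> {0..T}"
  shows "(norm (\<integral>s. indicator {0..t} s *\<^sub>R g s \<partial>TL))\<^sup>2 \<le> T * (\<integral>s. (norm (g s))\<^sup>2 \<partial>TL)"
proof -
  have "{0..t} \<in> sets TL" using t by (auto simp: sets_restrict_space)
  then have g': "square_integrable_rv TL (\<lambda>s. indicator {0..t} s *\<^sub>R g s)"
    by (rule sqi_indicator[OF g])
  define h where "h s = norm (indicator {0..t} s *\<^sub>R g s)" for s
  have h: "square_integrable_rv TL h"
    using sqi_D(2)[OF g'] measurable_compose[OF sqi_D(1)[OF g'] borel_measurable_norm] unfolding h_def square_integrable_rv_def by simp
  have "norm (\<integral>s. indicator {0..t} s *\<^sub>R g s \<partial>TL) \<le> (\<integral>s. h s \<partial>TL)"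
    unfolding h_def by (rule integral_norm_bound)
  then have "(norm (\<integral>s. indicator {0..t} s *\<^sub>R g s \<partial>TL))\<^sup>2 \<le> (\<integral>s. h s \<partial>TL)\<^sup>2"
    by (rule power_mono) simp
  also have "\<dots> = (\<integral>s. h s \<bullet> 1 \<partial>TL)\<^sup>2" by simp
  also have "\<dots> \<le> (\<integral>s. h s \<bullet> h s \<partial>TL) * (\<integral>s. (1::real) \<bullet> 1 \<partial>TL)"
    by (rule sqi_Cauchy_Schwarz[OF h sqi_const[OF finite_TL]])
  also have "(\<integral>s. (1::real) \<bullet> 1 \<partial>TL) = T"
    using measure_TL by (simp add: space_TL)
  also have "(\<integral>s. h s \<bullet> h s \<partial>TL) \<le> (\<integral>s. (norm (g s))\<^sup>2 \<partial>TL)"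
    using sqi_D[OF g] sqi_inner_integrable[OF h h]
    by (intro integral_mono) (auto simp: h_def indicator_def power2_eq_square)
  finally show ?thesis using T_pos by (simp add: mult.commute mult_left_mono)
qed

lemma integrable_N_snd_comp: "integrable N (\<lambda>z. g (snd z))" if "integrable M g" for g :: "'w \<Rightarrow> real"
proof -
  have "integrable (TL \<Otimes>\<^sub>M M) (\<lambda>z. g (snd z))"
  proof (rule NP.Fubini_integrable)
    show "(\<lambda>z. g (snd z)) \<in> borel_measurable (TL \<Otimes>\<^sub>M M)"
      using that by (intro measurable_compose[OF measurable_snd]) auto
  qed (use that in auto)
  then show ?thesis by (simp add: time_prob_def)
qed

text \<open>The exceptional set of \<omega> is common to all times, hence the bad points lie in a
  rectangle of measure zero. Unlike Fubini this works for predicates that are not known to be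
  measurable.\<close>

lemma AE_N_I:
  assumes P: "AE \<omega> in M. \<forall>t\<in>{0..T}. P t \<omega>"
  shows "AE z in N. P (fst z) (snd z)"
proof -
  obtain S where S: "{\<omega>\<in>space M. \<not> (\<forall>t\<in>{0..T}. P t \<omega>)} \<subseteq> S" "S \<in> sets M" "emeasure M S = 0"
    using P by (rule AE_E) auto
  have "{0..T} \<times> S \<in> null_sets N"
  proof
    show "{0..T} \<times> S \<in> sets N" unfolding time_prob_def
      using S by (intro pair_measureI) (auto simp: sets_restrict_space)
    show "emeasure N ({0..T} \<times> S) = 0" unfolding time_prob_def
      using S by (subst emeasure_pair_measure_Times) (auto simp: sets_restrict_space)
  qed
  then show ?thesis by (rule AE_I') (use S(1) in \<open>force simp: space_N\<close>)
qed

context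
  fixes f :: "real \<Rightarrow> 'w \<Rightarrow> 'e::euclidean_space"
  assumes f: "square_integrable_process T M f"
begin

lemma running_integral_bound:
  "AE \<omega> in M. \<forall>t\<in>{0..T}. (norm (running_integral f t \<omega>))\<^sup>2 \<le> T * (\<integral>s. (norm (f s \<omega>))\<^sup>2 \<partial>TL)"
  using sqi_section_snd[OF f]
  by eventually_elim (auto simp: running_integral_eq intro!: integral_norm_sq_le)

lemma integrable_bound_M: "integrable M (\<lambda>\<omega>. T * (\<integral>s. (norm (f s \<omega>))\<^sup>2 \<partial>TL))"
  using integrable_N_snd[OF sqi_D(2)[OF f]] by simp

lemma sqi_running_integral_at:
  assumes t: "t \<in> {0..T}"
  shows "square_integrable_rv M (running_integral f t)"
proof (rule sqi_bound[OF _ integrable_bound_M])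
  show "running_integral f t \<in> borel_measurable M"
    using running_integral_measurable[OF sqi_D(1)[OF f]] t by (rule measurable_section_fst)
  show "AE \<omega> in M. (norm (running_integral f t \<omega>))\<^sup>2 \<le> T * (\<integral>s. (norm (f s \<omega>))\<^sup>2 \<partial>TL)"
    using running_integral_bound t by auto
qed

lemma sqi_running_integral: "square_integrable_process T M (running_integral f)"
proof (rule sqi_bound)
  show "(\<lambda>z. running_integral f (fst z) (snd z)) \<in> borel_measurable N"
    by (rule running_integral_measurable[OF sqi_D(1)[OF f]])
  show "integrable N (\<lambda>z. T * (\<integral>s. (norm (f s (snd z)))\<^sup>2 \<partial>TL))"
    using integrable_N_snd_comp[OF integrable_bound_M] .
  show "AE z in N. (norm (running_integral f (fst z) (snd z)))\<^sup>2 \<le> T * (\<integral>s. (norm (f s (snd z)))\<^sup>2 \<partial>TL)"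
    using AE_N_I[OF running_integral_bound] .
qed

end

lemma sqi_N_snd_comp:
  fixes V :: "'w \<Rightarrow> 'e::euclidean_space"
  assumes "square_integrable_rv M V"
  shows "square_integrable_process T M (\<lambda>_. V)"
proof -
  have "integrable N (\<lambda>z. (norm (V (snd z)))\<^sup>2)"
    by (rule integrable_N_snd_comp[OF sqi_D(2)[OF assms]])
  then show ?thesis unfolding square_integrable_rv_def
    using measurable_compose[OF measurable_snd_N sqi_D(1)[OF assms]] by simp
qed

lemma sqi_N_indicator:
  fixes f :: "real \<Rightarrow> 'w \<Rightarrow> 'e::euclidean_space"
  assumes f: "square_integrable_process T M f"
  shows "square_integrable_process T M (\<lambda>s \<omega>. indicator {0..t} s *\<^sub>R f s \<omega>)"
proof (rule sqi_bound[OF _ sqi_D(2)[OF f]])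
  have [measurable]: "(\<lambda>z. indicator {0..t} (fst z) :: real) \<in> borel_measurable N" by measurable
  show "(\<lambda>z. indicator {0..t} (fst z) *\<^sub>R f (fst z) (snd z)) \<in> borel_measurable N"
    using sqi_D(1)[OF f] by measurable
qed (simp add: indicator_def)

lemma integrable_path:
  fixes f :: "real \<Rightarrow> 'w \<Rightarrow> 'e::euclidean_space"
  assumes f: "square_integrable_process T M f"
  shows "AE \<omega> in M. integrable TL (\<lambda>t. f t \<omega>)"
  using sqi_section_snd[OF f] by eventually_elim (rule sqi_integrable[OF finite_TL])

lemma set_integrable_path:
  fixes f :: "real \<Rightarrow> 'w \<Rightarrow> 'e::euclidean_space"
  assumes f: "square_integrable_process T M f"
  shows "AE \<omega> in M. \<forall>t\<in>{0..T}. set_integrable lborel {0..t} (\<lambda>t. f t \<omega>)"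
  using integrable_path[OF f]
proof eventually_elim
  case (elim \<omega>)
  then have i: "set_integrable lborel {0..T} (\<lambda>s. f s \<omega>)"
    unfolding set_integrable_def by (subst (asm) integrable_restrict_space) auto
  show ?case by (auto intro!: set_integrable_subset[OF i])
qed

text \<open>The iterated form gives access to what is known at each single time s: conditional
  expectations in \<open>cexp_running_integral\<close>, the backward equation in
  \<open>backward_duality\<close>.\<close>

lemma integral_inner_running_integral:
  fixes f :: "real \<Rightarrow> 'w \<Rightarrow> 'e::euclidean_space"
  assumes f: "square_integrable_process T M f" and V: "square_integrable_rv M V" and t: "t \<in> {0..T}"
  shows "(\<integral>\<omega>. V \<omega> \<bullet> running_integral f t \<omega> \<partial>M)
           = (\<integral>z. V (snd z) \<bullet> (indicator {0..t} (fst z) *\<^sub>R f (fst z) (snd z)) \<partial>N)" (is ?A)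
    and "(\<integral>\<omega>. V \<omega> \<bullet> running_integral f t \<omega> \<partial>M)
           = (\<integral>s. indicator {0..t} s *\<^sub>R (\<integral>\<omega>. V \<omega> \<bullet> f s \<omega> \<partial>M) \<partial>TL)" (is ?B)
proof -
  note f' = sqi_N_indicator[OF f, of t]
  note i = sqi_inner_integrable[OF sqi_N_snd_comp[OF V] f']
  have "(\<integral>\<omega>. V \<omega> \<bullet> running_integral f t \<omega> \<partial>M)
      = (\<integral>\<omega>. \<integral>s. V \<omega> \<bullet> (indicator {0..t} s *\<^sub>R f s \<omega>) \<partial>TL \<partial>M)"
  proof (rule integral_cong_AE)
    show "AE \<omega> in M. V \<omega> \<bullet> running_integral f t \<omega> = (\<integral>s. V \<omega> \<bullet> (indicator {0..t} s *\<^sub>R f s \<omega>) \<partial>TL)"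
      using integrable_path[OF f']
      by eventually_elim (simp only: running_integral_eq[OF t] integral_inner_right)
    show "(\<lambda>\<omega>. V \<omega> \<bullet> running_integral f t \<omega>) \<in> borel_measurable M"
      using sqi_D(1)[OF V] sqi_D(1)[OF sqi_running_integral_at[OF f t]] by measurable
    show "(\<lambda>\<omega>. \<integral>s. V \<omega> \<bullet> (indicator {0..t} s *\<^sub>R f s \<omega>) \<partial>TL) \<in> borel_measurable M"
      using integrable_N_snd[OF i] by auto
  qed
  also have "\<dots> = (\<integral>z. V (snd z) \<bullet> (indicator {0..t} (fst z) *\<^sub>R f (fst z) (snd z)) \<partial>N)"
    using integral_N_snd[OF i] by simp
  finally show ?A .
  also have "\<dots> = (\<integral>s. \<integral>\<omega>. V \<omega> \<bullet> (indicator {0..t} s *\<^sub>R f s \<omega>) \<partial>M \<partial>TL)"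
    using integral_N_fst[OF i] by simp
  also have "\<dots> = (\<integral>s. indicator {0..t} s *\<^sub>R (\<integral>\<omega>. V \<omega> \<bullet> f s \<omega> \<partial>M) \<partial>TL)"
    by simp
  finally show ?B .
qed

text \<open>Integration by parts as Fubini on the square [0, T] x [0, T]: the two inner integrals
  run over the triangles t \<le> s and s \<le> t, which cover the square and meet only in the null
  diagonal.\<close>

lemma running_integral_parts_path:
  fixes f g :: "real \<Rightarrow> 'e::euclidean_space"
  assumes f: "integrable TL f" and g: "integrable TL g"
  shows "(\<integral>s. f s \<bullet> (\<integral>t. indicator {0..s} t *\<^sub>R g t \<partial>TL) \<partial>TL) + (\<integral>t. (\<integral>s. indicator {0..t} s *\<^sub>R f s \<partial>TL) \<bullet> g t \<partial>TL)
    = (\<integral>s. f s \<bullet> (\<integral>t. g t \<partial>TL) \<partial>TL)"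
proof -
  interpret P: pair_sigma_finite TL TL ..
  note [measurable] = borel_measurable_integrable[OF f] borel_measurable_integrable[OF g]
  have m: "(\<lambda>z. fst z) \<in> borel_measurable (TL \<Otimes>\<^sub>M TL)" "(\<lambda>z. snd z) \<in> borel_measurable (TL \<Otimes>\<^sub>M TL)"
    using measurable_compose[OF measurable_fst borel_measurable_ident_TL]
      measurable_compose[OF measurable_snd borel_measurable_ident_TL] by auto
  note [measurable] = m measurable_indicator_le[OF m] measurable_indicator_le[OF m(2,1)]
  have fm: "(\<lambda>z. f (fst z)) \<in> borel_measurable (TL \<Otimes>\<^sub>M TL)" "(\<lambda>z. g (snd z)) \<in> borel_measurable (TL \<Otimes>\<^sub>M TL)"
    by measurable
  note [measurable] = fm
  have ii: "integrable (TL \<Otimes>\<^sub>M TL) (\<lambda>z. f (fst z) \<bullet> g (snd z))"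
  proof (rule Bochner_Integration.integrable_bound)
    show "integrable (TL \<Otimes>\<^sub>M TL) (\<lambda>z. norm (f (fst z)) * norm (g (snd z)))"
      by (rule P.Fubini_integrable) (use f g in auto)
    show "AE z in TL \<Otimes>\<^sub>M TL. norm (f (fst z) \<bullet> g (snd z)) \<le> norm (norm (f (fst z)) * norm (g (snd z)))"
      by (simp add: Cauchy_Schwarz_ineq2)
  qed measurable
  have i1: "integrable (TL \<Otimes>\<^sub>M TL) (\<lambda>(s, t). indicator {0..s} t * (f s \<bullet> g t))"
    by (rule Bochner_Integration.integrable_bound[OF ii])
       (auto simp: case_prod_beta' indicator_def[of "{0.._}" "snd _"])
  have i2: "integrable (TL \<Otimes>\<^sub>M TL) (\<lambda>(s, t). indicator {0..t} s * (f s \<bullet> g t))"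
    by (rule Bochner_Integration.integrable_bound[OF ii])
       (auto simp: case_prod_beta' indicator_def[of "{0.._}" "fst _"])
  have ii': "integrable (TL \<Otimes>\<^sub>M TL) (\<lambda>(s, t). f s \<bullet> g t)" using ii by (simp add: case_prod_beta')
  have gi: "integrable TL (\<lambda>t. indicator {0..s} t *\<^sub>R g t)" for s
    by (rule Bochner_Integration.integrable_bound[OF g]) (auto simp: indicator_def)
  have fi: "integrable TL (\<lambda>t. indicator {0..s} t *\<^sub>R f t)" for s
    by (rule Bochner_Integration.integrable_bound[OF f]) (auto simp: indicator_def)
  have "(\<integral>s. f s \<bullet> (\<integral>t. indicator {0..s} t *\<^sub>R g t \<partial>TL) \<partial>TL) = (\<integral>s. \<integral>t. indicator {0..s} t * (f s \<bullet> g t) \<partial>TL \<partial>TL)"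
    unfolding integral_inner_right[OF gi, symmetric] by simp
  also have "\<dots> = (\<integral>(s, t). indicator {0..s} t * (f s \<bullet> g t) \<partial>(TL \<Otimes>\<^sub>M TL))"
    by (rule P.integral_fst[OF i1])
  finally have 1: "(\<integral>s. f s \<bullet> (\<integral>t. indicator {0..s} t *\<^sub>R g t \<partial>TL) \<partial>TL)
    = (\<integral>(s, t). indicator {0..s} t * (f s \<bullet> g t) \<partial>(TL \<Otimes>\<^sub>M TL))" .
  have "(\<integral>t. (\<integral>s. indicator {0..t} s *\<^sub>R f s \<partial>TL) \<bullet> g t \<partial>TL) = (\<integral>t. \<integral>s. indicator {0..t} s * (f s \<bullet> g t) \<partial>TL \<partial>TL)"
    unfolding integral_inner_left[OF fi, symmetric] by simp
  also have "\<dots> = (\<integral>(s, t). indicator {0..t} s * (f s \<bullet> g t) \<partial>(TL \<Otimes>\<^sub>M TL))"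
    by (rule P.integral_snd[OF i2])
  finally have 2: "(\<integral>t. (\<integral>s. indicator {0..t} s *\<^sub>R f s \<partial>TL) \<bullet> g t \<partial>TL)
    = (\<integral>(s, t). indicator {0..t} s * (f s \<bullet> g t) \<partial>(TL \<Otimes>\<^sub>M TL))" .
  have "(\<integral>s. f s \<bullet> (\<integral>t. g t \<partial>TL) \<partial>TL) = (\<integral>s. \<integral>t. f s \<bullet> g t \<partial>TL \<partial>TL)"
    unfolding integral_inner_right[OF g, symmetric] by simp
  also have "\<dots> = (\<integral>(s, t). f s \<bullet> g t \<partial>(TL \<Otimes>\<^sub>M TL))"
    by (rule P.integral_fst[OF ii'])
  also have "\<dots> = (\<integral>z. (case z of (s, t) \<Rightarrow> indicator {0..s} t * (f s \<bullet> g t))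
      + (case z of (s, t) \<Rightarrow> indicator {0..t} s * (f s \<bullet> g t)) \<partial>(TL \<Otimes>\<^sub>M TL))"
  proof (rule integral_cong_AE)
    have d: "{z \<in> space (TL \<Otimes>\<^sub>M TL). fst z \<noteq> snd z} \<in> sets (TL \<Otimes>\<^sub>M TL)" by measurable
    have "AE s in TL. AE t in TL. s \<noteq> t"
    proof (rule AE_I2)
      fix s :: real
      have "AE t in lborel. s \<noteq> t" using AE_lborel_singleton[of s] by eventually_elim auto
      then show "AE t in TL. s \<noteq> t" by (subst AE_restrict_space_iff) auto
    qed
    then have "AE z in TL \<Otimes>\<^sub>M TL. fst z \<noteq> snd z"
      using P.AE_pair_iff[OF d] by simp
    with AE_space show "AE z in TL \<Otimes>\<^sub>M TL. (case z of (s, t) \<Rightarrow> f s \<bullet> g t)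
        = (case z of (s, t) \<Rightarrow> indicator {0..s} t * (f s \<bullet> g t)) + (case z of (s, t) \<Rightarrow> indicator {0..t} s * (f s \<bullet> g t))"
      by eventually_elim (auto simp: space_pair_measure space_TL indicator_def)
  qed (use borel_measurable_integrable[OF ii'] borel_measurable_integrable[OF i1] borel_measurable_integrable[OF i2] in auto)
  also have "\<dots> = (\<integral>(s, t). indicator {0..s} t * (f s \<bullet> g t) \<partial>(TL \<Otimes>\<^sub>M TL))
     + (\<integral>(s, t). indicator {0..t} s * (f s \<bullet> g t) \<partial>(TL \<Otimes>\<^sub>M TL))"
    by (rule Bochner_Integration.integral_add[OF i1 i2])
  finally show ?thesis using 1 2 by simp
qed

text \<open>In \<open>backward_duality\<close>, \<open>f\<close> is the rate of the test process and
  \<open>g\<close> the driver of the backward equation; for these two this identity takes the place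
  of a product rule.\<close>

lemma running_integral_parts:
  fixes f g :: "real \<Rightarrow> 'w \<Rightarrow> 'e::euclidean_space"
  assumes f: "square_integrable_process T M f" and g: "square_integrable_process T M g"
  shows "(\<integral>z. f (fst z) (snd z) \<bullet> (running_integral g T (snd z) - running_integral g (fst z) (snd z)) \<partial>N)
    = (\<integral>z. running_integral f (fst z) (snd z) \<bullet> g (fst z) (snd z) \<partial>N)"
proof -
  have TT: "T \<in> {0..T}" using T_pos by simp
  note G = sqi_diff[OF sqi_N_snd_comp[OF sqi_running_integral_at[OF g TT]] sqi_running_integral[OF g]]
  note i1 = sqi_inner_integrable[OF f G] and i2 = sqi_inner_integrable[OF sqi_running_integral[OF f] g]
  have "(\<integral>z. f (fst z) (snd z) \<bullet> (running_integral g T (snd z) - running_integral g (fst z) (snd z)) \<partial>N)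
    = (\<integral>\<omega>. \<integral>t. f t \<omega> \<bullet> (running_integral g T \<omega> - running_integral g t \<omega>) \<partial>TL \<partial>M)"
    by (rule integral_N_snd[OF i1])
  also have "\<dots> = (\<integral>\<omega>. \<integral>t. running_integral f t \<omega> \<bullet> g t \<omega> \<partial>TL \<partial>M)"
  proof (rule integral_cong_AE)
    show "AE \<omega> in M. (\<integral>t. f t \<omega> \<bullet> (running_integral g T \<omega> - running_integral g t \<omega>) \<partial>TL)
        = (\<integral>t. running_integral f t \<omega> \<bullet> g t \<omega> \<partial>TL)"
      using sqi_section_snd[OF f] sqi_section_snd[OF g] sqi_section_snd[OF sqi_running_integral[OF g]]
    proof eventually_elim
      case (elim \<omega>)
      note fi = sqi_integrable[OF finite_TL elim(1)] and gi = sqi_integrable[OF finite_TL elim(2)]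
      have r: "(\<integral>t. running_integral f t \<omega> \<bullet> g t \<omega> \<partial>TL)
          = (\<integral>t. (\<integral>s. indicator {0..t} s *\<^sub>R f s \<omega> \<partial>TL) \<bullet> g t \<omega> \<partial>TL)"
        by (rule Bochner_Integration.integral_cong) (auto simp: running_integral_eq space_TL)
      have l: "(\<integral>t. f t \<omega> \<bullet> running_integral g t \<omega> \<partial>TL)
          = (\<integral>t. f t \<omega> \<bullet> (\<integral>s. indicator {0..t} s *\<^sub>R g s \<omega> \<partial>TL) \<partial>TL)"
        by (rule Bochner_Integration.integral_cong) (auto simp: running_integral_eq space_TL)
      have u: "running_integral g T \<omega> = (\<integral>t. g t \<omega> \<partial>TL)"
        unfolding running_integral_eq[OF TT]
        by (rule Bochner_Integration.integral_cong) (auto simp: space_TL)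
      have "(\<integral>t. f t \<omega> \<bullet> (running_integral g T \<omega> - running_integral g t \<omega>) \<partial>TL)
         = (\<integral>t. f t \<omega> \<bullet> running_integral g T \<omega> \<partial>TL) - (\<integral>t. f t \<omega> \<bullet> running_integral g t \<omega> \<partial>TL)"
        unfolding inner_diff_right
        by (rule Bochner_Integration.integral_diff) (use fi sqi_inner_integrable[OF elim(1,3)] in auto)
      then show ?case using running_integral_parts_path[OF fi gi] unfolding r l u by linarith
    qed
  qed (use borel_measurable_integrable[OF integrable_N_snd[OF i1]]
        borel_measurable_integrable[OF integrable_N_snd[OF i2]] in auto)
  also have "\<dots> = (\<integral>z. running_integral f (fst z) (snd z) \<bullet> g (fst z) (snd z) \<partial>N)"
    by (rule integral_N_snd[OF i2, symmetric])
  finally show ?thesis .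
qed

end

text \<open>Rounding is downwards, so that a process read at the rounded time uses only information
  available at the true time. The conversion to \<open>nat\<close> sends negative times to
  0.\<close>

definition dyadic_floor :: "nat \<Rightarrow> real \<Rightarrow> real" where
  "dyadic_floor n t = real (nat \<lfloor>2 ^ n * t\<rfloor>) / 2 ^ n"

lemma dyadic_floor_nonneg: "0 \<le> dyadic_floor n t"
  by (simp add: dyadic_floor_def)

lemma dyadic_floor_le: "0 \<le> t \<Longrightarrow> dyadic_floor n t \<le> t"
proof -
  assume "0 \<le> t"
  then have "real (nat \<lfloor>2 ^ n * t\<rfloor>) \<le> 2 ^ n * t" by (simp add: of_nat_nat)
  then show ?thesis unfolding dyadic_floor_def by (simp add: field_simps)
qed

lemma dyadic_floor_tendsto: "0 \<le> t \<Longrightarrow> (\<lambda>n. dyadic_floor n t) \<longlonglongrightarrow> t"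
proof (rule tendsto_sandwich[of "\<lambda>n. t - (1/2) ^ n" _ _ "\<lambda>_. t"])
  assume t: "0 \<le> t"
  have "t - (1/2) ^ n \<le> dyadic_floor n t" for n
  proof -
    have "2 ^ n * t - 1 \<le> real (nat \<lfloor>2 ^ n * t\<rfloor>)" using t by (simp add: of_nat_nat)
    then have "(2 ^ n * t - 1) / 2 ^ n \<le> dyadic_floor n t"
      unfolding dyadic_floor_def by (rule divide_right_mono) simp
    then show ?thesis by (simp add: diff_divide_distrib power_one_over)
  qed
  then show "\<forall>\<^sub>F n in sequentially. t - (1/2) ^ n \<le> dyadic_floor n t" by simp
  show "\<forall>\<^sub>F n in sequentially. dyadic_floor n t \<le> t" using dyadic_floor_le[OF t] by simp
  have "(\<lambda>n. t - (1/2) ^ n) \<longlonglongrightarrow> t - 0"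
    by (intro tendsto_diff tendsto_const LIMSEQ_power_zero) simp
  then show "(\<lambda>n. t - (1/2) ^ n) \<longlonglongrightarrow> t" by simp
qed simp

section \<open>Adapted processes and their projections\<close>

context time_prob_space
begin

definition filtration_on :: "(real \<Rightarrow> 'w measure) \<Rightarrow> bool" where
  "filtration_on F \<longleftrightarrow> (\<forall>t\<in>{0..T}. subalgebra M (F t)) \<and>
     (\<forall>s t. 0 \<le> s \<longrightarrow> s \<le> t \<longrightarrow> t \<le> T \<longrightarrow> sets (F s) \<subseteq> sets (F t))"

text \<open>Measurability for this sigma-algebra is what \<open>L2_adapted\<close> asks for beyond
  square-integrability, so the orthogonal projection onto adapted processes becomes a conditional
  expectation. It contains the progressive sigma-algebra: sections at different times are linked by
  joint measurability alone.\<close>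

definition adapted_sigma :: "(real \<Rightarrow> 'w measure) \<Rightarrow> (real \<times> 'w) measure" where
  "adapted_sigma F = sigma (space N) {A \<in> sets N. \<forall>t\<in>{0..T}. Pair t -` A \<in> sets (F t)}"

definition adapted_projection ::
    "(real \<Rightarrow> 'w measure) \<Rightarrow> (real \<Rightarrow> 'w \<Rightarrow> real ^ 'n) \<Rightarrow> real \<Rightarrow> 'w \<Rightarrow> real ^ 'n" where
  "adapted_projection F f t \<omega> = conditional_expectation N (adapted_sigma F) (\<lambda>z. f (fst z) (snd z)) (t, \<omega>)"

lemma filtration_onD:
  assumes "filtration_on F" "t \<in> {0..T}"
  shows "subalgebra M (F t)" "space (F t) = space M" "sets (F t) \<subseteq> sets M"
  using assms unfolding filtration_on_def subalgebra_def by auto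

lemma filtration_on_mono:
  assumes "filtration_on F" "s \<in> {0..T}" "t \<in> {0..T}" "s \<le> t"
  shows "subalgebra (F t) (F s)"
  using assms unfolding filtration_on_def subalgebra_def by auto

lemma filtration_measurable_mono:
  assumes "filtration_on F" "s \<in> {0..T}" "t \<in> {0..T}" "s \<le> t" "f \<in> measurable (F s) R"
  shows "f \<in> measurable (F t) R"
  using measurable_from_subalg[OF filtration_on_mono[OF assms(1-4)] assms(5)] .

text \<open>The sets with adapted sections already form a sigma-algebra; for complements it matters
  that all \<open>F t\<close> live on the same space.\<close>

lemma sets_adapted_sigma:
  assumes F: "filtration_on F"
  shows "sets (adapted_sigma F) = {A \<in> sets N. \<forall>t\<in>{0..T}. Pair t -` A \<in> sets (F t)}" (is "_ = ?S")
proof -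
  have "sigma_algebra (space N) ?S"
    unfolding sigma_algebra_iff2
  proof (intro conjI ballI allI impI)
    show "?S \<subseteq> Pow (space N)" using sets.sets_into_space by auto
    show "{} \<in> ?S" by simp
    fix A assume A: "A \<in> ?S"
    have "Pair t -` (space N - A) = space (F t) - Pair t -` A" if "t \<in> {0..T}" for t
      using that filtration_onD(2)[OF F that] by (auto simp: space_N)
    then show "space N - A \<in> ?S" using A by auto
  next
    fix A :: "nat \<Rightarrow> (real \<times> 'w) set" assume "range A \<subseteq> ?S"
    then show "(\<Union>i. A i) \<in> ?S" by (auto simp: vimage_UN)
  qed
  then show ?thesis unfolding adapted_sigma_def by (simp add: sigma_algebra.sets_measure_of_eq)
qed

lemma space_adapted_sigma: "space (adapted_sigma F) = space N"
  unfolding adapted_sigma_def by (rule space_measure_of) (use sets.sets_into_space in auto)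

lemma subalgebra_adapted_sigma: "filtration_on F \<Longrightarrow> subalgebra N (adapted_sigma F)"
  unfolding subalgebra_def by (simp add: space_adapted_sigma sets_adapted_sigma)

text \<open>Sections of preimages are preimages under sections, so the condition on sets translates
  literally into one on each \<open>f t\<close>.\<close>

lemma measurable_adapted_sigma_iff:
  fixes f :: "real \<Rightarrow> 'w \<Rightarrow> 'e::euclidean_space"
  assumes F: "filtration_on F"
  shows "(\<lambda>z. f (fst z) (snd z)) \<in> borel_measurable (adapted_sigma F)
    \<longleftrightarrow> (\<lambda>z. f (fst z) (snd z)) \<in> borel_measurable N \<and> (\<forall>t\<in>{0..T}. f t \<in> borel_measurable (F t))"
proof safe
  assume f: "(\<lambda>z. f (fst z) (snd z)) \<in> borel_measurable (adapted_sigma F)"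
  show "(\<lambda>z. f (fst z) (snd z)) \<in> borel_measurable N"
    by (rule measurable_from_subalg[OF subalgebra_adapted_sigma[OF F] f])
  fix t assume t: "t \<in> {0..T}"
  show "f t \<in> borel_measurable (F t)"
  proof (rule measurableI)
    fix A :: "'e set" assume "A \<in> sets borel"
    then have "(\<lambda>z. f (fst z) (snd z)) -` A \<inter> space N \<in> sets (adapted_sigma F)"
      using measurable_sets[OF f] by (simp add: space_adapted_sigma)
    then have "Pair t -` ((\<lambda>z. f (fst z) (snd z)) -` A \<inter> space N) \<in> sets (F t)"
      using t by (simp add: sets_adapted_sigma[OF F])
    moreover have "Pair t -` ((\<lambda>z. f (fst z) (snd z)) -` A \<inter> space N) = f t -` A \<inter> space (F t)"
      using t filtration_onD(2)[OF F t] by (auto simp: space_N)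
    ultimately show "f t -` A \<inter> space (F t) \<in> sets (F t)" by simp
  qed simp
next
  assume N: "(\<lambda>z. f (fst z) (snd z)) \<in> borel_measurable N" and t: "\<forall>t\<in>{0..T}. f t \<in> borel_measurable (F t)"
  show "(\<lambda>z. f (fst z) (snd z)) \<in> borel_measurable (adapted_sigma F)"
  proof (rule measurableI)
    fix A :: "'e set" assume A: "A \<in> sets borel"
    have "Pair t -` ((\<lambda>z. f (fst z) (snd z)) -` A \<inter> space N) \<in> sets (F t)" if "t \<in> {0..T}" for t
    proof -
      have "Pair t -` ((\<lambda>z. f (fst z) (snd z)) -` A \<inter> space N) = f t -` A \<inter> space (F t)"
        using that filtration_onD(2)[OF F that] by (auto simp: space_N)
      then show ?thesis using measurable_sets[OF bspec[OF t that] A] by simp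
    qed
    then show "(\<lambda>z. f (fst z) (snd z)) -` A \<inter> space (adapted_sigma F) \<in> sets (adapted_sigma F)"
      using measurable_sets[OF N A] by (simp add: sets_adapted_sigma[OF F] space_adapted_sigma)
  qed simp
qed

lemma L2_adapted_adapted_sigma:
  fixes x :: "real \<Rightarrow> 'w \<Rightarrow> 'e::euclidean_space"
  assumes F: "filtration_on F"
  shows "L2_adapted T M F x \<longleftrightarrow>
    square_integrable_process T M x \<and> (\<lambda>z. x (fst z) (snd z)) \<in> borel_measurable (adapted_sigma F)"
  unfolding L2_adapted_iff measurable_adapted_sigma_iff[OF F] using sqi_D(1) by blast

lemma L2_adapted_projection:
  fixes f :: "real \<Rightarrow> 'w \<Rightarrow> real ^ 'n"
  assumes F: "filtration_on F" and f: "square_integrable_process T M f"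
  shows "L2_adapted T M F (adapted_projection F f)"
  unfolding L2_adapted_adapted_sigma[OF F] adapted_projection_def
  using cexp_sqi[OF finite_N subalgebra_adapted_sigma[OF F] f]
    cexp_measurable[OF finite_N subalgebra_adapted_sigma[OF F]]
  by simp

lemma adapted_projection_inner:
  fixes f v :: "real \<Rightarrow> 'w \<Rightarrow> real ^ 'n"
  assumes F: "filtration_on F" and f: "square_integrable_process T M f" and v: "L2_adapted T M F v"
  shows "(\<integral>z. v (fst z) (snd z) \<bullet> adapted_projection F f (fst z) (snd z) \<partial>N)
      = (\<integral>z. v (fst z) (snd z) \<bullet> f (fst z) (snd z) \<partial>N)"
  using cexp_inner[OF finite_N subalgebra_adapted_sigma[OF F] f] v
  unfolding L2_adapted_adapted_sigma[OF F] adapted_projection_def by simp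

lemma L2_adapted_sqi: "L2_adapted T M F x \<Longrightarrow> square_integrable_process T M x"
  unfolding L2_adapted_iff by simp

lemma L2_adapted_at: "L2_adapted T M F x \<Longrightarrow> t \<in> {0..T} \<Longrightarrow> x t \<in> borel_measurable (F t)"
  unfolding L2_adapted_iff by simp

lemma L2_adapted_add:
  fixes x y :: "real \<Rightarrow> 'w \<Rightarrow> 'e::euclidean_space"
  shows "L2_adapted T M F x \<Longrightarrow> L2_adapted T M F y \<Longrightarrow> L2_adapted T M F (\<lambda>t \<omega>. x t \<omega> + y t \<omega>)"
  unfolding L2_adapted_iff by (auto intro: sqi_add borel_measurable_add)

lemma L2_adapted_diff:
  fixes x y :: "real \<Rightarrow> 'w \<Rightarrow> 'e::euclidean_space"
  shows "L2_adapted T M F x \<Longrightarrow> L2_adapted T M F y \<Longrightarrow> L2_adapted T M F (\<lambda>t \<omega>. x t \<omega> - y t \<omega>)"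
  unfolding L2_adapted_iff by (auto intro: sqi_diff borel_measurable_diff)

lemma L2_adapted_bounded_linear:
  fixes x :: "real \<Rightarrow> 'w \<Rightarrow> 'e::euclidean_space" and h :: "'e \<Rightarrow> 'f::euclidean_space"
  assumes "bounded_linear h" "L2_adapted T M F x"
  shows "L2_adapted T M F (\<lambda>t \<omega>. h (x t \<omega>))"
  using assms sqi_bounded_linear[OF assms(1)]
    measurable_compose[OF _ borel_measurable_continuous_onI[OF linear_continuous_on[OF assms(1)]]]
  unfolding L2_adapted_iff by blast

lemma L2_adapted_mult_vec:
  fixes x :: "real \<Rightarrow> 'w \<Rightarrow> real ^ 'n" and A :: "real ^ 'n ^ 'm"
  shows "L2_adapted T M F x \<Longrightarrow> L2_adapted T M F (\<lambda>t \<omega>. A *v x t \<omega>)"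
  by (rule L2_adapted_bounded_linear[OF matrix_vector_mul_bounded_linear])

lemma L2_adapted_scaleR:
  fixes x :: "real \<Rightarrow> 'w \<Rightarrow> 'e::euclidean_space"
  shows "L2_adapted T M F x \<Longrightarrow> L2_adapted T M F (\<lambda>t \<omega>. c *\<^sub>R x t \<omega>)"
  by (rule L2_adapted_bounded_linear[OF bounded_linear_scaleR_right])

lemma L2_adapted_uminus:
  fixes x :: "real \<Rightarrow> 'w \<Rightarrow> 'e::euclidean_space"
  shows "L2_adapted T M F x \<Longrightarrow> L2_adapted T M F (\<lambda>t \<omega>. - x t \<omega>)"
  by (rule L2_adapted_bounded_linear[OF bounded_linear_minus[OF bounded_linear_ident]])

lemma L2_adapted_const:
  fixes c :: "'e::euclidean_space"
  shows "L2_adapted T M F (\<lambda>t \<omega>. c)"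
  unfolding L2_adapted_iff by (simp add: sqi_const[OF finite_N])

lemma L2_adapted_mono:
  assumes "L2_adapted T M F x" "\<And>t. t \<in> {0..T} \<Longrightarrow> subalgebra (G t) (F t)"
  shows "L2_adapted T M G x"
  using assms measurable_from_subalg unfolding L2_adapted_iff by blast

lemma AE_N_eq:
  fixes x y :: "real \<Rightarrow> 'w \<Rightarrow> 'e::euclidean_space"
  assumes [measurable]: "(\<lambda>z. x (fst z) (snd z)) \<in> borel_measurable N"
      "(\<lambda>z. y (fst z) (snd z)) \<in> borel_measurable N"
    and eq: "AE t in TL. AE \<omega> in M. x t \<omega> = y t \<omega>"
  shows "AE z in N. x (fst z) (snd z) = y (fst z) (snd z)"
proof -
  have "{z \<in> space N. x (fst z) (snd z) = y (fst z) (snd z)} \<in> sets N" by measurable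
  from AE_N_iff[OF this] eq show ?thesis by simp
qed

lemma AE_TL_I: "(\<And>t. t \<in> {0..T} \<Longrightarrow> P t) \<Longrightarrow> AE t in TL. P t"
  by (rule AE_I2) (simp add: space_TL)

lemma L2_adapted_modification:
  fixes x y :: "real \<Rightarrow> 'w \<Rightarrow> 'e::euclidean_space"
  assumes "square_integrable_process T M x" "square_integrable_process T M y" "modification T M x y"
  shows "AE z in N. x (fst z) (snd z) = y (fst z) (snd z)"
  by (rule AE_N_eq) (use assms sqi_D(1) in \<open>auto simp: modification_def intro!: AE_TL_I\<close>)

text \<open>For s \<le> t the pairing of \<open>V\<close> with \<open>f s\<close> sees only
  E[V | F t]. Integrating in s, so does the pairing of \<open>V\<close> with the time integral,
  although the latter is not known to be \<open>F t\<close>-measurable. A variable with this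
  property almost surely equals its own conditional expectation.\<close>

lemma cexp_running_integral:
  fixes f :: "real \<Rightarrow> 'w \<Rightarrow> real ^ 'n"
  assumes F: "filtration_on F" and f: "L2_adapted T M F f" and t: "t \<in> {0..T}"
  shows "AE \<omega> in M. conditional_expectation M (F t) (running_integral f t) \<omega> = running_integral f t \<omega>"
proof -
  let ?E = "conditional_expectation M (F t)" and ?R = "running_integral f t"
  note sub = filtration_onD(1)[OF F t]
  note fin = finite_measure_axioms
  note sf = L2_adapted_sqi[OF f]
  note R = sqi_running_integral_at[OF sf t]
  have self_adjoint: "(\<integral>\<omega>. V \<omega> \<bullet> ?R \<omega> \<partial>M) = (\<integral>\<omega>. ?E V \<omega> \<bullet> ?R \<omega> \<partial>M)"
    if V: "square_integrable_rv M V" for V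
  proof -
    note EV = cexp_sqi[OF fin sub V]
    have meas: "(\<lambda>s. indicator {0..t} s *\<^sub>R (\<integral>\<omega>. W \<omega> \<bullet> f s \<omega> \<partial>M)) \<in> borel_measurable TL"
      if "square_integrable_rv M W" for W
      using borel_measurable_integrable[OF
          integrable_N_fst[OF sqi_inner_integrable[OF sqi_N_snd_comp[OF that] sqi_N_indicator[OF sf, of t]]]]
      by simp
    have "(\<integral>s. indicator {0..t} s *\<^sub>R (\<integral>\<omega>. V \<omega> \<bullet> f s \<omega> \<partial>M) \<partial>TL)
        = (\<integral>s. indicator {0..t} s *\<^sub>R (\<integral>\<omega>. ?E V \<omega> \<bullet> f s \<omega> \<partial>M) \<partial>TL)"
    proof (rule integral_cong_AE)
      show "AE s in TL. indicator {0..t} s *\<^sub>R (\<integral>\<omega>. V \<omega> \<bullet> f s \<omega> \<partial>M)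
          = indicator {0..t} s *\<^sub>R (\<integral>\<omega>. ?E V \<omega> \<bullet> f s \<omega> \<partial>M)"
        using sqi_section_fst[OF sf] AE_space
      proof eventually_elim
        case (elim s)
        show ?case
        proof (cases "s \<in> {0..t}")
          case True
          then have m: "f s \<in> borel_measurable (F t)"
            using elim(2) t
            by (intro filtration_measurable_mono[OF F, of s t]) (auto intro: L2_adapted_at[OF f])
          show ?thesis using cexp_inner[OF fin sub V elim(1) m]
            by (simp add: inner_commute[of _ "f s _"])
        qed simp
      qed
    qed (use meas[OF V] meas[OF EV] in auto)
    then show ?thesis
      using integral_inner_running_integral(2)[OF sf V t] integral_inner_running_integral(2)[OF sf EV t]
      by simp
  qed
  define D where "D \<omega> = ?R \<omega> - ?E ?R \<omega>" for \<omega>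
  note ER = cexp_sqi[OF fin sub R]
  have D: "square_integrable_rv M D" unfolding D_def by (rule sqi_diff[OF R ER])
  note ED = cexp_sqi[OF fin sub D]
  note ii = sqi_inner_integrable
  \<comment> \<open>Each of the two pairings below reduces to the one of E[D | F t] with the
    conditional expectation of the running integral.\<close>
  have "(\<integral>\<omega>. D \<omega> \<bullet> D \<omega> \<partial>M) = (\<integral>\<omega>. D \<omega> \<bullet> ?R \<omega> - ?E ?R \<omega> \<bullet> D \<omega> \<partial>M)"
    by (simp add: D_def inner_diff_left inner_diff_right inner_commute)
  also have "\<dots> = (\<integral>\<omega>. D \<omega> \<bullet> ?R \<omega> \<partial>M) - (\<integral>\<omega>. ?E ?R \<omega> \<bullet> D \<omega> \<partial>M)"
    by (rule Bochner_Integration.integral_diff) (use ii D R ER in auto)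
  also have "\<dots> = (\<integral>\<omega>. ?E D \<omega> \<bullet> ?R \<omega> \<partial>M) - (\<integral>\<omega>. ?E ?R \<omega> \<bullet> ?E D \<omega> \<partial>M)"
    using self_adjoint[OF D] cexp_inner[OF fin sub D ER cexp_measurable[OF fin sub]] by simp
  also have "\<dots> = 0"
    using cexp_inner[OF fin sub R ED cexp_measurable[OF fin sub]]
    by (simp add: inner_commute[of "?E ?R _"])
  finally have "AE \<omega> in M. D \<omega> = 0" by (rule sqi_zero_AE[OF D])
  then show ?thesis by eventually_elim (simp add: D_def)
qed

text \<open>Only countably many of the \<open>U t\<close> occur, which gives joint measurability
  although \<open>U\<close> is given time by time. Adaptedness holds because the grid time is never
  later than the true one.\<close>

lemma measurable_dyadic_step:
  fixes U :: "real \<Rightarrow> 'w \<Rightarrow> 'e::euclidean_space"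
  assumes F: "filtration_on F" and U: "\<And>t. t \<in> {0..T} \<Longrightarrow> U t \<in> borel_measurable (F t)"
  shows "(\<lambda>z. U (dyadic_floor n (fst z)) (snd z)) \<in> borel_measurable (adapted_sigma F)"
  unfolding measurable_adapted_sigma_iff[OF F, of "\<lambda>t. U (dyadic_floor n t)"]
proof safe
  \<comment> \<open>The grid is cut at T, since \<open>U\<close> is controlled on [0, T]
    only.\<close>
  let ?I = "{k. real k / 2 ^ n \<le> T}"
  show "(\<lambda>z. U (dyadic_floor n (fst z)) (snd z)) \<in> borel_measurable N"
    unfolding dyadic_floor_def
  proof (rule measurable_compose_countable'[where I = ?I
        and f = "\<lambda>k z. U (real k / 2 ^ n) (snd z)" and g = "\<lambda>z. nat \<lfloor>2 ^ n * fst z\<rfloor>"])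
    show "(\<lambda>z. U (real k / 2 ^ n) (snd z)) \<in> borel_measurable N" if "k \<in> ?I" for k
    proof -
      have "real k / 2 ^ n \<in> {0..T}" using that by auto
      from measurable_from_subalg[OF filtration_onD(1)[OF F this] U[OF this]]
      show ?thesis by (rule measurable_compose[OF measurable_snd_N])
    qed
    show "(\<lambda>z. nat \<lfloor>2 ^ n * fst z\<rfloor>) \<in> measurable N (count_space ?I)"
      unfolding measurable_count_space_eq2_countable
    proof safe
      fix a b assume "(a, b) \<in> space N"
      then show "real (nat \<lfloor>2 ^ n * fst (a, b)\<rfloor>) / 2 ^ n \<le> T"
        using dyadic_floor_le[of a n] unfolding dyadic_floor_def space_N by auto
    next
      fix k assume "real k / 2 ^ n \<le> T"
      have "(\<lambda>z. nat \<lfloor>2 ^ n * fst z\<rfloor>) \<in> measurable N (count_space UNIV)" by measurable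
      from measurable_sets[OF this, of "{k}"]
      show "(\<lambda>z. nat \<lfloor>2 ^ n * fst z\<rfloor>) -` {k} \<inter> space N \<in> sets N" by simp
    qed
  qed simp
next
  fix t assume t: "t \<in> {0..T}"
  then have "dyadic_floor n t \<in> {0..T}" "dyadic_floor n t \<le> t"
    using dyadic_floor_le[of t n] dyadic_floor_nonneg[of n t] by auto
  then show "U (dyadic_floor n t) \<in> borel_measurable (F t)"
    using filtration_measurable_mono[OF F _ t _ U] by blast
qed

lemma running_integral_path_continuous:
  fixes f :: "real \<Rightarrow> 'w \<Rightarrow> 'e::euclidean_space"
  assumes i: "integrable TL (\<lambda>s. f s \<omega>)" and t: "t \<in> {0..T}"
  shows "(\<lambda>n. running_integral f (dyadic_floor n t) \<omega>) \<longlonglongrightarrow> running_integral f t \<omega>"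
proof -
  have d: "dyadic_floor n t \<in> {0..T}" for n
    using dyadic_floor_le[of t n] dyadic_floor_nonneg[of n t] t by auto
  show ?thesis unfolding running_integral_eq[OF d] running_integral_eq[OF t]
  proof (rule integral_dominated_convergence)
    show "integrable TL (\<lambda>s. norm (f s \<omega>))" using i by simp
    have m: "(\<lambda>s. indicator {0..c} s *\<^sub>R f s \<omega>) \<in> borel_measurable TL" for c
      using borel_measurable_integrable[OF i] by measurable
    then show "(\<lambda>s. indicator {0..t} s *\<^sub>R f s \<omega>) \<in> borel_measurable TL"
      "\<And>n. (\<lambda>s. indicator {0..dyadic_floor n t} s *\<^sub>R f s \<omega>) \<in> borel_measurable TL" by auto
    \<comment> \<open>At s = t the indicators need not converge, since the grid times may stay
      strictly below t.\<close>
    have "AE s in lborel. s \<noteq> t" by (rule AE_lborel_singleton)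
    then have ne: "AE s in TL. s \<noteq> t" by (subst AE_restrict_space_iff) auto
    show "AE s in TL. (\<lambda>n. indicator {0..dyadic_floor n t} s *\<^sub>R f s \<omega>) \<longlonglongrightarrow> indicator {0..t} s *\<^sub>R f s \<omega>"
      using ne AE_space
    proof eventually_elim
      case (elim s)
      have "\<forall>\<^sub>F n in sequentially. indicator {0..dyadic_floor n t} s *\<^sub>R f s \<omega> = indicator {0..t} s *\<^sub>R f s \<omega>"
      proof (cases "s < t")
        case True
        then have "\<forall>\<^sub>F n in sequentially. s < dyadic_floor n t"
          using order_tendstoD(1)[OF dyadic_floor_tendsto] t by auto
        then show ?thesis by eventually_elim (use True elim in \<open>auto simp: indicator_def space_TL\<close>)
      next
        case False
        then have "t < s" using elim by auto
        moreover have "dyadic_floor n t \<le> t" for n using dyadic_floor_le t by auto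
        ultimately have "\<not> s \<le> dyadic_floor n t" for n by (meson leD order.strict_trans1)
        then show ?thesis using \<open>t < s\<close> by (simp add: indicator_def)
      qed
      then show ?case by (rule tendsto_eventually)
    qed
  qed (simp add: indicator_def)
qed

text \<open>The filtrations are not augmented by null sets and \<open>L2_adapted\<close> is weaker than progressive measurability,
  so that the running integral of an adapted process need not be adapted itself.\<close>

lemma adapted_running_integral:
  fixes f :: "real \<Rightarrow> 'w \<Rightarrow> real ^ 'n"
  assumes F: "filtration_on F" and f: "L2_adapted T M F f"
  obtains y where "L2_adapted T M F y" "\<And>t. t \<in> {0..T} \<Longrightarrow> AE \<omega> in M. y t \<omega> = running_integral f t \<omega>"
proof -
  \<comment> \<open>A version measurable at time t for each single t, but with a null set that
    depends on t and no joint measurability.\<close>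
  define U where "U t = conditional_expectation M (F t) (running_integral f t)" for t
  \<comment> \<open>Along the grid times only countably many null sets occur, and continuity of the
    integral identifies the limit from the left. Grid times do not exceed t, so the limit is
    adapted; \<open>lim\<close> is measurable also where the sequence diverges.\<close>
  define y where "y t \<omega> = lim (\<lambda>n. U (dyadic_floor n t) \<omega>)" for t \<omega>
  note sf = L2_adapted_sqi[OF f]
  have U: "U t \<in> borel_measurable (F t)" if "t \<in> {0..T}" for t
    unfolding U_def by (rule cexp_measurable[OF finite_measure_axioms filtration_onD(1)[OF F that]])
  have ym: "(\<lambda>z. y (fst z) (snd z)) \<in> borel_measurable (adapted_sigma F)"
    unfolding y_def by (rule borel_measurable_lim_metric) (rule measurable_dyadic_step[OF F U])
  have yR: "AE \<omega> in M. y t \<omega> = running_integral f t \<omega>" if t: "t \<in> {0..T}" for t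
  proof -
    have d: "dyadic_floor n t \<in> {0..T}" for n
      using dyadic_floor_le[of t n] dyadic_floor_nonneg[of n t] t by auto
    have "AE \<omega> in M. \<forall>n. U (dyadic_floor n t) \<omega> = running_integral f (dyadic_floor n t) \<omega>"
      unfolding AE_all_countable U_def using cexp_running_integral[OF F f d] by blast
    with integrable_path[OF sf] show ?thesis
    proof eventually_elim
      case (elim \<omega>)
      then show ?case unfolding y_def
        using running_integral_path_continuous[where \<omega> = \<omega> and f = f, OF _ t] by (simp add: limI)
    qed
  qed
  have mN: "(\<lambda>z. y (fst z) (snd z)) \<in> borel_measurable N"
    using measurable_from_subalg[OF subalgebra_adapted_sigma[OF F] ym] .
  have "AE z in N. y (fst z) (snd z) = running_integral f (fst z) (snd z)"
    by (rule AE_N_eq[OF mN running_integral_measurable[OF sqi_D(1)[OF sf]]]) (rule AE_TL_I[OF yR])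
  then have "square_integrable_process T M y"
    by (rule sqi_cong_AE[OF mN sqi_running_integral[OF sf]])
  then have "L2_adapted T M F y" unfolding L2_adapted_adapted_sigma[OF F] using ym by simp
  then show ?thesis using yR that by blast
qed

text \<open>The immersion property of filtrations: conditioning an \<open>F T\<close>-variable on
  the larger \<open>G t\<close> yields the same as conditioning on \<open>F t\<close>. It is stated
  in tested form and for real variables; \<open>immersed_inner\<close> passes to vectors of any
  dimension by coordinates.\<close>

definition immersed :: "(real \<Rightarrow> 'w measure) \<Rightarrow> (real \<Rightarrow> 'w measure) \<Rightarrow> bool" where
  "immersed F G \<longleftrightarrow> filtration_on F \<and> filtration_on G \<and> (\<forall>t\<in>{0..T}. sets (F t) \<subseteq> sets (G t)) \<and>
     (\<forall>t\<in>{0..T}. \<forall>V X :: 'w \<Rightarrow> real. V \<in> borel_measurable (F T) \<longrightarrow> X \<in> borel_measurable (G t) \<longrightarrow>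
        square_integrable_rv M V \<longrightarrow> square_integrable_rv M X \<longrightarrow>
        (\<integral>\<omega>. V \<omega> * X \<omega> \<partial>M) = (\<integral>\<omega>. real_cond_exp M (F t) V \<omega> * X \<omega> \<partial>M))"

lemma immersedD:
  assumes "immersed F G"
  shows "filtration_on F" "filtration_on G" "t \<in> {0..T} \<Longrightarrow> subalgebra (G t) (F t)"
  using assms filtration_onD(2)[of F] filtration_onD(2)[of G] unfolding immersed_def subalgebra_def by auto

lemma immersed_inner:
  fixes V X :: "'w \<Rightarrow> real ^ 'n"
  assumes FG: "immersed F G" and t: "t \<in> {0..T}"
    and V: "V \<in> borel_measurable (F T)" "square_integrable_rv M V"
    and X: "X \<in> borel_measurable (G t)" "square_integrable_rv M X"
  shows "(\<integral>\<omega>. V \<omega> \<bullet> X \<omega> \<partial>M) = (\<integral>\<omega>. conditional_expectation M (F t) V \<omega> \<bullet> X \<omega> \<partial>M)"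
proof -
  note EV = cexp_sqi[OF finite_measure_axioms filtration_onD(1)[OF immersedD(1)[OF FG] t] V(2)]
  have "(\<integral>\<omega>. V \<omega> \<bullet> X \<omega> \<partial>M) = (\<Sum>i\<in>UNIV. \<integral>\<omega>. V \<omega> $ i * X \<omega> $ i \<partial>M)"
    using sqi_inner_integrable[OF sqi_nth[OF V(2)] sqi_nth[OF X(2)]] by (simp add: inner_vec_def)
  also have "\<dots> = (\<Sum>i\<in>UNIV. \<integral>\<omega>. conditional_expectation M (F t) V \<omega> $ i * X \<omega> $ i \<partial>M)"
  proof (rule sum.cong)
    fix i
    show "(\<integral>\<omega>. V \<omega> $ i * X \<omega> $ i \<partial>M) = (\<integral>\<omega>. conditional_expectation M (F t) V \<omega> $ i * X \<omega> $ i \<partial>M)"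
      using FG t borel_measurable_vec_nth[OF V(1), of i] borel_measurable_vec_nth[OF X(1), of i]
        sqi_nth[OF V(2), of i] sqi_nth[OF X(2), of i]
      unfolding immersed_def conditional_expectation_def by simp
  qed simp
  also have "\<dots> = (\<integral>\<omega>. conditional_expectation M (F t) V \<omega> \<bullet> X \<omega> \<partial>M)"
    using sqi_inner_integrable[OF sqi_nth[OF EV] sqi_nth[OF X(2)]] by (simp add: inner_vec_def)
  finally show ?thesis .
qed

context
  fixes F :: "real \<Rightarrow> 'w measure" and V :: "'w \<Rightarrow> real ^ 'n"
  assumes F: "filtration_on F" and V: "square_integrable_rv M V"
begin

definition "martingale_of t = conditional_expectation M (F t) V"

text \<open>The martingale is a family of separately chosen versions, not known to be jointly
  measurable in (t, \<omega>). Read at grid times it becomes an adapted process that can serve as a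
  test process.\<close>

definition "martingale_step n t = martingale_of (dyadic_floor n t)"

lemma martingale_of_props:
  assumes t: "t \<in> {0..T}"
  shows "martingale_of t \<in> borel_measurable (F t)" "square_integrable_rv M (martingale_of t)"
    "(\<integral>\<omega>. martingale_of t \<omega> \<bullet> martingale_of t \<omega> \<partial>M) \<le> (\<integral>\<omega>. V \<omega> \<bullet> V \<omega> \<partial>M)"
proof -
  note P = finite_measure_axioms filtration_onD(1)[OF F t]
  show "martingale_of t \<in> borel_measurable (F t)" unfolding martingale_of_def by (rule cexp_measurable[OF P])
  show "square_integrable_rv M (martingale_of t)" unfolding martingale_of_def by (rule cexp_sqi[OF P V])
  have "0 \<le> (\<integral>x. (V x - martingale_of t x) \<bullet> (V x - martingale_of t x) \<partial>M)" by simp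
  then show "(\<integral>\<omega>. martingale_of t \<omega> \<bullet> martingale_of t \<omega> \<partial>M) \<le> (\<integral>\<omega>. V \<omega> \<bullet> V \<omega> \<partial>M)"
    unfolding martingale_of_def cexp_norm_self[OF P V] by simp
qed

text \<open>Orthogonality of martingale increments: the later value pairs with the earlier one
  exactly as \<open>V\<close> does, and so does the earlier value itself.\<close>

lemma martingale_of_increment:
  assumes s: "s \<in> {0..T}" and t: "t \<in> {0..T}" and st: "s \<le> t"
  shows "(\<integral>\<omega>. (martingale_of t \<omega> - martingale_of s \<omega>) \<bullet> (martingale_of t \<omega> - martingale_of s \<omega>) \<partial>M)
    = (\<integral>\<omega>. martingale_of t \<omega> \<bullet> martingale_of t \<omega> \<partial>M) - (\<integral>\<omega>. martingale_of s \<omega> \<bullet> martingale_of s \<omega> \<partial>M)"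
proof -
  note ms = martingale_of_props[OF s] and mt = martingale_of_props[OF t]
  note ms_t = filtration_measurable_mono[OF F s t st ms(1)]
  have "(\<integral>\<omega>. martingale_of s \<omega> \<bullet> martingale_of t \<omega> \<partial>M) = (\<integral>\<omega>. martingale_of s \<omega> \<bullet> V \<omega> \<partial>M)"
    using cexp_inner[OF finite_measure_axioms filtration_onD(1)[OF F t] V ms(2) ms_t]
    by (simp add: martingale_of_def)
  also have "\<dots> = (\<integral>\<omega>. martingale_of s \<omega> \<bullet> martingale_of s \<omega> \<partial>M)"
    using cexp_inner[OF finite_measure_axioms filtration_onD(1)[OF F s] V ms(2,1)]
    by (simp add: martingale_of_def)
  finally have "(\<integral>\<omega>. martingale_of s \<omega> \<bullet> martingale_of t \<omega> \<partial>M) = \<dots>" .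
  then show ?thesis unfolding inner_diff_self
    using sqi_inner_integrable[OF mt(2) mt(2)] sqi_inner_integrable[OF ms(2) mt(2)]
      sqi_inner_integrable[OF ms(2) ms(2)] by simp
qed

text \<open>The second moment is nondecreasing in time, hence continuous outside a countable set of
  times, and mean-square increments are differences of it. Convergence from dyadic times thus holds
  at almost every time, without any regularity of paths.\<close>

lemma martingale_step_continuity:
  "AE s in TL. (\<lambda>n. \<integral>\<omega>. (martingale_of s \<omega> - martingale_step n s \<omega>) \<bullet> (martingale_of s \<omega> - martingale_step n s \<omega>) \<partial>M) \<longlonglongrightarrow> 0"
proof -
  define q where "q s = (\<integral>\<omega>. martingale_of s \<omega> \<bullet> martingale_of s \<omega> \<partial>M)" for s
  have "mono_on {0..T} q"
  proof (rule mono_onI)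
    fix s t assume st: "s \<in> {0..T}" "t \<in> {0..T}" "s \<le> t"
    have "0 \<le> (\<integral>\<omega>. (martingale_of t \<omega> - martingale_of s \<omega>) \<bullet> (martingale_of t \<omega> - martingale_of s \<omega>) \<partial>M)" by simp
    then show "q s \<le> q t" unfolding martingale_of_increment[OF st] q_def by simp
  qed
  then have "countable {s \<in> {0..T}. \<not> continuous (at s within {0..T}) q}" by (rule mono_on_ctble_discont)
  then have "AE s in lborel. s \<notin> {s \<in> {0..T}. \<not> continuous (at s within {0..T}) q}"
    using countable_imp_null_set_lborel AE_not_in by blast
  then have "AE s in TL. s \<notin> {s \<in> {0..T}. \<not> continuous (at s within {0..T}) q}"
    by (subst AE_restrict_space_iff) auto
  with AE_space show ?thesis
  proof eventually_elim
    case (elim s)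
    then have s: "s \<in> {0..T}" and c: "continuous (at s within {0..T}) q" by (auto simp: space_TL)
    have d: "dyadic_floor n s \<in> {0..T}" "dyadic_floor n s \<le> s" for n
      using dyadic_floor_le[of s n] dyadic_floor_nonneg[of n s] s by auto
    have "(\<lambda>n. q (dyadic_floor n s)) \<longlonglongrightarrow> q s"
      using continuous_within_tendsto_compose'[OF c d(1) dyadic_floor_tendsto] s by auto
    then have "(\<lambda>n. q s - q (dyadic_floor n s)) \<longlonglongrightarrow> q s - q s" by (intro tendsto_intros)
    then show ?case unfolding martingale_step_def martingale_of_increment[OF d(1) s d(2)] q_def by simp
  qed
qed

lemma L2_adapted_martingale_step: "L2_adapted T M F (martingale_step n)"
proof -
  have m: "(\<lambda>z. martingale_step n (fst z) (snd z)) \<in> borel_measurable (adapted_sigma F)"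
    unfolding martingale_step_def by (rule measurable_dyadic_step[OF F martingale_of_props(1)])
  note mN = measurable_from_subalg[OF subalgebra_adapted_sigma[OF F] m]
  have d: "dyadic_floor n s \<in> {0..T}" if "s \<in> {0..T}" for s
    using dyadic_floor_le[of s n] dyadic_floor_nonneg[of n s] that by auto
  define g where "g z = (norm (martingale_step n (fst z) (snd z)))\<^sup>2" for z
  have g: "g \<in> borel_measurable (TL \<Otimes>\<^sub>M M)"
    using mN unfolding g_def time_prob_def by measurable
  have "integrable (TL \<Otimes>\<^sub>M M) g"
  proof (rule NP.Fubini_integrable[OF g])
    have s: "integrable M (\<lambda>\<omega>. g (s, \<omega>))" if "s \<in> {0..T}" for s
      using sqi_D(2)[OF martingale_of_props(2)[OF d[OF that]]] by (simp add: g_def martingale_step_def)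
    then show "AE s in TL. integrable M (\<lambda>\<omega>. g (s, \<omega>))" by (rule AE_TL_I)
    have "(\<lambda>s. \<integral>\<omega>. norm (g (s, \<omega>)) \<partial>M) \<in> borel_measurable TL"
      by (rule borel_measurable_lebesgue_integral) (use g in simp)
    then show "integrable TL (\<lambda>s. \<integral>\<omega>. norm (g (s, \<omega>)) \<partial>M)"
    proof (rule TL.integrable_const_bound[rotated])
      show "AE s in TL. norm (\<integral>\<omega>. norm (g (s, \<omega>)) \<partial>M) \<le> (\<integral>\<omega>. V \<omega> \<bullet> V \<omega> \<partial>M)"
        by (rule AE_TL_I) (use martingale_of_props(3)[OF d] in
            \<open>simp add: g_def martingale_step_def power2_norm_eq_inner\<close>)
    qed
  qed
  then have "square_integrable_process T M (martingale_step n)"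
    using mN unfolding square_integrable_rv_def g_def[abs_def] time_prob_def by simp
  then show ?thesis unfolding L2_adapted_adapted_sigma[OF F] using m by simp
qed

text \<open>At almost every s, immersion replaces \<open>V\<close> by the martingale at s in the
  pairing with \<open>w s\<close>, and the dyadic values converge to it in mean square. Dominated
  convergence in s does the rest.\<close>

lemma martingale_step_inner_tendsto:
  fixes w :: "real \<Rightarrow> 'w \<Rightarrow> real ^ 'n"
  assumes FG: "immersed F G" and VF: "V \<in> borel_measurable (F T)" and w: "L2_adapted T M G w" and t: "t \<in> {0..T}"
  shows "(\<lambda>n. \<integral>z. (indicator {0..t} (fst z) *\<^sub>R martingale_step n (fst z) (snd z)) \<bullet> w (fst z) (snd z) \<partial>N)
     \<longlonglongrightarrow> (\<integral>\<omega>. V \<omega> \<bullet> running_integral w t \<omega> \<partial>M)"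
proof -
  note sw = L2_adapted_sqi[OF w]
  note ms = L2_adapted_sqi[OF L2_adapted_martingale_step]
  note i = sqi_inner_integrable[OF sqi_N_indicator[OF ms, of t] sw]
  let ?I = "indicator {0..t} :: real \<Rightarrow> real"
  have "(\<lambda>n. \<integral>s. \<integral>\<omega>. (?I s *\<^sub>R martingale_step n s \<omega>) \<bullet> w s \<omega> \<partial>M \<partial>TL)
     \<longlonglongrightarrow> (\<integral>s. ?I s *\<^sub>R (\<integral>\<omega>. V \<omega> \<bullet> w s \<omega> \<partial>M) \<partial>TL)"
  proof (rule integral_dominated_convergence)
    show "(\<lambda>s. ?I s *\<^sub>R (\<integral>\<omega>. V \<omega> \<bullet> w s \<omega> \<partial>M)) \<in> borel_measurable TL"
      using borel_measurable_integrable[OF integrable_N_fst[OF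
            sqi_inner_integrable[OF sqi_N_snd_comp[OF V] sqi_N_indicator[OF sw, of t]]]] by simp
    show "(\<lambda>s. \<integral>\<omega>. (?I s *\<^sub>R martingale_step n s \<omega>) \<bullet> w s \<omega> \<partial>M) \<in> borel_measurable TL" for n
      by (rule borel_measurable_integrable[OF integrable_N_fst[OF i]])
    show "integrable TL (\<lambda>s. (\<integral>\<omega>. V \<omega> \<bullet> V \<omega> \<partial>M) + (\<integral>\<omega>. w s \<omega> \<bullet> w s \<omega> \<partial>M))"
      using integrable_N_fst[OF sqi_inner_integrable[OF sw sw]] by simp
    show "AE s in TL. norm (\<integral>\<omega>. (?I s *\<^sub>R martingale_step n s \<omega>) \<bullet> w s \<omega> \<partial>M)
        \<le> (\<integral>\<omega>. V \<omega> \<bullet> V \<omega> \<partial>M) + (\<integral>\<omega>. w s \<omega> \<bullet> w s \<omega> \<partial>M)" for n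
      using sqi_section_fst[OF sw] AE_space
    proof eventually_elim
      case (elim s)
      then have d: "dyadic_floor n s \<in> {0..T}"
        using dyadic_floor_le[of s n] dyadic_floor_nonneg[of n s] by (auto simp: space_TL)
      note m = martingale_of_props[OF d, folded martingale_step_def]
      define a b c where "a = (\<integral>\<omega>. martingale_step n s \<omega> \<bullet> w s \<omega> \<partial>M)"
        and "b = (\<integral>\<omega>. V \<omega> \<bullet> V \<omega> \<partial>M)" and "c = (\<integral>\<omega>. w s \<omega> \<bullet> w s \<omega> \<partial>M)"
      have nn: "0 \<le> b" "0 \<le> c" unfolding b_def c_def by simp_all
      \<comment> \<open>Cauchy-Schwarz together with b c \<le> (b + c)^2 turns the product of norms
        into an integrable bound that is the same for all n.\<close>
      have "a\<^sup>2 \<le> (\<integral>\<omega>. martingale_step n s \<omega> \<bullet> martingale_step n s \<omega> \<partial>M) * c"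
        unfolding a_def c_def by (rule sqi_Cauchy_Schwarz[OF m(2) elim(1)])
      also have "\<dots> \<le> b * c" by (rule mult_right_mono) (use m(3) nn in \<open>auto simp: b_def\<close>)
      also have "\<dots> \<le> (b + c)\<^sup>2" using nn by (simp add: power2_eq_square algebra_simps)
      finally have "\<bar>a\<bar> \<le> b + c" using nn by (simp add: abs_le_square_iff[symmetric])
      moreover have "norm (\<integral>\<omega>. (?I s *\<^sub>R martingale_step n s \<omega>) \<bullet> w s \<omega> \<partial>M) \<le> \<bar>a\<bar>"
        unfolding a_def by (simp add: indicator_def)
      ultimately show ?case unfolding b_def c_def by simp
    qed
    show "AE s in TL. (\<lambda>n. \<integral>\<omega>. (?I s *\<^sub>R martingale_step n s \<omega>) \<bullet> w s \<omega> \<partial>M)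
        \<longlonglongrightarrow> ?I s *\<^sub>R (\<integral>\<omega>. V \<omega> \<bullet> w s \<omega> \<partial>M)"
      using sqi_section_fst[OF sw] martingale_step_continuity AE_space
    proof eventually_elim
      case (elim s)
      then have s: "s \<in> {0..T}" by (simp add: space_TL)
      have d: "dyadic_floor n s \<in> {0..T}" for n
        using dyadic_floor_le[of s n] dyadic_floor_nonneg[of n s] s by auto
      note m = martingale_of_props[OF d, folded martingale_step_def] and ms = martingale_of_props[OF s]
      define c where "c = (\<integral>\<omega>. w s \<omega> \<bullet> w s \<omega> \<partial>M)"
      have Vw: "(\<integral>\<omega>. V \<omega> \<bullet> w s \<omega> \<partial>M) = (\<integral>\<omega>. martingale_of s \<omega> \<bullet> w s \<omega> \<partial>M)"
        unfolding martingale_of_def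
        by (rule immersed_inner[OF FG s VF V L2_adapted_at[OF w s] elim(1)])
      have le: "(\<integral>\<omega>. (martingale_of s \<omega> - martingale_step n s \<omega>) \<bullet> w s \<omega> \<partial>M)\<^sup>2
          \<le> (\<integral>\<omega>. (martingale_of s \<omega> - martingale_step n s \<omega>) \<bullet> (martingale_of s \<omega> - martingale_step n s \<omega>) \<partial>M) * c" for n
        unfolding c_def by (rule sqi_Cauchy_Schwarz[OF sqi_diff[OF ms(2) m(2)] elim(1)])
      have "(\<lambda>n. (\<integral>\<omega>. (martingale_of s \<omega> - martingale_step n s \<omega>) \<bullet> w s \<omega> \<partial>M)\<^sup>2) \<longlonglongrightarrow> 0"
        by (rule tendsto_sandwich[OF _ _ tendsto_const tendsto_mult_left_zero[OF elim(2), of c]])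
           (use le in auto)
      then have "(\<lambda>n. \<integral>\<omega>. (martingale_of s \<omega> - martingale_step n s \<omega>) \<bullet> w s \<omega> \<partial>M) \<longlonglongrightarrow> 0" by simp
      then have lim: "(\<lambda>n. (\<integral>\<omega>. V \<omega> \<bullet> w s \<omega> \<partial>M) - (\<integral>\<omega>. martingale_step n s \<omega> \<bullet> w s \<omega> \<partial>M)) \<longlonglongrightarrow> 0"
        unfolding Vw inner_diff_left
        using sqi_inner_integrable[OF ms(2) elim(1)] sqi_inner_integrable[OF m(2) elim(1)] by simp
      have "(\<lambda>n. \<integral>\<omega>. martingale_step n s \<omega> \<bullet> w s \<omega> \<partial>M) \<longlonglongrightarrow> (\<integral>\<omega>. V \<omega> \<bullet> w s \<omega> \<partial>M)"
        using tendsto_diff[OF tendsto_const[of "\<integral>\<omega>. V \<omega> \<bullet> w s \<omega> \<partial>M"] lim] by simp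
      then have "(\<lambda>n. ?I s *\<^sub>R (\<integral>\<omega>. martingale_step n s \<omega> \<bullet> w s \<omega> \<partial>M)) \<longlonglongrightarrow> ?I s *\<^sub>R (\<integral>\<omega>. V \<omega> \<bullet> w s \<omega> \<partial>M)"
        by (intro tendsto_intros)
      then show ?case by simp
    qed
  qed
  then show ?thesis
    unfolding integral_inner_running_integral(2)[OF sw V t] integral_N_fst[OF i] .
qed

end

text \<open>Before the limit the test process is adapted to \<open>F\<close>, so it cannot tell
  \<open>w\<close> from its projection; in the limit it becomes \<open>V\<close>. This is the
  exchange of conditional expectation and time integral.\<close>

lemma immersed_projection:
  fixes w :: "real \<Rightarrow> 'w \<Rightarrow> real ^ 'n"
  assumes FG: "immersed F G" and V: "V \<in> borel_measurable (F T)" "square_integrable_rv M V"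
    and w: "L2_adapted T M G w" and t: "t \<in> {0..T}"
  shows "(\<integral>\<omega>. V \<omega> \<bullet> running_integral w t \<omega> \<partial>M)
    = (\<integral>\<omega>. V \<omega> \<bullet> running_integral (adapted_projection F w) t \<omega> \<partial>M)"
proof -
  note F = immersedD(1)[OF FG]
  note sw = L2_adapted_sqi[OF w]
  note p = L2_adapted_projection[OF F sw]
  note m = L2_adapted_martingale_step[OF F V(2)]
  \<comment> \<open>The cut at t is put into the test process: as a deterministic factor it
    preserves adaptedness, and it turns the integral up to t into one over the whole product
    space.\<close>
  have "L2_adapted T M F (\<lambda>s \<omega>. indicator {0..t} s *\<^sub>R martingale_step F V n s \<omega>)" for n
    unfolding L2_adapted_iff
  proof
    show "\<forall>s\<in>{0..T}. (\<lambda>\<omega>. indicator {0..t} s *\<^sub>R martingale_step F V n s \<omega>) \<in> borel_measurable (F s)"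
      using L2_adapted_at[OF m] by (intro ballI borel_measurable_scaleR) auto
  qed (rule sqi_N_indicator[OF L2_adapted_sqi[OF m]])
  note e = adapted_projection_inner[OF F sw this]
  show ?thesis
    using LIMSEQ_unique[OF martingale_step_inner_tendsto[OF F V(2) FG V(1) w t, folded e]
        martingale_step_inner_tendsto[OF F V(2) FG V(1) L2_adapted_mono[OF p immersedD(3)[OF FG]] t]] .
qed

end

section \<open>Products with bounded random coefficients\<close>

lemma sqi_sum:
  fixes f :: "'i \<Rightarrow> 'a \<Rightarrow> 'e::euclidean_space"
  assumes "finite_measure N" "\<And>i. i \<in> I \<Longrightarrow> square_integrable_rv N (f i)"
  shows "square_integrable_rv N (\<lambda>x. \<Sum>i\<in>I. f i x)"
  using assms(2) by (induction I rule: infinite_finite_induct) (auto intro: sqi_add sqi_const[OF assms(1)])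

lemma sqi_mult_bounded:
  fixes f g :: "'a \<Rightarrow> real"
  assumes f: "f \<in> borel_measurable N" "\<And>x. x \<in> space N \<Longrightarrow> \<bar>f x\<bar> \<le> K" and g: "square_integrable_rv N g"
  shows "square_integrable_rv N (\<lambda>x. f x * g x)"
proof (rule sqi_bound)
  show "(\<lambda>x. f x * g x) \<in> borel_measurable N" using f(1) sqi_D(1)[OF g] by simp
  show "integrable N (\<lambda>x. K\<^sup>2 * (norm (g x))\<^sup>2)" using sqi_D(2)[OF g] by simp
  show "AE x in N. (norm (f x * g x))\<^sup>2 \<le> K\<^sup>2 * (norm (g x))\<^sup>2"
  proof (rule AE_I2)
    fix x assume "x \<in> space N"
    then have "\<bar>f x\<bar>\<^sup>2 \<le> K\<^sup>2" using f(2) by (intro power_mono) auto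
    then show "(norm (f x * g x))\<^sup>2 \<le> K\<^sup>2 * (norm (g x))\<^sup>2"
      by (simp add: power_mult_distrib mult_right_mono)
  qed
qed

lemma matrix_vector_mult_component:
  fixes A :: "real ^ 'd ^ 'n"
  shows "(A *v v) $ j = (\<Sum>k\<in>UNIV. A $ j $ k * v $ k)"
  by (simp add: matrix_vector_mult_def)

lemma sqi_matrix_mult_bounded:
  fixes A :: "'a \<Rightarrow> real ^ 'd ^ 'n" and v :: "'a \<Rightarrow> real ^ 'd"
  assumes "finite_measure N" and A: "A \<in> borel_measurable N" "\<And>x. x \<in> space N \<Longrightarrow> norm (A x) \<le> K"
    and v: "square_integrable_rv N v"
  shows "square_integrable_rv N (\<lambda>x. A x *v v x)"
proof (rule sqi_vec)
  fix j
  have "(\<lambda>x. A x $ j) \<in> borel_measurable N"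
    using measurable_compose[OF A(1) borel_measurable_continuous_onI[OF
          linear_continuous_on[OF bounded_linear_vec_nth]]] .
  note Ajk = borel_measurable_vec_nth[OF this]
  have "\<bar>A x $ j $ k\<bar> \<le> K" if "x \<in> space N" for x k
    using A(2)[OF that] component_le_norm_cart[of "A x $ j" k] Finite_Cartesian_Product.norm_nth_le[of "A x" j] by simp
  then show "square_integrable_rv N (\<lambda>x. (A x *v v x) $ j)"
    unfolding matrix_vector_mult_component
    by (intro sqi_sum[OF assms(1)] sqi_mult_bounded[OF Ajk _ sqi_nth[OF v]])
qed

section \<open>Independence\<close>

context prob_space
begin

lemma sigma_algebra_sigma_of_process: "sigma_algebra (space M) (sigma_of_process M W)"
  unfolding sigma_of_process_def by (rule sigma_algebra_sigma_sets) auto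

lemma sigma_algebra_sigma_of_rv: "sigma_algebra (space M) (sigma_of_rv M X)"
  unfolding sigma_of_rv_def by (rule sigma_algebra_sigma_sets) auto

lemma sigma_algebra_Int_stable: "sigma_algebra (space M) A \<Longrightarrow> Int_stable A"
proof -
  assume "sigma_algebra (space M) A"
  then interpret sigma_algebra "space M" A .
  show "Int_stable A" by (rule Int_stableI) (rule Int)
qed

lemma sigma_algebra_space_closed: "sigma_algebra (space M) A \<Longrightarrow> A \<subseteq> Pow (space M)"
proof -
  assume "sigma_algebra (space M) A"
  then interpret sigma_algebra "space M" A .
  show "A \<subseteq> Pow (space M)" by (rule space_closed)
qed

lemma indep_set_mono: "indep_set A B \<Longrightarrow> A' \<subseteq> A \<Longrightarrow> B' \<subseteq> B \<Longrightarrow> indep_set A' B'"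
  unfolding indep_sets2_eq by blast

text \<open>Rectangles are closed under intersection and generate the join, so that independence and
  vanishing integrals can be checked on rectangles.\<close>

lemma sigma_sets_Un_rectangles:
  assumes A: "sigma_algebra (space M) A" and B: "sigma_algebra (space M) B"
  shows "Int_stable {a \<inter> b | a b. a \<in> A \<and> b \<in> B}" "{a \<inter> b | a b. a \<in> A \<and> b \<in> B} \<subseteq> Pow (space M)"
    "sigma_sets (space M) (A \<union> B) = sigma_sets (space M) {a \<inter> b | a b. a \<in> A \<and> b \<in> B}"
proof -
  let ?R = "{a \<inter> b | a b. a \<in> A \<and> b \<in> B}"
  interpret A: sigma_algebra "space M" A by fact
  interpret B: sigma_algebra "space M" B by fact
  show "Int_stable ?R"
  proof (rule Int_stableI)
    fix x y assume "x \<in> ?R" "y \<in> ?R"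
    then obtain a b a' b' where "x = a \<inter> b" "y = a' \<inter> b'" "a \<in> A" "a' \<in> A" "b \<in> B" "b' \<in> B" by auto
    then show "x \<inter> y \<in> ?R" by (intro CollectI exI[of _ "a \<inter> a'"] exI[of _ "b \<inter> b'"]) auto
  qed
  show "?R \<subseteq> Pow (space M)" using A.sets_into_space by auto
  show "sigma_sets (space M) (A \<union> B) = sigma_sets (space M) ?R"
  proof (rule sigma_sets_eqI)
    fix x assume "x \<in> A \<union> B"
    then have "x \<in> ?R"
    proof
      assume "x \<in> A" then have "x = x \<inter> space M" using A.sets_into_space by auto
      then show ?thesis using \<open>x \<in> A\<close> B.top by blast
    next
      assume "x \<in> B" then have "x = space M \<inter> x" using B.sets_into_space by auto
      then show ?thesis using \<open>x \<in> B\<close> A.top by blast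
    qed
    then show "x \<in> sigma_sets (space M) ?R" by (rule sigma_sets.Basic)
  next
    fix x assume "x \<in> ?R"
    then obtain a b where x: "x = a \<inter> b" "a \<in> A" "b \<in> B" by auto
    interpret S: sigma_algebra "space M" "sigma_sets (space M) (A \<union> B)"
      by (rule sigma_algebra_sigma_sets) (use A.sets_into_space B.sets_into_space in auto)
    show "x \<in> sigma_sets (space M) (A \<union> B)"
      using x by (auto intro: S.Int sigma_sets.Basic)
  qed
qed

text \<open>Events of \<open>T1\<close> and \<open>T2\<close> both lie in \<open>S1\<close>, so the
  \<open>S2\<close> event splits off first and \<open>T1\<close>, \<open>T2\<close> separate
  afterwards. In this way outside information can be added to the past of a process.\<close>

lemma indep_set_nested:
  assumes S: "indep_set S1 S2" "sigma_algebra (space M) S1" "sigma_algebra (space M) S2"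
    and T: "indep_set T1 T2" "T1 \<subseteq> S1" "T2 \<subseteq> S1" "sigma_algebra (space M) T1" "sigma_algebra (space M) T2"
  shows "indep_set (sigma_sets (space M) (T1 \<union> S2)) T2"
proof -
  let ?R = "{a \<inter> b | a b. a \<in> T1 \<and> b \<in> S2}"
  note R = sigma_sets_Un_rectangles[OF T(4) S(3)]
  interpret S1: sigma_algebra "space M" S1 by fact
  have "prob ((a \<inter> b) \<inter> c) = prob (a \<inter> b) * prob c" if "a \<in> T1" "b \<in> S2" "c \<in> T2" for a b c
  proof -
    have "prob ((a \<inter> b) \<inter> c) = prob ((a \<inter> c) \<inter> b)" by (simp add: Int_ac)
    also have "\<dots> = prob (a \<inter> c) * prob b" using S(1) T that unfolding indep_sets2_eq by blast
    also have "\<dots> = prob a * prob c * prob b" using T(1) that unfolding indep_sets2_eq by simp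
    also have "\<dots> = prob (a \<inter> b) * prob c" using S(1) T(2) that unfolding indep_sets2_eq by auto
    finally show ?thesis .
  qed
  then have "indep_set ?R T2" using S(1) T(1) unfolding indep_sets2_eq by auto
  from indep_set_sigma_sets[OF this R(1) sigma_algebra_Int_stable[OF T(5)]]
  have "indep_set (sigma_sets (space M) ?R) (sigma_sets (space M) T2)" .
  then show ?thesis unfolding R(3) by (rule indep_set_mono) auto
qed

text \<open>Phrased with families of sets, because the sigma-algebras in question are generated by
  several noise sources and not by \<open>X\<close> and \<open>Y\<close> themselves.\<close>

lemma indep_set_integral_mult:
  fixes X Y :: "'a \<Rightarrow> real"
  assumes ind: "indep_set A B" "sigma_algebra (space M) A" "sigma_algebra (space M) B"
    and X: "integrable M X" "\<And>S. S \<in> sets borel \<Longrightarrow> X -` S \<inter> space M \<in> A"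
    and Y: "integrable M Y" "\<And>S. S \<in> sets borel \<Longrightarrow> Y -` S \<inter> space M \<in> B"
  shows "(\<integral>x. X x * Y x \<partial>M) = (\<integral>x. X x \<partial>M) * (\<integral>x. Y x \<partial>M)" "integrable M (\<lambda>x. X x * Y x)"
proof -
  have "indep_var borel X borel Y"
    unfolding indep_var_eq
  proof (intro conjI)
    show "indep_set (sigma_sets (space M) {X -` A \<inter> space M |A. A \<in> sets borel})
        (sigma_sets (space M) {Y -` A \<inter> space M |A. A \<in> sets borel})"
      by (rule indep_set_mono[OF ind(1)])
         (use X(2) Y(2) in \<open>auto intro!: sigma_algebra.sigma_sets_subset[OF ind(2)] sigma_algebra.sigma_sets_subset[OF ind(3)]\<close>)
  qed (use X Y in auto)
  then show "(\<integral>x. X x * Y x \<partial>M) = (\<integral>x. X x \<partial>M) * (\<integral>x. Y x \<partial>M)" "integrable M (\<lambda>x. X x * Y x)"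
    using indep_var_lebesgue_integral[OF _ X(1) Y(1)] indep_var_integrable[OF _ X(1) Y(1)] by auto
qed

text \<open>The definition of Brownian motion speaks of finitely many consecutive increments only.
  Events at finitely many past times form a \<pi>-system generating the past, and they can be
  expressed by increments from time 0. As the process starts at 0 only almost surely, the expression
  is correct up to a null set, which the product rule does not notice.\<close>

lemma brownian_increment_indep:
  assumes w: "brownian_motion M w" and ab: "0 \<le> a" "a \<le> b"
  shows "indep_set (sigma_sets (space M) {w s -` A \<inter> space M | s A. 0 \<le> s \<and> s \<le> a \<and> A \<in> sets borel})
    (sigma_of_rv M (\<lambda>\<omega>. w b \<omega> - w a \<omega>))"
proof -
  let ?P = "{space M \<inter> (\<Inter>s\<in>S. w s -` A s) | S A. finite S \<and> S \<subseteq> {0..a} \<and> (\<forall>s. A s \<in> sets (borel :: real measure))}"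
  let ?B = "{(\<lambda>\<omega>. w b \<omega> - w a \<omega>) -` A \<inter> space M | A. A \<in> sets borel}"
  have wm [measurable]: "w t \<in> borel_measurable M" if "0 \<le> t" for t
    using w that unfolding brownian_motion_def by simp
  have w0: "AE \<omega> in M. w 0 \<omega> = 0" using w unfolding brownian_motion_def by simp
  have incr: "indep_vars (\<lambda>_. borel) (\<lambda>i \<omega>. w (\<tau> (Suc i)) \<omega> - w (\<tau> i) \<omega>) {..<n}"
    if "0 \<le> \<tau> 0" "\<And>i. i < n \<Longrightarrow> \<tau> i \<le> \<tau> (Suc i)" for \<tau> :: "nat \<Rightarrow> real" and n
    using w that unfolding brownian_motion_def by blast
  have P_stable: "Int_stable ?P"
  proof (rule Int_stableI)
    fix x y assume "x \<in> ?P" "y \<in> ?P"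
    then obtain S A S' A' where x: "x = space M \<inter> (\<Inter>s\<in>S. w s -` A s)" "finite S" "S \<subseteq> {0..a}" "\<And>s. A s \<in> sets (borel :: real measure)"
      and y: "y = space M \<inter> (\<Inter>s\<in>S'. w s -` A' s)" "finite S'" "S' \<subseteq> {0..a}" "\<And>s. A' s \<in> sets (borel :: real measure)" by blast
    \<comment> \<open>At a time that occurs in one family only, the other imposes no
      condition.\<close>
    define C where "C s = (if s \<in> S then A s else UNIV) \<inter> (if s \<in> S' then A' s else UNIV)" for s
    have "x \<inter> y = space M \<inter> (\<Inter>s\<in>S \<union> S'. w s -` C s)"
      unfolding x(1) y(1) C_def by (auto split: if_splits)
    then show "x \<inter> y \<in> ?P" using x(2-4) y(2-4)
      by (intro CollectI exI[of _ "S \<union> S'"] exI[of _ C]) (auto simp: C_def)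
  qed
  have "indep_set ?P ?B"
    unfolding indep_sets2_eq
  proof (intro conjI ballI)
    show "?P \<subseteq> events"
    proof
      fix x assume "x \<in> ?P"
      then obtain S A where x: "x = space M \<inter> (\<Inter>s\<in>S. w s -` A s)" "finite S" "S \<subseteq> {0..a}" "\<And>s. A s \<in> sets (borel :: real measure)" by blast
      have "x = space M \<inter> (\<Inter>s\<in>S. w s -` A s \<inter> space M)" using x(1) by auto
      also have "\<dots> \<in> events"
      proof (cases "S = {}")
        case False
        have "w s -` A s \<inter> space M \<in> events" if "s \<in> S" for s
          using x(3,4) that by (intro measurable_sets[OF wm]) auto
        then show ?thesis using x(2) False by (intro sets.Int[OF sets.top] sets.finite_INT)
      qed simp
      finally show "x \<in> events" .
    qed
    show "?B \<subseteq> events" using ab by (auto intro!: measurable_sets)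
    fix x y assume "x \<in> ?P" "y \<in> ?B"
    then obtain S A C where x: "x = space M \<inter> (\<Inter>s\<in>S. w s -` A s)" "finite S" "S \<subseteq> {0..a}" "\<And>s. A s \<in> sets (borel :: real measure)"
      and y: "y = (\<lambda>\<omega>. w b \<omega> - w a \<omega>) -` C \<inter> space M" "C \<in> sets borel" by blast
    define l where "l = sorted_list_of_set S"
    define n where "n = length l"
    \<comment> \<open>The grid is 0, then the n times of \<open>S\<close> in increasing order, then
      a, then b. The increments with index below n + 1 describe the past, and the one with index n +
      1 is \<open>w b - w a\<close>.\<close>
    define \<tau> where "\<tau> i = (if i = 0 then 0 else if i \<le> n then l ! (i - 1) else if i = Suc n then a else b)" for i
    have set_l: "set l = S" "sorted l" using x(2) by (auto simp: l_def)
    have l_in: "l ! i \<in> {0..a}" if "i < n" for i using that x(3) set_l n_def nth_mem by blast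
    have mono: "\<tau> i \<le> \<tau> (Suc i)" if "i < n + 2" for i
      using that ab l_in[of "i - 1"] l_in[of i] set_l(2)
      unfolding \<tau>_def by (auto simp: sorted_iff_nth_mono n_def)
    have \<tau>_nonneg: "0 \<le> \<tau> i" for i
      using l_in[of "i - 1"] ab unfolding \<tau>_def by auto
    have S_eq: "S = {\<tau> (Suc i) | i. i < n}"
      unfolding \<tau>_def using set_l(1) by (auto simp: n_def set_conv_nth)
    define D where "D i \<omega> = w (\<tau> (Suc i)) \<omega> - w (\<tau> i) \<omega>" for i \<omega>
    have Dm: "D i \<in> borel_measurable M" for i unfolding D_def using \<tau>_nonneg by measurable
    have "indep_vars (\<lambda>_. borel) D {..<n + 2}" unfolding D_def by (rule incr) (use mono \<tau>_nonneg in auto)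
    then have "indep_sets (\<lambda>i. sigma_of_rv M (D i)) (\<Union>j\<in>UNIV. if j then {..<n + 1} else {n + 1})"
      unfolding indep_vars_def sigma_of_rv_def by (rule indep_sets_mono_index[rotated, OF conjunct2]) auto
    then have "indep_sets (\<lambda>j. sigma_sets (space M) (\<Union>i\<in>(if j then {..<n + 1} else {n + 1}). sigma_of_rv M (D i))) UNIV"
      by (rule indep_sets_collect_sigma)
         (auto simp: disjoint_family_on_def intro: sigma_algebra_Int_stable sigma_algebra_sigma_of_rv)
    then have ind: "indep_set (sigma_sets (space M) (\<Union>i<n + 1. sigma_of_rv M (D i))) (sigma_of_rv M (D (n + 1)))"
      unfolding indep_set_def by (rule indep_sets_mono_sets) (auto split: bool.split)
    \<comment> \<open>The event \<open>x\<close> with values of \<open>w\<close> replaced by sums of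
      increments, that is, by values of \<open>w\<close> minus \<open>w 0\<close>.\<close>
    define x' where "x' = space M \<inter> {\<omega>. \<forall>i<n. (\<Sum>k<Suc i. D k \<omega>) \<in> A (\<tau> (Suc i))}"
    have tel: "(\<Sum>k<Suc i. D k \<omega>) = w (\<tau> (Suc i)) \<omega> - w 0 \<omega>" for i \<omega>
      unfolding D_def by (subst sum_lessThan_telescope) (simp add: \<tau>_def)
    define \<D> where "\<D> = sigma (space M) (\<Union>i<n + 1. sigma_of_rv M (D i))"
    have gen_sub: "(\<Union>i<n + 1. sigma_of_rv M (D i)) \<subseteq> Pow (space M)"
      unfolding sigma_of_rv_def by (auto dest: sigma_sets_into_sp[rotated])
    have sp: "space \<D> = space M" unfolding \<D>_def by (rule space_measure_of[OF gen_sub])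
    have se: "sets \<D> = sigma_sets (space M) (\<Union>i<n + 1. sigma_of_rv M (D i))"
      unfolding \<D>_def by (rule sets_measure_of[OF gen_sub])
    have DD: "D i \<in> borel_measurable \<D>" if "i < n + 1" for i
    proof (rule measurableI)
      fix B :: "real set" assume "B \<in> sets borel"
      then have "D i -` B \<inter> space M \<in> sigma_of_rv M (D i)" unfolding sigma_of_rv_def by auto
      then show "D i -` B \<inter> space \<D> \<in> sets \<D>" unfolding se sp using that by auto
    qed simp
    have "x' = (\<Inter>i\<in>{..<n}. (\<lambda>\<omega>. \<Sum>k<Suc i. D k \<omega>) -` A (\<tau> (Suc i)) \<inter> space \<D>) \<inter> space \<D>"
      unfolding x'_def sp by auto
    also have "\<dots> \<in> sets \<D>"
    proof (cases "n = 0")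
      case False
      then show ?thesis using x(4)
        by (intro sets.Int sets.finite_INT measurable_sets[OF borel_measurable_sum[OF DD]]) auto
    qed simp
    finally have x'D: "x' \<in> sets \<D>" .
    have "D (n + 1) = (\<lambda>\<omega>. w b \<omega> - w a \<omega>)" unfolding D_def \<tau>_def by auto
    then have yD: "y \<in> sigma_of_rv M (D (n + 1))" using y unfolding sigma_of_rv_def by auto
    from ind x'D yD have p: "prob (x' \<inter> y) = prob x' * prob y" "x' \<in> events" "y \<in> events"
      unfolding indep_sets2_eq se by auto
    have ae: "AE \<omega> in M. \<omega> \<in> x \<longleftrightarrow> \<omega> \<in> x'"
      using w0 AE_space unfolding x(1) x'_def S_eq tel by eventually_elim auto
    have xev: "x \<in> events" using \<open>?P \<subseteq> events\<close> \<open>x \<in> ?P\<close> by blast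
    have "prob x = prob x'" by (rule finite_measure_eq_AE) (use ae xev p in auto)
    moreover have "prob (x \<inter> y) = prob (x' \<inter> y)"
      by (rule finite_measure_eq_AE) (use ae xev p in \<open>auto elim!: eventually_mono\<close>)
    ultimately show "prob (x \<inter> y) = prob x * prob y" using p by simp
  qed
  moreover have "Int_stable ?B"
  proof (rule Int_stableI)
    fix x y assume "x \<in> ?B" "y \<in> ?B"
    then obtain A C where "x = (\<lambda>\<omega>. w b \<omega> - w a \<omega>) -` A \<inter> space M" "A \<in> sets borel"
      "y = (\<lambda>\<omega>. w b \<omega> - w a \<omega>) -` C \<inter> space M" "C \<in> sets borel" by blast
    then show "x \<inter> y \<in> ?B" by (intro CollectI exI[of _ "A \<inter> C"]) auto
  qed
  ultimately have "indep_set (sigma_sets (space M) ?P) (sigma_of_rv M (\<lambda>\<omega>. w b \<omega> - w a \<omega>))"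
    unfolding sigma_of_rv_def using P_stable by (intro indep_set_sigma_sets)
  then show ?thesis
  proof (rule indep_set_mono)
    show "sigma_sets (space M) {w s -` A \<inter> space M |s A. 0 \<le> s \<and> s \<le> a \<and> A \<in> sets borel} \<subseteq> sigma_sets (space M) ?P"
    proof (rule sigma_sets_mono, rule subsetI)
      fix x assume "x \<in> {w s -` A \<inter> space M |s A. 0 \<le> s \<and> s \<le> a \<and> A \<in> sets borel}"
      then obtain s A where "x = w s -` A \<inter> space M" "0 \<le> s" "s \<le> a" "A \<in> sets borel" by blast
      then have "x \<in> ?P" by (intro CollectI exI[of _ "{s}"] exI[of _ "\<lambda>_. A"]) auto
      then show "x \<in> sigma_sets (space M) ?P" by (rule sigma_sets.Basic)
    qed
  qed simp
qed

text \<open>The normal law is prescribed for s < t only, so the increment over a degenerate interval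
  is treated apart.\<close>

lemma brownian_increment_moments:
  assumes w: "brownian_motion M w" and ab: "0 \<le> a" "a \<le> b"
  shows "square_integrable_rv M (\<lambda>\<omega>. w b \<omega> - w a \<omega>)" "(\<integral>\<omega>. w b \<omega> - w a \<omega> \<partial>M) = 0"
proof -
  have m: "(\<lambda>\<omega>. w b \<omega> - w a \<omega>) \<in> borel_measurable M"
    using w ab unfolding brownian_motion_def by (intro borel_measurable_diff) auto
  have "square_integrable_rv M (\<lambda>\<omega>. w b \<omega> - w a \<omega>) \<and> (\<integral>\<omega>. w b \<omega> - w a \<omega> \<partial>M) = 0"
  proof (cases "a = b")
    case True
    then show ?thesis by (simp add: sqi_const[OF finite_measure_axioms])
  next
    case False
    then have d: "distributed M lborel (\<lambda>\<omega>. w b \<omega> - w a \<omega>) (normal_density 0 (sqrt (b - a)))"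
      using w ab unfolding brownian_motion_def by simp
    have "integrable M (\<lambda>\<omega>. (w b \<omega> - w a \<omega>) ^ 2)"
      by (rule distributed_integrable[OF d, of "\<lambda>x. x ^ 2", THEN iffD1])
         (use integrable_normal_moment[of "sqrt (b - a)" 0 2] False ab in auto)
    then show ?thesis
      using m normal_distributed_expectation[OF _ d] False ab unfolding square_integrable_rv_def by simp
  qed
  then show "square_integrable_rv M (\<lambda>\<omega>. w b \<omega> - w a \<omega>)" "(\<integral>\<omega>. w b \<omega> - w a \<omega> \<partial>M) = 0" by auto
qed

text \<open>Only increments have a prescribed law; \<open>W t\<close> is compared with its increment
  from time 0, where the process vanishes almost surely.\<close>

lemma wiener_sqi:
  assumes W: "wiener_process M W" and t: "0 \<le> t"
  shows "square_integrable_rv M (W t)"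
proof (rule sqi_vec)
  fix i
  have w: "brownian_motion M (\<lambda>t \<omega>. W t \<omega> $ i)" using W unfolding wiener_process_def by simp
  then have "(\<lambda>\<omega>. W t \<omega> $ i) \<in> borel_measurable M" "AE \<omega> in M. W 0 \<omega> $ i = 0"
    using t unfolding brownian_motion_def by auto
  then show "square_integrable_rv M (\<lambda>\<omega>. W t \<omega> $ i)"
    by (rule_tac sqi_cong_AE[OF _ brownian_increment_moments(1)[OF w order_refl t]]) auto
qed

lemma wiener_mean:
  assumes W: "wiener_process M W" and t: "0 \<le> t"
  shows "(\<integral>\<omega>. W t \<omega> $ i \<partial>M) = 0"
proof -
  have w: "brownian_motion M (\<lambda>t \<omega>. W t \<omega> $ i)" using W unfolding wiener_process_def by simp
  then have m: "(\<lambda>\<omega>. W s \<omega> $ i) \<in> borel_measurable M" if "0 \<le> s" for s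
    using that unfolding brownian_motion_def by auto
  have "AE \<omega> in M. W 0 \<omega> $ i = 0" using w unfolding brownian_motion_def by auto
  then have "(\<integral>\<omega>. W t \<omega> $ i \<partial>M) = (\<integral>\<omega>. W t \<omega> $ i - W 0 \<omega> $ i \<partial>M)"
    by (intro integral_cong_AE) (use m t in auto)
  then show ?thesis using brownian_increment_moments(2)[OF w order_refl t] by simp
qed

text \<open>\<open>indep_set_nested\<close> is applied twice: first the whole paths of the other
  coordinates are added to the past of coordinate i, then the outside sigma-algebra
  \<open>\<O>\<close>. The past of the vector process is contained in the first of these
  joins.\<close>

lemma wiener_increment_indep:
  fixes W :: "real \<Rightarrow> 'a \<Rightarrow> real ^ 'd"
  assumes W: "wiener_process M W" and ab: "0 \<le> a" "a \<le> b"
    and \<O>: "indep_set (sigma_of_process M W) \<O>" "sigma_algebra (space M) \<O>"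
  shows "indep_set
    (sigma_sets (space M) ({W s -` A \<inter> space M | s A. 0 \<le> s \<and> s \<le> a \<and> A \<in> sets borel} \<union> \<O>))
    (sigma_of_rv M (\<lambda>\<omega>. W b \<omega> $ i - W a \<omega> $ i))"
proof -
  let ?w = "\<lambda>j t \<omega>. W t \<omega> $ j"
  let ?G = "\<lambda>j. {?w j s -` A \<inter> space M | s A. 0 \<le> s \<and> s \<le> a \<and> A \<in> sets borel}"
  let ?T1 = "sigma_sets (space M) (?G i)"
  let ?T2 = "sigma_of_rv M (\<lambda>\<omega>. W b \<omega> $ i - W a \<omega> $ i)"
  let ?S2 = "sigma_sets (space M) (\<Union>j\<in>- {i}. sigma_of_process M (?w j))"
  let ?U = "sigma_sets (space M) (?T1 \<union> ?S2)"
  have w: "brownian_motion M (?w j)" for j using W unfolding wiener_process_def by simp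
  have "indep_sets (\<lambda>j. sigma_of_process M (?w j)) (\<Union>c\<in>UNIV. if c then {i} else - {i})"
    using W unfolding wiener_process_def by (rule indep_sets_mono_index[rotated, OF conjunct2]) auto
  then have "indep_sets (\<lambda>c. sigma_sets (space M) (\<Union>j\<in>(if c then {i} else - {i}). sigma_of_process M (?w j))) UNIV"
    by (rule indep_sets_collect_sigma)
       (auto simp: disjoint_family_on_def intro: sigma_algebra_Int_stable sigma_algebra_sigma_of_process)
  then have ind: "indep_set (sigma_of_process M (?w i)) ?S2"
    unfolding indep_set_def by (rule indep_sets_mono_sets) (auto split: bool.split)
  have proc_sub: "sigma_of_process M V \<subseteq> Pow (space M)" for V :: "real \<Rightarrow> 'a \<Rightarrow> 'f::topological_space"
    using sigma_algebra_space_closed[OF sigma_algebra_sigma_of_process] .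
  have alg: "sigma_algebra (space M) ?T1" "sigma_algebra (space M) ?T2" "sigma_algebra (space M) ?S2"
    using proc_sub sigma_algebra_sigma_of_rv by (blast intro: sigma_algebra_sigma_sets)+
  have T1: "?T1 \<subseteq> sigma_of_process M (?w i)"
    unfolding sigma_of_process_def by (rule sigma_sets_mono) auto
  have wS: "(\<lambda>\<omega>. W s \<omega> $ j) \<in> borel_measurable (sigma (space M) {?w j s -` A \<inter> space M | s A. 0 \<le> s \<and> A \<in> sets borel})"
    if "0 \<le> s" for s j
    by (rule measurableI) (use that in \<open>auto simp: space_measure_of_conv sets_measure_of_conv intro!: sigma_sets.Basic\<close>)
  have T2: "?T2 \<subseteq> sigma_of_process M (?w i)"
    unfolding sigma_of_rv_def
  proof (rule sigma_algebra.sigma_sets_subset[OF sigma_algebra_sigma_of_process], rule subsetI)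
    fix x assume "x \<in> {(\<lambda>\<omega>. W b \<omega> $ i - W a \<omega> $ i) -` A \<inter> space M |A. A \<in> sets borel}"
    then obtain A where x: "x = (\<lambda>\<omega>. W b \<omega> $ i - W a \<omega> $ i) -` A \<inter> space M" "A \<in> sets borel" by auto
    let ?\<Sigma> = "sigma (space M) {?w i s -` A \<inter> space M | s A. 0 \<le> s \<and> A \<in> sets borel}"
    have "(\<lambda>\<omega>. W b \<omega> $ i - W a \<omega> $ i) \<in> borel_measurable ?\<Sigma>"
      using wS ab by (intro borel_measurable_diff) auto
    moreover have sub: "{?w i s -` A \<inter> space M | s A. 0 \<le> s \<and> A \<in> sets borel} \<subseteq> Pow (space M)" by auto
    ultimately show "x \<in> sigma_of_process M (?w i)"
      using measurable_sets[OF _ x(2), of "\<lambda>\<omega>. W b \<omega> $ i - W a \<omega> $ i" ?\<Sigma>]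
      unfolding x(1) sigma_of_process_def space_measure_of[OF sub] sets_measure_of[OF sub] by blast
  qed
  from indep_set_nested[OF ind sigma_algebra_sigma_of_process alg(3) brownian_increment_indep[OF w ab] T1 T2 alg(1,2)]
  have ind2: "indep_set ?U ?T2" .
  have U_alg: "sigma_algebra (space M) ?U"
    by (rule sigma_algebra_sigma_sets) (use alg sigma_algebra_space_closed in blast)
  have comp: "sigma_of_process M (?w j) \<subseteq> sigma_of_process M W" for j
    unfolding sigma_of_process_def
  proof (rule sigma_sets_mono, rule subsetI)
    fix x assume "x \<in> {?w j s -` A \<inter> space M | s A. 0 \<le> s \<and> A \<in> sets borel}"
    then obtain s A where x: "x = ?w j s -` A \<inter> space M" "0 \<le> s" "A \<in> sets borel" by auto
    have "(\<lambda>v :: real ^ 'd. v $ j) -` A \<inter> space borel \<in> sets borel"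
      by (rule measurable_sets[OF borel_measurable_vec_nth[OF measurable_ident] x(3), unfolded id_def]) 
    moreover have "x = W s -` ((\<lambda>v :: real ^ 'd. v $ j) -` A) \<inter> space M" using x(1) by auto
    ultimately show "x \<in> sigma_sets (space M) {W s -` A \<inter> space M | s A. 0 \<le> s \<and> A \<in> sets borel}"
      using x(2) by (intro sigma_sets.Basic) auto
  qed
  have UW: "?U \<subseteq> sigma_of_process M W"
  proof (rule sigma_algebra.sigma_sets_subset[OF sigma_algebra_sigma_of_process])
    have "?S2 \<subseteq> sigma_of_process M W"
      by (rule sigma_algebra.sigma_sets_subset[OF sigma_algebra_sigma_of_process]) (use comp in blast)
    then show "?T1 \<union> ?S2 \<subseteq> sigma_of_process M W"
      using order_trans[OF T1 comp] by (rule Un_least[rotated])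
  qed
  have ind3: "indep_set (sigma_sets (space M) (?U \<union> \<O>)) ?T2"
    by (rule indep_set_nested[OF \<O>(1) sigma_algebra_sigma_of_process \<O>(2) ind2 UW order_trans[OF T2 comp] U_alg alg(2)])
  \<comment> \<open>The vector at time s is rebuilt from its coordinates: coordinate i lies in its
    own past, the others are covered by their whole paths.\<close>
  have "{W s -` A \<inter> space M | s A. 0 \<le> s \<and> s \<le> a \<and> A \<in> sets borel} \<subseteq> ?U"
  proof
    fix x assume "x \<in> {W s -` A \<inter> space M | s A. 0 \<le> s \<and> s \<le> a \<and> A \<in> sets borel}"
    then obtain s A where x: "x = W s -` A \<inter> space M" "0 \<le> s" "s \<le> a" "A \<in> sets borel" by auto
    define \<Sigma> where "\<Sigma> = sigma (space M) ?U"
    have \<Sigma>: "space \<Sigma> = space M" "sets \<Sigma> = ?U"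
      unfolding \<Sigma>_def using sigma_algebra_space_closed[OF U_alg] sigma_algebra.sigma_sets_eq[OF U_alg]
      by (auto simp: space_measure_of_conv sets_measure_of_conv)
    have "?w j s -` B \<inter> space M \<in> ?U" if "B \<in> sets borel" for j B
    proof (cases "j = i")
      case True
      then have "?w j s -` B \<inter> space M \<in> ?T1" using x that by (intro sigma_sets.Basic) auto
      then show ?thesis by (intro sigma_sets.Basic) auto
    next
      case False
      then have "?w j s -` B \<inter> space M \<in> sigma_of_process M (?w j)"
        unfolding sigma_of_process_def using x that by (intro sigma_sets.Basic) auto
      then have "?w j s -` B \<inter> space M \<in> ?S2" using False by (intro sigma_sets.Basic) auto
      then show ?thesis by (intro sigma_sets.Basic) auto
    qed
    then have "?w j s \<in> borel_measurable \<Sigma>" for j by (intro measurableI) (auto simp: \<Sigma>)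
    then have "(\<lambda>\<omega>. \<chi> j. W s \<omega> $ j) \<in> borel_measurable \<Sigma>" by (rule borel_measurable_vec_lambda)
    from measurable_sets[OF this x(4)] show "x \<in> ?U" unfolding x(1) \<Sigma> by simp
  qed
  then show ?thesis
    by (intro indep_set_mono[OF ind3] sigma_sets_mono') auto
qed

end

section \<open>The filtrations of the leaders and of the follower\<close>

lemma space_history [simp]: "space (history M \<eta> W t) = space M"
  unfolding history_def by (rule space_measure_of) auto

lemma sets_history:
  "sets (history M \<eta> W t) = sigma_sets (space M)
     ({\<eta> -` A \<inter> space M | A. A \<in> sets borel} \<union> {W s -` A \<inter> space M | s A. 0 \<le> s \<and> s \<le> t \<and> A \<in> sets borel})"
  unfolding history_def by (rule sets_measure_of) auto

lemma space_join_filtration [simp]: "space (H t) = space (F t) \<Longrightarrow> space (join_filtration F H t) = space (F t)"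
  unfolding join_filtration_def by (rule space_measure_of) (use sets.sets_into_space in force)

lemma sets_join_filtration:
  "space (H t) = space (F t) \<Longrightarrow> sets (join_filtration F H t) = sigma_sets (space (F t)) (sets (F t) \<union> sets (H t))"
  unfolding join_filtration_def by (rule sets_measure_of) (use sets.sets_into_space in force)

lemma sets_join_subset:
  assumes "sigma_algebra (space (F t)) S" "sets (F t) \<subseteq> S" "sets (H t) \<subseteq> S" "space (H t) = space (F t)"
  shows "sets (join_filtration F H t) \<subseteq> S"
  unfolding sets_join_filtration[where F = F and H = H, OF assms(4)] using assms by (intro sigma_algebra.sigma_sets_subset) auto

lemma sets_join_superset:
  assumes "space (H t) = space (F t)"
  shows "sets (F t) \<subseteq> sets (join_filtration F H t)" "sets (H t) \<subseteq> sets (join_filtration F H t)"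
  unfolding sets_join_filtration[where F = F and H = H, OF assms]
  by (rule subsetI, rule sigma_sets.Basic, simp)+

lemma sets_join_mono:
  assumes "sets (F s) \<subseteq> sets (F t)" "sets (H s) \<subseteq> sets (H t)"
    "space (F s) = space (F t)" "space (H s) = space (F s)" "space (H t) = space (F t)"
  shows "sets (join_filtration F H s) \<subseteq> sets (join_filtration F H t)"
  unfolding sets_join_filtration[where F = F and H = H, OF assms(4)]
    sets_join_filtration[where F = F and H = H, OF assms(5)] assms(3)
  by (rule sigma_sets_mono', rule Un_mono) (rule assms)+

lemma sets_history_mono: "s \<le> t \<Longrightarrow> sets (history M \<eta> W s) \<subseteq> sets (history M \<eta> W t)"
  unfolding sets_history
  by (rule sigma_sets_mono', rule Un_mono[OF order_refl]) (blast intro: order_trans)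

lemma sets_history_subset:
  assumes "sigma_algebra (space M) S" "sigma_of_rv M \<eta> \<subseteq> S"
    "{W s -` A \<inter> space M | s A. 0 \<le> s \<and> s \<le> t \<and> A \<in> sets borel} \<subseteq> S"
  shows "sets (history M \<eta> W t) \<subseteq> S"
  unfolding sets_history
proof (rule sigma_algebra.sigma_sets_subset[OF assms(1)])
  have "{\<eta> -` A \<inter> space M | A. A \<in> sets borel} \<subseteq> sigma_of_rv M \<eta>"
    unfolding sigma_of_rv_def by (auto intro: sigma_sets.Basic)
  then show "{\<eta> -` A \<inter> space M |A. A \<in> sets borel} \<union>
      {W s -` A \<inter> space M |s A. 0 \<le> s \<and> s \<le> t \<and> A \<in> sets borel} \<subseteq> S"
    using assms by blast
qed

lemma past_subset_process:
  "{W s -` A \<inter> space M | s A. 0 \<le> s \<and> s \<le> t \<and> A \<in> sets borel} \<subseteq> sigma_of_process M W"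
  unfolding sigma_of_process_def by (auto intro: sigma_sets.Basic)

locale noise_space =
  fixes \<N> :: "('w, 'na::finite, 'nb::finite, 'n1::finite, 'da::finite, 'db::finite, 'd1::finite) noise"
    and T :: real
  assumes driving_noise: "driving_noise \<N>" and horizon_pos: "0 < T"

sublocale noise_space \<subseteq> time_prob_space "prob_measure \<N>" T
  using driving_noise horizon_pos unfolding driving_noise_def Let_def
  by (intro time_prob_space.intro time_prob_space_axioms.intro) auto

context noise_space
begin

abbreviation "M \<equiv> prob_measure \<N>"
abbreviation "\<F> \<equiv> leader_filtration \<N>"
abbreviation "\<G>\<^sub>1 \<equiv> follower_filtration \<N>"

text \<open>Indices 0, 1, 2 are the Wiener processes and 3, 4, 5 the initial values of \<alpha>,
  \<beta> and the follower. The leaders' noise is thus {0, 1, 3, 4} and the follower's own noise {2,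
  5}.\<close>

definition noise_sigma :: "nat \<Rightarrow> 'w set set" where
  "noise_sigma k = [sigma_of_process M (W\<^sub>\<alpha> \<N>), sigma_of_process M (W\<^sub>\<beta> \<N>), sigma_of_process M (W\<^sub>1 \<N>),
      sigma_of_rv M (\<eta>\<^sub>\<alpha> \<N>), sigma_of_rv M (\<eta>\<^sub>\<beta> \<N>), sigma_of_rv M (\<eta>\<^sub>1 \<N>)] ! k"

definition noise_join :: "nat set \<Rightarrow> 'w set set" where
  "noise_join I = sigma_sets (space M) (\<Union>k\<in>I. noise_sigma k)"

lemma noise_sigma_simps:
  "noise_sigma 0 = sigma_of_process M (W\<^sub>\<alpha> \<N>)" "noise_sigma (Suc 0) = sigma_of_process M (W\<^sub>\<beta> \<N>)"
  "noise_sigma 2 = sigma_of_process M (W\<^sub>1 \<N>)" "noise_sigma 3 = sigma_of_rv M (\<eta>\<^sub>\<alpha> \<N>)"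
  "noise_sigma 4 = sigma_of_rv M (\<eta>\<^sub>\<beta> \<N>)" "noise_sigma 5 = sigma_of_rv M (\<eta>\<^sub>1 \<N>)"
  unfolding noise_sigma_def by (simp_all add: numeral_eq_Suc)

lemma wiener: "wiener_process M (W\<^sub>\<alpha> \<N>)" "wiener_process M (W\<^sub>\<beta> \<N>)" "wiener_process M (W\<^sub>1 \<N>)"
  using driving_noise unfolding driving_noise_def Let_def by auto

lemma initial_sqi:
  "square_integrable_rv M (\<eta>\<^sub>\<alpha> \<N>)" "square_integrable_rv M (\<eta>\<^sub>\<beta> \<N>)" "square_integrable_rv M (\<eta>\<^sub>1 \<N>)"
  using driving_noise unfolding driving_noise_def Let_def by auto

lemma noise_indep: "indep_sets noise_sigma {..<6}"
  using driving_noise unfolding driving_noise_def Let_def noise_sigma_def[abs_def] by auto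

lemma sigma_algebra_noise: "k < 6 \<Longrightarrow> sigma_algebra (space M) (noise_sigma k)"
proof -
  assume "k < 6"
  then have "k \<in> {0, Suc 0, 2, 3, 4, 5}" by auto
  then show ?thesis
    by (auto simp: noise_sigma_simps sigma_algebra_sigma_of_process sigma_algebra_sigma_of_rv)
qed

lemma sigma_algebra_noise_join: "I \<subseteq> {..<6} \<Longrightarrow> sigma_algebra (space M) (noise_join I)"
  unfolding noise_join_def
  by (rule sigma_algebra_sigma_sets) (use sigma_algebra_space_closed[OF sigma_algebra_noise] in blast)

lemma noise_sigma_subset_join: "k \<in> I \<Longrightarrow> noise_sigma k \<subseteq> noise_join I"
  unfolding noise_join_def by (auto intro: sigma_sets.Basic)

lemma noise_join_indep:
  assumes "I \<subseteq> {..<6}" "J \<subseteq> {..<6}" "I \<inter> J = {}"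
  shows "indep_set (noise_join I) (noise_join J)"
proof -
  have "indep_sets noise_sigma (\<Union>c\<in>UNIV. if c then I else J)"
    by (rule indep_sets_mono_index[OF _ noise_indep]) (use assms in auto)
  then have "indep_sets (\<lambda>c. sigma_sets (space M) (\<Union>k\<in>(if c then I else J). noise_sigma k)) UNIV"
    by (rule indep_sets_collect_sigma)
       (use assms in \<open>auto simp: disjoint_family_on_def split: if_splits intro!: sigma_algebra_Int_stable sigma_algebra_noise\<close>)
  then show ?thesis
    unfolding indep_set_def noise_join_def by (rule indep_sets_mono_sets) (auto split: bool.split)
qed

text \<open>Independence of families includes that they consist of events, so pairing with the empty
  group suffices.\<close>

lemma noise_join_events: "I \<subseteq> {..<6} \<Longrightarrow> noise_join I \<subseteq> events"
  using noise_join_indep[of I "{}"] unfolding indep_sets2_eq by auto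

lemma space_leader [simp]: "space (\<F> t) = space M"
  unfolding leader_filtration_def by simp

lemma space_follower [simp]: "space (\<G>\<^sub>1 t) = space M"
  unfolding follower_filtration_def by simp

lemma history_subset:
  "sets (history M (\<eta>\<^sub>\<alpha> \<N>) (W\<^sub>\<alpha> \<N>) t) \<subseteq> noise_join {0, 3}"
  "sets (history M (\<eta>\<^sub>\<beta> \<N>) (W\<^sub>\<beta> \<N>) t) \<subseteq> noise_join {Suc 0, 4}"
  "sets (history M (\<eta>\<^sub>1 \<N>) (W\<^sub>1 \<N>) t) \<subseteq> noise_join {2, 5}"
proof -
  note a = noise_sigma_subset_join
  show "sets (history M (\<eta>\<^sub>\<alpha> \<N>) (W\<^sub>\<alpha> \<N>) t) \<subseteq> noise_join {0, 3}"
    by (rule sets_history_subset[OF sigma_algebra_noise_join _ order_trans[OF past_subset_process]])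
       (use a[of 0 "{0, 3}"] a[of 3 "{0, 3}"] in \<open>simp_all add: noise_sigma_simps\<close>)
  show "sets (history M (\<eta>\<^sub>\<beta> \<N>) (W\<^sub>\<beta> \<N>) t) \<subseteq> noise_join {Suc 0, 4}"
    by (rule sets_history_subset[OF sigma_algebra_noise_join _ order_trans[OF past_subset_process]])
       (use a[of "Suc 0" "{Suc 0, 4}"] a[of 4 "{Suc 0, 4}"] in \<open>simp_all add: noise_sigma_simps\<close>)
  show "sets (history M (\<eta>\<^sub>1 \<N>) (W\<^sub>1 \<N>) t) \<subseteq> noise_join {2, 5}"
    by (rule sets_history_subset[OF sigma_algebra_noise_join _ order_trans[OF past_subset_process]])
       (use a[of 2 "{2, 5}"] a[of 5 "{2, 5}"] in \<open>simp_all add: noise_sigma_simps\<close>)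
qed

lemma noise_join_mono: "I \<subseteq> J \<Longrightarrow> noise_join I \<subseteq> noise_join J"
  unfolding noise_join_def by (rule sigma_sets_mono') blast

lemma leader_subset: "sets (\<F> t) \<subseteq> noise_join {0, Suc 0, 3, 4}"
  unfolding leader_filtration_def
  by (rule sets_join_subset[OF _ order_trans[OF history_subset(1) noise_join_mono]
        order_trans[OF history_subset(2) noise_join_mono]])
     (auto intro: sigma_algebra_noise_join)

lemma follower_subset: "sets (\<G>\<^sub>1 t) \<subseteq> noise_join {..<6}"
  unfolding follower_filtration_def
  by (rule sets_join_subset[OF _ order_trans[OF leader_subset noise_join_mono]
        order_trans[OF history_subset(3) noise_join_mono]])
     (auto intro: sigma_algebra_noise_join)

lemma leader_follower: "sets (\<F> t) \<subseteq> sets (\<G>\<^sub>1 t)"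
  unfolding follower_filtration_def by (rule sets_join_superset) simp

lemma sets_leader_mono: "s \<le> t \<Longrightarrow> sets (\<F> s) \<subseteq> sets (\<F> t)"
  unfolding leader_filtration_def
  by (rule sets_join_mono) (simp_all add: sets_history_mono)

lemma sets_follower_mono: "s \<le> t \<Longrightarrow> sets (\<G>\<^sub>1 s) \<subseteq> sets (\<G>\<^sub>1 t)"
  unfolding follower_filtration_def
  by (rule sets_join_mono) (simp_all add: sets_history_mono sets_leader_mono)

lemma leader_filtration_on: "filtration_on \<F>"
  unfolding filtration_on_def subalgebra_def
  using leader_subset noise_join_events[of "{0, Suc 0, 3, 4}"] sets_leader_mono by auto

lemma follower_filtration_on: "filtration_on \<G>\<^sub>1"
  unfolding filtration_on_def subalgebra_def
  using follower_subset noise_join_events[of "{..<6}"] sets_follower_mono by auto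

lemma leader_in_follower: "subalgebra (\<G>\<^sub>1 t) (\<F> t)"
  unfolding subalgebra_def using leader_follower by simp

lemma leader_indep_integral:
  fixes X Y :: "'w \<Rightarrow> real"
  assumes X: "integrable M X" "X \<in> borel_measurable (\<F> t)"
    and Y: "integrable M Y" "\<And>S. S \<in> sets borel \<Longrightarrow> Y -` S \<inter> space M \<in> noise_join {2, 5}"
  shows "(\<integral>x. X x * Y x \<partial>M) = (\<integral>x. X x \<partial>M) * (\<integral>x. Y x \<partial>M)" "integrable M (\<lambda>x. X x * Y x)"
proof -
  have X': "X -` S \<inter> space M \<in> noise_join {0, Suc 0, 3, 4}" if "S \<in> sets borel" for S
    using measurable_sets[OF X(2) that] leader_subset by auto
  note I = indep_set_integral_mult[OF noise_join_indep sigma_algebra_noise_join sigma_algebra_noise_join,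
      of "{0, Suc 0, 3, 4}" "{2, 5}", OF _ _ _ _ _ X(1) X' Y]
  show "(\<integral>x. X x * Y x \<partial>M) = (\<integral>x. X x \<partial>M) * (\<integral>x. Y x \<partial>M)" "integrable M (\<lambda>x. X x * Y x)"
    by (rule I; simp)+
qed

text \<open>The follower's information at t is the join of \<open>\<F> t\<close> with his own
  history, and the latter is independent of everything the leaders ever see. Hence \<open>V\<close>
  minus its conditional expectation given \<open>\<F> t\<close> integrates to 0 over each rectangle,
  and then over each event of \<open>\<G>\<^sub>1 t\<close>.\<close>

lemma leader_immersed: "immersed \<F> \<G>\<^sub>1"
  unfolding immersed_def
proof (intro conjI ballI allI impI)
  show "sets (\<F> t) \<subseteq> sets (\<G>\<^sub>1 t)" for t by (rule leader_follower)
  fix t and V X :: "'w \<Rightarrow> real"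
  assume t: "t \<in> {0..T}" and V: "V \<in> borel_measurable (\<F> T)" "square_integrable_rv M V"
    and X: "X \<in> borel_measurable (\<G>\<^sub>1 t)" "square_integrable_rv M X"
  let ?H = "history M (\<eta>\<^sub>1 \<N>) (W\<^sub>1 \<N>) t"
  let ?E = "real_cond_exp M (\<F> t) V"
  interpret F: finite_measure_subalgebra M "\<F> t"
    using filtration_onD(1)[OF leader_filtration_on t] by unfold_locales
  interpret G: finite_measure_subalgebra M "\<G>\<^sub>1 t"
    using filtration_onD(1)[OF follower_filtration_on t] by unfold_locales
  note iV = sqi_integrable[OF finite_measure_axioms V(2)]
  have iE: "integrable M ?E" using iV by (rule F.real_cond_exp_int)
  have TT: "T \<in> {0..T}" using T_pos by simp
  have E_T: "?E \<in> borel_measurable (\<F> T)"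
    by (rule filtration_measurable_mono[OF leader_filtration_on t TT]) (use t in auto)
  define D where "D \<omega> = V \<omega> - ?E \<omega>" for \<omega>
  have D: "integrable M D" "D \<in> borel_measurable (\<F> T)"
    unfolding D_def using iV iE V(1) E_T by auto
  let ?R = "{a \<inter> b | a b. a \<in> sets (\<F> t) \<and> b \<in> sets ?H}"
  have algs: "sigma_algebra (space M) (sets (\<F> t))" "sigma_algebra (space M) (sets ?H)"
    using sets.sigma_algebra_axioms[of "\<F> t"] sets.sigma_algebra_axioms[of ?H] by simp_all
  note rect = sigma_sets_Un_rectangles[OF algs]
  have G_eq: "sets (\<G>\<^sub>1 t) = sigma_sets (space M) ?R"
    unfolding follower_filtration_def
    by (subst sets_join_filtration) (simp_all add: rect(3))
  \<comment> \<open>Induction over the sigma-algebra generated by rectangles: complements use that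
    \<open>D\<close> has mean zero, disjoint unions use countable additivity of the
    integral.\<close>
  have zero: "(\<integral>\<omega>. indicator A \<omega> * D \<omega> \<partial>M) = 0" if A: "A \<in> sets (\<G>\<^sub>1 t)" for A
    using rect(1,2) A unfolding G_eq
  proof (induction rule: sigma_sets_induct_disjoint)
    case (basic A)
    then obtain a b where A: "A = a \<inter> b" "a \<in> sets (\<F> t)" "b \<in> sets ?H" by blast
    have ae: "a \<in> events" using A(2) filtration_onD(3)[OF leader_filtration_on t] by blast
    have aT: "a \<in> sets (\<F> T)" using A(2) sets_leader_mono[of t T] t by auto
    have "b \<in> noise_join {2, 5}" using A(3) history_subset(3) by blast
    then have b: "b \<in> events" "\<And>S. (indicator b :: 'w \<Rightarrow> real) -` S \<inter> space M \<in> noise_join {2, 5}"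
    proof -
      assume b: "b \<in> noise_join {2, 5}"
      then show "b \<in> events" using noise_join_events[of "{2, 5}"] by auto
      interpret S: sigma_algebra "space M" "noise_join {2, 5}" by (rule sigma_algebra_noise_join) simp
      fix S :: "real set"
      \<comment> \<open>An indicator takes the values 0 and 1 only, so its preimages are the empty
        set, \<open>b\<close>, the complement of \<open>b\<close> and the whole space.\<close>
      have "(indicator b :: 'w \<Rightarrow> real) -` S \<inter> space M
          = (if 1 \<in> S then b \<inter> space M else {}) \<union> (if 0 \<in> S then space M - b else {})" (is "?l = ?r")
      proof (rule set_eqI)
        show "x \<in> ?l \<longleftrightarrow> x \<in> ?r" for x by (cases "x \<in> b") auto
      qed
      also have "\<dots> \<in> noise_join {2, 5}"
        using b by (intro S.Un) (auto intro: S.Int)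
      finally show "(indicator b :: 'w \<Rightarrow> real) -` S \<inter> space M \<in> noise_join {2, 5}" .
    qed
    have ia: "integrable M (\<lambda>\<omega>. indicator a \<omega> * D \<omega>)"
      using integrable_mult_indicator[OF ae D(1)] by simp
    have ma: "(\<lambda>\<omega>. indicator a \<omega> * D \<omega>) \<in> borel_measurable (\<F> T)" using aT D(2) by simp
    have "(\<integral>\<omega>. indicator A \<omega> * D \<omega> \<partial>M) = (\<integral>\<omega>. (indicator a \<omega> * D \<omega>) * indicator b \<omega> \<partial>M)"
      unfolding A(1) by (rule Bochner_Integration.integral_cong) (auto simp: indicator_def)
    also have "\<dots> = (\<integral>\<omega>. indicator a \<omega> * D \<omega> \<partial>M) * (\<integral>\<omega>. indicator b \<omega> \<partial>M)"
      by (rule leader_indep_integral[OF ia ma]) (use b in \<open>auto intro!: integrable_real_indicator simp: emeasure_eq_measure\<close>)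
    also have "(\<integral>\<omega>. indicator a \<omega> * D \<omega> \<partial>M) = 0"
    proof -
      have i1: "integrable M (\<lambda>\<omega>. indicator a \<omega> * V \<omega>)" using integrable_mult_indicator[OF ae iV] by simp
      have i2: "integrable M (\<lambda>\<omega>. indicator a \<omega> * ?E \<omega>)" using integrable_mult_indicator[OF ae iE] by simp
      have "(\<integral>\<omega>. indicator a \<omega> * ?E \<omega> \<partial>M) = (\<integral>\<omega>. indicator a \<omega> * V \<omega> \<partial>M)"
        by (rule F.real_cond_exp_intg[OF i1]) (use A(2) iV in auto)
      then show ?thesis unfolding D_def right_diff_distrib using i1 i2 by simp
    qed
    finally show ?case by simp
  next
    case empty
    then show ?case by simp
  next
    case (compl A)
    have A: "A \<in> events" using compl(1) filtration_onD(3)[OF follower_filtration_on t] unfolding G_eq by blast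
    have "(\<integral>\<omega>. D \<omega> \<partial>M) = 0" unfolding D_def using iV iE F.real_cond_exp_int(2)[OF iV] by simp
    moreover have "(\<integral>\<omega>. indicator (space M - A) \<omega> * D \<omega> \<partial>M) = (\<integral>\<omega>. D \<omega> - indicator A \<omega> * D \<omega> \<partial>M)"
      by (rule Bochner_Integration.integral_cong) (auto simp: indicator_def)
    moreover have "\<dots> = (\<integral>\<omega>. D \<omega> \<partial>M) - (\<integral>\<omega>. indicator A \<omega> * D \<omega> \<partial>M)"
      using integrable_mult_indicator[OF A D(1)] by (intro Bochner_Integration.integral_diff D) simp
    ultimately show ?case using compl(2) by simp
  next
    case (union A)
    have A: "A i \<in> events" for i
      using union(2) filtration_onD(3)[OF follower_filtration_on t] unfolding G_eq by blast
    have "(LINT \<omega>:(\<Union>i. A i)|M. D \<omega>) = (\<Sum>i. LINT \<omega>:A i|M. D \<omega>)"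
    proof (rule lebesgue_integral_countable_add[OF A])
      show "A i \<inter> A j = {}" if "i \<noteq> j" for i j using union(1) that by (auto simp: disjoint_family_on_def)
      show "set_integrable M (\<Union>i. A i) D" unfolding set_integrable_def
        by (rule integrable_mult_indicator[OF _ D(1)]) (use A in auto)
    qed
    then show ?case using union(3) unfolding set_lebesgue_integral_def by simp
  qed
  have "AE \<omega> in M. real_cond_exp M (\<G>\<^sub>1 t) V \<omega> = ?E \<omega>"
  proof (rule G.real_cond_exp_charact[OF _ iV iE])
    show "?E \<in> borel_measurable (\<G>\<^sub>1 t)"
      by (rule measurable_from_subalg[OF leader_in_follower]) simp
    fix A assume A: "A \<in> sets (\<G>\<^sub>1 t)"
    then have Ae: "A \<in> events" using filtration_onD(3)[OF follower_filtration_on t] by blast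
    show "(LINT \<omega>:A|M. V \<omega>) = (LINT \<omega>:A|M. ?E \<omega>)"
      using zero[OF A] integrable_mult_indicator[OF Ae iV] integrable_mult_indicator[OF Ae iE]
      unfolding set_lebesgue_integral_def D_def right_diff_distrib by simp
  qed
  then have ae: "AE \<omega> in M. X \<omega> * real_cond_exp M (\<G>\<^sub>1 t) V \<omega> = ?E \<omega> * X \<omega>" by auto
  have iXV: "integrable M (\<lambda>\<omega>. X \<omega> * V \<omega>)" using sqi_inner_integrable[OF X(2) V(2)] by simp
  have "(\<integral>\<omega>. V \<omega> * X \<omega> \<partial>M) = (\<integral>\<omega>. X \<omega> * real_cond_exp M (\<G>\<^sub>1 t) V \<omega> \<partial>M)"
    using G.real_cond_exp_intg(2)[OF iXV X(1)] sqi_D(1)[OF V(2)] by (simp add: mult.commute)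
  also have "\<dots> = (\<integral>\<omega>. ?E \<omega> * X \<omega> \<partial>M)"
    by (rule integral_cong_AE[OF _ _ ae])
       (use sqi_D(1)[OF X(2)] iE G.real_cond_exp_int(1)[OF iV] in auto)
  finally show "(\<integral>\<omega>. V \<omega> * X \<omega> \<partial>M) = (\<integral>\<omega>. ?E \<omega> * X \<omega> \<partial>M)" .
qed (rule leader_filtration_on follower_filtration_on)+

end

text \<open>The product rule is avoided by writing the terminal pairing as a time integral of the
  pairings of \<open>f s\<close> with \<open>P\<close> and using the backward equation at each s
  separately. The driver then appears in a double integral over s and later times, which
  \<open>running_integral_parts\<close> turns into its pairing with \<open>y\<close>.\<close>

lemma (in time_prob_space) backward_duality:
  fixes f g y p :: "real \<Rightarrow> 'w \<Rightarrow> real ^ 'n"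
  assumes G: "filtration_on G"
    and f: "L2_adapted T M G f" and y: "L2_adapted T M G y"
    and y_eq: "\<And>t. t \<in> {0..T} \<Longrightarrow> AE \<omega> in M. y t \<omega> = running_integral f t \<omega>"
    and p: "square_integrable_process T M p" and g: "square_integrable_process T M g"
    and pT: "square_integrable_rv M P"
    and I: "\<And>t. t \<in> {0..T} \<Longrightarrow> square_integrable_rv M (I t)"
    and p_eq: "\<And>t. t \<in> {0..T} \<Longrightarrow>
      AE \<omega> in M. p t \<omega> = P \<omega> + (LINT s:{t..T}|lborel. g s \<omega>) - (I T \<omega> - I t \<omega>)"
    and orth: "\<And>t \<xi>. t \<in> {0..T} \<Longrightarrow> \<xi> \<in> borel_measurable (G t) \<Longrightarrow> square_integrable_rv M \<xi> \<Longrightarrow>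
      (\<integral>\<omega>. \<xi> \<omega> \<bullet> (I T \<omega> - I t \<omega>) \<partial>M) = 0"
  shows "(\<integral>\<omega>. y T \<omega> \<bullet> P \<omega> \<partial>M) =
    (\<integral>z. f (fst z) (snd z) \<bullet> p (fst z) (snd z) \<partial>N) - (\<integral>z. y (fst z) (snd z) \<bullet> g (fst z) (snd z) \<partial>N)"
proof -
  have TT: "T \<in> {0..T}" using T_pos by simp
  note sf = L2_adapted_sqi[OF f] and sy = L2_adapted_sqi[OF y]
  let ?R = "running_integral g"
  note RT = sqi_running_integral_at[OF g TT]
  note G' = sqi_diff[OF sqi_N_snd_comp[OF RT] sqi_running_integral[OF g]]
  note ii = sqi_inner_integrable
  have "(\<integral>\<omega>. y T \<omega> \<bullet> P \<omega> \<partial>M) = (\<integral>\<omega>. P \<omega> \<bullet> running_integral f T \<omega> \<partial>M)"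
  proof (rule integral_cong_AE)
    show "AE \<omega> in M. y T \<omega> \<bullet> P \<omega> = P \<omega> \<bullet> running_integral f T \<omega>"
      using y_eq[OF TT] by eventually_elim (simp add: inner_commute)
    show "(\<lambda>\<omega>. y T \<omega> \<bullet> P \<omega>) \<in> borel_measurable M"
      using sqi_D(1)[OF pT] measurable_from_subalg[OF filtration_onD(1)[OF G TT] L2_adapted_at[OF y TT]] by simp
    show "(\<lambda>\<omega>. P \<omega> \<bullet> running_integral f T \<omega>) \<in> borel_measurable M"
      using sqi_D(1)[OF pT] sqi_D(1)[OF sqi_running_integral_at[OF sf TT]] by simp
  qed
  also have "\<dots> = (\<integral>s. indicator {0..T} s *\<^sub>R (\<integral>\<omega>. P \<omega> \<bullet> f s \<omega> \<partial>M) \<partial>TL)"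
    by (rule integral_inner_running_integral(2)[OF sf pT TT])
  also have "\<dots> = (\<integral>s. (\<integral>\<omega>. f s \<omega> \<bullet> p s \<omega> \<partial>M) - (\<integral>\<omega>. f s \<omega> \<bullet> (?R T \<omega> - ?R s \<omega>) \<partial>M) \<partial>TL)"
  proof (rule integral_cong_AE)
    show "(\<lambda>s. indicator {0..T} s *\<^sub>R (\<integral>\<omega>. P \<omega> \<bullet> f s \<omega> \<partial>M)) \<in> borel_measurable TL"
      using borel_measurable_integrable[OF integrable_N_fst[OF ii[OF sqi_N_snd_comp[OF pT] sqi_N_indicator[OF sf, of T]]]]
      by simp
    show "(\<lambda>s. (\<integral>\<omega>. f s \<omega> \<bullet> p s \<omega> \<partial>M) - (\<integral>\<omega>. f s \<omega> \<bullet> (?R T \<omega> - ?R s \<omega>) \<partial>M)) \<in> borel_measurable TL"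
      using borel_measurable_integrable[OF integrable_N_fst[OF ii[OF sf p]]]
        borel_measurable_integrable[OF integrable_N_fst[OF ii[OF sf G']]] by simp
    show "AE s in TL. indicator {0..T} s *\<^sub>R (\<integral>\<omega>. P \<omega> \<bullet> f s \<omega> \<partial>M)
        = (\<integral>\<omega>. f s \<omega> \<bullet> p s \<omega> \<partial>M) - (\<integral>\<omega>. f s \<omega> \<bullet> (?R T \<omega> - ?R s \<omega>) \<partial>M)"
      using sqi_section_fst[OF sf] sqi_section_fst[OF p] AE_space
    proof eventually_elim
      case (elim s)
      then have s: "s \<in> {0..T}" by (simp add: space_TL)
      note Rs = sqi_running_integral_at[OF g s]
      note IT = sqi_diff[OF I[OF TT] I[OF s]]
      note G'' = sqi_diff[OF RT Rs]
      have "(\<integral>\<omega>. f s \<omega> \<bullet> p s \<omega> \<partial>M) = (\<integral>\<omega>. P \<omega> \<bullet> f s \<omega> + f s \<omega> \<bullet> (?R T \<omega> - ?R s \<omega>) - f s \<omega> \<bullet> (I T \<omega> - I s \<omega>) \<partial>M)"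
      proof (rule integral_cong_AE)
        show "AE \<omega> in M. f s \<omega> \<bullet> p s \<omega> = P \<omega> \<bullet> f s \<omega> + f s \<omega> \<bullet> (?R T \<omega> - ?R s \<omega>) - f s \<omega> \<bullet> (I T \<omega> - I s \<omega>)"
          using p_eq[OF s] integrable_path[OF g]
        proof eventually_elim
          case (elim \<omega>)
          show ?case unfolding elim(1) set_integral_interval[where f = g and \<omega> = \<omega>, OF s elim(2)]
            by (simp add: inner_add_right inner_diff_right inner_commute[of "P \<omega>"])
        qed
      qed (use ii[OF elim(1,2)] ii[OF pT elim(1)] ii[OF elim(1) G''] ii[OF elim(1) IT] in auto)
      also have "\<dots> = (\<integral>\<omega>. P \<omega> \<bullet> f s \<omega> \<partial>M) + (\<integral>\<omega>. f s \<omega> \<bullet> (?R T \<omega> - ?R s \<omega>) \<partial>M) - (\<integral>\<omega>. f s \<omega> \<bullet> (I T \<omega> - I s \<omega>) \<partial>M)"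
        using ii[OF pT elim(1)] ii[OF elim(1) G''] ii[OF elim(1) IT] by simp
      \<comment> \<open>\<open>f s\<close> is known at time s, so it is orthogonal to the increment
        of the martingale term after s.\<close>
      also have "(\<integral>\<omega>. f s \<omega> \<bullet> (I T \<omega> - I s \<omega>) \<partial>M) = 0"
        by (rule orth[OF s L2_adapted_at[OF f s] elim(1)])
      finally show ?case using s by simp
    qed
  qed
  also have "\<dots> = (\<integral>s. (\<integral>\<omega>. f s \<omega> \<bullet> p s \<omega> \<partial>M) \<partial>TL) - (\<integral>s. (\<integral>\<omega>. f s \<omega> \<bullet> (?R T \<omega> - ?R s \<omega>) \<partial>M) \<partial>TL)"
    by (rule Bochner_Integration.integral_diff[OF integrable_N_fst[OF ii[OF sf p]] integrable_N_fst[OF ii[OF sf G']]])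
  also have "\<dots> = (\<integral>z. f (fst z) (snd z) \<bullet> p (fst z) (snd z) \<partial>N)
      - (\<integral>z. f (fst z) (snd z) \<bullet> (?R T (snd z) - ?R (fst z) (snd z)) \<partial>N)"
    using integral_N_fst[OF ii[OF sf p]] integral_N_fst[OF ii[OF sf G']] by simp
  also have "(\<integral>z. f (fst z) (snd z) \<bullet> (?R T (snd z) - ?R (fst z) (snd z)) \<partial>N)
      = (\<integral>z. running_integral f (fst z) (snd z) \<bullet> g (fst z) (snd z) \<partial>N)"
    by (rule running_integral_parts[OF sf g])
  also have "\<dots> = (\<integral>z. y (fst z) (snd z) \<bullet> g (fst z) (snd z) \<partial>N)"
  proof (rule integral_cong_AE)
    have "AE z in N. y (fst z) (snd z) = running_integral f (fst z) (snd z)"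
      by (rule AE_N_eq[OF sqi_D(1)[OF sy] sqi_D(1)[OF sqi_running_integral[OF sf]]]) (rule AE_TL_I[OF y_eq])
    then show "AE z in N. running_integral f (fst z) (snd z) \<bullet> g (fst z) (snd z) = y (fst z) (snd z) \<bullet> g (fst z) (snd z)"
      by eventually_elim simp
  qed (use ii[OF sqi_running_integral[OF sf] g] ii[OF sy g] in auto)
  finally show ?thesis .
qed

section \<open>Orthogonality of stochastic integrals to the follower's past\<close>

lemma diff_diff_swap: "(a - b) - (c - d) = (a - c) - (b - (d :: 'a::ab_group_add))"
  by simp

lemma W_vec_component:
  "W_vec \<N> t \<omega> $ Inl i = W\<^sub>\<alpha> \<N> t \<omega> $ i" "W_vec \<N> t \<omega> $ Inr j = W\<^sub>\<beta> \<N> t \<omega> $ j"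
  by (simp_all add: W_vec_def vstack_def)

context noise_space
begin

text \<open>Kept general in \<open>W\<close> and \<open>\<O>\<close>, since the same argument serves
  both leaders' Wiener processes, each with the remaining noise as \<open>\<O>\<close>.\<close>

lemma increment_orthogonal_aux:
  fixes W :: "real \<Rightarrow> 'w \<Rightarrow> real ^ 'd"
  assumes W: "wiener_process M W" and ab: "0 \<le> a" "a \<le> b"
    and \<O>: "indep_set (sigma_of_process M W) \<O>" "sigma_algebra (space M) \<O>"
    and G: "sets (\<G>\<^sub>1 a) \<subseteq> sigma_sets (space M) ({W s -` A \<inter> space M | s A. 0 \<le> s \<and> s \<le> a \<and> A \<in> sets borel} \<union> \<O>)"
    and X: "integrable M X" "X \<in> borel_measurable (\<G>\<^sub>1 a)"
  shows "(\<integral>\<omega>. X \<omega> * (W b \<omega> $ i - W a \<omega> $ i) \<partial>M) = 0"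
proof -
  let ?U = "sigma_sets (space M) ({W s -` A \<inter> space M | s A. 0 \<le> s \<and> s \<le> a \<and> A \<in> sets borel} \<union> \<O>)"
  let ?Y = "\<lambda>\<omega>. W b \<omega> $ i - W a \<omega> $ i"
  have w: "brownian_motion M (\<lambda>t \<omega>. W t \<omega> $ i)" using W unfolding wiener_process_def by simp
  note mom = brownian_increment_moments[OF w ab]
  have alg: "sigma_algebra (space M) ?U"
    by (rule sigma_algebra_sigma_sets) (use sigma_algebra_space_closed[OF \<O>(2)] in blast)
  have "(\<integral>\<omega>. X \<omega> * ?Y \<omega> \<partial>M) = (\<integral>\<omega>. X \<omega> \<partial>M) * (\<integral>\<omega>. ?Y \<omega> \<partial>M)"
  proof (rule indep_set_integral_mult(1)[OF wiener_increment_indep[OF W ab \<O>] alg sigma_algebra_sigma_of_rv X(1)])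
    show "X -` S \<inter> space M \<in> ?U" if "S \<in> sets borel" for S
      using measurable_sets[OF X(2) that] G by auto
    show "integrable M ?Y" by (rule sqi_integrable[OF finite_measure_axioms mom(1)])
    show "?Y -` S \<inter> space M \<in> sigma_of_rv M ?Y" if "S \<in> sets borel" for S
      unfolding sigma_of_rv_def using that by (intro sigma_sets.Basic) auto
  qed
  then show ?thesis using mom(2) by simp
qed

text \<open>For a coordinate of one leader's process, all five other noise sources go into
  \<open>?O\<close> with their whole paths, so the follower's information at time a fits into the
  join with the past of that process. The larger filtration matters because the test processes of
  the duality involve the follower's state.\<close>

lemma increment_orthogonal:
  assumes ab: "0 \<le> a" "a \<le> b" and X: "integrable M X" "X \<in> borel_measurable (\<G>\<^sub>1 a)"
  shows "(\<integral>\<omega>. X \<omega> * (W_vec \<N> b \<omega> $ k - W_vec \<N> a \<omega> $ k) \<partial>M) = 0"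
proof (cases k)
  case (Inl i)
  let ?O = "noise_join {Suc 0, 2, 3, 4, 5}"
  let ?past = "{W\<^sub>\<alpha> \<N> s -` A \<inter> space M | s A. 0 \<le> s \<and> s \<le> a \<and> A \<in> sets borel}"
  have O: "sigma_algebra (space M) ?O" by (rule sigma_algebra_noise_join) auto
  have U: "sigma_algebra (space M) (sigma_sets (space M) (?past \<union> ?O))"
    by (rule sigma_algebra_sigma_sets) (use sigma_algebra_space_closed[OF O] in blast)
  have O_U: "?O \<subseteq> sigma_sets (space M) (?past \<union> ?O)" and P_U: "?past \<subseteq> sigma_sets (space M) (?past \<union> ?O)"
    by (rule subsetI, rule sigma_sets.Basic, simp)+
  have "sets (\<G>\<^sub>1 a) \<subseteq> sigma_sets (space M) (?past \<union> ?O)"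
    unfolding follower_filtration_def leader_filtration_def
  proof (intro sets_join_subset)
    show "sets (history M (\<eta>\<^sub>\<alpha> \<N>) (W\<^sub>\<alpha> \<N>) a) \<subseteq> sigma_sets (space M) (?past \<union> ?O)"
      using noise_sigma_subset_join[of 3 "{Suc 0, 2, 3, 4, 5}"] O_U
      by (intro sets_history_subset[OF U _ P_U]) (auto simp: noise_sigma_simps)
  qed (use U order_trans[OF order_trans[OF history_subset(2) noise_join_mono] O_U]
        order_trans[OF order_trans[OF history_subset(3) noise_join_mono] O_U] in auto)
  moreover have "indep_set (sigma_of_process M (W\<^sub>\<alpha> \<N>)) ?O"
    by (rule indep_set_mono[OF noise_join_indep[of "{0}" "{Suc 0, 2, 3, 4, 5}"]])
       (use noise_sigma_subset_join[of 0 "{0}"] in \<open>auto simp: noise_sigma_simps\<close>)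
  ultimately show ?thesis unfolding Inl W_vec_component
    using increment_orthogonal_aux[OF wiener(1) ab _ O _ X] by blast
next
  case (Inr i)
  let ?O = "noise_join {0, 2, 3, 4, 5}"
  let ?past = "{W\<^sub>\<beta> \<N> s -` A \<inter> space M | s A. 0 \<le> s \<and> s \<le> a \<and> A \<in> sets borel}"
  have O: "sigma_algebra (space M) ?O" by (rule sigma_algebra_noise_join) auto
  have U: "sigma_algebra (space M) (sigma_sets (space M) (?past \<union> ?O))"
    by (rule sigma_algebra_sigma_sets) (use sigma_algebra_space_closed[OF O] in blast)
  have O_U: "?O \<subseteq> sigma_sets (space M) (?past \<union> ?O)" and P_U: "?past \<subseteq> sigma_sets (space M) (?past \<union> ?O)"
    by (rule subsetI, rule sigma_sets.Basic, simp)+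
  have "sets (\<G>\<^sub>1 a) \<subseteq> sigma_sets (space M) (?past \<union> ?O)"
    unfolding follower_filtration_def leader_filtration_def
  proof (intro sets_join_subset)
    show "sets (history M (\<eta>\<^sub>\<beta> \<N>) (W\<^sub>\<beta> \<N>) a) \<subseteq> sigma_sets (space M) (?past \<union> ?O)"
      using noise_sigma_subset_join[of 4 "{0, 2, 3, 4, 5}"] O_U
      by (intro sets_history_subset[OF U _ P_U]) (auto simp: noise_sigma_simps)
  qed (use U order_trans[OF order_trans[OF history_subset(1) noise_join_mono] O_U]
        order_trans[OF order_trans[OF history_subset(3) noise_join_mono] O_U] in auto)
  moreover have "indep_set (sigma_of_process M (W\<^sub>\<beta> \<N>)) ?O"
    by (rule indep_set_mono[OF noise_join_indep[of "{Suc 0}" "{0, 2, 3, 4, 5}"]])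
       (use noise_sigma_subset_join[of "Suc 0" "{Suc 0}"] in \<open>auto simp: noise_sigma_simps\<close>)
  ultimately show ?thesis unfolding Inr W_vec_component
    using increment_orthogonal_aux[OF wiener(2) ab _ O _ X] by blast
qed

lemma sqi_W_vec: "0 \<le> t \<Longrightarrow> square_integrable_rv M (W_vec \<N> t)"
proof (rule sqi_vec)
  fix k assume t: "0 \<le> t"
  show "square_integrable_rv M (\<lambda>\<omega>. W_vec \<N> t \<omega> $ k)"
    using sqi_nth[OF wiener_sqi[OF wiener(1) t]] sqi_nth[OF wiener_sqi[OF wiener(2) t]]
    by (cases k) (simp_all add: W_vec_component)
qed

text \<open>Expansion into entries; boundedness of \<open>Z\<close> keeps its products with \<xi>
  square-integrable, and both factors are known at time a.\<close>

lemma matrix_increment_orthogonal: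
  fixes Z :: "'w \<Rightarrow> real ^ ('da + 'db) ^ 'n"
  assumes ab: "0 \<le> a" "a \<le> b" "b \<le> T"
    and Z: "Z \<in> borel_measurable (\<G>\<^sub>1 a)" "\<And>\<omega>. \<omega> \<in> space M \<Longrightarrow> norm (Z \<omega>) \<le> K"
    and \<xi>: "\<xi> \<in> borel_measurable (\<G>\<^sub>1 a)" "square_integrable_rv M \<xi>"
  shows "(\<integral>\<omega>. \<xi> \<omega> \<bullet> (Z \<omega> *v (W_vec \<N> b \<omega> - W_vec \<N> a \<omega>)) \<partial>M) = 0"
proof -
  note subG = filtration_onD(1)[OF follower_filtration_on, of a]
  have Zjk: "(\<lambda>\<omega>. Z \<omega> $ j $ k) \<in> borel_measurable (\<G>\<^sub>1 a)" for j k
    by (rule borel_measurable_vec_nth) (use measurable_compose[OF Z(1) borel_measurable_continuous_onI[OF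
          linear_continuous_on[OF bounded_linear_vec_nth]]] in auto)
  have bnd: "\<bar>Z \<omega> $ j $ k\<bar> \<le> K" if "\<omega> \<in> space M" for \<omega> j k
    using Z(2)[OF that] component_le_norm_cart[of "Z \<omega> $ j" k] Finite_Cartesian_Product.norm_nth_le[of "Z \<omega>" j] by simp
  have ZM: "(\<lambda>\<omega>. Z \<omega> $ j $ k) \<in> borel_measurable M" for j k
    by (rule measurable_from_subalg[OF subG Zjk]) (use ab in auto)
  have sX: "square_integrable_rv M (\<lambda>\<omega>. Z \<omega> $ j $ k * \<xi> \<omega> $ j)" for j k
    by (rule sqi_mult_bounded[OF ZM bnd sqi_nth[OF \<xi>(2)]])
  have mX: "(\<lambda>\<omega>. Z \<omega> $ j $ k * \<xi> \<omega> $ j) \<in> borel_measurable (\<G>\<^sub>1 a)" for j k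
    using Zjk borel_measurable_vec_nth[OF \<xi>(1)] by simp
  have sW: "square_integrable_rv M (\<lambda>\<omega>. W_vec \<N> b \<omega> $ k - W_vec \<N> a \<omega> $ k)" for k
    by (intro sqi_diff sqi_nth sqi_W_vec) (use ab in auto)
  note i = sqi_inner_integrable[OF sX sW, unfolded inner_real_def]
  have "(\<integral>\<omega>. \<xi> \<omega> \<bullet> (Z \<omega> *v (W_vec \<N> b \<omega> - W_vec \<N> a \<omega>)) \<partial>M)
    = (\<integral>\<omega>. (\<Sum>j\<in>UNIV. \<Sum>k\<in>UNIV. Z \<omega> $ j $ k * \<xi> \<omega> $ j * (W_vec \<N> b \<omega> $ k - W_vec \<N> a \<omega> $ k)) \<partial>M)"
    by (simp add: inner_vec_def matrix_vector_mult_component sum_distrib_left algebra_simps flip: sum_subtractf)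
  also have "\<dots> = (\<Sum>j\<in>UNIV. \<Sum>k\<in>UNIV. (\<integral>\<omega>. Z \<omega> $ j $ k * \<xi> \<omega> $ j * (W_vec \<N> b \<omega> $ k - W_vec \<N> a \<omega> $ k) \<partial>M))"
    using i by simp
  also have "\<dots> = 0"
    using increment_orthogonal[OF ab(1,2) sqi_integrable[OF finite_measure_axioms sX] mX] by simp
  finally show ?thesis .
qed

lemma simple_integrand_bounds:
  assumes "simple_integrand T M F n \<tau> \<xi>" "i \<le> n"
  shows "0 \<le> \<tau> i" "\<tau> i \<le> T"
proof -
  have s: "\<tau> 0 = 0" "\<tau> n = T" "\<And>i. i < n \<Longrightarrow> \<tau> i < \<tau> (Suc i)"
    using assms(1) unfolding simple_integrand_def by auto
  have "\<tau> 0 \<le> \<tau> i"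
    using assms(2)
  proof (induction i)
    case (Suc i)
    then show ?case using s(3)[of i] by auto
  qed simp
  moreover have "\<tau> i \<le> \<tau> n"
    using assms(2)
  proof (induction rule: inc_induct)
    case (step m)
    then show ?case using s(3)[of m] by auto
  qed simp
  ultimately show "0 \<le> \<tau> i" "\<tau> i \<le> T" using s by auto
qed

lemma simple_ito_orthogonal:
  fixes \<zeta> :: "nat \<Rightarrow> 'w \<Rightarrow> real ^ ('da + 'db) ^ 'n"
  assumes s: "simple_integrand T M \<F> n \<tau> \<zeta>" and t: "t \<in> {0..T}"
  shows "square_integrable_rv M (simple_ito (W_vec \<N>) n \<tau> \<zeta> t)"
    and "\<xi> \<in> borel_measurable (\<G>\<^sub>1 t) \<Longrightarrow> square_integrable_rv M \<xi> \<Longrightarrow>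
      (\<integral>\<omega>. \<xi> \<omega> \<bullet> (simple_ito (W_vec \<N>) n \<tau> \<zeta> T \<omega> - simple_ito (W_vec \<N>) n \<tau> \<zeta> t \<omega>) \<partial>M) = 0"
proof -
  note b = simple_integrand_bounds[OF s]
  have ord: "\<tau> i \<le> \<tau> (Suc i)" if "i < n" for i using s that unfolding simple_integrand_def by (auto intro: less_imp_le)
  have \<zeta>: "\<zeta> i \<in> borel_measurable (\<F> (\<tau> i))" "\<exists>K. \<forall>\<omega>\<in>space M. norm (\<zeta> i \<omega>) \<le> K" if "i < n" for i
    using s that unfolding simple_integrand_def by auto
  have \<zeta>M: "\<zeta> i \<in> borel_measurable M" if "i < n" for i
    by (rule measurable_from_subalg[OF filtration_onD(1)[OF leader_filtration_on] \<zeta>(1)[OF that]])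
       (use b that in auto)
  have term_sqi: "square_integrable_rv M (\<lambda>\<omega>. \<zeta> i \<omega> *v (W_vec \<N> c \<omega> - W_vec \<N> a \<omega>))" if "i < n" "0 \<le> a" "0 \<le> c" for i a c
  proof -
    from \<zeta>(2)[OF that(1)] obtain K where "\<forall>\<omega>\<in>space M. norm (\<zeta> i \<omega>) \<le> K" by blast
    then show ?thesis
      using sqi_diff[OF sqi_W_vec[OF that(3)] sqi_W_vec[OF that(2)]]
      by (intro sqi_matrix_mult_bounded[OF finite_measure_axioms \<zeta>M[OF that(1)]]) auto
  qed
  have "square_integrable_rv M (\<lambda>\<omega>. simple_ito (W_vec \<N>) n \<tau> \<zeta> t \<omega>)"
    unfolding simple_ito_def
    by (rule sqi_sum[OF finite_measure_axioms], rule term_sqi) (use b t in auto)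
  then show "square_integrable_rv M (simple_ito (W_vec \<N>) n \<tau> \<zeta> t)" .
  assume \<xi>: "\<xi> \<in> borel_measurable (\<G>\<^sub>1 t)" "square_integrable_rv M \<xi>"
  \<comment> \<open>Terms stopped at T minus terms stopped at t are increments from
    \<open>max t (\<tau> i)\<close> to \<open>max t (\<tau> (Suc i))\<close>. They start no earlier
    than t and \<tau> i, so both \<xi> and \<open>\<zeta> i\<close> are known by then.\<close>
  have diff: "simple_ito (W_vec \<N>) n \<tau> \<zeta> T \<omega> - simple_ito (W_vec \<N>) n \<tau> \<zeta> t \<omega>
      = (\<Sum>i<n. \<zeta> i \<omega> *v (W_vec \<N> (max t (\<tau> (Suc i))) \<omega> - W_vec \<N> (max t (\<tau> i)) \<omega>))" for \<omega>
    unfolding simple_ito_def sum_subtractf[symmetric]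
  proof (rule sum.cong)
    fix i assume "i \<in> {..<n}"
    then have i: "i \<le> n" "Suc i \<le> n" by auto
    have e: "W_vec \<N> (min T c) \<omega> - W_vec \<N> (min t c) \<omega> = W_vec \<N> (max t c) \<omega> - W_vec \<N> t \<omega>" if "c \<le> T" for c
      using that by (cases "c \<le> t") (auto simp: min_def max_def)
    have "(W_vec \<N> (min T (\<tau> (Suc i))) \<omega> - W_vec \<N> (min T (\<tau> i)) \<omega>)
        - (W_vec \<N> (min t (\<tau> (Suc i))) \<omega> - W_vec \<N> (min t (\<tau> i)) \<omega>)
        = W_vec \<N> (max t (\<tau> (Suc i))) \<omega> - W_vec \<N> (max t (\<tau> i)) \<omega>"
      by (subst diff_diff_swap) (simp add: e[OF b(2)[OF i(2)]] e[OF b(2)[OF i(1)]])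
    then show "\<zeta> i \<omega> *v (W_vec \<N> (min T (\<tau> (Suc i))) \<omega> - W_vec \<N> (min T (\<tau> i)) \<omega>)
        - \<zeta> i \<omega> *v (W_vec \<N> (min t (\<tau> (Suc i))) \<omega> - W_vec \<N> (min t (\<tau> i)) \<omega>)
        = \<zeta> i \<omega> *v (W_vec \<N> (max t (\<tau> (Suc i))) \<omega> - W_vec \<N> (max t (\<tau> i)) \<omega>)"
      unfolding matrix_vector_mult_diff_distrib[symmetric] by simp
  qed simp
  have i: "integrable M (\<lambda>\<omega>. \<xi> \<omega> \<bullet> (\<zeta> i \<omega> *v (W_vec \<N> (max t (\<tau> (Suc i))) \<omega> - W_vec \<N> (max t (\<tau> i)) \<omega>)))"
    if "i < n" for i
    by (rule sqi_inner_integrable[OF \<xi>(2) term_sqi[OF that]]) (use b t in auto)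
  have "(\<integral>\<omega>. \<xi> \<omega> \<bullet> (simple_ito (W_vec \<N>) n \<tau> \<zeta> T \<omega> - simple_ito (W_vec \<N>) n \<tau> \<zeta> t \<omega>) \<partial>M)
    = (\<Sum>i<n. \<integral>\<omega>. \<xi> \<omega> \<bullet> (\<zeta> i \<omega> *v (W_vec \<N> (max t (\<tau> (Suc i))) \<omega> - W_vec \<N> (max t (\<tau> i)) \<omega>)) \<partial>M)"
    unfolding diff inner_sum_right using i by (intro Bochner_Integration.integral_sum) auto
  also have "\<dots> = 0"
  proof (rule sum.neutral, rule ballI)
    fix i assume "i \<in> {..<n}"
    then have i: "i < n" by simp
    obtain K where K: "\<forall>\<omega>\<in>space M. norm (\<zeta> i \<omega>) \<le> K" using \<zeta>(2)[OF i] by blast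
    have m: "max t (\<tau> i) \<in> {0..T}" "max t (\<tau> (Suc i)) \<in> {0..T}" using b[of i] b[of "Suc i"] i t by auto
    show "(\<integral>\<omega>. \<xi> \<omega> \<bullet> (\<zeta> i \<omega> *v (W_vec \<N> (max t (\<tau> (Suc i))) \<omega> - W_vec \<N> (max t (\<tau> i)) \<omega>)) \<partial>M) = 0"
    proof (rule matrix_increment_orthogonal)
      show "\<xi> \<in> borel_measurable (\<G>\<^sub>1 (max t (\<tau> i)))"
        by (rule filtration_measurable_mono[OF follower_filtration_on t m(1) _ \<xi>(1)]) simp
      show "\<zeta> i \<in> borel_measurable (\<G>\<^sub>1 (max t (\<tau> i)))"
        by (rule measurable_from_subalg[OF leader_in_follower],
            rule filtration_measurable_mono[OF leader_filtration_on _ m(1) _ \<zeta>(1)[OF i]])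
           (use b[of i] i in auto)
    qed (use m ord[OF i] K \<xi>(2) in auto)
  qed
  finally show "(\<integral>\<omega>. \<xi> \<omega> \<bullet> (simple_ito (W_vec \<N>) n \<tau> \<zeta> T \<omega> - simple_ito (W_vec \<N>) n \<tau> \<zeta> t \<omega>) \<partial>M) = 0" .
qed

text \<open>Orthogonality holds for simple integrands and survives mean-square limits by
  Cauchy-Schwarz.\<close>

lemma ito_integral_orthogonal:
  fixes Z :: "real \<Rightarrow> 'w \<Rightarrow> real ^ ('da + 'db) ^ 'n"
  assumes I: "ito_integral T M \<F> (W_vec \<N>) Z I" and t: "t \<in> {0..T}"
  shows "square_integrable_rv M (I t)"
    and "\<xi> \<in> borel_measurable (\<G>\<^sub>1 t) \<Longrightarrow> square_integrable_rv M \<xi> \<Longrightarrow> (\<integral>\<omega>. \<xi> \<omega> \<bullet> (I T \<omega> - I t \<omega>) \<partial>M) = 0"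
proof -
  obtain n \<tau> \<zeta> where s: "\<And>k. simple_integrand T M \<F> (n k) (\<tau> k) (\<zeta> k)"
    and lim: "\<And>t. t \<in> {0..T} \<Longrightarrow>
      (\<lambda>k. \<integral>\<^sup>+\<omega>. ennreal ((norm (I t \<omega> - simple_ito (W_vec \<N>) (n k) (\<tau> k) (\<zeta> k) t \<omega>))\<^sup>2) \<partial>M) \<longlonglongrightarrow> 0"
    using I unfolding ito_integral_def by blast
  have Im: "\<And>t. t \<in> {0..T} \<Longrightarrow> I t \<in> borel_measurable M" using I unfolding ito_integral_def by blast
  define S where "S k = simple_ito (W_vec \<N>) (n k) (\<tau> k) (\<zeta> k)" for k
  have S: "square_integrable_rv M (S k t)" if "t \<in> {0..T}" for k t
    unfolding S_def by (rule simple_ito_orthogonal(1)[OF s that])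
  have I_sqi: "square_integrable_rv M (I t)" if t: "t \<in> {0..T}" for t
  proof -
    \<comment> \<open>The definition gives only measurability of \<open>I t\<close>; one simple
      integral at squared distance less than 1 makes it square-integrable.\<close>
    have "\<forall>\<^sub>F k in sequentially. (\<integral>\<^sup>+\<omega>. ennreal ((norm (I t \<omega> - S k t \<omega>))\<^sup>2) \<partial>M) < 1"
      using order_tendstoD(2)[OF lim[OF t], of 1] unfolding S_def by simp
    then obtain k where k: "(\<integral>\<^sup>+\<omega>. ennreal ((norm (I t \<omega> - S k t \<omega>))\<^sup>2) \<partial>M) < 1"
      using eventually_happens'[OF sequentially_bot] by blast
    have m: "(\<lambda>\<omega>. I t \<omega> - S k t \<omega>) \<in> borel_measurable M"
      using Im[OF t] sqi_D(1)[OF S[OF t]] by simp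
    have "integrable M (\<lambda>\<omega>. (norm (I t \<omega> - S k t \<omega>))\<^sup>2)"
    proof (rule integrableI_bounded)
      show "(\<integral>\<^sup>+\<omega>. ennreal (norm ((norm (I t \<omega> - S k t \<omega>))\<^sup>2)) \<partial>M) < \<infinity>"
        using order.strict_trans[OF k ennreal_one_less_top] by simp
    qed (use m in simp)
    then have "square_integrable_rv M (\<lambda>\<omega>. I t \<omega> - S k t \<omega>)" using m unfolding square_integrable_rv_def by simp
    from sqi_add[OF this S[OF t, of k]] show ?thesis by simp
  qed
  then show "square_integrable_rv M (I t)" using t .
  have conv: "(\<lambda>k. \<integral>\<omega>. (I t \<omega> - S k t \<omega>) \<bullet> (I t \<omega> - S k t \<omega>) \<partial>M) \<longlonglongrightarrow> 0" if t: "t \<in> {0..T}" for t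
  proof -
    have "(\<integral>\<^sup>+\<omega>. ennreal ((norm (I t \<omega> - S k t \<omega>))\<^sup>2) \<partial>M)
        = ennreal (\<integral>\<omega>. (I t \<omega> - S k t \<omega>) \<bullet> (I t \<omega> - S k t \<omega>) \<partial>M)" for k
      unfolding power2_norm_eq_inner
      by (rule nn_integral_eq_integral[OF sqi_inner_integrable[OF sqi_diff[OF I_sqi[OF t] S[OF t]]
            sqi_diff[OF I_sqi[OF t] S[OF t]]]]) simp
    then have "(\<lambda>k. ennreal (\<integral>\<omega>. (I t \<omega> - S k t \<omega>) \<bullet> (I t \<omega> - S k t \<omega>) \<partial>M)) \<longlonglongrightarrow> ennreal 0"
      using lim[OF t] unfolding S_def by simp
    then show ?thesis by (rule tendsto_ennrealD) auto
  qed
  assume \<xi>: "\<xi> \<in> borel_measurable (\<G>\<^sub>1 t)" "square_integrable_rv M \<xi>"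
  have lim_t: "(\<lambda>k. \<integral>\<omega>. \<xi> \<omega> \<bullet> (I t \<omega> - S k t \<omega>) \<partial>M) \<longlonglongrightarrow> 0" if t: "t \<in> {0..T}" for t
  proof -
    have le: "(\<integral>\<omega>. \<xi> \<omega> \<bullet> (I t \<omega> - S k t \<omega>) \<partial>M)\<^sup>2
        \<le> (\<integral>\<omega>. \<xi> \<omega> \<bullet> \<xi> \<omega> \<partial>M) * (\<integral>\<omega>. (I t \<omega> - S k t \<omega>) \<bullet> (I t \<omega> - S k t \<omega>) \<partial>M)" for k
      by (rule sqi_Cauchy_Schwarz[OF \<xi>(2) sqi_diff[OF I_sqi[OF t] S[OF t]]])
    have "(\<lambda>k. (\<integral>\<omega>. \<xi> \<omega> \<bullet> (I t \<omega> - S k t \<omega>) \<partial>M)\<^sup>2) \<longlonglongrightarrow> 0"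
      by (rule tendsto_sandwich[OF _ _ tendsto_const tendsto_mult_right_zero[OF conv[OF t], of "\<integral>\<omega>. \<xi> \<omega> \<bullet> \<xi> \<omega> \<partial>M"]])
         (use le in auto)
    then show ?thesis by simp
  qed
  have TT: "T \<in> {0..T}" using T_pos by simp
  have "(\<integral>\<omega>. \<xi> \<omega> \<bullet> (I T \<omega> - I t \<omega>) \<partial>M)
      = (\<integral>\<omega>. \<xi> \<omega> \<bullet> (I T \<omega> - S k T \<omega>) \<partial>M) - (\<integral>\<omega>. \<xi> \<omega> \<bullet> (I t \<omega> - S k t \<omega>) \<partial>M)" for k
  proof -
    note ii = sqi_inner_integrable[OF \<xi>(2)]
    have "(\<integral>\<omega>. \<xi> \<omega> \<bullet> (I T \<omega> - I t \<omega>) \<partial>M) = (\<integral>\<omega>. \<xi> \<omega> \<bullet> (I T \<omega> - S k T \<omega>) - \<xi> \<omega> \<bullet> (I t \<omega> - S k t \<omega>)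
        + \<xi> \<omega> \<bullet> (S k T \<omega> - S k t \<omega>) \<partial>M)"
      by (simp add: inner_diff_right)
    also have "\<dots> = (\<integral>\<omega>. \<xi> \<omega> \<bullet> (I T \<omega> - S k T \<omega>) \<partial>M) - (\<integral>\<omega>. \<xi> \<omega> \<bullet> (I t \<omega> - S k t \<omega>) \<partial>M)
        + (\<integral>\<omega>. \<xi> \<omega> \<bullet> (S k T \<omega> - S k t \<omega>) \<partial>M)"
      using ii[OF sqi_diff[OF I_sqi[OF TT] S[OF TT]]] ii[OF sqi_diff[OF I_sqi[OF t] S[OF t]]]
        ii[OF sqi_diff[OF S[OF TT] S[OF t]]] by simp
    also have "(\<integral>\<omega>. \<xi> \<omega> \<bullet> (S k T \<omega> - S k t \<omega>) \<partial>M) = 0"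
      unfolding S_def by (rule simple_ito_orthogonal(2)[OF s t \<xi>])
    finally show ?thesis by simp
  qed
  then have "(\<lambda>k. \<integral>\<omega>. \<xi> \<omega> \<bullet> (I T \<omega> - I t \<omega>) \<partial>M) \<longlonglongrightarrow> 0 - 0"
    using tendsto_diff[OF lim_t[OF TT] lim_t[OF t]] by simp
  then show "(\<integral>\<omega>. \<xi> \<omega> \<bullet> (I T \<omega> - I t \<omega>) \<partial>M) = 0" using LIMSEQ_const_iff by force
qed

text \<open>Against variables known to the leaders, the follower's own noise acts through its mean
  alone. This puts the expectation of the initial value into the mean field equation and removes the
  diffusion term from it.\<close>

lemma leader_mean:
  fixes V Y :: "'w \<Rightarrow> real ^ 'n"
  assumes V: "V \<in> borel_measurable (\<F> t)" "square_integrable_rv M V"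
    and Y: "square_integrable_rv M Y" "\<And>S i. S \<in> sets borel \<Longrightarrow> (\<lambda>\<omega>. Y \<omega> $ i) -` S \<inter> space M \<in> noise_join {2, 5}"
  shows "(\<integral>\<omega>. V \<omega> \<bullet> Y \<omega> \<partial>M) = (\<integral>\<omega>. V \<omega> \<bullet> (\<chi> i. \<integral>\<omega>. Y \<omega> $ i \<partial>M) \<partial>M)"
proof -
  have iV: "integrable M (\<lambda>\<omega>. V \<omega> $ i)" and iY: "integrable M (\<lambda>\<omega>. Y \<omega> $ i)" for i
    using sqi_integrable[OF finite_measure_axioms sqi_nth[OF V(2)]]
      sqi_integrable[OF finite_measure_axioms sqi_nth[OF Y(1)]] by auto
  note l = leader_indep_integral[OF iV borel_measurable_vec_nth[OF V(1)] iY Y(2)]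
  show ?thesis unfolding inner_vec_def using l iV by simp
qed

lemma eta1_mean:
  assumes V: "V \<in> borel_measurable (\<F> t)" "square_integrable_rv M V"
  shows "(\<integral>\<omega>. V \<omega> \<bullet> \<eta>\<^sub>1 \<N> \<omega> \<partial>M) = (\<integral>\<omega>. V \<omega> \<bullet> integral\<^sup>L M (\<eta>\<^sub>1 \<N>) \<partial>M)"
proof -
  have i: "integrable M (\<eta>\<^sub>1 \<N>)" by (rule sqi_integrable[OF finite_measure_axioms initial_sqi(3)])
  have "(\<lambda>\<omega>. \<eta>\<^sub>1 \<N> \<omega> $ i) -` S \<inter> space M \<in> noise_join {2, 5}" if S: "S \<in> sets borel" for S i
  proof -
    have "(\<lambda>v :: real ^ 'n1. v $ i) -` S \<in> sets borel"
      using measurable_sets[OF borel_measurable_vec_nth[OF measurable_ident] S, of i, unfolded id_def] by simp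
    then have "\<eta>\<^sub>1 \<N> -` ((\<lambda>v. v $ i) -` S) \<inter> space M \<in> noise_sigma 5"
      unfolding noise_sigma_simps sigma_of_rv_def by (intro sigma_sets.Basic) auto
    moreover have "\<eta>\<^sub>1 \<N> -` ((\<lambda>v. v $ i) -` S) = (\<lambda>\<omega>. \<eta>\<^sub>1 \<N> \<omega> $ i) -` S" by auto
    ultimately show ?thesis using noise_sigma_subset_join[of 5 "{2, 5}"] by auto
  qed
  from leader_mean[OF V initial_sqi(3) this]
  have "(\<integral>\<omega>. V \<omega> \<bullet> \<eta>\<^sub>1 \<N> \<omega> \<partial>M) = (\<integral>\<omega>. V \<omega> \<bullet> (\<chi> i. \<integral>\<omega>. \<eta>\<^sub>1 \<N> \<omega> $ i \<partial>M) \<partial>M)" .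
  moreover have "(\<chi> i. \<integral>\<omega>. \<eta>\<^sub>1 \<N> \<omega> $ i \<partial>M) = integral\<^sup>L M (\<eta>\<^sub>1 \<N>)"
    using integral_bounded_linear[OF bounded_linear_vec_nth i] by (simp add: vec_eq_iff)
  ultimately show ?thesis by simp
qed

lemma W1_mean:
  fixes S :: "real ^ 'd1 ^ 'n"
  assumes V: "V \<in> borel_measurable (\<F> t)" "square_integrable_rv M V" and r: "0 \<le> r"
  shows "(\<integral>\<omega>. V \<omega> \<bullet> (S *v W\<^sub>1 \<N> r \<omega>) \<partial>M) = 0"
proof -
  let ?V = "\<lambda>\<omega>. transpose S *v V \<omega>"
  have V': "?V \<in> borel_measurable (\<F> t)" "square_integrable_rv M ?V"
    by (rule measurable_compose[OF V(1) borel_measurable_continuous_onI[OF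
          linear_continuous_on[OF matrix_vector_mul_bounded_linear]]], rule sqi_mult_vec[OF V(2)])
  have "(\<lambda>\<omega>. W\<^sub>1 \<N> r \<omega> $ i) -` B \<inter> space M \<in> noise_join {2, 5}" if B: "B \<in> sets borel" for B i
  proof -
    have "(\<lambda>v :: real ^ 'd1. v $ i) -` B \<in> sets borel"
      using measurable_sets[OF borel_measurable_vec_nth[OF measurable_ident] B, of i, unfolded id_def] by simp
    then have "W\<^sub>1 \<N> r -` ((\<lambda>v. v $ i) -` B) \<inter> space M \<in> noise_sigma 2"
      unfolding noise_sigma_simps sigma_of_process_def using r by (intro sigma_sets.Basic) auto
    moreover have "W\<^sub>1 \<N> r -` ((\<lambda>v. v $ i) -` B) = (\<lambda>\<omega>. W\<^sub>1 \<N> r \<omega> $ i) -` B" by auto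
    ultimately show ?thesis using noise_sigma_subset_join[of 2 "{2, 5}"] by auto
  qed
  from leader_mean[OF V' wiener_sqi[OF wiener(3) r] this]
  have "(\<integral>\<omega>. ?V \<omega> \<bullet> W\<^sub>1 \<N> r \<omega> \<partial>M) = (\<integral>\<omega>. ?V \<omega> \<bullet> 0 \<partial>M)"
    using wiener_mean[OF wiener(3) r] by (simp add: zero_vec_def)
  then show ?thesis by (simp add: dot_lmul_matrix vector_transpose_matrix transpose_matrix_vector)
qed

end

section \<open>Block vectors and matrices\<close>

lemma vstack_nth [simp]: "(u \<sslash> v) $ Inl i = u $ i" "(u \<sslash> v) $ Inr j = v $ j"
  by (simp_all add: vstack_def)

lemma head_block_vstack [simp]: "head_block (u \<sslash> v) = u"
  by (simp add: head_block_def vec_eq_iff)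

lemma tail_block_vstack [simp]: "tail_block (u \<sslash> v) = v"
  by (simp add: tail_block_def vec_eq_iff)

lemma bounded_linear_head_block:
  "bounded_linear (head_block :: real ^ ('p::finite + 'q::finite) \<Rightarrow> real ^ 'p)"
  unfolding linear_conv_bounded_linear[symmetric]
  by (rule linearI) (simp_all add: head_block_def vec_eq_iff)

lemma bounded_linear_tail_block:
  "bounded_linear (tail_block :: real ^ ('p::finite + 'q::finite) \<Rightarrow> real ^ 'q)"
  unfolding linear_conv_bounded_linear[symmetric]
  by (rule linearI) (simp_all add: tail_block_def vec_eq_iff)

lemma head_block_simps [simp]:
  fixes u v :: "real ^ ('p::finite + 'q::finite)"
  shows "head_block (u + v) = head_block u + head_block v" "head_block (u - v) = head_block u - head_block v"
  by (simp_all add: head_block_def vec_eq_iff)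

lemma tail_block_simps [simp]:
  fixes u v :: "real ^ ('p::finite + 'q::finite)"
  shows "tail_block (u + v) = tail_block u + tail_block v" "tail_block (u - v) = tail_block u - tail_block v"
  by (simp_all add: tail_block_def vec_eq_iff)

lemma sum_UNIV_Plus:
  "(\<Sum>i\<in>(UNIV :: ('p::finite + 'q::finite) set). f i) = (\<Sum>i\<in>UNIV. f (Inl i)) + (\<Sum>j\<in>UNIV. f (Inr j))"
  unfolding UNIV_Plus_UNIV[symmetric] by (subst sum.Plus) (auto simp: comp_def)

lemma inner_vstack [simp]:
  fixes u :: "real ^ 'p::finite" and v :: "real ^ 'q::finite"
  shows "(u \<sslash> v) \<bullet> w = u \<bullet> head_block w + v \<bullet> tail_block w"
  by (simp add: inner_vec_def sum_UNIV_Plus head_block_def tail_block_def)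

lemma vstack_mult_vec [simp]:
  fixes A :: "real ^ 'n::finite ^ 'p::finite" and B :: "real ^ 'n ^ 'q::finite"
  shows "(A \<sslash> B) *v x = (A *v x) \<sslash> (B *v x)"
  unfolding vec_eq_iff
proof
  fix i show "((A \<sslash> B) *v x) $ i = ((A *v x) \<sslash> (B *v x)) $ i"
    by (cases i) (simp_all add: matrix_vector_mult_def)
qed

lemma hstack_mult_vec [simp]:
  fixes A :: "real ^ 'p::finite ^ 'm::finite" and B :: "real ^ 'q::finite ^ 'm"
  shows "(A \<brokenbar> B) *v x = A *v head_block x + B *v tail_block x"
  by (simp add: hstack_def matrix_vector_mult_def vec_eq_iff sum_UNIV_Plus head_block_def tail_block_def)

lemma bounded_linear_vstack:
  assumes "bounded_linear f" "bounded_linear g"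
  shows "bounded_linear (\<lambda>x. (f x :: real ^ 'p::finite) \<sslash> (g x :: real ^ 'q::finite))"
proof -
  interpret f: bounded_linear f by fact
  interpret g: bounded_linear g by fact
  obtain K L where K: "\<And>x. norm (f x) \<le> norm x * K" and L: "\<And>x. norm (g x) \<le> norm x * L"
    using f.bounded g.bounded by blast
  show ?thesis
  proof (rule bounded_linear_intro[where K = "K + L"])
    show "f (x + y) \<sslash> g (x + y) = (f x \<sslash> g x) + (f y \<sslash> g y)" for x y
      unfolding vec_eq_iff by (auto simp: vstack_def f.add g.add split: sum.split)
    show "f (r *\<^sub>R x) \<sslash> g (r *\<^sub>R x) = r *\<^sub>R (f x \<sslash> g x)" for r x
      unfolding vec_eq_iff by (auto simp: vstack_def f.scaleR g.scaleR split: sum.split)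
    fix x
    have "(norm (f x \<sslash> g x))\<^sup>2 = (norm (f x))\<^sup>2 + (norm (g x))\<^sup>2"
      by (simp add: power2_norm_eq_inner)
    also have "\<dots> \<le> (norm (f x) + norm (g x))\<^sup>2" by (simp add: power2_sum)
    finally have "norm (f x \<sslash> g x) \<le> norm (f x) + norm (g x)" by (rule power2_le_imp_le) simp
    then show "norm (f x \<sslash> g x) \<le> norm x * (K + L)" using K[of x] L[of x] by (simp add: algebra_simps)
  qed
qed

lemma bounded_linear_vstack_left: "bounded_linear (\<lambda>x :: real ^ 'p::finite. x \<sslash> (0 :: real ^ 'q::finite))"
  by (rule bounded_linear_vstack) simp_all

lemma bounded_linear_vstack_right: "bounded_linear (\<lambda>x :: real ^ 'q::finite. (0 :: real ^ 'p::finite) \<sslash> x)"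
  by (rule bounded_linear_vstack) simp_all

lemma inner_transpose_mult:
  fixes A :: "real ^ 'n ^ 'm"
  shows "x \<bullet> (transpose A *v y) = (A *v x) \<bullet> y"
  by (metis dot_lmul_matrix inner_commute transpose_matrix_vector vector_transpose_matrix transpose_transpose)

lemma inner_symmetric_mult:
  fixes Q :: "real ^ 'n ^ 'n"
  shows "transpose Q = Q \<Longrightarrow> (Q *v x) \<bullet> y = x \<bullet> (Q *v y)"
  using inner_transpose_mult[of x Q y] by simp

lemma neg_matrix_mult_vec: "(- A) *v x = - (A *v (x :: real ^ 'n))"
  using matrix_vector_mult_diff_rdistrib[of 0 A x] by simp

lemma mult_vec_neg: "A *v (- x) = - (A *v (x :: real ^ 'n))"
  using matrix_vector_mult_diff_distrib[of A 0 x] by simp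

abbreviation "blk1 x \<equiv> head_block x"
abbreviation "blk2 x \<equiv> head_block (tail_block x)"
abbreviation "blk3 x \<equiv> head_block (tail_block (tail_block x))"
abbreviation "blk4 x \<equiv> head_block (tail_block (tail_block (tail_block x)))"
abbreviation "blk5 x \<equiv> tail_block (tail_block (tail_block (tail_block x)))"

text \<open>Blocks six and seven carry the sensitivity of each leader's cost to the other leader's
  state, in the order \<open>\<beta>\<close>, \<open>\<alpha>\<close>. When the two costs are added,
  each joins the row of the state with respect to which it differentiates, hence the crossed
  addition.\<close>

lemma I1_mat_mult:
  fixes w :: "real ^ ('na::finite, 'nb::finite, 'n1::finite) idx7"
  shows "I1_mat *v w = (blk1 w + tail_block (tail_block (blk5 w))) \<sslash> (blk2 w + head_block (tail_block (blk5 w)))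
    \<sslash> blk3 w \<sslash> blk4 w \<sslash> head_block (blk5 w)"
  by (simp add: I1_mat_def)

lemma I2_mat_mult:
  fixes x :: "real ^ ('na::finite, 'nb::finite, 'n1::finite) idx5"
  shows "I2_mat *v x = blk1 x \<sslash> blk2 x \<sslash> blk3 x \<sslash> blk4 x \<sslash> blk5 x \<sslash> 0 \<sslash> 0"
  by (simp add: I2_mat_def)

lemmas mult_vec_simps =
  matrix_vector_mult_diff_distrib matrix_vector_right_distrib neg_matrix_mult_vec
  matrix_vector_mult_diff_rdistrib matrix_vector_mult_add_rdistrib
  matrix_vector_mul_assoc[symmetric] matrix_transpose_mul

lemma transpose_diff: "transpose (A - B) = transpose A - transpose (B :: real ^ 'n ^ 'm)"
  by (simp add: transpose_def vec_eq_iff)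

context
  fixes Qa :: "real ^ 'na::finite ^ 'na" and Fa :: "real ^ 'n1::finite ^ 'na" and Ga :: "real ^ 'nb::finite ^ 'na"
    and Ma :: "real ^ 'na"
    and Qb :: "real ^ 'nb ^ 'nb" and Fb :: "real ^ 'n1 ^ 'nb" and Gb :: "real ^ 'na ^ 'nb" and Mb :: "real ^ 'nb"
    and Q1 :: "real ^ 'n1 ^ 'n1" and F1 :: "real ^ 'n1 ^ 'n1" and G1 :: "real ^ 'na ^ 'n1" and H1 :: "real ^ 'nb ^ 'n1"
    and M1 :: "real ^ 'n1"
  assumes sym: "transpose Qa = Qa" "transpose Qb = Qb" "transpose Q1 = Q1"
begin

private abbreviation "W \<equiv> weight_mat Qa Fa Ga Qb Fb Gb Q1 F1 G1 H1"
private abbreviation "w \<equiv> weight_vec Qa Fa Ga Ma Qb Fb Gb Mb Q1 M1"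

text \<open>Multiplied out, the rows are gradients up to a factor: the first two of the joint
  leaders' cost in their states, with the sum of blocks four and five as multiplier of the
  follower's error; the third of the follower's cost with the mean field in place of his state. The
  last two split between the leaders the gradient in the mean field.\<close>

lemma weight_blocks:
  fixes x :: "real ^ ('na, 'nb, 'n1) idx5"
  defines "ea \<equiv> blk1 x - Fa *v blk3 x - Ga *v blk2 x - Ma"
    and "eb \<equiv> blk2 x - Fb *v blk3 x - Gb *v blk1 x - Mb"
    and "e1 \<equiv> blk3 x - F1 *v blk3 x - G1 *v blk1 x - H1 *v blk2 x - M1"
  shows "(I1_mat ** W) *v x + I1_mat *v w =
    (Qa *v ea - transpose Gb *v (Qb *v eb) - transpose G1 *v (Q1 *v (blk4 x + blk5 x))) \<sslash>
    (Qb *v eb - transpose Ga *v (Qa *v ea) - transpose H1 *v (Q1 *v (blk4 x + blk5 x))) \<sslash>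
    Q1 *v e1 \<sslash>
    (Q1 *v blk4 x - transpose F1 *v (Q1 *v blk4 x) - transpose Fa *v (Qa *v ea)) \<sslash>
    (Q1 *v blk5 x - transpose F1 *v (Q1 *v blk5 x) - transpose Fb *v (Qb *v eb))"
  unfolding matrix_vector_mul_assoc[symmetric] matrix_vector_right_distrib[symmetric]
  unfolding I1_mat_mult weight_mat_def weight_vec_def ea_def eb_def e1_def
  by (simp add: mult_vec_simps transpose_diff sym transpose_mat del: transpose_matrix_vector)
     (simp add: algebra_simps del: transpose_matrix_vector)

end

lemma A_mat_mult:
  "A_mat \<G> *v x =
    (A\<^sub>\<alpha> \<G> *v blk1 x + B\<^sub>\<alpha> \<G> *v blk2 x + C\<^sub>\<alpha> \<G> *v blk3 x) \<sslash>
    (A\<^sub>\<beta> \<G> *v blk1 x + B\<^sub>\<beta> \<G> *v blk2 x + C\<^sub>\<beta> \<G> *v blk3 x) \<sslash>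
    (C\<^sub>1 \<G> *v blk1 x + D\<^sub>1 \<G> *v blk2 x + (A\<^sub>1 \<G> + B\<^sub>1 \<G>) *v blk3 x) \<sslash>
    A\<^sub>1 \<G> *v blk4 x \<sslash> A\<^sub>1 \<G> *v blk5 x"
  by (simp add: A_mat_def algebra_simps)

abbreviation control_weight :: "real ^ 'm ^ 'n \<Rightarrow> real ^ 'm ^ 'm \<Rightarrow> real ^ 'n ^ 'n" where
  "control_weight D R \<equiv> D ** matrix_inv R ** transpose D"

lemma BP_mat_mult:
  "BP_mat \<G> *v p =
    control_weight (D\<^sub>\<alpha> \<G>) (R\<^sub>\<alpha> \<G>) *v blk1 p \<sslash>
    control_weight (D\<^sub>\<beta> \<G>) (R\<^sub>\<beta> \<G>) *v blk2 p \<sslash>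
    control_weight (E\<^sub>1 \<G>) (R\<^sub>1 \<G>) *v blk3 p \<sslash>
    control_weight (E\<^sub>1 \<G>) (R\<^sub>1 \<G>) *v blk4 p \<sslash>
    control_weight (E\<^sub>1 \<G>) (R\<^sub>1 \<G>) *v blk5 p"
  unfolding BP_mat_def matrix_vector_mul_assoc[symmetric, of _ I2_mat] I2_mat_mult BN_mat_def Let_def
  by simp

text \<open>After folding, the rows are transposes of the coupled drift. The first two rows see the
  last two adjoint blocks only through their sum.\<close>

lemma CP_mat_mult:
  "CP_mat \<G> *v p =
    (transpose (A\<^sub>\<alpha> \<G>) *v blk1 p + transpose (A\<^sub>\<beta> \<G>) *v blk2 p + transpose (C\<^sub>1 \<G>) *v (blk4 p + blk5 p)) \<sslash>
    (transpose (B\<^sub>\<alpha> \<G>) *v blk1 p + transpose (B\<^sub>\<beta> \<G>) *v blk2 p + transpose (D\<^sub>1 \<G>) *v (blk4 p + blk5 p)) \<sslash>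
    transpose (A\<^sub>1 \<G>) *v blk3 p \<sslash>
    (transpose (C\<^sub>\<alpha> \<G>) *v blk1 p + transpose (A\<^sub>1 \<G> + B\<^sub>1 \<G>) *v blk4 p) \<sslash>
    (transpose (C\<^sub>\<beta> \<G>) *v blk2 p + transpose (A\<^sub>1 \<G> + B\<^sub>1 \<G>) *v blk5 p)"
  unfolding CP_mat_def matrix_vector_mul_assoc[symmetric] I1_mat_mult I2_mat_mult CN_mat_def
  by (simp add: matrix_vector_right_distrib algebra_simps del: transpose_matrix_vector)

lemma Sigma_mat_mult:
  "Sigma_mat \<G> *v W_vec \<N> t \<omega> = \<sigma>\<^sub>\<alpha> \<G> *v W\<^sub>\<alpha> \<N> t \<omega> \<sslash> \<sigma>\<^sub>\<beta> \<G> *v W\<^sub>\<beta> \<N> t \<omega> \<sslash> 0 \<sslash> 0 \<sslash> 0"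
  by (simp add: Sigma_mat_def W_vec_def)

context
  fixes \<G> :: "('na::finite, 'nb::finite, 'n1::finite, 'ma::finite, 'mb::finite, 'm1::finite,
                'da::finite, 'db::finite, 'd1::finite) game"
  assumes coefficients: "game_coefficients \<G>"
begin

lemma weights_symmetric:
  "transpose (Q\<^sub>\<alpha> \<G>) = Q\<^sub>\<alpha> \<G>" "transpose (Q\<^sub>\<beta> \<G>) = Q\<^sub>\<beta> \<G>" "transpose (Q\<^sub>1 \<G>) = Q\<^sub>1 \<G>"
  "transpose (Qb\<^sub>\<alpha> \<G>) = Qb\<^sub>\<alpha> \<G>" "transpose (Qb\<^sub>\<beta> \<G>) = Qb\<^sub>\<beta> \<G>" "transpose (Qb\<^sub>1 \<G>) = Qb\<^sub>1 \<G>"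
  "transpose (R\<^sub>\<alpha> \<G>) = R\<^sub>\<alpha> \<G>" "transpose (R\<^sub>\<beta> \<G>) = R\<^sub>\<beta> \<G>" "transpose (R\<^sub>1 \<G>) = R\<^sub>1 \<G>"
  using coefficients unfolding game_coefficients_def pos_definite_def pos_semidefinite_def by auto

end

text \<open>The vector \<open>z'\<close> is free: the last summand vanishes in expectation when \<open>c\<close> projects onto \<open>z'\<close>.\<close>

lemma weight_duality:
  fixes x :: "real ^ ('na::finite, 'nb::finite, 'n1::finite) idx5"
    and Fa :: "real ^ 'n1 ^ 'na" and Ga :: "real ^ 'nb ^ 'na" and Ma :: "real ^ 'na"
    and Fb :: "real ^ 'n1 ^ 'nb" and Gb :: "real ^ 'na ^ 'nb" and Mb :: "real ^ 'nb"
  assumes sym: "transpose Qa = Qa" "transpose Qb = Qb" "transpose Q1 = Q1"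
  defines "ea \<equiv> blk1 x - Fa *v blk3 x - Ga *v blk2 x - Ma"
    and "eb \<equiv> blk2 x - Fb *v blk3 x - Gb *v blk1 x - Mb"
    and "s \<equiv> blk4 x + blk5 x"
  shows "(a \<sslash> b \<sslash> 0 \<sslash> c \<sslash> c) \<bullet> ((I1_mat ** weight_mat Qa Fa Ga Qb Fb Gb Q1 F1 G1 H1) *v x
      + I1_mat *v weight_vec Qa Fa Ga Ma Qb Fb Gb Mb Q1 M1)
    = (a - Fa *v z' - Ga *v b) \<bullet> (Qa *v ea) + (b - Fb *v z' - Gb *v a) \<bullet> (Qb *v eb)
      + s \<bullet> (Q1 *v (c - F1 *v z' - G1 *v a - H1 *v b))
      + (z' - c) \<bullet> (transpose Fa *v (Qa *v ea) + transpose Fb *v (Qb *v eb) + transpose F1 *v (Q1 *v s))"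
proof -
  have "s \<bullet> (Q1 *v (c - F1 *v z' - G1 *v a - H1 *v b)) = (c - F1 *v z' - G1 *v a - H1 *v b) \<bullet> (Q1 *v s)"
    using inner_symmetric_mult[OF sym(3), of "c - F1 *v z' - G1 *v a - H1 *v b" s] by (simp add: inner_commute)
  then show ?thesis
    unfolding weight_blocks[OF sym] ea_def[symmetric] eb_def[symmetric] s_def[symmetric]
    by (simp add: inner_add_right inner_diff_right inner_add_left inner_diff_left inner_transpose_mult
        del: transpose_matrix_vector)
       (simp add: s_def matrix_vector_right_distrib inner_add_right algebra_simps)
qed

text \<open>A test vector supported in the third block isolates the gradient of the follower's cost,
  taken at the mean field instead of his own state.\<close>

lemma weight_duality_follower:
  fixes x :: "real ^ ('na::finite, 'nb::finite, 'n1::finite) idx5"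
  assumes sym: "transpose Qa = Qa" "transpose Qb = Qb" "transpose Q1 = Q1"
  shows "(0 \<sslash> 0 \<sslash> y \<sslash> 0 \<sslash> 0) \<bullet> ((I1_mat ** weight_mat Qa Fa Ga Qb Fb Gb Q1 F1 G1 H1) *v x
      + I1_mat *v weight_vec Qa Fa Ga Ma Qb Fb Gb Mb Q1 M1)
    = y \<bullet> (Q1 *v (blk3 x - F1 *v blk3 x - G1 *v blk1 x - H1 *v blk2 x - M1))"
  unfolding weight_blocks[OF sym] by simp

text \<open>Transposition cancels the state terms and leaves the control terms. Putting
  \<open>c\<close> where the mean field \<open>z'\<close> belongs costs the last summand, which
  later disappears because \<open>z' - c\<close> is orthogonal to the leaders' information.\<close>

lemma drift_duality:
  "(A\<^sub>\<alpha> \<G> *v a + B\<^sub>\<alpha> \<G> *v b + C\<^sub>\<alpha> \<G> *v z' + D\<^sub>\<alpha> \<G> *v va \<sslash>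
    A\<^sub>\<beta> \<G> *v a + B\<^sub>\<beta> \<G> *v b + C\<^sub>\<beta> \<G> *v z' + D\<^sub>\<beta> \<G> *v vb \<sslash> 0 \<sslash> f \<sslash> f) \<bullet> p
   - (a \<sslash> b \<sslash> 0 \<sslash> c \<sslash> c) \<bullet> (CP_mat \<G> *v p)
   = (D\<^sub>\<alpha> \<G> *v va) \<bullet> blk1 p + (D\<^sub>\<beta> \<G> *v vb) \<bullet> blk2 p + (E\<^sub>1 \<G> *v v1) \<bullet> (blk4 p + blk5 p)
     + (z' - c) \<bullet> (transpose (C\<^sub>\<alpha> \<G>) *v blk1 p + transpose (C\<^sub>\<beta> \<G>) *v blk2 p + transpose (B\<^sub>1 \<G>) *v (blk4 p + blk5 p))"
  if "f = A\<^sub>1 \<G> *v c + B\<^sub>1 \<G> *v z' + C\<^sub>1 \<G> *v a + D\<^sub>1 \<G> *v b + E\<^sub>1 \<G> *v v1"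
  unfolding that CP_mat_mult
  by (simp add: inner_add_right inner_diff_right inner_add_left inner_diff_left inner_transpose_mult
      matrix_vector_mult_add_rdistrib matrix_vector_mult_diff_distrib del: transpose_matrix_vector)

lemma drift_duality_follower:
  "(0 \<sslash> 0 \<sslash> A\<^sub>1 \<G> *v y + E\<^sub>1 \<G> *v w \<sslash> 0 \<sslash> 0) \<bullet> p - (0 \<sslash> 0 \<sslash> y \<sslash> 0 \<sslash> 0) \<bullet> (CP_mat \<G> *v p)
    = (E\<^sub>1 \<G> *v w) \<bullet> blk3 p"
  unfolding CP_mat_mult by (simp add: inner_add_left inner_transpose_mult del: transpose_matrix_vector)

text \<open>\<open>matrix_inv\<close> is a choice operator, so its characteristic equation requires
  invertibility, obtained here from the trivial kernel.\<close>

lemma pos_definite_inverse: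
  fixes R :: "real ^ 'n ^ 'n"
  assumes "pos_definite R"
  shows "R ** matrix_inv R = mat 1"
proof -
  have "\<forall>x. R *v x = 0 \<longrightarrow> x = 0"
  proof (intro allI impI)
    fix x assume "R *v x = 0"
    then have "qform R x = 0" unfolding qform_def by simp
    then show "x = 0" using assms unfolding pos_definite_def by fastforce
  qed
  then obtain B where "B ** R = mat 1" using matrix_left_invertible_ker[of R] by blast
  then have "invertible R" using invertible_left_inverse by blast
  then obtain B where "R ** B = mat 1 \<and> B ** R = mat 1" unfolding invertible_def by blast
  then show ?thesis unfolding matrix_inv_def by (rule someI2) simp
qed

lemma pos_definite_D:
  assumes "pos_definite R"
  shows "transpose R = R" "0 \<le> x \<bullet> (R *v x)" "x \<bullet> (R *v x) = 0 \<Longrightarrow> x = 0"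
proof -
  have p: "x \<noteq> 0 \<Longrightarrow> 0 < x \<bullet> (R *v x)" using assms unfolding pos_definite_def qform_def by blast
  show "0 \<le> x \<bullet> (R *v x)" using p by (cases "x = 0") auto
  show "x \<bullet> (R *v x) = 0 \<Longrightarrow> x = 0" using p by force
  show "transpose R = R" using assms unfolding pos_definite_def by simp
qed

text \<open>For the control u with \<open>R\<close> u equal to minus
  \<open>transpose D *v p\<close>, this is stationarity of the Hamiltonian in the control
  variable.\<close>

lemma control_weight_mult:
  assumes "pos_definite R"
  shows "R *v ((matrix_inv R ** transpose D) *v p) = transpose D *v p"
  unfolding matrix_vector_mul_assoc matrix_mul_assoc pos_definite_inverse[OF assms] by simp

lemma mult_vec_scaleR: "A *v (c *\<^sub>R x) = c *\<^sub>R (A *v (x :: real ^ 'n))" for A :: "real ^ 'n ^ 'm"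
  by (rule linear_cmul[OF matrix_vector_mul_linear])

lemma inner_symmetric_commute:
  fixes Q :: "real ^ 'n ^ 'n"
  shows "transpose Q = Q \<Longrightarrow> x \<bullet> (Q *v y) = y \<bullet> (Q *v x)"
  by (metis inner_symmetric_mult inner_commute)

context time_prob_space
begin

section \<open>Linearity of running integrals\<close>

lemma running_integral_add:
  fixes f g :: "real \<Rightarrow> 'w \<Rightarrow> 'e::euclidean_space"
  assumes f: "square_integrable_process T M f" and g: "square_integrable_process T M g"
  shows "AE \<omega> in M. \<forall>t\<in>{0..T}. running_integral (\<lambda>s \<omega>. f s \<omega> + g s \<omega>) t \<omega>
    = running_integral f t \<omega> + running_integral g t \<omega>"
  using set_integrable_path[OF f] set_integrable_path[OF g]
  by eventually_elim (auto simp: running_integral_def)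

lemma running_integral_diff:
  fixes f g :: "real \<Rightarrow> 'w \<Rightarrow> 'e::euclidean_space"
  assumes f: "square_integrable_process T M f" and g: "square_integrable_process T M g"
  shows "AE \<omega> in M. \<forall>t\<in>{0..T}. running_integral (\<lambda>s \<omega>. f s \<omega> - g s \<omega>) t \<omega>
    = running_integral f t \<omega> - running_integral g t \<omega>"
  using set_integrable_path[OF f] set_integrable_path[OF g]
  by eventually_elim (auto simp: running_integral_def)

lemma running_integral_bounded_linear:
  fixes f :: "real \<Rightarrow> 'w \<Rightarrow> 'e::euclidean_space" and h :: "'e \<Rightarrow> 'f::euclidean_space"
  assumes h: "bounded_linear h" and f: "square_integrable_process T M f"
  shows "AE \<omega> in M. \<forall>t\<in>{0..T}. running_integral (\<lambda>s \<omega>. h (f s \<omega>)) t \<omega> = h (running_integral f t \<omega>)"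
  using set_integrable_path[OF f]
proof eventually_elim
  case (elim \<omega>)
  show ?case
  proof
    fix t assume "t \<in> {0..T}"
    then have "integrable lborel (\<lambda>s. indicator {0..t} s *\<^sub>R f s \<omega>)" using elim unfolding set_integrable_def by blast
    from integral_bounded_linear[OF h this]
    show "running_integral (\<lambda>s \<omega>. h (f s \<omega>)) t \<omega> = h (running_integral f t \<omega>)"
      unfolding running_integral_def set_lebesgue_integral_def
      by (simp add: linear_simps(5)[OF h])
  qed
qed

text \<open>The mean-square bound for the integral of the difference is uniform in t, so one null
  set of \<omega> serves all times.\<close>

lemma running_integral_cong_AE:
  fixes f g :: "real \<Rightarrow> 'w \<Rightarrow> 'e::euclidean_space"
  assumes f: "square_integrable_process T M f" and g: "square_integrable_process T M g"
    and eq: "AE z in N. f (fst z) (snd z) = g (fst z) (snd z)"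
  shows "AE \<omega> in M. \<forall>t\<in>{0..T}. running_integral f t \<omega> = running_integral g t \<omega>"
proof -
  let ?d = "\<lambda>s \<omega>. f s \<omega> - g s \<omega>"
  note d = sqi_diff[OF f g]
  have "(\<integral>\<omega>. (\<integral>s. (norm (?d s \<omega>))\<^sup>2 \<partial>TL) \<partial>M) = (\<integral>z. (norm (?d (fst z) (snd z)))\<^sup>2 \<partial>N)"
    by (rule integral_N_snd[OF sqi_D(2)[OF d], symmetric])
  also have "\<dots> = 0" by (rule integral_eq_zero_AE) (use eq in auto)
  finally have "AE \<omega> in M. (\<integral>s. (norm (?d s \<omega>))\<^sup>2 \<partial>TL) = 0"
    using integral_nonneg_eq_0_iff_AE[OF integrable_N_snd[OF sqi_D(2)[OF d]]] by simp
  with running_integral_bound[OF d] running_integral_diff[OF f g] show ?thesis by eventually_elim auto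
qed

section \<open>Quadratic functionals\<close>

text \<open>The polarisation of \<open>lq_cost\<close>: its diagonal is the cost, and with a
  direction in the first three function slots and a point in the last three it is half a directional
  derivative.\<close>

definition lq_form ::
    "real ^ 'n ^ 'n \<Rightarrow> real ^ 'm ^ 'm \<Rightarrow> real ^ 'n ^ 'n \<Rightarrow>
     (real \<Rightarrow> 'w \<Rightarrow> real ^ 'n) \<Rightarrow> (real \<Rightarrow> 'w \<Rightarrow> real ^ 'm) \<Rightarrow> ('w \<Rightarrow> real ^ 'n) \<Rightarrow>
     (real \<Rightarrow> 'w \<Rightarrow> real ^ 'n) \<Rightarrow> (real \<Rightarrow> 'w \<Rightarrow> real ^ 'm) \<Rightarrow> ('w \<Rightarrow> real ^ 'n) \<Rightarrow> real" where
  "lq_form Q R Q' e v eT e' v' eT' =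
    (\<integral>z. e (fst z) (snd z) \<bullet> (Q *v e' (fst z) (snd z)) \<partial>N) + (\<integral>z. v (fst z) (snd z) \<bullet> (R *v v' (fst z) (snd z)) \<partial>N)
      + (\<integral>\<omega>. eT \<omega> \<bullet> (Q' *v eT' \<omega>) \<partial>M)"

definition lq_space :: "(real \<Rightarrow> 'w \<Rightarrow> real ^ 'n) \<Rightarrow> (real \<Rightarrow> 'w \<Rightarrow> real ^ 'm) \<Rightarrow> ('w \<Rightarrow> real ^ 'n) \<Rightarrow> bool" where
  "lq_space e v eT \<longleftrightarrow> square_integrable_process T M e \<and> square_integrable_process T M v \<and> square_integrable_rv M eT"

lemma lq_form_add_right:
  assumes "lq_space e v eT" "lq_space e1 v1 eT1" "lq_space e2 v2 eT2"
  shows "lq_form Q R Q' e v eT (\<lambda>t \<omega>. e1 t \<omega> + e2 t \<omega>) (\<lambda>t \<omega>. v1 t \<omega> + v2 t \<omega>) (\<lambda>\<omega>. eT1 \<omega> + eT2 \<omega>)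
    = lq_form Q R Q' e v eT e1 v1 eT1 + lq_form Q R Q' e v eT e2 v2 eT2"
proof -
  have i: "integrable N (\<lambda>z. e (fst z) (snd z) \<bullet> (Q *v e1 (fst z) (snd z)))"
    "integrable N (\<lambda>z. e (fst z) (snd z) \<bullet> (Q *v e2 (fst z) (snd z)))"
    "integrable N (\<lambda>z. v (fst z) (snd z) \<bullet> (R *v v1 (fst z) (snd z)))"
    "integrable N (\<lambda>z. v (fst z) (snd z) \<bullet> (R *v v2 (fst z) (snd z)))"
    "integrable M (\<lambda>\<omega>. eT \<omega> \<bullet> (Q' *v eT1 \<omega>))" "integrable M (\<lambda>\<omega>. eT \<omega> \<bullet> (Q' *v eT2 \<omega>))"
    using assms unfolding lq_space_def by (auto intro!: sqi_inner_integrable sqi_mult_vec)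
  show ?thesis unfolding lq_form_def matrix_vector_right_distrib inner_add_right using i by simp
qed

lemma lq_form_add_left:
  assumes "lq_space e v eT" "lq_space e1 v1 eT1" "lq_space e2 v2 eT2"
  shows "lq_form Q R Q' (\<lambda>t \<omega>. e1 t \<omega> + e2 t \<omega>) (\<lambda>t \<omega>. v1 t \<omega> + v2 t \<omega>) (\<lambda>\<omega>. eT1 \<omega> + eT2 \<omega>) e v eT
    = lq_form Q R Q' e1 v1 eT1 e v eT + lq_form Q R Q' e2 v2 eT2 e v eT"
proof -
  have i: "integrable N (\<lambda>z. e1 (fst z) (snd z) \<bullet> (Q *v e (fst z) (snd z)))"
    "integrable N (\<lambda>z. e2 (fst z) (snd z) \<bullet> (Q *v e (fst z) (snd z)))"
    "integrable N (\<lambda>z. v1 (fst z) (snd z) \<bullet> (R *v v (fst z) (snd z)))"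
    "integrable N (\<lambda>z. v2 (fst z) (snd z) \<bullet> (R *v v (fst z) (snd z)))"
    "integrable M (\<lambda>\<omega>. eT1 \<omega> \<bullet> (Q' *v eT \<omega>))" "integrable M (\<lambda>\<omega>. eT2 \<omega> \<bullet> (Q' *v eT \<omega>))"
    using assms unfolding lq_space_def by (auto intro!: sqi_inner_integrable sqi_mult_vec)
  show ?thesis unfolding lq_form_def inner_add_left using i by simp
qed

lemma lq_form_scale:
  "lq_form Q R Q' (\<lambda>t \<omega>. c *\<^sub>R e t \<omega>) (\<lambda>t \<omega>. c *\<^sub>R v t \<omega>) (\<lambda>\<omega>. c *\<^sub>R eT \<omega>) e' v' eT' = c * lq_form Q R Q' e v eT e' v' eT'"
  "lq_form Q R Q' e v eT (\<lambda>t \<omega>. c *\<^sub>R e' t \<omega>) (\<lambda>t \<omega>. c *\<^sub>R v' t \<omega>) (\<lambda>\<omega>. c *\<^sub>R eT' \<omega>) = c * lq_form Q R Q' e v eT e' v' eT'"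
  unfolding lq_form_def mult_vec_scaleR by (simp_all add: algebra_simps)

lemma lq_form_commute:
  assumes "transpose Q = Q" "transpose R = R" "transpose Q' = Q'"
  shows "lq_form Q R Q' e v eT e' v' eT' = lq_form Q R Q' e' v' eT' e v eT"
  unfolding lq_form_def
  by (intro arg_cong2[where f = "(+)"] Bochner_Integration.integral_cong refl inner_symmetric_commute assms)

lemma lq_space_add:
  "lq_space e v eT \<Longrightarrow> lq_space e' v' eT' \<Longrightarrow>
    lq_space (\<lambda>t \<omega>. e t \<omega> + e' t \<omega>) (\<lambda>t \<omega>. v t \<omega> + v' t \<omega>) (\<lambda>\<omega>. eT \<omega> + eT' \<omega>)"
  unfolding lq_space_def by (auto intro: sqi_add)

lemma lq_space_diff:
  "lq_space e v eT \<Longrightarrow> lq_space e' v' eT' \<Longrightarrow>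
    lq_space (\<lambda>t \<omega>. e t \<omega> - e' t \<omega>) (\<lambda>t \<omega>. v t \<omega> - v' t \<omega>) (\<lambda>\<omega>. eT \<omega> - eT' \<omega>)"
  unfolding lq_space_def by (auto intro: sqi_diff)

lemma lq_space_scale:
  "lq_space e v eT \<Longrightarrow> lq_space (\<lambda>t \<omega>. c *\<^sub>R e t \<omega>) (\<lambda>t \<omega>. c *\<^sub>R v t \<omega>) (\<lambda>\<omega>. c *\<^sub>R eT \<omega>)"
  unfolding lq_space_def by (auto intro: sqi_scaleR)

lemma lq_form_expand:
  assumes sym: "transpose Q = Q" "transpose R = R" "transpose Q' = Q'"
    and X: "lq_space e v eT" and D: "lq_space e' v' eT'"
  shows "lq_form Q R Q' (\<lambda>t \<omega>. e t \<omega> + c *\<^sub>R e' t \<omega>) (\<lambda>t \<omega>. v t \<omega> + c *\<^sub>R v' t \<omega>) (\<lambda>\<omega>. eT \<omega> + c *\<^sub>R eT' \<omega>)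
      (\<lambda>t \<omega>. e t \<omega> + c *\<^sub>R e' t \<omega>) (\<lambda>t \<omega>. v t \<omega> + c *\<^sub>R v' t \<omega>) (\<lambda>\<omega>. eT \<omega> + c *\<^sub>R eT' \<omega>)
    = lq_form Q R Q' e v eT e v eT + 2 * c * lq_form Q R Q' e' v' eT' e v eT + c\<^sup>2 * lq_form Q R Q' e' v' eT' e' v' eT'"
  unfolding lq_form_add_left[OF lq_space_add[OF X lq_space_scale[OF D]] X lq_space_scale[OF D]]
    lq_form_add_right[OF X X lq_space_scale[OF D]] lq_form_add_right[OF lq_space_scale[OF D] X lq_space_scale[OF D]]
    lq_form_scale lq_form_commute[OF sym, of e v eT e' v' eT']
  by (simp add: power2_eq_square)

text \<open>Dropping the tracking terms keeps the control energy. This is the coercivity behind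
  uniqueness of the optimal controls.\<close>

lemma lq_form_nonneg:
  assumes "\<And>x. 0 \<le> x \<bullet> (Q *v x)" "\<And>x. 0 \<le> x \<bullet> (R *v x)" "\<And>x. 0 \<le> x \<bullet> (Q' *v x)"
  shows "0 \<le> lq_form Q R Q' e v eT e v eT"
    "(\<integral>z. v (fst z) (snd z) \<bullet> (R *v v (fst z) (snd z)) \<partial>N) \<le> lq_form Q R Q' e v eT e v eT"
  unfolding lq_form_def using assms by (simp_all add: add_nonneg_nonneg)

lemma lq_form_cong_AE:
  assumes "lq_space e1 v1 eT1" "lq_space e1' v1' eT1'" "lq_space e2 v2 eT2" "lq_space e2' v2' eT2'"
    and "AE z in N. e1 (fst z) (snd z) = e2 (fst z) (snd z)" "AE z in N. v1 (fst z) (snd z) = v2 (fst z) (snd z)"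
      "AE \<omega> in M. eT1 \<omega> = eT2 \<omega>"
    and "AE z in N. e1' (fst z) (snd z) = e2' (fst z) (snd z)" "AE z in N. v1' (fst z) (snd z) = v2' (fst z) (snd z)"
      "AE \<omega> in M. eT1' \<omega> = eT2' \<omega>"
  shows "lq_form Q R Q' e1 v1 eT1 e1' v1' eT1' = lq_form Q R Q' e2 v2 eT2 e2' v2' eT2'"
proof -
  note b = borel_measurable_integrable[OF sqi_inner_integrable[OF _ sqi_mult_vec]]
  have "(\<integral>z. e1 (fst z) (snd z) \<bullet> (Q *v e1' (fst z) (snd z)) \<partial>N) = (\<integral>z. e2 (fst z) (snd z) \<bullet> (Q *v e2' (fst z) (snd z)) \<partial>N)"
    by (rule integral_cong_AE) (use assms b in \<open>auto simp: lq_space_def\<close>)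
  moreover have "(\<integral>z. v1 (fst z) (snd z) \<bullet> (R *v v1' (fst z) (snd z)) \<partial>N) = (\<integral>z. v2 (fst z) (snd z) \<bullet> (R *v v2' (fst z) (snd z)) \<partial>N)"
    by (rule integral_cong_AE) (use assms b in \<open>auto simp: lq_space_def\<close>)
  moreover have "(\<integral>\<omega>. eT1 \<omega> \<bullet> (Q' *v eT1' \<omega>) \<partial>M) = (\<integral>\<omega>. eT2 \<omega> \<bullet> (Q' *v eT2' \<omega>) \<partial>M)"
    by (rule integral_cong_AE) (use assms b in \<open>auto simp: lq_space_def\<close>)
  ultimately show ?thesis unfolding lq_form_def by simp
qed

text \<open>Tonelli exchanges expectation and time, and square-integrability makes the value finite,
  so that costs can be expanded in real arithmetic.\<close>

lemma lq_cost_eq: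
  assumes pos: "\<And>x. 0 \<le> x \<bullet> (Q *v x)" "\<And>x. 0 \<le> x \<bullet> (R *v x)" "\<And>x. 0 \<le> x \<bullet> (Q' *v x)"
    and X: "lq_space e v eT"
  shows "lq_cost T M Q R Q' e v eT = ennreal (lq_form Q R Q' e v eT e v eT)"
proof -
  let ?r = "\<lambda>t \<omega>. qform Q (e t \<omega>) + qform R (v t \<omega>)"
  have i: "integrable N (\<lambda>z. e (fst z) (snd z) \<bullet> (Q *v e (fst z) (snd z)))"
    "integrable N (\<lambda>z. v (fst z) (snd z) \<bullet> (R *v v (fst z) (snd z)))"
    "integrable M (\<lambda>\<omega>. eT \<omega> \<bullet> (Q' *v eT \<omega>))"
    using X unfolding lq_space_def by (auto intro!: sqi_inner_integrable sqi_mult_vec)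
  then have ir: "integrable N (\<lambda>z. ?r (fst z) (snd z))" unfolding qform_def by simp
  have mr: "(\<lambda>(t, \<omega>). ennreal (?r t \<omega>)) \<in> borel_measurable (TL \<Otimes>\<^sub>M M)"
    using borel_measurable_integrable[OF ir] unfolding time_prob_def case_prod_beta' by simp
  have inner: "(\<integral>\<^sup>+t\<in>{0..T}. ennreal (?r t \<omega>) \<partial>lborel) = (\<integral>\<^sup>+t. ennreal (?r t \<omega>) \<partial>TL)" for \<omega>
    by (subst nn_integral_restrict_space) auto
  have mi: "(\<lambda>\<omega>. \<integral>\<^sup>+t. ennreal (?r t \<omega>) \<partial>TL) \<in> borel_measurable M"
    using TL.borel_measurable_nn_integral[of "\<lambda>\<omega> t. ennreal (?r t \<omega>)" M]
      measurable_compose[OF measurable_pair_swap' mr] by (simp add: case_prod_beta')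
  have mT: "(\<lambda>\<omega>. ennreal (qform Q' (eT \<omega>))) \<in> borel_measurable M"
    using borel_measurable_integrable[OF i(3)] unfolding qform_def by simp
  have "lq_cost T M Q R Q' e v eT
      = (\<integral>\<^sup>+\<omega>. (\<integral>\<^sup>+t. ennreal (?r t \<omega>) \<partial>TL) \<partial>M) + (\<integral>\<^sup>+\<omega>. ennreal (qform Q' (eT \<omega>)) \<partial>M)"
    unfolding lq_cost_def inner using mi mT by (rule nn_integral_add)
  also have "(\<integral>\<^sup>+\<omega>. (\<integral>\<^sup>+t. ennreal (?r t \<omega>) \<partial>TL) \<partial>M) = (\<integral>\<^sup>+z. ennreal (?r (fst z) (snd z)) \<partial>N)"
    using NP.nn_integral_snd[OF mr] unfolding time_prob_def case_prod_beta' by simp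
  also have "\<dots> = ennreal (\<integral>z. ?r (fst z) (snd z) \<partial>N)"
    by (rule nn_integral_eq_integral[OF ir]) (use pos in \<open>auto simp: qform_def\<close>)
  also have "(\<integral>\<^sup>+\<omega>. ennreal (qform Q' (eT \<omega>)) \<partial>M) = ennreal (\<integral>\<omega>. qform Q' (eT \<omega>) \<partial>M)"
    by (rule nn_integral_eq_integral) (use pos i(3) in \<open>auto simp: qform_def\<close>)
  also have "ennreal (\<integral>z. ?r (fst z) (snd z) \<partial>N) + ennreal (\<integral>\<omega>. qform Q' (eT \<omega>) \<partial>M)
      = ennreal ((\<integral>z. ?r (fst z) (snd z) \<partial>N) + (\<integral>\<omega>. qform Q' (eT \<omega>) \<partial>M))"
    by (rule ennreal_plus[symmetric]) (use pos in \<open>auto simp: qform_def intro!: integral_nonneg_AE\<close>)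
  also have "(\<integral>z. ?r (fst z) (snd z) \<partial>N) + (\<integral>\<omega>. qform Q' (eT \<omega>) \<partial>M) = lq_form Q R Q' e v eT e v eT"
    unfolding lq_form_def qform_def using i by simp
  finally show ?thesis .
qed

section \<open>Orthogonality to a filtration\<close>

text \<open>Zero projection onto the \<open>F\<close>-adapted processes, in tested form;
  \<open>orthogonal_at\<close> is the counterpart at a single time, zero conditional expectation
  given \<open>F t\<close>.\<close>

definition orthogonal_process :: "(real \<Rightarrow> 'w measure) \<Rightarrow> (real \<Rightarrow> 'w \<Rightarrow> real ^ 'n) \<Rightarrow> bool" where
  "orthogonal_process F w \<longleftrightarrow> square_integrable_process T M w \<and>
    (\<forall>\<phi>. L2_adapted T M F \<phi> \<longrightarrow> (\<integral>z. \<phi> (fst z) (snd z) \<bullet> w (fst z) (snd z) \<partial>N) = 0)"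

definition orthogonal_at :: "(real \<Rightarrow> 'w measure) \<Rightarrow> real \<Rightarrow> ('w \<Rightarrow> real ^ 'n) \<Rightarrow> bool" where
  "orthogonal_at F t Y \<longleftrightarrow> square_integrable_rv M Y \<and>
    (\<forall>V. V \<in> borel_measurable (F t) \<longrightarrow> square_integrable_rv M V \<longrightarrow> (\<integral>\<omega>. V \<omega> \<bullet> Y \<omega> \<partial>M) = 0)"

lemma orthogonal_projection:
  assumes F: "filtration_on F" and w: "square_integrable_process T M w"
  shows "orthogonal_process F (\<lambda>t \<omega>. w t \<omega> - adapted_projection F w t \<omega>)"
proof -
  note p = L2_adapted_sqi[OF L2_adapted_projection[OF F w]]
  have "(\<integral>z. \<phi> (fst z) (snd z) \<bullet> (w (fst z) (snd z) - adapted_projection F w (fst z) (snd z)) \<partial>N) = 0"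
    if \<phi>: "L2_adapted T M F \<phi>" for \<phi>
    unfolding inner_diff_right
    using sqi_inner_integrable[OF L2_adapted_sqi[OF \<phi>] w] sqi_inner_integrable[OF L2_adapted_sqi[OF \<phi>] p]
      adapted_projection_inner[OF F w \<phi>] by simp
  then show ?thesis unfolding orthogonal_process_def using sqi_diff[OF w p] by simp
qed

lemma orthogonal_process_add:
  assumes "orthogonal_process F v" "orthogonal_process F w"
  shows "orthogonal_process F (\<lambda>t \<omega>. v t \<omega> + w t \<omega>)"
  using assms unfolding orthogonal_process_def inner_add_right
  by (auto intro!: sqi_add simp: sqi_inner_integrable L2_adapted_sqi)

lemma orthogonal_process_mult_vec:
  fixes A :: "real ^ 'n ^ 'm"
  assumes w: "orthogonal_process F w"
  shows "orthogonal_process F (\<lambda>t \<omega>. A *v w t \<omega>)"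
proof -
  have "(\<integral>z. \<phi> (fst z) (snd z) \<bullet> (A *v w (fst z) (snd z)) \<partial>N) = 0" if "L2_adapted T M F \<phi>" for \<phi>
  proof -
    have "(\<integral>z. (transpose A *v \<phi> (fst z) (snd z)) \<bullet> w (fst z) (snd z) \<partial>N) = 0"
      using w L2_adapted_mult_vec[OF that, of "transpose A"] unfolding orthogonal_process_def by blast
    then show ?thesis using inner_transpose_mult[of _ A] by (simp add: inner_commute)
  qed
  then show ?thesis using w unfolding orthogonal_process_def by (auto intro: sqi_mult_vec)
qed

lemma orthogonal_at_mult_vec:
  fixes A :: "real ^ 'n ^ 'm"
  assumes w: "orthogonal_at F t Y"
  shows "orthogonal_at F t (\<lambda>\<omega>. A *v Y \<omega>)"
proof -
  have "(\<integral>\<omega>. V \<omega> \<bullet> (A *v Y \<omega>) \<partial>M) = 0" if V: "V \<in> borel_measurable (F t)" "square_integrable_rv M V" for V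
  proof -
    have "(\<lambda>\<omega>. transpose A *v V \<omega>) \<in> borel_measurable (F t)"
      by (rule measurable_compose[OF V(1) borel_measurable_continuous_onI[OF
            linear_continuous_on[OF matrix_vector_mul_bounded_linear]]])
    then have "(\<integral>\<omega>. (transpose A *v V \<omega>) \<bullet> Y \<omega> \<partial>M) = 0"
      using w sqi_mult_vec[OF V(2), of "transpose A"] unfolding orthogonal_at_def by blast
    then show ?thesis using inner_transpose_mult[of _ A] by (simp add: inner_commute)
  qed
  then show ?thesis using w unfolding orthogonal_at_def by (auto intro: sqi_mult_vec)
qed

text \<open>By Fubini almost every section of an adapted test process is an admissible test variable
  at its own time.\<close>

lemma orthogonal_process_pointwise:
  assumes w: "square_integrable_process T M w" and o: "\<And>t. t \<in> {0..T} \<Longrightarrow> orthogonal_at F t (w t)"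
  shows "orthogonal_process F w"
proof -
  have "(\<integral>z. \<phi> (fst z) (snd z) \<bullet> w (fst z) (snd z) \<partial>N) = 0" if \<phi>: "L2_adapted T M F \<phi>" for \<phi>
  proof -
    have "(\<integral>z. \<phi> (fst z) (snd z) \<bullet> w (fst z) (snd z) \<partial>N) = (\<integral>t. (\<integral>\<omega>. \<phi> t \<omega> \<bullet> w t \<omega> \<partial>M) \<partial>TL)"
      by (rule integral_N_fst[OF sqi_inner_integrable[OF L2_adapted_sqi[OF \<phi>] w]])
    also have "\<dots> = 0"
    proof (rule integral_eq_zero_AE)
      show "AE t in TL. (\<integral>\<omega>. \<phi> t \<omega> \<bullet> w t \<omega> \<partial>M) = 0"
        using sqi_section_fst[OF L2_adapted_sqi[OF \<phi>]] AE_space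
        by eventually_elim (use o L2_adapted_at[OF \<phi>] in \<open>auto simp: orthogonal_at_def space_TL\<close>)
    qed
    finally show ?thesis .
  qed
  then show ?thesis unfolding orthogonal_process_def using w by simp
qed

text \<open>By immersion the integrand may be replaced by its projection, which vanishes.
  \<open>V\<close> may look beyond t, up to the horizon.\<close>

lemma orthogonal_running_integral:
  fixes w :: "real \<Rightarrow> 'w \<Rightarrow> real ^ 'n"
  assumes FG: "immersed F G" and w: "L2_adapted T M G w" and o: "orthogonal_process F w" and t: "t \<in> {0..T}"
    and V: "V \<in> borel_measurable (F T)" "square_integrable_rv M V"
  shows "(\<integral>\<omega>. V \<omega> \<bullet> running_integral w t \<omega> \<partial>M) = 0"
proof -
  note F = immersedD(1)[OF FG]
  let ?p = "adapted_projection F w"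
  note sw = L2_adapted_sqi[OF w]
  note p = L2_adapted_projection[OF F sw]
  note sp = L2_adapted_sqi[OF p]
  have "(\<integral>z. ?p (fst z) (snd z) \<bullet> ?p (fst z) (snd z) \<partial>N) = (\<integral>z. ?p (fst z) (snd z) \<bullet> w (fst z) (snd z) \<partial>N)"
    by (rule adapted_projection_inner[OF F sw p])
  also have "\<dots> = 0" using o p unfolding orthogonal_process_def by blast
  finally have "AE z in N. ?p (fst z) (snd z) = 0" by (rule sqi_zero_AE[OF sp])
  then have "AE \<omega> in M. \<forall>t\<in>{0..T}. running_integral ?p t \<omega> = running_integral (\<lambda>_ _. 0) t \<omega>"
    by (intro running_integral_cong_AE[OF sp sqi_const[OF finite_N]])
  then have "AE \<omega> in M. V \<omega> \<bullet> running_integral ?p t \<omega> = 0"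
    by eventually_elim (use t in \<open>auto simp: running_integral_def\<close>)
  then have "(\<integral>\<omega>. V \<omega> \<bullet> running_integral ?p t \<omega> \<partial>M) = 0" by (rule integral_eq_zero_AE)
  then show ?thesis unfolding immersed_projection[OF FG V w t] .
qed

text \<open>One triple is adapted, the other orthogonal, and constant matrices respect both
  properties.\<close>

lemma lq_form_orthogonal:
  assumes e: "L2_adapted T M F e" "L2_adapted T M F v" "eT \<in> borel_measurable (F T)" "square_integrable_rv M eT"
    and o: "orthogonal_process F e'" "orthogonal_process F v'" "orthogonal_at F T eT'"
  shows "lq_form Q R Q' e v eT e' v' eT' = 0" "lq_form Q R Q' e' v' eT' e v eT = 0"
proof -
  show "lq_form Q R Q' e v eT e' v' eT' = 0"
    using e orthogonal_process_mult_vec[OF o(1), of Q] orthogonal_process_mult_vec[OF o(2), of R]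
      orthogonal_at_mult_vec[OF o(3), of Q']
    unfolding lq_form_def orthogonal_process_def orthogonal_at_def by simp
  have "(\<lambda>\<omega>. Q' *v eT \<omega>) \<in> borel_measurable (F T)"
    by (rule measurable_compose[OF e(3) borel_measurable_continuous_onI[OF
          linear_continuous_on[OF matrix_vector_mul_bounded_linear]]])
  then show "lq_form Q R Q' e' v' eT' e v eT = 0"
    using o(1)[unfolded orthogonal_process_def, THEN conjunct2, rule_format, OF L2_adapted_mult_vec[OF e(1), of Q]]
      o(2)[unfolded orthogonal_process_def, THEN conjunct2, rule_format, OF L2_adapted_mult_vec[OF e(2), of R]]
      o(3)[unfolded orthogonal_at_def, THEN conjunct2, rule_format, OF _ sqi_mult_vec[OF e(4), of Q']]
    unfolding lq_form_def inner_commute[of "e' _ _"] inner_commute[of "v' _ _"] inner_commute[of "eT' _"] by simp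
qed

text \<open>Conditioning a linear controlled equation on the smaller filtration gives the same
  equation, by the exchange of projection and time integral. It splits the follower's test
  directions in \<open>response_of_solution\<close>.\<close>

lemma project_linear_system:
  fixes A :: "real ^ 'n ^ 'n" and E :: "real ^ 'm ^ 'n"
  assumes FG: "immersed F G" and w: "L2_adapted T M G w" and y: "L2_adapted T M G y"
    and y_eq: "\<And>t. t \<in> {0..T} \<Longrightarrow> AE \<omega> in M. y t \<omega> = running_integral (\<lambda>s \<omega>. A *v y s \<omega> + E *v w s \<omega>) t \<omega>"
  obtains w' y' where "L2_adapted T M F w'" "L2_adapted T M F y'"
    "\<forall>t\<in>{0..T}. AE \<omega> in M. y' t \<omega> = running_integral (\<lambda>s \<omega>. A *v y' s \<omega> + E *v w' s \<omega>) t \<omega>"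
    "orthogonal_process F (\<lambda>t \<omega>. w t \<omega> - w' t \<omega>)" "orthogonal_process F (\<lambda>t \<omega>. y t \<omega> - y' t \<omega>)"
    "orthogonal_at F T (\<lambda>\<omega>. y T \<omega> - y' T \<omega>)"
proof -
  note F = immersedD(1)[OF FG] and G = immersedD(2)[OF FG]
  note sw = L2_adapted_sqi[OF w] and sy = L2_adapted_sqi[OF y]
  define w' where "w' = adapted_projection F w"
  define q where "q = adapted_projection F y"
  have w': "L2_adapted T M F w'" and q: "L2_adapted T M F q"
    unfolding w'_def q_def by (rule L2_adapted_projection[OF F sw], rule L2_adapted_projection[OF F sy])
  have ow: "orthogonal_process F (\<lambda>t \<omega>. w t \<omega> - w' t \<omega>)" and oy: "orthogonal_process F (\<lambda>t \<omega>. y t \<omega> - q t \<omega>)"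
    unfolding w'_def q_def by (rule orthogonal_projection[OF F sw], rule orthogonal_projection[OF F sy])
  let ?f = "\<lambda>s \<omega>. A *v y s \<omega> + E *v w s \<omega>" and ?g = "\<lambda>s \<omega>. A *v q s \<omega> + E *v w' s \<omega>"
  have f: "L2_adapted T M G ?f" by (intro L2_adapted_add L2_adapted_mult_vec y w)
  have g: "L2_adapted T M F ?g" by (intro L2_adapted_add L2_adapted_mult_vec q w')
  have gG: "L2_adapted T M G ?g" by (rule L2_adapted_mono[OF g immersedD(3)[OF FG]])
  note sf = L2_adapted_sqi[OF f] and sg = L2_adapted_sqi[OF g]
  \<comment> \<open>The projection \<open>q\<close> is determined only up to null sets of the
    product space and satisfies no equation at a given time. Hence the state is defined afresh, as
    an adapted version of the integral driven by \<open>q\<close> and \<open>w'\<close>.\<close>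
  obtain y' where y': "L2_adapted T M F y'" and y'_eq: "\<And>t. t \<in> {0..T} \<Longrightarrow> AE \<omega> in M. y' t \<omega> = running_integral ?g t \<omega>"
    using adapted_running_integral[OF F g] by blast
  note sy' = L2_adapted_sqi[OF y']
  have od: "orthogonal_process F (\<lambda>s \<omega>. ?f s \<omega> - ?g s \<omega>)"
  proof -
    have "(\<lambda>s \<omega>. ?f s \<omega> - ?g s \<omega>) = (\<lambda>s \<omega>. A *v (y s \<omega> - q s \<omega>) + E *v (w s \<omega> - w' s \<omega>))"
      by (simp add: fun_eq_iff matrix_vector_mult_diff_distrib)
    then show ?thesis
      using orthogonal_process_add[OF orthogonal_process_mult_vec[OF oy, of A] orthogonal_process_mult_vec[OF ow, of E]]
      by simp
  qed
  have o_at: "orthogonal_at F t (\<lambda>\<omega>. y t \<omega> - y' t \<omega>)" if t: "t \<in> {0..T}" for t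
    unfolding orthogonal_at_def
  proof (intro conjI allI impI)
    have TT: "T \<in> {0..T}" and tT: "t \<le> T" using T_pos t by auto
    have m: "y t \<in> borel_measurable M" "y' t \<in> borel_measurable M"
      using measurable_from_subalg[OF filtration_onD(1)[OF G t] L2_adapted_at[OF y t]]
        measurable_from_subalg[OF filtration_onD(1)[OF F t] L2_adapted_at[OF y' t]] by auto
    have st: "square_integrable_rv M (y t)" "square_integrable_rv M (y' t)"
      by (rule sqi_cong_AE[OF m(1) sqi_running_integral_at[OF sf t] y_eq[OF t]],
          rule sqi_cong_AE[OF m(2) sqi_running_integral_at[OF sg t] y'_eq[OF t]])
    then show "square_integrable_rv M (\<lambda>\<omega>. y t \<omega> - y' t \<omega>)" by (rule sqi_diff)
    fix V :: "'w \<Rightarrow> real ^ 'n" assume V: "V \<in> borel_measurable (F t)" "square_integrable_rv M V"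
    have VT: "V \<in> borel_measurable (F T)" by (rule filtration_measurable_mono[OF F t TT tT V(1)])
    have "(\<integral>\<omega>. V \<omega> \<bullet> (y t \<omega> - y' t \<omega>) \<partial>M) = (\<integral>\<omega>. V \<omega> \<bullet> running_integral (\<lambda>s \<omega>. ?f s \<omega> - ?g s \<omega>) t \<omega> \<partial>M)"
    proof (rule integral_cong_AE)
      show "AE \<omega> in M. V \<omega> \<bullet> (y t \<omega> - y' t \<omega>) = V \<omega> \<bullet> running_integral (\<lambda>s \<omega>. ?f s \<omega> - ?g s \<omega>) t \<omega>"
        using y_eq[OF t] y'_eq[OF t] running_integral_diff[OF sf sg] by eventually_elim (use t in auto)
    qed (use sqi_D(1)[OF V(2)] m sqi_D(1)[OF sqi_running_integral_at[OF sqi_diff[OF sf sg] t]] in auto)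
    also have "\<dots> = 0" by (rule orthogonal_running_integral[OF FG L2_adapted_diff[OF f gG] od t VT V(2)])
    finally show "(\<integral>\<omega>. V \<omega> \<bullet> (y t \<omega> - y' t \<omega>) \<partial>M) = 0" .
  qed
  have oyy': "orthogonal_process F (\<lambda>t \<omega>. y t \<omega> - y' t \<omega>)"
    by (rule orthogonal_process_pointwise[OF sqi_diff[OF sy sy'] o_at])
  \<comment> \<open>Both \<open>q\<close> and \<open>y'\<close> differ from \<open>y\<close> by an
    orthogonal process, so they agree almost everywhere and \<open>y'\<close> may replace
    \<open>q\<close> in its own drift.\<close>
  let ?d = "\<lambda>t \<omega>. q t \<omega> - y' t \<omega>"
  have d: "L2_adapted T M F ?d" by (rule L2_adapted_diff[OF q y'])
  have "(\<integral>z. ?d (fst z) (snd z) \<bullet> ?d (fst z) (snd z) \<partial>N)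
     = (\<integral>z. ?d (fst z) (snd z) \<bullet> (y (fst z) (snd z) - y' (fst z) (snd z)) - ?d (fst z) (snd z) \<bullet> (y (fst z) (snd z) - q (fst z) (snd z)) \<partial>N)"
    by (simp add: inner_diff_right)
  also have "\<dots> = 0"
    using sqi_inner_integrable[OF L2_adapted_sqi[OF d] sqi_diff[OF sy sy']]
      sqi_inner_integrable[OF L2_adapted_sqi[OF d] sqi_diff[OF sy L2_adapted_sqi[OF q]]]
      oyy'[unfolded orthogonal_process_def, THEN conjunct2, rule_format, OF d]
      oy[unfolded orthogonal_process_def, THEN conjunct2, rule_format, OF d] by simp
  finally have "AE z in N. ?d (fst z) (snd z) = 0" by (rule sqi_zero_AE[OF L2_adapted_sqi[OF d]])
  then have eq: "AE z in N. ?g (fst z) (snd z) = A *v y' (fst z) (snd z) + E *v w' (fst z) (snd z)"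
    by eventually_elim simp
  have g': "L2_adapted T M F (\<lambda>s \<omega>. A *v y' s \<omega> + E *v w' s \<omega>)" by (intro L2_adapted_add L2_adapted_mult_vec y' w')
  have "AE \<omega> in M. y' t \<omega> = running_integral (\<lambda>s \<omega>. A *v y' s \<omega> + E *v w' s \<omega>) t \<omega>" if t: "t \<in> {0..T}" for t
    using y'_eq[OF t] running_integral_cong_AE[OF sg L2_adapted_sqi[OF g'] eq] by eventually_elim (use t in auto)
  then show ?thesis using that[OF w' y' _ ow oyy' o_at] T_pos by auto
qed

end

lemma quadratic_nonneg_linear_zero:
  fixes b d :: real
  assumes "\<And>c. 0 \<le> 2 * c * b + c\<^sup>2 * d" "0 \<le> d"
  shows "b = 0"
proof -
  \<comment> \<open>The minimiser -b/d is replaced by -b/(d + 1), so that d = 0 is covered as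
    well.\<close>
  define k where "k = b / (d + 1)"
  have b: "b = k * (d + 1)" unfolding k_def using assms(2) by simp
  have "0 \<le> 2 * (- k) * b + (- k)\<^sup>2 * d" by (rule assms)
  also have "\<dots> = - (k\<^sup>2 * (d + 2))" unfolding b by (simp add: power2_eq_square algebra_simps)
  finally have "k\<^sup>2 * (d + 2) \<le> 0" by simp
  then have "k = 0" using assms(2) by (auto simp: mult_le_0_iff)
  then show ?thesis using b by simp
qed

locale game_space =
  fixes \<G> :: "('na::finite, 'nb::finite, 'n1::finite, 'ma::finite, 'mb::finite, 'm1::finite,
                'da::finite, 'db::finite, 'd1::finite) game"
    and \<N> :: "('w, 'na, 'nb, 'n1, 'da, 'db, 'd1) noise"
  assumes coefficients: "game_coefficients \<G>" and driving_noise: "driving_noise \<N>"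

sublocale game_space \<subseteq> noise_space \<N> "horizon \<G>"
  using coefficients driving_noise unfolding game_coefficients_def by unfold_locales auto

context game_space
begin

abbreviation "T \<equiv> horizon \<G>"

lemmas sym = weights_symmetric[OF coefficients]

lemma weights_definite:
  "pos_definite (R\<^sub>\<alpha> \<G>)" "pos_definite (R\<^sub>\<beta> \<G>)" "pos_definite (R\<^sub>1 \<G>)"
  using coefficients unfolding game_coefficients_def by auto

lemma weights_nonneg:
  "0 \<le> x \<bullet> (Q\<^sub>\<alpha> \<G> *v x)" "0 \<le> y \<bullet> (Q\<^sub>\<beta> \<G> *v y)" "0 \<le> z \<bullet> (Q\<^sub>1 \<G> *v z)"
  "0 \<le> x \<bullet> (Qb\<^sub>\<alpha> \<G> *v x)" "0 \<le> y \<bullet> (Qb\<^sub>\<beta> \<G> *v y)" "0 \<le> z \<bullet> (Qb\<^sub>1 \<G> *v z)"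
  "0 \<le> ua \<bullet> (R\<^sub>\<alpha> \<G> *v ua)" "0 \<le> ub \<bullet> (R\<^sub>\<beta> \<G> *v ub)" "0 \<le> u1 \<bullet> (R\<^sub>1 \<G> *v u1)"
  using coefficients unfolding game_coefficients_def pos_semidefinite_def qform_def
  by (auto intro: pos_definite_D(2))

lemma horizon_mem: "T \<in> {0..T}"
  using T_pos by simp

section \<open>The follower's problem\<close>

text \<open>The directions in which the follower can vary: in the difference of two of his states
  for the same leaders and mean field, the initial value, the noise and all exogenous terms
  cancel.\<close>

definition follower_test :: "(real \<Rightarrow> 'w \<Rightarrow> real ^ 'm1) \<Rightarrow> (real \<Rightarrow> 'w \<Rightarrow> real ^ 'n1) \<Rightarrow> bool" where
  "follower_test w y \<longleftrightarrow> L2_adapted T M \<G>\<^sub>1 w \<and> L2_adapted T M \<G>\<^sub>1 y \<and>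
    (\<forall>t\<in>{0..T}. AE \<omega> in M. y t \<omega> = running_integral (\<lambda>s \<omega>. A\<^sub>1 \<G> *v y s \<omega> + E\<^sub>1 \<G> *v w s \<omega>) t \<omega>)"

definition "follower_error x1 xa xb z t \<omega> =
  x1 t \<omega> - F\<^sub>1 \<G> *v z t \<omega> - G\<^sub>1 \<G> *v xa t \<omega> - H\<^sub>1 \<G> *v xb t \<omega> - M\<^sub>1 \<G>"

definition "follower_terminal_error x1 xa xb z \<omega> =
  x1 T \<omega> - Fb\<^sub>1 \<G> *v z T \<omega> - Gb\<^sub>1 \<G> *v xa T \<omega> - Hb\<^sub>1 \<G> *v xb T \<omega> - Mb\<^sub>1 \<G>"

definition "follower_form = lq_form (Q\<^sub>1 \<G>) (R\<^sub>1 \<G>) (Qb\<^sub>1 \<G>)"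

text \<open>Half the derivative of the follower's cost in each test direction is zero.\<close>

definition "follower_foc u1 x1 xa xb z \<longleftrightarrow>
  (\<forall>w y. follower_test w y \<longrightarrow>
    follower_form y w (y T) (follower_error x1 xa xb z) u1 (follower_terminal_error x1 xa xb z) = 0)"

text \<open>Square-integrability on the product space says nothing about a particular time; the
  terminal costs need it at the horizon.\<close>

definition square_integrable_state :: "(real \<Rightarrow> 'w \<Rightarrow> real ^ 'n) \<Rightarrow> bool" where
  "square_integrable_state x \<longleftrightarrow>
    square_integrable_process T M x \<and> (\<forall>t\<in>{0..T}. square_integrable_rv M (x t))"

text \<open>The integral equation transfers square-integrability from the data to every single
  time.\<close>

lemma square_integrable_stateI:
  fixes x f :: "real \<Rightarrow> 'w \<Rightarrow> real ^ 'n"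
  assumes F: "filtration_on F" and x: "L2_adapted T M F x"
    and f: "square_integrable_process T M f"
    and \<xi>: "\<And>t. t \<in> {0..T} \<Longrightarrow> square_integrable_rv M (\<xi> t)"
    and eq: "\<And>t. t \<in> {0..T} \<Longrightarrow> AE \<omega> in M. x t \<omega> = \<xi> t \<omega> + running_integral f t \<omega>"
  shows "square_integrable_state x"
  unfolding square_integrable_state_def
proof (intro conjI ballI)
  fix t assume t: "t \<in> {0..T}"
  show "square_integrable_rv M (x t)"
    by (rule sqi_cong_AE[OF measurable_from_subalg[OF filtration_onD(1)[OF F t] L2_adapted_at[OF x t]]
          sqi_add[OF \<xi>[OF t] sqi_running_integral_at[OF f t]] eq[OF t]])
qed (rule L2_adapted_sqi[OF x])

lemma follower_state_iff:
  "follower_state \<G> \<N> v1 xa xb z x1 \<longleftrightarrow> L2_adapted T M \<G>\<^sub>1 x1 \<and>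
    (\<forall>t\<in>{0..T}. AE \<omega> in M. x1 t \<omega> = \<eta>\<^sub>1 \<N> \<omega>
      + running_integral (\<lambda>s \<omega>. A\<^sub>1 \<G> *v x1 s \<omega> + B\<^sub>1 \<G> *v z s \<omega> + C\<^sub>1 \<G> *v xa s \<omega> + D\<^sub>1 \<G> *v xb s \<omega> + E\<^sub>1 \<G> *v v1 s \<omega>) t \<omega>
      + \<sigma>\<^sub>1 \<G> *v W\<^sub>1 \<N> t \<omega>)"
  unfolding follower_state_def running_integral_def by simp

lemma follower_test_state:
  assumes "follower_test w y"
  shows "square_integrable_state y" "square_integrable_process T M w"
proof -
  have w: "L2_adapted T M \<G>\<^sub>1 w" and y: "L2_adapted T M \<G>\<^sub>1 y" and
    eq: "\<And>t. t \<in> {0..T} \<Longrightarrow> AE \<omega> in M. y t \<omega> = running_integral (\<lambda>s \<omega>. A\<^sub>1 \<G> *v y s \<omega> + E\<^sub>1 \<G> *v w s \<omega>) t \<omega>"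
    using assms unfolding follower_test_def by auto
  show "square_integrable_process T M w" by (rule L2_adapted_sqi[OF w])
  show "square_integrable_state y"
    by (rule square_integrable_stateI[OF follower_filtration_on y
          sqi_add[OF sqi_mult_vec[OF L2_adapted_sqi[OF y]] sqi_mult_vec[OF L2_adapted_sqi[OF w]]]
          sqi_const[OF finite_measure_axioms, of 0]])
       (use eq in simp)
qed

lemma follower_state_sqi:
  assumes "follower_state \<G> \<N> v1 xa xb z x1" "L2_adapted T M \<G>\<^sub>1 v1"
    "square_integrable_process T M xa" "square_integrable_process T M xb" "square_integrable_process T M z"
  shows "square_integrable_state x1"
proof (rule square_integrable_stateI[OF follower_filtration_on])
  show x1: "L2_adapted T M \<G>\<^sub>1 x1" using assms(1) unfolding follower_state_iff by simp
  let ?f = "\<lambda>s \<omega>. A\<^sub>1 \<G> *v x1 s \<omega> + B\<^sub>1 \<G> *v z s \<omega> + C\<^sub>1 \<G> *v xa s \<omega> + D\<^sub>1 \<G> *v xb s \<omega> + E\<^sub>1 \<G> *v v1 s \<omega>"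
  show "square_integrable_process T M ?f"
    by (intro sqi_add sqi_mult_vec assms L2_adapted_sqi[OF x1] L2_adapted_sqi[OF assms(2)])
  fix t assume t: "t \<in> {0..T}"
  show "square_integrable_rv M (\<lambda>\<omega>. \<eta>\<^sub>1 \<N> \<omega> + \<sigma>\<^sub>1 \<G> *v W\<^sub>1 \<N> t \<omega>)"
    by (intro sqi_add sqi_mult_vec initial_sqi wiener_sqi[OF wiener(3)]) (use t in simp)
  have "AE \<omega> in M. x1 t \<omega> = \<eta>\<^sub>1 \<N> \<omega> + running_integral ?f t \<omega> + \<sigma>\<^sub>1 \<G> *v W\<^sub>1 \<N> t \<omega>"
    using assms(1) t unfolding follower_state_iff by blast
  then show "AE \<omega> in M. x1 t \<omega> = \<eta>\<^sub>1 \<N> \<omega> + \<sigma>\<^sub>1 \<G> *v W\<^sub>1 \<N> t \<omega> + running_integral ?f t \<omega>"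
    by eventually_elim (simp add: algebra_simps)
qed

context
  fixes xa :: "real \<Rightarrow> 'w \<Rightarrow> real ^ 'na" and xb :: "real \<Rightarrow> 'w \<Rightarrow> real ^ 'nb" and z :: "real \<Rightarrow> 'w \<Rightarrow> real ^ 'n1"
  assumes xa: "square_integrable_state xa" and xb: "square_integrable_state xb" and z: "square_integrable_state z"
begin

lemma follower_lq_space:
  assumes "square_integrable_state x1" "square_integrable_process T M u1"
  shows "lq_space (follower_error x1 xa xb z) u1 (follower_terminal_error x1 xa xb z)"
  using assms xa xb z horizon_mem
  unfolding lq_space_def follower_error_def follower_terminal_error_def square_integrable_state_def
  by (auto intro!: sqi_diff sqi_mult_vec sqi_const[OF finite_N] sqi_const[OF finite_measure_axioms])

lemma follower_form_nonneg: "0 \<le> follower_form e v eT e v eT"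
  unfolding follower_form_def by (rule lq_form_nonneg(1)[OF weights_nonneg(3,9,6)])

lemma follower_cost_eq:
  assumes "square_integrable_state x1" "square_integrable_process T M u1"
  shows "follower_cost \<G> \<N> u1 x1 xa xb z = ennreal (follower_form (follower_error x1 xa xb z) u1 (follower_terminal_error x1 xa xb z)
      (follower_error x1 xa xb z) u1 (follower_terminal_error x1 xa xb z))"
  using lq_cost_eq[OF weights_nonneg(3,9,6) follower_lq_space[OF assms]]
  unfolding follower_cost_def follower_error_def follower_terminal_error_def follower_form_def .

lemma follower_form_expand:
  assumes "square_integrable_state x1" "square_integrable_process T M u1"
    "square_integrable_state y" "square_integrable_process T M w"
  shows "follower_form (follower_error (\<lambda>t \<omega>. x1 t \<omega> + c *\<^sub>R y t \<omega>) xa xb z) (\<lambda>t \<omega>. u1 t \<omega> + c *\<^sub>R w t \<omega>)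
        (follower_terminal_error (\<lambda>t \<omega>. x1 t \<omega> + c *\<^sub>R y t \<omega>) xa xb z)
      (follower_error (\<lambda>t \<omega>. x1 t \<omega> + c *\<^sub>R y t \<omega>) xa xb z) (\<lambda>t \<omega>. u1 t \<omega> + c *\<^sub>R w t \<omega>)
        (follower_terminal_error (\<lambda>t \<omega>. x1 t \<omega> + c *\<^sub>R y t \<omega>) xa xb z)
    = follower_form (follower_error x1 xa xb z) u1 (follower_terminal_error x1 xa xb z)
        (follower_error x1 xa xb z) u1 (follower_terminal_error x1 xa xb z)
      + 2 * c * follower_form y w (y T) (follower_error x1 xa xb z) u1 (follower_terminal_error x1 xa xb z)
      + c\<^sup>2 * follower_form y w (y T) y w (y T)"
proof -
  have e: "follower_error (\<lambda>t \<omega>. x1 t \<omega> + c *\<^sub>R y t \<omega>) xa xb z = (\<lambda>t \<omega>. follower_error x1 xa xb z t \<omega> + c *\<^sub>R y t \<omega>)"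
    "follower_terminal_error (\<lambda>t \<omega>. x1 t \<omega> + c *\<^sub>R y t \<omega>) xa xb z = (\<lambda>\<omega>. follower_terminal_error x1 xa xb z \<omega> + c *\<^sub>R y T \<omega>)"
    by (simp_all add: follower_error_def follower_terminal_error_def fun_eq_iff algebra_simps)
  have Y: "lq_space y w (y T)" using assms horizon_mem unfolding lq_space_def square_integrable_state_def by auto
  show ?thesis unfolding e follower_form_def
    by (rule lq_form_expand[OF sym(3,9,6) follower_lq_space[OF assms(1,2)] Y])
qed

text \<open>Along the line through the optimum in a test direction, the cost is a real quadratic
  polynomial with its minimum at c = 0.\<close>

lemma follower_optimal_foc:
  assumes opt: "follower_optimal \<G> \<N> xa xb z u1 x1"
  shows "follower_foc u1 x1 xa xb z"
  unfolding follower_foc_def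
proof (intro allI impI)
  fix w y assume test: "follower_test w y"
  have u1: "L2_adapted T M \<G>\<^sub>1 u1" and st: "follower_state \<G> \<N> u1 xa xb z x1"
    using opt unfolding follower_optimal_def follower_admissible_def by auto
  have x1: "L2_adapted T M \<G>\<^sub>1 x1" using st unfolding follower_state_iff by simp
  note s = xa[unfolded square_integrable_state_def, THEN conjunct1] xb[unfolded square_integrable_state_def, THEN conjunct1]
    z[unfolded square_integrable_state_def, THEN conjunct1]
  note sx1 = follower_state_sqi[OF st u1 s] and su1 = L2_adapted_sqi[OF u1] and ty = follower_test_state[OF test]
  have w: "L2_adapted T M \<G>\<^sub>1 w" and y: "L2_adapted T M \<G>\<^sub>1 y" using test unfolding follower_test_def by auto
  let ?f = "follower_form (follower_error x1 xa xb z) u1 (follower_terminal_error x1 xa xb z)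
        (follower_error x1 xa xb z) u1 (follower_terminal_error x1 xa xb z)"
  let ?b = "follower_form y w (y T) (follower_error x1 xa xb z) u1 (follower_terminal_error x1 xa xb z)"
  let ?d = "follower_form y w (y T) y w (y T)"
  have "0 \<le> 2 * c * ?b + c\<^sup>2 * ?d" for c
  proof -
    let ?v = "\<lambda>t \<omega>. u1 t \<omega> + c *\<^sub>R w t \<omega>" and ?y = "\<lambda>t \<omega>. x1 t \<omega> + c *\<^sub>R y t \<omega>"
    have v: "L2_adapted T M \<G>\<^sub>1 ?v" by (intro L2_adapted_add u1 L2_adapted_scaleR w)
    have Y: "L2_adapted T M \<G>\<^sub>1 ?y" by (intro L2_adapted_add x1 L2_adapted_scaleR y)
    let ?g = "\<lambda>s \<omega>. A\<^sub>1 \<G> *v x1 s \<omega> + B\<^sub>1 \<G> *v z s \<omega> + C\<^sub>1 \<G> *v xa s \<omega> + D\<^sub>1 \<G> *v xb s \<omega> + E\<^sub>1 \<G> *v u1 s \<omega>"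
    let ?h = "\<lambda>s \<omega>. A\<^sub>1 \<G> *v y s \<omega> + E\<^sub>1 \<G> *v w s \<omega>"
    have sg: "square_integrable_process T M ?g" and sh: "square_integrable_process T M ?h"
      by (intro sqi_add sqi_mult_vec s L2_adapted_sqi[OF x1] su1 L2_adapted_sqi[OF y] L2_adapted_sqi[OF w])+
    have e: "(\<lambda>s \<omega>. A\<^sub>1 \<G> *v ?y s \<omega> + B\<^sub>1 \<G> *v z s \<omega> + C\<^sub>1 \<G> *v xa s \<omega> + D\<^sub>1 \<G> *v xb s \<omega> + E\<^sub>1 \<G> *v ?v s \<omega>)
        = (\<lambda>s \<omega>. ?g s \<omega> + c *\<^sub>R ?h s \<omega>)"
      by (simp add: fun_eq_iff matrix_vector_right_distrib mult_vec_scaleR algebra_simps)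
    have st': "follower_state \<G> \<N> ?v xa xb z ?y"
      unfolding follower_state_iff e
    proof (intro conjI Y ballI)
      fix t assume t: "t \<in> {0..T}"
      have x1_eq: "AE \<omega> in M. x1 t \<omega> = \<eta>\<^sub>1 \<N> \<omega> + running_integral ?g t \<omega> + \<sigma>\<^sub>1 \<G> *v W\<^sub>1 \<N> t \<omega>"
        using st t unfolding follower_state_iff by blast
      have y_eq: "AE \<omega> in M. y t \<omega> = running_integral ?h t \<omega>"
        using test t unfolding follower_test_def by blast
      show "AE \<omega> in M. ?y t \<omega> = \<eta>\<^sub>1 \<N> \<omega> + running_integral (\<lambda>s \<omega>. ?g s \<omega> + c *\<^sub>R ?h s \<omega>) t \<omega> + \<sigma>\<^sub>1 \<G> *v W\<^sub>1 \<N> t \<omega>"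
        using x1_eq y_eq running_integral_add[OF sg sqi_scaleR[OF sh, of c]]
          running_integral_bounded_linear[OF bounded_linear_scaleR_right[of c] sh]
        by eventually_elim (use t in \<open>simp add: algebra_simps\<close>)
    qed
    have "follower_cost \<G> \<N> u1 x1 xa xb z \<le> follower_cost \<G> \<N> ?v ?y xa xb z"
      using opt v st' unfolding follower_optimal_def follower_admissible_def by blast
    also have "\<dots> = ennreal (?f + 2 * c * ?b + c\<^sup>2 * ?d)"
      using follower_form_expand[OF sx1 su1 ty]
      by (subst follower_cost_eq[OF follower_state_sqi[OF st' v s] L2_adapted_sqi[OF v]]) simp
    finally have "ennreal ?f \<le> ennreal (?f + 2 * c * ?b + c\<^sup>2 * ?d)"
      unfolding follower_cost_eq[OF sx1 su1] .
    \<comment> \<open>Negative reals are truncated by \<open>ennreal\<close>, so the inequality of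
      costs is pulled back to the reals using that the right-hand side is nonnegative.\<close>
    moreover have "0 \<le> ?f + 2 * c * ?b + c\<^sup>2 * ?d"
      unfolding follower_form_expand[OF sx1 su1 ty, symmetric] by (rule follower_form_nonneg)
    ultimately show ?thesis by (simp add: ennreal_le_iff)
  qed
  moreover have "0 \<le> ?d" by (rule follower_form_nonneg)
  ultimately show "?b = 0" by (rule quadratic_nonneg_linear_zero)
qed

text \<open>Convexity: the difference to any competitor is a test direction, and in the expansion at
  c = 1 the linear term vanishes while the quadratic one is nonnegative.\<close>

lemma follower_foc_optimal:
  assumes u1: "L2_adapted T M \<G>\<^sub>1 u1" and st: "follower_state \<G> \<N> u1 xa xb z x1"
    and foc: "follower_foc u1 x1 xa xb z"
  shows "follower_optimal \<G> \<N> xa xb z u1 x1"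
  unfolding follower_optimal_def follower_admissible_def
proof (intro conjI allI impI u1 st)
  fix v1 y1 assume "L2_adapted T M \<G>\<^sub>1 v1 \<and> follower_state \<G> \<N> v1 xa xb z y1"
  then have v1: "L2_adapted T M \<G>\<^sub>1 v1" and st': "follower_state \<G> \<N> v1 xa xb z y1" by auto
  have x1: "L2_adapted T M \<G>\<^sub>1 x1" and y1: "L2_adapted T M \<G>\<^sub>1 y1"
    using st st' unfolding follower_state_iff by auto
  note s = xa[unfolded square_integrable_state_def, THEN conjunct1] xb[unfolded square_integrable_state_def, THEN conjunct1]
    z[unfolded square_integrable_state_def, THEN conjunct1]
  note sx1 = follower_state_sqi[OF st u1 s] and su1 = L2_adapted_sqi[OF u1]
  let ?w = "\<lambda>t \<omega>. v1 t \<omega> - u1 t \<omega>" and ?y = "\<lambda>t \<omega>. y1 t \<omega> - x1 t \<omega>"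
  let ?g = "\<lambda>x1 u1 s \<omega>. A\<^sub>1 \<G> *v x1 s \<omega> + B\<^sub>1 \<G> *v z s \<omega> + C\<^sub>1 \<G> *v xa s \<omega> + D\<^sub>1 \<G> *v xb s \<omega> + E\<^sub>1 \<G> *v u1 s \<omega>"
  have sg: "square_integrable_process T M (?g x1 u1)" "square_integrable_process T M (?g y1 v1)"
    by (intro sqi_add sqi_mult_vec s L2_adapted_sqi[OF x1] su1 L2_adapted_sqi[OF y1] L2_adapted_sqi[OF v1])+
  have e: "(\<lambda>s \<omega>. A\<^sub>1 \<G> *v ?y s \<omega> + E\<^sub>1 \<G> *v ?w s \<omega>) = (\<lambda>s \<omega>. ?g y1 v1 s \<omega> - ?g x1 u1 s \<omega>)"
    by (simp add: fun_eq_iff matrix_vector_mult_diff_distrib algebra_simps)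
  have test: "follower_test ?w ?y"
    unfolding follower_test_def e
  proof (intro conjI L2_adapted_diff v1 u1 y1 x1 ballI)
    fix t assume t: "t \<in> {0..T}"
    have "AE \<omega> in M. x1 t \<omega> = \<eta>\<^sub>1 \<N> \<omega> + running_integral (?g x1 u1) t \<omega> + \<sigma>\<^sub>1 \<G> *v W\<^sub>1 \<N> t \<omega>"
      "AE \<omega> in M. y1 t \<omega> = \<eta>\<^sub>1 \<N> \<omega> + running_integral (?g y1 v1) t \<omega> + \<sigma>\<^sub>1 \<G> *v W\<^sub>1 \<N> t \<omega>"
      using st st' t unfolding follower_state_iff by blast+
    with running_integral_diff[OF sg(2,1)]
    show "AE \<omega> in M. ?y t \<omega> = running_integral (\<lambda>s \<omega>. ?g y1 v1 s \<omega> - ?g x1 u1 s \<omega>) t \<omega>"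
      by eventually_elim (use t in \<open>simp add: algebra_simps\<close>)
  qed
  note ex = follower_form_expand[OF sx1 su1 follower_test_state[OF test], of 1]
  have "follower_form (follower_error x1 xa xb z) u1 (follower_terminal_error x1 xa xb z)
        (follower_error x1 xa xb z) u1 (follower_terminal_error x1 xa xb z)
      \<le> follower_form (follower_error y1 xa xb z) v1 (follower_terminal_error y1 xa xb z)
        (follower_error y1 xa xb z) v1 (follower_terminal_error y1 xa xb z)"
    using ex foc[unfolded follower_foc_def, rule_format, OF test] follower_form_nonneg[of ?y ?w "?y T"] by simp
  then show "follower_cost \<G> \<N> u1 x1 xa xb z \<le> follower_cost \<G> \<N> v1 y1 xa xb z"
    unfolding follower_cost_eq[OF sx1 su1] follower_cost_eq[OF follower_state_sqi[OF st' v1 s] L2_adapted_sqi[OF v1]]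
    by (rule ennreal_leI)
qed

end

end

context game_space
begin

section \<open>Responses to the leaders' controls\<close>

lemma leader_states_iff:
  "leader_states \<G> \<N> va vb xa xb z \<longleftrightarrow>
     L2_adapted T M \<F> xa \<and> L2_adapted T M \<F> xb \<and>
     (\<forall>t\<in>{0..T}. AE \<omega> in M. xa t \<omega> = \<eta>\<^sub>\<alpha> \<N> \<omega>
        + running_integral (\<lambda>s \<omega>. A\<^sub>\<alpha> \<G> *v xa s \<omega> + B\<^sub>\<alpha> \<G> *v xb s \<omega> + C\<^sub>\<alpha> \<G> *v z s \<omega> + D\<^sub>\<alpha> \<G> *v va s \<omega>) t \<omega>
        + \<sigma>\<^sub>\<alpha> \<G> *v W\<^sub>\<alpha> \<N> t \<omega>) \<and>
     (\<forall>t\<in>{0..T}. AE \<omega> in M. xb t \<omega> = \<eta>\<^sub>\<beta> \<N> \<omega>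
        + running_integral (\<lambda>s \<omega>. A\<^sub>\<beta> \<G> *v xa s \<omega> + B\<^sub>\<beta> \<G> *v xb s \<omega> + C\<^sub>\<beta> \<G> *v z s \<omega> + D\<^sub>\<beta> \<G> *v vb s \<omega>) t \<omega>
        + \<sigma>\<^sub>\<beta> \<G> *v W\<^sub>\<beta> \<N> t \<omega>)"
  unfolding leader_states_def running_integral_def by simp

lemma leader_states_sqi:
  assumes st: "leader_states \<G> \<N> va vb xa xb z" and adm: "admissible_pair \<G> \<N> va vb"
    and z: "square_integrable_process T M z"
  shows "square_integrable_state xa" "square_integrable_state xb"
proof -
  have xa: "L2_adapted T M \<F> xa" and xb: "L2_adapted T M \<F> xb" using st unfolding leader_states_iff by auto
  have v: "square_integrable_process T M va" "square_integrable_process T M vb"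
    using adm L2_adapted_sqi unfolding admissible_pair_def by auto
  let ?f = "\<lambda>s \<omega>. A\<^sub>\<alpha> \<G> *v xa s \<omega> + B\<^sub>\<alpha> \<G> *v xb s \<omega> + C\<^sub>\<alpha> \<G> *v z s \<omega> + D\<^sub>\<alpha> \<G> *v va s \<omega>"
  let ?g = "\<lambda>s \<omega>. A\<^sub>\<beta> \<G> *v xa s \<omega> + B\<^sub>\<beta> \<G> *v xb s \<omega> + C\<^sub>\<beta> \<G> *v z s \<omega> + D\<^sub>\<beta> \<G> *v vb s \<omega>"
  have f: "square_integrable_process T M ?f" and g: "square_integrable_process T M ?g"
    by (intro sqi_add sqi_mult_vec v z L2_adapted_sqi[OF xa] L2_adapted_sqi[OF xb])+
  show "square_integrable_state xa"
  proof (rule square_integrable_stateI[OF leader_filtration_on xa f])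
    fix t assume t: "t \<in> {0..T}"
    show "square_integrable_rv M (\<lambda>\<omega>. \<eta>\<^sub>\<alpha> \<N> \<omega> + \<sigma>\<^sub>\<alpha> \<G> *v W\<^sub>\<alpha> \<N> t \<omega>)"
      by (intro sqi_add sqi_mult_vec initial_sqi wiener_sqi[OF wiener(1)]) (use t in simp)
    have "AE \<omega> in M. xa t \<omega> = \<eta>\<^sub>\<alpha> \<N> \<omega> + running_integral ?f t \<omega> + \<sigma>\<^sub>\<alpha> \<G> *v W\<^sub>\<alpha> \<N> t \<omega>"
      using st t unfolding leader_states_iff by blast
    then show "AE \<omega> in M. xa t \<omega> = \<eta>\<^sub>\<alpha> \<N> \<omega> + \<sigma>\<^sub>\<alpha> \<G> *v W\<^sub>\<alpha> \<N> t \<omega> + running_integral ?f t \<omega>"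
      by eventually_elim (simp add: algebra_simps)
  qed
  show "square_integrable_state xb"
  proof (rule square_integrable_stateI[OF leader_filtration_on xb g])
    fix t assume t: "t \<in> {0..T}"
    show "square_integrable_rv M (\<lambda>\<omega>. \<eta>\<^sub>\<beta> \<N> \<omega> + \<sigma>\<^sub>\<beta> \<G> *v W\<^sub>\<beta> \<N> t \<omega>)"
      by (intro sqi_add sqi_mult_vec initial_sqi wiener_sqi[OF wiener(2)]) (use t in simp)
    have "AE \<omega> in M. xb t \<omega> = \<eta>\<^sub>\<beta> \<N> \<omega> + running_integral ?g t \<omega> + \<sigma>\<^sub>\<beta> \<G> *v W\<^sub>\<beta> \<N> t \<omega>"
      using st t unfolding leader_states_iff by blast
    then show "AE \<omega> in M. xb t \<omega> = \<eta>\<^sub>\<beta> \<N> \<omega> + \<sigma>\<^sub>\<beta> \<G> *v W\<^sub>\<beta> \<N> t \<omega> + running_integral ?g t \<omega>"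
      by eventually_elim (simp add: algebra_simps)
  qed
qed

text \<open>Turns the mean field condition from an equality with a version of a conditional
  expectation into one about tested expectations.\<close>

lemma orthogonal_at_cexp:
  fixes X :: "'w \<Rightarrow> real ^ 'n"
  assumes t: "t \<in> {0..T}" and X: "square_integrable_rv M X"
    and Y: "Y \<in> borel_measurable (\<F> t)" "AE \<omega> in M. Y \<omega> = conditional_expectation M (\<F> t) X \<omega>"
  shows "square_integrable_rv M Y" "orthogonal_at \<F> t (\<lambda>\<omega>. X \<omega> - Y \<omega>)"
proof -
  note P = finite_measure_axioms filtration_onD(1)[OF leader_filtration_on t]
  note C = cexp_sqi[OF P X]
  show Ys: "square_integrable_rv M Y" by (rule sqi_cong_AE[OF measurable_from_subalg[OF P(2) Y(1)] C Y(2)])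
  have "(\<integral>\<omega>. V \<omega> \<bullet> (X \<omega> - Y \<omega>) \<partial>M) = 0" if V: "V \<in> borel_measurable (\<F> t)" "square_integrable_rv M V" for V
  proof -
    have "(\<integral>\<omega>. V \<omega> \<bullet> Y \<omega> \<partial>M) = (\<integral>\<omega>. V \<omega> \<bullet> conditional_expectation M (\<F> t) X \<omega> \<partial>M)"
      by (rule integral_cong_AE) (use Y(2) sqi_D(1)[OF V(2)] sqi_D(1)[OF Ys] sqi_D(1)[OF C] in auto)
    then show ?thesis
      using cexp_inner[OF P X V(2,1)] sqi_inner_integrable[OF V(2) X] sqi_inner_integrable[OF V(2) Ys]
      unfolding inner_diff_right by simp
  qed
  then show "orthogonal_at \<F> t (\<lambda>\<omega>. X \<omega> - Y \<omega>)" unfolding orthogonal_at_def using sqi_diff[OF X Ys] by blast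
qed

text \<open>The form in which responses are used from here on: optimality of the follower as a
  first-order condition, the mean field condition as orthogonality of \<open>x1 - z\<close> at each
  time, and square-integrability at each time for the terminal costs.\<close>

lemma response_elim:
  assumes resp: "response \<G> \<N> va vb xa xb z" and adm: "admissible_pair \<G> \<N> va vb"
  obtains u1 x1 where "L2_adapted T M \<F> xa" "L2_adapted T M \<F> xb" "L2_adapted T M \<F> z"
    "square_integrable_state xa" "square_integrable_state xb" "square_integrable_state z"
    "L2_adapted T M \<G>\<^sub>1 u1" "L2_adapted T M \<G>\<^sub>1 x1" "square_integrable_state x1"
    "follower_state \<G> \<N> u1 xa xb z x1" "follower_foc u1 x1 xa xb z"
    "\<And>t. t \<in> {0..T} \<Longrightarrow> orthogonal_at \<F> t (\<lambda>\<omega>. x1 t \<omega> - z t \<omega>)"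
proof -
  have st: "leader_states \<G> \<N> va vb xa xb z" and mf: "mean_field_equilibrium \<G> \<N> xa xb z"
    using resp unfolding response_def by auto
  have z: "L2_adapted T M \<F> z" using mf unfolding mean_field_equilibrium_def by auto
  have x: "L2_adapted T M \<F> xa" "L2_adapted T M \<F> xb" using st unfolding leader_states_iff by auto
  obtain u1 x1 where opt: "follower_optimal \<G> \<N> xa xb z u1 x1"
    and zc: "\<forall>t\<in>{0..T}. AE \<omega> in M. z t \<omega> = conditional_expectation M (\<F> t) (x1 t) \<omega>"
    using mf unfolding mean_field_equilibrium_def by auto
  have u1: "L2_adapted T M \<G>\<^sub>1 u1" and fs: "follower_state \<G> \<N> u1 xa xb z x1"
    using opt unfolding follower_optimal_def follower_admissible_def by auto
  have x1: "L2_adapted T M \<G>\<^sub>1 x1" using fs unfolding follower_state_iff by auto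
  note sx = leader_states_sqi[OF st adm L2_adapted_sqi[OF z]]
  have sx1: "square_integrable_state x1"
    by (rule follower_state_sqi[OF fs u1 L2_adapted_sqi[OF x(1)] L2_adapted_sqi[OF x(2)] L2_adapted_sqi[OF z]])
  note o = orthogonal_at_cexp[OF _ _ L2_adapted_at[OF z] bspec[OF zc]]
  have sx1_at: "\<And>t. t \<in> {0..T} \<Longrightarrow> square_integrable_rv M (x1 t)" using sx1 unfolding square_integrable_state_def by auto
  have sz: "square_integrable_state z"
    unfolding square_integrable_state_def using L2_adapted_sqi[OF z] o(1)[OF _ sx1_at] by blast
  show ?thesis
    by (rule that[OF x z sx sz u1 x1 sx1 fs follower_optimal_foc[OF sx sz opt] o(2)[OF _ sx1_at]]) auto
qed

end

section \<open>The solution of the FBSDE\<close>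

locale fbsde_solution = game_space \<G> \<N>
  for \<G> :: "('na::finite, 'nb::finite, 'n1::finite, 'ma::finite, 'mb::finite, 'm1::finite,
                'da::finite, 'db::finite, 'd1::finite) game"
    and \<N> :: "('w, 'na, 'nb, 'n1, 'da, 'db, 'd1) noise" +
  fixes x p :: "real \<Rightarrow> 'w \<Rightarrow> real ^ ('na, 'nb, 'n1) idx5" and Z
  assumes solution: "pareto_fbsde \<G> \<N> x p Z"
begin

abbreviation (input) "x\<^sub>\<alpha> \<equiv> \<lambda>t \<omega>. blk1 (x t \<omega>)"
abbreviation (input) "x\<^sub>\<beta> \<equiv> \<lambda>t \<omega>. blk2 (x t \<omega>)"
abbreviation (input) "z\<^sub>P \<equiv> \<lambda>t \<omega>. blk3 (x t \<omega>)"
abbreviation (input) "s\<^sub>P \<equiv> \<lambda>t \<omega>. blk4 (x t \<omega>) + blk5 (x t \<omega>)"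
abbreviation (input) "r\<^sub>P \<equiv> \<lambda>t \<omega>. blk4 (p t \<omega>) + blk5 (p t \<omega>)"

definition "u\<^sub>\<alpha> t \<omega> = - ((matrix_inv (R\<^sub>\<alpha> \<G>) ** transpose (D\<^sub>\<alpha> \<G>)) *v blk1 (p t \<omega>))"
definition "u\<^sub>\<beta> t \<omega> = - ((matrix_inv (R\<^sub>\<beta> \<G>) ** transpose (D\<^sub>\<beta> \<G>)) *v blk2 (p t \<omega>))"
text \<open>This will be the leader-adapted part of the follower's optimal control. In contrast
  \<open>u\<^sub>r\<close> is no player's control: it steers the multiplier
  \<open>s\<^sub>P\<close>.\<close>

definition "u\<^sub>\<zeta> t \<omega> = - ((matrix_inv (R\<^sub>1 \<G>) ** transpose (E\<^sub>1 \<G>)) *v blk3 (p t \<omega>))"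
definition "u\<^sub>r t \<omega> = - ((matrix_inv (R\<^sub>1 \<G>) ** transpose (E\<^sub>1 \<G>)) *v (blk4 (p t \<omega>) + blk5 (p t \<omega>)))"

lemma x_adapted: "L2_adapted T M \<F> x" and p_adapted: "L2_adapted T M \<F> p"
  using solution unfolding pareto_fbsde_def Let_def by auto

lemma x_eq: "t \<in> {0..T} \<Longrightarrow> AE \<omega> in M. x t \<omega> = x0_vec \<N> \<omega>
    + running_integral (\<lambda>s \<omega>. A_mat \<G> *v x s \<omega> - BP_mat \<G> *v p s \<omega>) t \<omega> + Sigma_mat \<G> *v W_vec \<N> t \<omega>"
  using solution unfolding pareto_fbsde_def Let_def running_integral_def by auto

lemmas blk_bounded_linear =
  bounded_linear_head_block
  bounded_linear_compose[OF bounded_linear_head_block bounded_linear_tail_block]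
  bounded_linear_compose[OF bounded_linear_head_block bounded_linear_compose[OF bounded_linear_tail_block bounded_linear_tail_block]]
  bounded_linear_add[OF bounded_linear_compose[OF bounded_linear_head_block bounded_linear_compose[OF
      bounded_linear_tail_block bounded_linear_compose[OF bounded_linear_tail_block bounded_linear_tail_block]]]
    bounded_linear_compose[OF bounded_linear_tail_block bounded_linear_compose[OF
      bounded_linear_tail_block bounded_linear_compose[OF bounded_linear_tail_block bounded_linear_tail_block]]]]

lemma blocks_adapted:
  "L2_adapted T M \<F> x\<^sub>\<alpha>" "L2_adapted T M \<F> x\<^sub>\<beta>" "L2_adapted T M \<F> z\<^sub>P" "L2_adapted T M \<F> s\<^sub>P"
  "L2_adapted T M \<F> (\<lambda>t \<omega>. blk1 (p t \<omega>))" "L2_adapted T M \<F> (\<lambda>t \<omega>. blk2 (p t \<omega>))"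
  "L2_adapted T M \<F> (\<lambda>t \<omega>. blk3 (p t \<omega>))" "L2_adapted T M \<F> r\<^sub>P"
  by (rule L2_adapted_bounded_linear[OF blk_bounded_linear(1) x_adapted]
      L2_adapted_bounded_linear[OF blk_bounded_linear(2) x_adapted]
      L2_adapted_bounded_linear[OF blk_bounded_linear(3) x_adapted]
      L2_adapted_bounded_linear[OF blk_bounded_linear(4) x_adapted]
      L2_adapted_bounded_linear[OF blk_bounded_linear(1) p_adapted]
      L2_adapted_bounded_linear[OF blk_bounded_linear(2) p_adapted]
      L2_adapted_bounded_linear[OF blk_bounded_linear(3) p_adapted]
      L2_adapted_bounded_linear[OF blk_bounded_linear(4) p_adapted])+

lemma controls_adapted:
  "L2_adapted T M \<F> u\<^sub>\<alpha>" "L2_adapted T M \<F> u\<^sub>\<beta>" "L2_adapted T M \<F> u\<^sub>\<zeta>" "L2_adapted T M \<F> u\<^sub>r"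
  unfolding u\<^sub>\<alpha>_def[abs_def] u\<^sub>\<beta>_def[abs_def] u\<^sub>\<zeta>_def[abs_def] u\<^sub>r_def[abs_def]
  by (rule L2_adapted_uminus[OF L2_adapted_mult_vec], rule blocks_adapted)+

lemma drift_sqi: "square_integrable_process T M (\<lambda>s \<omega>. A_mat \<G> *v x s \<omega> - BP_mat \<G> *v p s \<omega>)"
  by (intro sqi_diff sqi_mult_vec L2_adapted_sqi[OF x_adapted] L2_adapted_sqi[OF p_adapted])

lemma component_eq:
  fixes h :: "real ^ ('na, 'nb, 'n1) idx5 \<Rightarrow> 'e::euclidean_space"
  assumes h: "bounded_linear h" and t: "t \<in> {0..T}"
    and f: "\<And>s \<omega>. h (A_mat \<G> *v x s \<omega> - BP_mat \<G> *v p s \<omega>) = f s \<omega>"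
  shows "AE \<omega> in M. h (x t \<omega>) = h (x0_vec \<N> \<omega>) + running_integral f t \<omega> + h (Sigma_mat \<G> *v W_vec \<N> t \<omega>)"
  using x_eq[OF t] running_integral_bounded_linear[OF h drift_sqi, unfolded f]
  by eventually_elim (use t in \<open>simp add: linear_simps(1)[OF h]\<close>)

text \<open>Rewrites the feedback term of the FBSDE as the control term of a state equation.\<close>

lemma control_split:
  "A - control_weight D R *v q = A + D *v (- ((matrix_inv R ** transpose D) *v q))"
  by (simp add: mult_vec_neg matrix_vector_mul_assoc matrix_mul_assoc)

lemma x\<^sub>\<alpha>_eq: "t \<in> {0..T} \<Longrightarrow> AE \<omega> in M. x\<^sub>\<alpha> t \<omega> = \<eta>\<^sub>\<alpha> \<N> \<omega>
    + running_integral (\<lambda>s \<omega>. A\<^sub>\<alpha> \<G> *v x\<^sub>\<alpha> s \<omega> + B\<^sub>\<alpha> \<G> *v x\<^sub>\<beta> s \<omega> + C\<^sub>\<alpha> \<G> *v z\<^sub>P s \<omega> + D\<^sub>\<alpha> \<G> *v u\<^sub>\<alpha> s \<omega>) t \<omega>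
    + \<sigma>\<^sub>\<alpha> \<G> *v W\<^sub>\<alpha> \<N> t \<omega>"
  using component_eq[OF blk_bounded_linear(1), of t "\<lambda>s \<omega>. A\<^sub>\<alpha> \<G> *v x\<^sub>\<alpha> s \<omega> + B\<^sub>\<alpha> \<G> *v x\<^sub>\<beta> s \<omega> + C\<^sub>\<alpha> \<G> *v z\<^sub>P s \<omega> + D\<^sub>\<alpha> \<G> *v u\<^sub>\<alpha> s \<omega>"]
  by (simp add: A_mat_mult BP_mat_mult control_split u\<^sub>\<alpha>_def x0_vec_def Sigma_mat_mult)

lemma x\<^sub>\<beta>_eq: "t \<in> {0..T} \<Longrightarrow> AE \<omega> in M. x\<^sub>\<beta> t \<omega> = \<eta>\<^sub>\<beta> \<N> \<omega>
    + running_integral (\<lambda>s \<omega>. A\<^sub>\<beta> \<G> *v x\<^sub>\<alpha> s \<omega> + B\<^sub>\<beta> \<G> *v x\<^sub>\<beta> s \<omega> + C\<^sub>\<beta> \<G> *v z\<^sub>P s \<omega> + D\<^sub>\<beta> \<G> *v u\<^sub>\<beta> s \<omega>) t \<omega>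
    + \<sigma>\<^sub>\<beta> \<G> *v W\<^sub>\<beta> \<N> t \<omega>"
  using component_eq[OF blk_bounded_linear(2), of t "\<lambda>s \<omega>. A\<^sub>\<beta> \<G> *v x\<^sub>\<alpha> s \<omega> + B\<^sub>\<beta> \<G> *v x\<^sub>\<beta> s \<omega> + C\<^sub>\<beta> \<G> *v z\<^sub>P s \<omega> + D\<^sub>\<beta> \<G> *v u\<^sub>\<beta> s \<omega>"]
  by (simp add: A_mat_mult BP_mat_mult control_split u\<^sub>\<beta>_def x0_vec_def Sigma_mat_mult)

lemma z\<^sub>P_eq: "t \<in> {0..T} \<Longrightarrow> AE \<omega> in M. z\<^sub>P t \<omega> = integral\<^sup>L M (\<eta>\<^sub>1 \<N>)
    + running_integral (\<lambda>s \<omega>. C\<^sub>1 \<G> *v x\<^sub>\<alpha> s \<omega> + D\<^sub>1 \<G> *v x\<^sub>\<beta> s \<omega> + (A\<^sub>1 \<G> + B\<^sub>1 \<G>) *v z\<^sub>P s \<omega> + E\<^sub>1 \<G> *v u\<^sub>\<zeta> s \<omega>) t \<omega>"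
  using component_eq[OF blk_bounded_linear(3), of t "\<lambda>s \<omega>. C\<^sub>1 \<G> *v x\<^sub>\<alpha> s \<omega> + D\<^sub>1 \<G> *v x\<^sub>\<beta> s \<omega> + (A\<^sub>1 \<G> + B\<^sub>1 \<G>) *v z\<^sub>P s \<omega> + E\<^sub>1 \<G> *v u\<^sub>\<zeta> s \<omega>"]
  by (simp add: A_mat_mult BP_mat_mult control_split u\<^sub>\<zeta>_def x0_vec_def Sigma_mat_mult)

text \<open>Initial value and diffusion vanish in the last two blocks, and both have the same
  dynamics, so their sum is a test process of the follower.\<close>

lemma s\<^sub>P_eq: "t \<in> {0..T} \<Longrightarrow> AE \<omega> in M. s\<^sub>P t \<omega>
    = running_integral (\<lambda>s \<omega>. A\<^sub>1 \<G> *v s\<^sub>P s \<omega> + E\<^sub>1 \<G> *v u\<^sub>r s \<omega>) t \<omega>"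
  using component_eq[OF blk_bounded_linear(4), of t "\<lambda>s \<omega>. A\<^sub>1 \<G> *v s\<^sub>P s \<omega> + E\<^sub>1 \<G> *v u\<^sub>r s \<omega>"]
  by (simp add: A_mat_mult BP_mat_mult control_split u\<^sub>r_def x0_vec_def Sigma_mat_mult
      matrix_vector_right_distrib mult_vec_neg algebra_simps)

lemma x_sqi: "square_integrable_state x"
proof (rule square_integrable_stateI[OF leader_filtration_on x_adapted drift_sqi])
  fix t assume t: "t \<in> {0..T}"
  have b: "bounded_linear (\<lambda>v :: real ^ 'na. v \<sslash> (0 :: real ^ 'nb) \<sslash> (0 :: real ^ 'n1) \<sslash> (0 :: real ^ 'n1) \<sslash> (0 :: real ^ 'n1))"
    "bounded_linear (\<lambda>v :: real ^ 'nb. (0 :: real ^ 'na) \<sslash> v \<sslash> (0 :: real ^ 'n1) \<sslash> (0 :: real ^ 'n1) \<sslash> (0 :: real ^ 'n1))"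
    by (intro bounded_linear_vstack bounded_linear_ident bounded_linear_zero)+
  have "x0_vec \<N> = (\<lambda>\<omega>. (\<eta>\<^sub>\<alpha> \<N> \<omega> \<sslash> 0 \<sslash> 0 \<sslash> 0 \<sslash> 0) + (0 \<sslash> \<eta>\<^sub>\<beta> \<N> \<omega> \<sslash> 0 \<sslash> 0 \<sslash> 0) + (0 \<sslash> 0 \<sslash> integral\<^sup>L M (\<eta>\<^sub>1 \<N>) \<sslash> 0 \<sslash> 0))"
    by (auto simp: x0_vec_def fun_eq_iff vec_eq_iff vstack_def split: sum.split)
  moreover have "square_integrable_rv M \<dots>"
    by (intro sqi_add sqi_bounded_linear[OF b(1) initial_sqi(1)] sqi_bounded_linear[OF b(2) initial_sqi(2)]
        sqi_const[OF finite_measure_axioms])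
  ultimately have "square_integrable_rv M (x0_vec \<N>)" by simp
  then show "square_integrable_rv M (\<lambda>\<omega>. x0_vec \<N> \<omega> + Sigma_mat \<G> *v W_vec \<N> t \<omega>)"
    by (intro sqi_add sqi_mult_vec sqi_W_vec) (use t in auto)
  show "AE \<omega> in M. x t \<omega> = x0_vec \<N> \<omega> + Sigma_mat \<G> *v W_vec \<N> t \<omega>
      + running_integral (\<lambda>s \<omega>. A_mat \<G> *v x s \<omega> - BP_mat \<G> *v p s \<omega>) t \<omega>"
    using x_eq[OF t] by eventually_elim (simp add: algebra_simps)
qed

lemma square_integrable_state_bounded_linear:
  fixes h :: "real ^ 'i \<Rightarrow> real ^ 'j"
  shows "bounded_linear h \<Longrightarrow> square_integrable_state y \<Longrightarrow> square_integrable_state (\<lambda>t \<omega>. h (y t \<omega>))"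
  unfolding square_integrable_state_def by (auto intro: sqi_bounded_linear)

lemma blocks_sqi:
  "square_integrable_state x\<^sub>\<alpha>" "square_integrable_state x\<^sub>\<beta>" "square_integrable_state z\<^sub>P" "square_integrable_state s\<^sub>P"
  by (rule square_integrable_state_bounded_linear[OF blk_bounded_linear(1) x_sqi]
      square_integrable_state_bounded_linear[OF blk_bounded_linear(2) x_sqi]
      square_integrable_state_bounded_linear[OF blk_bounded_linear(3) x_sqi]
      square_integrable_state_bounded_linear[OF blk_bounded_linear(4) x_sqi])+

text \<open>Although \<open>p\<close> is adapted to the leaders, the test process may use the
  follower's information, because increments of the stochastic integral are orthogonal to that as
  well.\<close>

lemma adjoint_duality:
  assumes f: "L2_adapted T M \<G>\<^sub>1 f" and y: "L2_adapted T M \<G>\<^sub>1 y"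
    and y_eq: "\<And>t. t \<in> {0..T} \<Longrightarrow> AE \<omega> in M. y t \<omega> = running_integral f t \<omega>"
  shows "(\<integral>\<omega>. y T \<omega> \<bullet> (EP_mat \<G> *v x T \<omega> + hP_vec \<G>) \<partial>M) =
    (\<integral>z. f (fst z) (snd z) \<bullet> p (fst z) (snd z) - y (fst z) (snd z) \<bullet> (CP_mat \<G> *v p (fst z) (snd z))
      - y (fst z) (snd z) \<bullet> (DP_mat \<G> *v x (fst z) (snd z) + MP_vec \<G>) \<partial>N)"
proof -
  obtain I where I: "ito_integral T M \<F> (W_vec \<N>) Z I"
    and p_eq: "\<forall>t\<in>{0..T}. AE \<omega> in M. p t \<omega> = EP_mat \<G> *v x T \<omega> + hP_vec \<G>
                + (LINT s:{t..T}|lborel. CP_mat \<G> *v p s \<omega> + DP_mat \<G> *v x s \<omega> + MP_vec \<G>) - (I T \<omega> - I t \<omega>)"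
    using solution unfolding pareto_fbsde_def Let_def by auto
  let ?g = "\<lambda>s \<omega>. CP_mat \<G> *v p s \<omega> + DP_mat \<G> *v x s \<omega> + MP_vec \<G>"
  note sx = L2_adapted_sqi[OF x_adapted] and sp = L2_adapted_sqi[OF p_adapted]
  have g: "square_integrable_process T M ?g"
    by (intro sqi_add sqi_mult_vec sx sp sqi_const[OF finite_N])
  have P: "square_integrable_rv M (\<lambda>\<omega>. EP_mat \<G> *v x T \<omega> + hP_vec \<G>)"
    using x_sqi horizon_mem unfolding square_integrable_state_def
    by (intro sqi_add sqi_mult_vec sqi_const[OF finite_measure_axioms]) auto
  have "(\<integral>\<omega>. y T \<omega> \<bullet> (EP_mat \<G> *v x T \<omega> + hP_vec \<G>) \<partial>M)
    = (\<integral>z. f (fst z) (snd z) \<bullet> p (fst z) (snd z) \<partial>N) - (\<integral>z. y (fst z) (snd z) \<bullet> ?g (fst z) (snd z) \<partial>N)"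
    by (rule backward_duality[OF follower_filtration_on f y y_eq sp g P, where I = I])
       (use p_eq ito_integral_orthogonal[OF I] in auto)
  also have "\<dots> = (\<integral>z. f (fst z) (snd z) \<bullet> p (fst z) (snd z) - y (fst z) (snd z) \<bullet> ?g (fst z) (snd z) \<partial>N)"
    by (rule Bochner_Integration.integral_diff[symmetric])
       (rule sqi_inner_integrable[OF L2_adapted_sqi[OF f] sp], rule sqi_inner_integrable[OF L2_adapted_sqi[OF y] g])
  finally show ?thesis by (simp add: inner_add_right algebra_simps)
qed

text \<open>Placed in the third block, a follower test process meets only the adjoint \<zeta>. Thus
  \<open>z\<^sub>P\<close> with \<open>u\<^sub>\<zeta>\<close> satisfies the follower's first-order
  condition in the role of his state and control, although its equation contains neither his noise
  nor his random initial value.\<close>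

lemma adjoint_follower_form:
  assumes test: "follower_test w y"
  shows "follower_form y w (y T) (follower_error z\<^sub>P x\<^sub>\<alpha> x\<^sub>\<beta> z\<^sub>P) u\<^sub>\<zeta> (follower_terminal_error z\<^sub>P x\<^sub>\<alpha> x\<^sub>\<beta> z\<^sub>P) = 0"
proof -
  have w: "L2_adapted T M \<G>\<^sub>1 w" and y: "L2_adapted T M \<G>\<^sub>1 y" and
    eq: "\<And>t. t \<in> {0..T} \<Longrightarrow> AE \<omega> in M. y t \<omega> = running_integral (\<lambda>s \<omega>. A\<^sub>1 \<G> *v y s \<omega> + E\<^sub>1 \<G> *v w s \<omega>) t \<omega>"
    using test unfolding follower_test_def by auto
  let ?h = "\<lambda>v :: real ^ 'n1. (0 :: real ^ 'na) \<sslash> (0 :: real ^ 'nb) \<sslash> v \<sslash> (0 :: real ^ 'n1) \<sslash> (0 :: real ^ 'n1)"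
  let ?f = "\<lambda>s \<omega>. A\<^sub>1 \<G> *v y s \<omega> + E\<^sub>1 \<G> *v w s \<omega>"
  have h: "bounded_linear ?h" by (intro bounded_linear_vstack bounded_linear_ident bounded_linear_zero)
  have f: "L2_adapted T M \<G>\<^sub>1 ?f" by (intro L2_adapted_add L2_adapted_mult_vec w y)
  let ?e = "follower_error z\<^sub>P x\<^sub>\<alpha> x\<^sub>\<beta> z\<^sub>P" and ?eT = "follower_terminal_error z\<^sub>P x\<^sub>\<alpha> x\<^sub>\<beta> z\<^sub>P"
  have "(\<integral>\<omega>. ?h (y T \<omega>) \<bullet> (EP_mat \<G> *v x T \<omega> + hP_vec \<G>) \<partial>M) =
    (\<integral>z. ?h (?f (fst z) (snd z)) \<bullet> p (fst z) (snd z) - ?h (y (fst z) (snd z)) \<bullet> (CP_mat \<G> *v p (fst z) (snd z))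
      - ?h (y (fst z) (snd z)) \<bullet> (DP_mat \<G> *v x (fst z) (snd z) + MP_vec \<G>) \<partial>N)"
  proof (rule adjoint_duality[OF L2_adapted_bounded_linear[OF h f] L2_adapted_bounded_linear[OF h y]])
    fix t assume t: "t \<in> {0..T}"
    show "AE \<omega> in M. ?h (y t \<omega>) = running_integral (\<lambda>s \<omega>. ?h (?f s \<omega>)) t \<omega>"
      using eq[OF t] running_integral_bounded_linear[OF h L2_adapted_sqi[OF f]]
      by eventually_elim (use t in simp)
  qed
  then have "(\<integral>\<omega>. y T \<omega> \<bullet> (Qb\<^sub>1 \<G> *v ?eT \<omega>) \<partial>M)
    = (\<integral>z. (E\<^sub>1 \<G> *v w (fst z) (snd z)) \<bullet> blk3 (p (fst z) (snd z)) - y (fst z) (snd z) \<bullet> (Q\<^sub>1 \<G> *v ?e (fst z) (snd z)) \<partial>N)"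
    unfolding drift_duality_follower EP_mat_def EN_mat_def hP_vec_def hN_vec_def DP_mat_def DN_mat_def MP_vec_def MN_vec_def
      weight_duality_follower[OF sym(1,2,3)] weight_duality_follower[OF sym(4,5,6)]
      follower_error_def follower_terminal_error_def .
  also have "\<dots> = (\<integral>z. (E\<^sub>1 \<G> *v w (fst z) (snd z)) \<bullet> blk3 (p (fst z) (snd z)) \<partial>N)
      - (\<integral>z. y (fst z) (snd z) \<bullet> (Q\<^sub>1 \<G> *v ?e (fst z) (snd z)) \<partial>N)"
  proof (rule Bochner_Integration.integral_diff)
    show "integrable N (\<lambda>z. (E\<^sub>1 \<G> *v w (fst z) (snd z)) \<bullet> blk3 (p (fst z) (snd z)))"
      by (rule sqi_inner_integrable[OF sqi_mult_vec[OF L2_adapted_sqi[OF w]] L2_adapted_sqi[OF blocks_adapted(7)]])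
    show "integrable N (\<lambda>z. y (fst z) (snd z) \<bullet> (Q\<^sub>1 \<G> *v ?e (fst z) (snd z)))"
      using follower_lq_space[OF blocks_sqi(1-3,3) L2_adapted_sqi[OF controls_adapted(3)]]
      unfolding lq_space_def by (intro sqi_inner_integrable L2_adapted_sqi[OF y] sqi_mult_vec) auto
  qed
  finally show ?thesis
    unfolding follower_form_def lq_form_def u\<^sub>\<zeta>_def mult_vec_neg control_weight_mult[OF weights_definite(3)]
      inner_minus_right inner_transpose_mult by simp
qed

end

section \<open>Dynamics of the mean field\<close>

lemma (in time_prob_space) orthogonal_at_unique:
  fixes A B :: "'w \<Rightarrow> real ^ 'n"
  assumes A: "A \<in> borel_measurable (F t)" "square_integrable_rv M A"
    and B: "B \<in> borel_measurable (F t)" "square_integrable_rv M B"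
    and o: "orthogonal_at F t (\<lambda>\<omega>. X \<omega> - A \<omega>)" "orthogonal_at F t (\<lambda>\<omega>. X \<omega> - B \<omega>)"
  shows "AE \<omega> in M. A \<omega> = B \<omega>"
proof -
  let ?D = "\<lambda>\<omega>. A \<omega> - B \<omega>"
  have D: "square_integrable_rv M ?D" by (rule sqi_diff[OF A(2) B(2)])
  have Dm: "?D \<in> borel_measurable (F t)" using A(1) B(1) by simp
  have X: "square_integrable_rv M (\<lambda>\<omega>. X \<omega> - A \<omega>)" "square_integrable_rv M (\<lambda>\<omega>. X \<omega> - B \<omega>)"
    and z: "(\<integral>\<omega>. ?D \<omega> \<bullet> (X \<omega> - A \<omega>) \<partial>M) = 0" "(\<integral>\<omega>. ?D \<omega> \<bullet> (X \<omega> - B \<omega>) \<partial>M) = 0"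
    using o D Dm unfolding orthogonal_at_def by blast+
  have "(\<integral>\<omega>. ?D \<omega> \<bullet> ?D \<omega> \<partial>M) = (\<integral>\<omega>. ?D \<omega> \<bullet> (X \<omega> - B \<omega>) - ?D \<omega> \<bullet> (X \<omega> - A \<omega>) \<partial>M)"
    by (simp add: inner_diff_right)
  also have "\<dots> = 0"
    using sqi_inner_integrable[OF D X(1)] sqi_inner_integrable[OF D X(2)] z by simp
  finally have "AE \<omega> in M. ?D \<omega> = 0" by (rule sqi_zero_AE[OF D])
  then show ?thesis by simp
qed

lemma (in time_prob_space) L2_adapted_vstack:
  fixes u :: "real \<Rightarrow> 'w \<Rightarrow> real ^ 'p::finite" and v :: "real \<Rightarrow> 'w \<Rightarrow> real ^ 'q::finite"
  assumes "L2_adapted T M F u" "L2_adapted T M F v"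
  shows "L2_adapted T M F (\<lambda>t \<omega>. u t \<omega> \<sslash> v t \<omega>)"
proof -
  have "(\<lambda>t \<omega>. u t \<omega> \<sslash> v t \<omega>) = (\<lambda>t \<omega>. (u t \<omega> \<sslash> 0) + (0 \<sslash> v t \<omega>))"
    by (auto simp: fun_eq_iff vec_eq_iff vstack_def split: sum.split)
  then show ?thesis
    using L2_adapted_add[OF L2_adapted_bounded_linear[OF bounded_linear_vstack_left assms(1)]
        L2_adapted_bounded_linear[OF bounded_linear_vstack_right assms(2)]] by simp
qed

lemma (in time_prob_space) running_integral_vstack:
  fixes u :: "real \<Rightarrow> 'w \<Rightarrow> real ^ 'p::finite" and v :: "real \<Rightarrow> 'w \<Rightarrow> real ^ 'q::finite"
  assumes u: "square_integrable_process T M u" and v: "square_integrable_process T M v"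
  shows "AE \<omega> in M. \<forall>t\<in>{0..T}. running_integral (\<lambda>s \<omega>. u s \<omega> \<sslash> v s \<omega>) t \<omega>
    = running_integral u t \<omega> \<sslash> running_integral v t \<omega>"
proof -
  have e: "(\<lambda>t \<omega>. u t \<omega> \<sslash> v t \<omega>) = (\<lambda>t \<omega>. (u t \<omega> \<sslash> 0) + (0 \<sslash> v t \<omega>))"
    by (auto simp: fun_eq_iff vec_eq_iff vstack_def split: sum.split)
  have e': "(a \<sslash> 0) + (0 \<sslash> b) = a \<sslash> b" for a :: "real ^ 'p" and b :: "real ^ 'q"
    by (auto simp: vec_eq_iff vstack_def split: sum.split)
  have hl: "bounded_linear (\<lambda>x :: real ^ 'p. x \<sslash> (0 :: real ^ 'q))" by (rule bounded_linear_vstack_left)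
  have hr: "bounded_linear (\<lambda>x :: real ^ 'q. (0 :: real ^ 'p) \<sslash> x)" by (rule bounded_linear_vstack_right)
  show ?thesis unfolding e
    using running_integral_add[OF sqi_bounded_linear[OF hl u] sqi_bounded_linear[OF hr v]]
      running_integral_bounded_linear[OF hl u] running_integral_bounded_linear[OF hr v]
    by eventually_elim (simp add: e')
qed

context game_space
begin

text \<open>The right-hand side, in an adapted version, differs from \<open>x1\<close> by something
  orthogonal to the leaders' information at t: the follower's noise and the fluctuation of his
  initial value are independent of it, and the drifts differ by an orthogonal process. Up to null
  sets \<open>z\<close> is the only adapted variable with this property.\<close>

lemma mean_field_dynamics:
  fixes z :: "real \<Rightarrow> 'w \<Rightarrow> real ^ 'n1"
  assumes x: "L2_adapted T M \<F> xa" "L2_adapted T M \<F> xb" and z: "L2_adapted T M \<F> z" "square_integrable_state z"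
    and u1: "L2_adapted T M \<G>\<^sub>1 u1" and x1: "L2_adapted T M \<G>\<^sub>1 x1" "square_integrable_state x1"
    and st: "follower_state \<G> \<N> u1 xa xb z x1"
    and o: "\<And>t. t \<in> {0..T} \<Longrightarrow> orthogonal_at \<F> t (\<lambda>\<omega>. x1 t \<omega> - z t \<omega>)"
    and ub: "L2_adapted T M \<F> ub" "orthogonal_process \<F> (\<lambda>t \<omega>. u1 t \<omega> - ub t \<omega>)"
    and t: "t \<in> {0..T}"
  shows "AE \<omega> in M. z t \<omega> = integral\<^sup>L M (\<eta>\<^sub>1 \<N>)
    + running_integral (\<lambda>s \<omega>. C\<^sub>1 \<G> *v xa s \<omega> + D\<^sub>1 \<G> *v xb s \<omega> + (A\<^sub>1 \<G> + B\<^sub>1 \<G>) *v z s \<omega> + E\<^sub>1 \<G> *v ub s \<omega>) t \<omega>"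
proof -
  let ?h = "\<lambda>s \<omega>. C\<^sub>1 \<G> *v xa s \<omega> + D\<^sub>1 \<G> *v xb s \<omega> + (A\<^sub>1 \<G> + B\<^sub>1 \<G>) *v z s \<omega> + E\<^sub>1 \<G> *v ub s \<omega>"
  let ?k = "\<lambda>s \<omega>. A\<^sub>1 \<G> *v x1 s \<omega> + B\<^sub>1 \<G> *v z s \<omega> + C\<^sub>1 \<G> *v xa s \<omega> + D\<^sub>1 \<G> *v xb s \<omega> + E\<^sub>1 \<G> *v u1 s \<omega>"
  note lift = L2_adapted_mono[OF _ leader_in_follower]
  have h: "L2_adapted T M \<F> ?h" by (intro L2_adapted_add L2_adapted_mult_vec x z ub)
  have k: "L2_adapted T M \<G>\<^sub>1 ?k" by (intro L2_adapted_add L2_adapted_mult_vec x1 u1 lift[OF x(1)] lift[OF x(2)] lift[OF z(1)])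
  note sh = L2_adapted_sqi[OF h] and sk = L2_adapted_sqi[OF k]
  \<comment> \<open>The integral itself may fail to be measurable for \<open>\<F> t\<close>, so an
    adapted version takes its place.\<close>
  obtain y where y: "L2_adapted T M \<F> y" and y_eq: "\<And>t. t \<in> {0..T} \<Longrightarrow> AE \<omega> in M. y t \<omega> = running_integral ?h t \<omega>"
    using adapted_running_integral[OF leader_filtration_on h] by blast
  let ?m = "integral\<^sup>L M (\<eta>\<^sub>1 \<N>)"
  let ?Y = "\<lambda>\<omega>. ?m + y t \<omega>"
  have sc: "square_integrable_rv M (\<lambda>_. ?m)" by (rule sqi_const[OF finite_measure_axioms])
  have Ym: "?Y \<in> borel_measurable (\<F> t)" using L2_adapted_at[OF y t] by simp
  have YM: "?Y \<in> borel_measurable M"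
    by (rule measurable_from_subalg[OF filtration_onD(1)[OF leader_filtration_on t] Ym])
  have "AE \<omega> in M. ?Y \<omega> = ?m + running_integral ?h t \<omega>" using y_eq[OF t] by eventually_elim simp
  from sqi_cong_AE[OF YM sqi_add[OF sc sqi_running_integral_at[OF sh t]] this]
  have sY: "square_integrable_rv M ?Y" .
  have sx1t: "square_integrable_rv M (x1 t)" and szt: "square_integrable_rv M (z t)"
    using x1(2) z(2) t unfolding square_integrable_state_def by auto
  \<comment> \<open>The leaders' states and \<open>B\<^sub>1 \<G> *v z\<close> cancel; only the
    deviations \<open>x1 - z\<close> and \<open>u1 - ub\<close> are left.\<close>
  have d: "(\<lambda>s \<omega>. ?k s \<omega> - ?h s \<omega>) = (\<lambda>s \<omega>. A\<^sub>1 \<G> *v (x1 s \<omega> - z s \<omega>) + E\<^sub>1 \<G> *v (u1 s \<omega> - ub s \<omega>))"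
    by (simp add: fun_eq_iff matrix_vector_mult_diff_distrib matrix_vector_mult_add_rdistrib algebra_simps)
  have "orthogonal_process \<F> (\<lambda>s \<omega>. x1 s \<omega> - z s \<omega>)"
    by (rule orthogonal_process_pointwise[OF sqi_diff[OF L2_adapted_sqi[OF x1(1)] L2_adapted_sqi[OF z(1)]] o])
  from orthogonal_process_add[OF orthogonal_process_mult_vec[OF this, of "A\<^sub>1 \<G>"] orthogonal_process_mult_vec[OF ub(2), of "E\<^sub>1 \<G>"]]
  have od: "orthogonal_process \<F> (\<lambda>s \<omega>. ?k s \<omega> - ?h s \<omega>)" unfolding d .
  have "orthogonal_at \<F> t (\<lambda>\<omega>. x1 t \<omega> - ?Y \<omega>)"
    unfolding orthogonal_at_def
  proof (intro conjI allI impI sqi_diff[OF sx1t sY])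
    fix V :: "'w \<Rightarrow> real ^ 'n1" assume V: "V \<in> borel_measurable (\<F> t)" "square_integrable_rv M V"
    have VT: "V \<in> borel_measurable (\<F> T)"
      by (rule filtration_measurable_mono[OF leader_filtration_on t horizon_mem _ V(1)]) (use t in simp)
    let ?R = "running_integral (\<lambda>s \<omega>. ?k s \<omega> - ?h s \<omega>) t"
    have sW: "square_integrable_rv M (\<lambda>\<omega>. \<sigma>\<^sub>1 \<G> *v W\<^sub>1 \<N> t \<omega>)"
      by (intro sqi_mult_vec wiener_sqi[OF wiener(3)]) (use t in simp)
    have sR: "square_integrable_rv M ?R" by (rule sqi_running_integral_at[OF sqi_diff[OF sk sh] t])
    note ii = sqi_inner_integrable[OF V(2)]
    have x1_eq: "AE \<omega> in M. x1 t \<omega> = \<eta>\<^sub>1 \<N> \<omega> + running_integral ?k t \<omega> + \<sigma>\<^sub>1 \<G> *v W\<^sub>1 \<N> t \<omega>"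
      using st t unfolding follower_state_iff by blast
    have "(\<integral>\<omega>. V \<omega> \<bullet> (x1 t \<omega> - ?Y \<omega>) \<partial>M)
        = (\<integral>\<omega>. (V \<omega> \<bullet> \<eta>\<^sub>1 \<N> \<omega> - V \<omega> \<bullet> ?m) + V \<omega> \<bullet> ?R \<omega> + V \<omega> \<bullet> (\<sigma>\<^sub>1 \<G> *v W\<^sub>1 \<N> t \<omega>) \<partial>M)"
    proof (rule integral_cong_AE)
      show "AE \<omega> in M. V \<omega> \<bullet> (x1 t \<omega> - ?Y \<omega>) = (V \<omega> \<bullet> \<eta>\<^sub>1 \<N> \<omega> - V \<omega> \<bullet> ?m) + V \<omega> \<bullet> ?R \<omega> + V \<omega> \<bullet> (\<sigma>\<^sub>1 \<G> *v W\<^sub>1 \<N> t \<omega>)"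
        using x1_eq y_eq[OF t] running_integral_diff[OF sk sh]
        by eventually_elim (use t in \<open>simp add: inner_add_right inner_diff_right\<close>)
    qed (use ii[OF sqi_diff[OF sx1t sY]] ii[OF initial_sqi(3)] ii[OF sc] ii[OF sR] ii[OF sW] in \<open>auto dest!: borel_measurable_integrable\<close>)
    also have "\<dots> = ((\<integral>\<omega>. V \<omega> \<bullet> \<eta>\<^sub>1 \<N> \<omega> \<partial>M) - (\<integral>\<omega>. V \<omega> \<bullet> ?m \<partial>M)) + (\<integral>\<omega>. V \<omega> \<bullet> ?R \<omega> \<partial>M)
        + (\<integral>\<omega>. V \<omega> \<bullet> (\<sigma>\<^sub>1 \<G> *v W\<^sub>1 \<N> t \<omega>) \<partial>M)"
      using ii[OF initial_sqi(3)] ii[OF sc] ii[OF sR] ii[OF sW] by (simp del: integral_inner_left)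
    also have "\<dots> = 0"
      using eta1_mean[OF V] W1_mean[OF V, of t "\<sigma>\<^sub>1 \<G>"] t
        orthogonal_running_integral[OF leader_immersed L2_adapted_diff[OF k lift[OF h]] od t VT V(2)] by simp
    finally show "(\<integral>\<omega>. V \<omega> \<bullet> (x1 t \<omega> - ?Y \<omega>) \<partial>M) = 0" .
  qed
  from orthogonal_at_unique[OF L2_adapted_at[OF z(1) t] szt Ym sY o[OF t] this] y_eq[OF t]
  show ?thesis by eventually_elim simp
qed

end

section \<open>The FBSDE solution as the response to its controls\<close>

context fbsde_solution
begin

text \<open>The follower's fluctuation around its conditional mean does not depend on the leaders' states:
  it is taken over from any response to the same controls.\<close>

lemma response_of_solution:
  assumes resp: "response \<G> \<N> u\<^sub>\<alpha> u\<^sub>\<beta> xa xb z"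
  shows "response \<G> \<N> u\<^sub>\<alpha> u\<^sub>\<beta> x\<^sub>\<alpha> x\<^sub>\<beta> z\<^sub>P"
proof -
  have adm: "admissible_pair \<G> \<N> u\<^sub>\<alpha> u\<^sub>\<beta>" unfolding admissible_pair_def using controls_adapted by simp
  obtain u1 x1 where x: "L2_adapted T M \<F> xa" "L2_adapted T M \<F> xb" and z: "L2_adapted T M \<F> z"
    and sx: "square_integrable_state xa" "square_integrable_state xb" and sz: "square_integrable_state z"
    and u1: "L2_adapted T M \<G>\<^sub>1 u1" and x1: "L2_adapted T M \<G>\<^sub>1 x1" "square_integrable_state x1"
    and st: "follower_state \<G> \<N> u1 xa xb z x1" and foc: "follower_foc u1 x1 xa xb z"
    and o: "\<And>t. t \<in> {0..T} \<Longrightarrow> orthogonal_at \<F> t (\<lambda>\<omega>. x1 t \<omega> - z t \<omega>)"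
    by (rule response_elim[OF resp adm]) blast
  note lift = L2_adapted_mono[OF _ leader_in_follower]
  \<comment> \<open>What the leaders see of the follower's control; the remainder
    \<open>u1 - ub\<close> is the part to be transplanted.\<close>
  define ub where "ub = adapted_projection \<F> u1"
  have ub: "L2_adapted T M \<F> ub" and oub: "orthogonal_process \<F> (\<lambda>t \<omega>. u1 t \<omega> - ub t \<omega>)"
    unfolding ub_def by (rule L2_adapted_projection[OF leader_filtration_on L2_adapted_sqi[OF u1]],
        rule orthogonal_projection[OF leader_filtration_on L2_adapted_sqi[OF u1]])
  have ox: "orthogonal_process \<F> (\<lambda>t \<omega>. x1 t \<omega> - z t \<omega>)"
    by (rule orthogonal_process_pointwise[OF sqi_diff[OF L2_adapted_sqi[OF x1(1)] L2_adapted_sqi[OF z]] o])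
  \<comment> \<open>The fluctuations of the given response are put on top of the FBSDE:
    \<open>u\<^sub>\<zeta>\<close> and \<open>z\<^sub>P\<close> replace \<open>ub\<close> and
    \<open>z\<close>.\<close>
  define v where "v t \<omega> = u\<^sub>\<zeta> t \<omega> + (u1 t \<omega> - ub t \<omega>)" for t \<omega>
  define y where "y t \<omega> = z\<^sub>P t \<omega> + (x1 t \<omega> - z t \<omega>)" for t \<omega>
  have v: "L2_adapted T M \<G>\<^sub>1 v" unfolding v_def
    by (intro L2_adapted_add L2_adapted_diff u1 lift[OF ub] lift[OF controls_adapted(3)])
  have y: "L2_adapted T M \<G>\<^sub>1 y" unfolding y_def
    by (intro L2_adapted_add L2_adapted_diff x1 lift[OF z] lift[OF blocks_adapted(3)])
  let ?a = "\<lambda>s \<omega>. C\<^sub>1 \<G> *v x\<^sub>\<alpha> s \<omega> + D\<^sub>1 \<G> *v x\<^sub>\<beta> s \<omega> + (A\<^sub>1 \<G> + B\<^sub>1 \<G>) *v z\<^sub>P s \<omega> + E\<^sub>1 \<G> *v u\<^sub>\<zeta> s \<omega>"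
  let ?b = "\<lambda>s \<omega>. A\<^sub>1 \<G> *v x1 s \<omega> + B\<^sub>1 \<G> *v z s \<omega> + C\<^sub>1 \<G> *v xa s \<omega> + D\<^sub>1 \<G> *v xb s \<omega> + E\<^sub>1 \<G> *v u1 s \<omega>"
  let ?c = "\<lambda>s \<omega>. C\<^sub>1 \<G> *v xa s \<omega> + D\<^sub>1 \<G> *v xb s \<omega> + (A\<^sub>1 \<G> + B\<^sub>1 \<G>) *v z s \<omega> + E\<^sub>1 \<G> *v ub s \<omega>"
  note sq = L2_adapted_sqi
  have sa: "square_integrable_process T M ?a" and sb: "square_integrable_process T M ?b" and sc: "square_integrable_process T M ?c"
    by (intro sqi_add sqi_mult_vec sq[OF blocks_adapted(1)] sq[OF blocks_adapted(2)] sq[OF blocks_adapted(3)]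
        sq[OF controls_adapted(3)] sq[OF x1(1)] sq[OF u1] sq[OF x(1)] sq[OF x(2)] sq[OF z] sq[OF ub])+
  \<comment> \<open>The drift of \<open>z\<^sub>P\<close>, plus that of \<open>x1\<close>, minus
    that of \<open>z\<close> according to \<open>mean_field_dynamics\<close>. The means of the
    initial value cancel, while the random initial value and the noise of \<open>x1\<close>
    survive.\<close>
  have e: "(\<lambda>s \<omega>. A\<^sub>1 \<G> *v y s \<omega> + B\<^sub>1 \<G> *v z\<^sub>P s \<omega> + C\<^sub>1 \<G> *v x\<^sub>\<alpha> s \<omega> + D\<^sub>1 \<G> *v x\<^sub>\<beta> s \<omega> + E\<^sub>1 \<G> *v v s \<omega>)
      = (\<lambda>s \<omega>. ?a s \<omega> + (?b s \<omega> - ?c s \<omega>))"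
    by (simp add: fun_eq_iff y_def v_def matrix_vector_right_distrib matrix_vector_mult_diff_distrib
        matrix_vector_mult_add_rdistrib algebra_simps)
  have st_y: "follower_state \<G> \<N> v x\<^sub>\<alpha> x\<^sub>\<beta> z\<^sub>P y"
    unfolding follower_state_iff e
  proof (intro conjI y ballI)
    fix t assume t: "t \<in> {0..T}"
    have x1_eq: "AE \<omega> in M. x1 t \<omega> = \<eta>\<^sub>1 \<N> \<omega> + running_integral ?b t \<omega> + \<sigma>\<^sub>1 \<G> *v W\<^sub>1 \<N> t \<omega>"
      using st t unfolding follower_state_iff by blast
    have z_eq: "AE \<omega> in M. z t \<omega> = integral\<^sup>L M (\<eta>\<^sub>1 \<N>) + running_integral ?c t \<omega>"
      by (rule mean_field_dynamics[OF x z sz u1 x1 st _ ub oub t]) (rule o)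
    show "AE \<omega> in M. y t \<omega> = \<eta>\<^sub>1 \<N> \<omega> + running_integral (\<lambda>s \<omega>. ?a s \<omega> + (?b s \<omega> - ?c s \<omega>)) t \<omega> + \<sigma>\<^sub>1 \<G> *v W\<^sub>1 \<N> t \<omega>"
      using x1_eq z\<^sub>P_eq[OF t] z_eq
        running_integral_add[OF sa sqi_diff[OF sb sc]] running_integral_diff[OF sb sc]
      by eventually_elim (use t in \<open>simp add: y_def algebra_simps\<close>)
  qed
  have sy: "square_integrable_state y"
    by (rule follower_state_sqi[OF st_y v sq[OF blocks_adapted(1)] sq[OF blocks_adapted(2)] sq[OF blocks_adapted(3)]])
  have foc_y: "follower_foc v y x\<^sub>\<alpha> x\<^sub>\<beta> z\<^sub>P"
    unfolding follower_foc_def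
  proof (intro allI impI)
    fix w q assume test: "follower_test w q"
    have w: "L2_adapted T M \<G>\<^sub>1 w" and q: "L2_adapted T M \<G>\<^sub>1 q" and
      q_eq: "\<And>t. t \<in> {0..T} \<Longrightarrow> AE \<omega> in M. q t \<omega> = running_integral (\<lambda>s \<omega>. A\<^sub>1 \<G> *v q s \<omega> + E\<^sub>1 \<G> *v w s \<omega>) t \<omega>"
      using test unfolding follower_test_def by auto
    \<comment> \<open>A test direction is split into a leader-adapted one and an orthogonal
      remainder. The former does not see the fluctuation of the follower, the latter does not see
      leader-adapted errors.\<close>
    obtain w' q' where w': "L2_adapted T M \<F> w'" and q': "L2_adapted T M \<F> q'" and
      q'_eq: "\<forall>t\<in>{0..T}. AE \<omega> in M. q' t \<omega> = running_integral (\<lambda>s \<omega>. A\<^sub>1 \<G> *v q' s \<omega> + E\<^sub>1 \<G> *v w' s \<omega>) t \<omega>"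
      and ow: "orthogonal_process \<F> (\<lambda>t \<omega>. w t \<omega> - w' t \<omega>)" and oq: "orthogonal_process \<F> (\<lambda>t \<omega>. q t \<omega> - q' t \<omega>)"
      and oqT: "orthogonal_at \<F> T (\<lambda>\<omega>. q T \<omega> - q' T \<omega>)"
      by (rule project_linear_system[OF leader_immersed w q q_eq])
    have test': "follower_test w' q'"
      unfolding follower_test_def using lift[OF w'] lift[OF q'] q'_eq by blast
    have at_T: "square_integrable_rv M (r T)" if "square_integrable_state r" for r :: "real \<Rightarrow> 'w \<Rightarrow> real ^ 'i"
      using that horizon_mem unfolding square_integrable_state_def by blast
    note tq = follower_test_state[OF test] and tq' = follower_test_state[OF test']
    let ?e = "\<lambda>t \<omega>. x1 t \<omega> - z t \<omega>" and ?v = "\<lambda>t \<omega>. u1 t \<omega> - ub t \<omega>"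
    let ?l = "follower_error z xa xb z" and ?lT = "follower_terminal_error z xa xb z"
    let ?dq = "\<lambda>t \<omega>. q t \<omega> - q' t \<omega>" and ?dw = "\<lambda>t \<omega>. w t \<omega> - w' t \<omega>"
    have Q: "lq_space q w (q T)" and Q': "lq_space q' w' (q' T)"
      unfolding lq_space_def by (intro conjI sq[OF q] sq[OF w] sq[OF q'] sq[OF w'] at_T tq tq')+
    note dQ = lq_space_diff[OF Q Q']
    have E: "lq_space ?e ?v (?e T)"
      unfolding lq_space_def by (intro conjI sqi_diff sq[OF x1(1)] sq[OF z] sq[OF u1] sq[OF ub] at_T x1(2) sz)
    have L: "lq_space ?l ub ?lT" by (rule follower_lq_space[OF sx sz sz sq[OF ub]])
    have P: "lq_space (follower_error z\<^sub>P x\<^sub>\<alpha> x\<^sub>\<beta> z\<^sub>P) u\<^sub>\<zeta> (follower_terminal_error z\<^sub>P x\<^sub>\<alpha> x\<^sub>\<beta> z\<^sub>P)"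
      by (rule follower_lq_space[OF blocks_sqi(1-3,3) sq[OF controls_adapted(3)]])
    have split: "follower_error y x\<^sub>\<alpha> x\<^sub>\<beta> z\<^sub>P = (\<lambda>t \<omega>. follower_error z\<^sub>P x\<^sub>\<alpha> x\<^sub>\<beta> z\<^sub>P t \<omega> + ?e t \<omega>)"
      "v = (\<lambda>t \<omega>. u\<^sub>\<zeta> t \<omega> + ?v t \<omega>)"
      "follower_terminal_error y x\<^sub>\<alpha> x\<^sub>\<beta> z\<^sub>P = (\<lambda>\<omega>. follower_terminal_error z\<^sub>P x\<^sub>\<alpha> x\<^sub>\<beta> z\<^sub>P \<omega> + ?e T \<omega>)"
      by (simp_all add: fun_eq_iff follower_error_def follower_terminal_error_def y_def v_def)
    have split1: "follower_error x1 xa xb z = (\<lambda>t \<omega>. ?l t \<omega> + ?e t \<omega>)" "u1 = (\<lambda>t \<omega>. ub t \<omega> + ?v t \<omega>)"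
      "follower_terminal_error x1 xa xb z = (\<lambda>\<omega>. ?lT \<omega> + ?e T \<omega>)"
      by (simp_all add: fun_eq_iff follower_error_def follower_terminal_error_def)
    have splitq: "follower_form q w (q T) a b c = follower_form ?dq ?dw (?dq T) a b c + follower_form q' w' (q' T) a b c"
      if "lq_space a b c" for a b c
      using lq_form_add_left[OF that dQ Q'] unfolding follower_form_def by simp
    have mT: "x T \<in> borel_measurable (\<F> T)" "q' T \<in> borel_measurable (\<F> T)" "z T \<in> borel_measurable (\<F> T)"
        "xa T \<in> borel_measurable (\<F> T)" "xb T \<in> borel_measurable (\<F> T)"
      using L2_adapted_at[OF x_adapted] L2_adapted_at[OF q'] L2_adapted_at[OF z] L2_adapted_at[OF x(1)]
        L2_adapted_at[OF x(2)] horizon_mem by auto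
    have mv: "(\<lambda>\<omega>. A *v g \<omega>) \<in> borel_measurable (\<F> T)" if "g \<in> borel_measurable (\<F> T)"
      for A :: "real ^ 'i ^ 'j" and g
      by (rule measurable_compose[OF that borel_measurable_continuous_onI[OF
            linear_continuous_on[OF matrix_vector_mul_bounded_linear]]])
    have l: "L2_adapted T M \<F> ?l"
      unfolding follower_error_def by (intro L2_adapted_diff L2_adapted_mult_vec z x L2_adapted_const)
    have lT: "?lT \<in> borel_measurable (\<F> T)"
      unfolding follower_terminal_error_def by (intro borel_measurable_diff mv mT borel_measurable_const)
    have slT: "square_integrable_rv M ?lT" using L unfolding lq_space_def by simp
    \<comment> \<open>The leader-adapted part of the old error is invisible to the remainder, so the
      old first-order condition becomes a statement about the fluctuation alone.\<close>
    have "follower_form ?dq ?dw (?dq T) ?e ?v (?e T)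
        = follower_form ?dq ?dw (?dq T) (follower_error x1 xa xb z) u1 (follower_terminal_error x1 xa xb z)
          - follower_form ?dq ?dw (?dq T) ?l ub ?lT"
      unfolding split1(1,3) unfolding follower_form_def
      using lq_form_add_right[OF dQ L E] by simp
    also have "follower_form ?dq ?dw (?dq T) ?l ub ?lT = 0"
      unfolding follower_form_def by (rule lq_form_orthogonal(2)[OF l ub lT slT oq ow oqT])
    also have "follower_form ?dq ?dw (?dq T) (follower_error x1 xa xb z) u1 (follower_terminal_error x1 xa xb z) = 0"
      using splitq[OF follower_lq_space[OF sx sz x1(2) sq[OF u1]]]
        foc[unfolded follower_foc_def, rule_format, OF test] foc[unfolded follower_foc_def, rule_format, OF test'] by simp
    finally have "follower_form ?dq ?dw (?dq T) ?e ?v (?e T) = 0" by simp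
    moreover have "follower_form q' w' (q' T) ?e ?v (?e T) = 0"
      unfolding follower_form_def
      by (rule lq_form_orthogonal(1)[OF q' w' mT(2) at_T[OF tq'(1)] ox oub o[OF horizon_mem]])
    ultimately have "follower_form q w (q T) ?e ?v (?e T) = 0" using splitq[OF E] by simp
    \<comment> \<open>The mean part of the new error is settled by the adjoint \<zeta> for the
      undivided test direction.\<close>
    moreover have "follower_form q w (q T) (follower_error z\<^sub>P x\<^sub>\<alpha> x\<^sub>\<beta> z\<^sub>P) u\<^sub>\<zeta> (follower_terminal_error z\<^sub>P x\<^sub>\<alpha> x\<^sub>\<beta> z\<^sub>P) = 0"
      by (rule adjoint_follower_form[OF test])
    ultimately show "follower_form q w (q T) (follower_error y x\<^sub>\<alpha> x\<^sub>\<beta> z\<^sub>P) v (follower_terminal_error y x\<^sub>\<alpha> x\<^sub>\<beta> z\<^sub>P) = 0"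
      unfolding split follower_form_def using lq_form_add_right[OF Q P E] by simp
  qed
  have opt: "follower_optimal \<G> \<N> x\<^sub>\<alpha> x\<^sub>\<beta> z\<^sub>P v y"
    by (rule follower_foc_optimal[OF blocks_sqi(1-3) v st_y foc_y])
  have cond: "AE \<omega> in M. z\<^sub>P t \<omega> = conditional_expectation M (\<F> t) (y t) \<omega>" if t: "t \<in> {0..T}" for t
  proof -
    have sz_t: "square_integrable_rv M (z\<^sub>P t)" and sy_t: "square_integrable_rv M (y t)"
      using blocks_sqi(3) sy t unfolding square_integrable_state_def by auto
    \<comment> \<open>\<open>y\<close> minus \<open>z\<^sub>P\<close> is the old fluctuation
      \<open>x1 - z\<close>, whose conditional mean vanishes.\<close>
    have "AE \<omega> in M. conditional_expectation M (\<F> t) (y t) \<omega> = z\<^sub>P t \<omega>"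
    proof (rule cexp_unique[OF finite_measure_axioms filtration_onD(1)[OF leader_filtration_on t] sy_t sz_t
          L2_adapted_at[OF blocks_adapted(3) t]])
      fix V :: "'w \<Rightarrow> real ^ 'n1" assume V: "V \<in> borel_measurable (\<F> t)" "square_integrable_rv M V"
      have ot: "square_integrable_rv M (\<lambda>\<omega>. x1 t \<omega> - z t \<omega>)" "(\<integral>\<omega>. V \<omega> \<bullet> (x1 t \<omega> - z t \<omega>) \<partial>M) = 0"
        using o[OF t] V unfolding orthogonal_at_def by blast+
      show "(\<integral>\<omega>. V \<omega> \<bullet> y t \<omega> \<partial>M) = (\<integral>\<omega>. V \<omega> \<bullet> z\<^sub>P t \<omega> \<partial>M)"
        unfolding y_def inner_add_right
        using ot sqi_inner_integrable[OF V(2) ot(1)] sqi_inner_integrable[OF V(2) sz_t] by simp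
    qed
    then show ?thesis by eventually_elim simp
  qed
  have "mean_field_equilibrium \<G> \<N> x\<^sub>\<alpha> x\<^sub>\<beta> z\<^sub>P"
    unfolding mean_field_equilibrium_def using blocks_adapted(3) opt cond by blast
  moreover have "leader_states \<G> \<N> u\<^sub>\<alpha> u\<^sub>\<beta> x\<^sub>\<alpha> x\<^sub>\<beta> z\<^sub>P"
    unfolding leader_states_iff using blocks_adapted(1,2) x\<^sub>\<alpha>_eq x\<^sub>\<beta>_eq by blast
  ultimately show ?thesis unfolding response_def by simp
qed

end

context game_space
begin

section \<open>The leaders' costs\<close>

definition "error\<^sub>\<alpha> xa xb z t \<omega> = xa t \<omega> - F\<^sub>\<alpha> \<G> *v z t \<omega> - G\<^sub>\<alpha> \<G> *v xb t \<omega> - M\<^sub>\<alpha> \<G>"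
definition "error\<^sub>\<beta> xa xb z t \<omega> = xb t \<omega> - F\<^sub>\<beta> \<G> *v z t \<omega> - G\<^sub>\<beta> \<G> *v xa t \<omega> - M\<^sub>\<beta> \<G>"
definition "terminal_error\<^sub>\<alpha> xa xb z \<omega> = xa T \<omega> - Fb\<^sub>\<alpha> \<G> *v z T \<omega> - Gb\<^sub>\<alpha> \<G> *v xb T \<omega> - Mb\<^sub>\<alpha> \<G>"
definition "terminal_error\<^sub>\<beta> xa xb z \<omega> = xb T \<omega> - Fb\<^sub>\<beta> \<G> *v z T \<omega> - Gb\<^sub>\<beta> \<G> *v xa T \<omega> - Mb\<^sub>\<beta> \<G>"

definition "form\<^sub>\<alpha> = lq_form (Q\<^sub>\<alpha> \<G>) (R\<^sub>\<alpha> \<G>) (Qb\<^sub>\<alpha> \<G>)"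
definition "form\<^sub>\<beta> = lq_form (Q\<^sub>\<beta> \<G>) (R\<^sub>\<beta> \<G>) (Qb\<^sub>\<beta> \<G>)"

definition "cost\<^sub>\<alpha> va xa xb z =
  form\<^sub>\<alpha> (error\<^sub>\<alpha> xa xb z) va (terminal_error\<^sub>\<alpha> xa xb z) (error\<^sub>\<alpha> xa xb z) va (terminal_error\<^sub>\<alpha> xa xb z)"
definition "cost\<^sub>\<beta> vb xa xb z =
  form\<^sub>\<beta> (error\<^sub>\<beta> xa xb z) vb (terminal_error\<^sub>\<beta> xa xb z) (error\<^sub>\<beta> xa xb z) vb (terminal_error\<^sub>\<beta> xa xb z)"

lemma leader_lq_space:
  assumes "square_integrable_state xa" "square_integrable_state xb" "square_integrable_state z"
  shows "square_integrable_process T M va \<Longrightarrow> lq_space (error\<^sub>\<alpha> xa xb z) va (terminal_error\<^sub>\<alpha> xa xb z)"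
    "square_integrable_process T M vb \<Longrightarrow> lq_space (error\<^sub>\<beta> xa xb z) vb (terminal_error\<^sub>\<beta> xa xb z)"
  using assms horizon_mem
  unfolding lq_space_def error\<^sub>\<alpha>_def error\<^sub>\<beta>_def terminal_error\<^sub>\<alpha>_def terminal_error\<^sub>\<beta>_def square_integrable_state_def
  by (auto intro!: sqi_diff sqi_mult_vec sqi_const[OF finite_N] sqi_const[OF finite_measure_axioms])

text \<open>The costs are evaluated at a chosen response. Another response may be substituted since
  modifications agree almost everywhere on the product space and almost surely at the
  horizon.\<close>

lemma leader_costs_eq:
  assumes wp: "well_posed \<G> \<N>" and adm: "admissible_pair \<G> \<N> va vb" and resp: "response \<G> \<N> va vb xa xb z"
  shows "J\<^sub>\<alpha> \<G> \<N> va vb = ennreal (cost\<^sub>\<alpha> va xa xb z)" "J\<^sub>\<beta> \<G> \<N> vb va = ennreal (cost\<^sub>\<beta> vb xa xb z)"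
proof -
  obtain xa' xb' z' where tr: "the_response \<G> \<N> va vb = (xa', xb', z')" by (metis prod_cases3)
  have "case the_response \<G> \<N> va vb of (xa, xb, z) \<Rightarrow> response \<G> \<N> va vb xa xb z"
    unfolding the_response_def by (rule someI[of _ "(xa, xb, z)"]) (use resp in simp)
  then have resp': "response \<G> \<N> va vb xa' xb' z'" unfolding tr by simp
  have s: "square_integrable_state xa" "square_integrable_state xb" "square_integrable_state z"
    by (rule response_elim[OF resp adm], assumption)+
  have s': "square_integrable_state xa'" "square_integrable_state xb'" "square_integrable_state z'"
    by (rule response_elim[OF resp' adm], assumption)+
  have sv: "square_integrable_process T M va" "square_integrable_process T M vb"
    using adm unfolding admissible_pair_def by (auto intro: L2_adapted_sqi)
  \<comment> \<open>Well-posedness compares every response with one unnamed reference; the two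
    responses at hand are linked through it.\<close>
  obtain xs ys zs where u: "\<And>xa' xb' z'. response \<G> \<N> va vb xa' xb' z' \<Longrightarrow>
              modification T M xa' xs \<and> modification T M xb' ys \<and> modification T M z' zs"
    using wp adm unfolding well_posed_def by metis
  have m: "modification T M xa' xa" "modification T M xb' xb" "modification T M z' z"
    using u[OF resp] u[OF resp'] unfolding modification_def by (auto elim!: ballE AE_mp)
  have ae: "AE q in N. xa' (fst q) (snd q) = xa (fst q) (snd q)" "AE q in N. xb' (fst q) (snd q) = xb (fst q) (snd q)"
    "AE q in N. z' (fst q) (snd q) = z (fst q) (snd q)"
    using s s' m unfolding square_integrable_state_def by (blast intro: L2_adapted_modification)+
  have aeT: "AE \<omega> in M. xa' T \<omega> = xa T \<omega>" "AE \<omega> in M. xb' T \<omega> = xb T \<omega>" "AE \<omega> in M. z' T \<omega> = z T \<omega>"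
    using m horizon_mem unfolding modification_def by auto
  note S = leader_lq_space(1)[OF s sv(1)] leader_lq_space(2)[OF s sv(2)]
  note S' = leader_lq_space(1)[OF s' sv(1)] leader_lq_space(2)[OF s' sv(2)]
  have e: "AE q in N. error\<^sub>\<alpha> xa' xb' z' (fst q) (snd q) = error\<^sub>\<alpha> xa xb z (fst q) (snd q)"
    "AE q in N. error\<^sub>\<beta> xa' xb' z' (fst q) (snd q) = error\<^sub>\<beta> xa xb z (fst q) (snd q)"
    "AE \<omega> in M. terminal_error\<^sub>\<alpha> xa' xb' z' \<omega> = terminal_error\<^sub>\<alpha> xa xb z \<omega>"
    "AE \<omega> in M. terminal_error\<^sub>\<beta> xa' xb' z' \<omega> = terminal_error\<^sub>\<beta> xa xb z \<omega>"
    unfolding error\<^sub>\<alpha>_def error\<^sub>\<beta>_def terminal_error\<^sub>\<alpha>_def terminal_error\<^sub>\<beta>_def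
    using ae aeT by auto
  have "J\<^sub>\<alpha> \<G> \<N> va vb = ennreal (cost\<^sub>\<alpha> va xa' xb' z')"
    using lq_cost_eq[OF weights_nonneg(1,7,4) S'(1)]
    unfolding J\<^sub>\<alpha>_def Let_def tr cost\<^sub>\<alpha>_def form\<^sub>\<alpha>_def error\<^sub>\<alpha>_def terminal_error\<^sub>\<alpha>_def by simp
  also have "cost\<^sub>\<alpha> va xa' xb' z' = cost\<^sub>\<alpha> va xa xb z"
    unfolding cost\<^sub>\<alpha>_def form\<^sub>\<alpha>_def by (rule lq_form_cong_AE[OF S'(1) S'(1) S(1) S(1)]) (use e in auto)
  finally show "J\<^sub>\<alpha> \<G> \<N> va vb = ennreal (cost\<^sub>\<alpha> va xa xb z)" .
  have "J\<^sub>\<beta> \<G> \<N> vb va = ennreal (cost\<^sub>\<beta> vb xa' xb' z')"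
    using lq_cost_eq[OF weights_nonneg(2,8,5) S'(2)]
    unfolding J\<^sub>\<beta>_def Let_def tr cost\<^sub>\<beta>_def form\<^sub>\<beta>_def error\<^sub>\<beta>_def terminal_error\<^sub>\<beta>_def by simp
  also have "cost\<^sub>\<beta> vb xa' xb' z' = cost\<^sub>\<beta> vb xa xb z"
    unfolding cost\<^sub>\<beta>_def form\<^sub>\<beta>_def by (rule lq_form_cong_AE[OF S'(2) S'(2) S(2) S(2)]) (use e in auto)
  finally show "J\<^sub>\<beta> \<G> \<N> vb va = ennreal (cost\<^sub>\<beta> vb xa xb z)" .
qed

lemma costs_nonneg: "0 \<le> cost\<^sub>\<alpha> va xa xb z" "0 \<le> cost\<^sub>\<beta> vb xa xb z"
  unfolding cost\<^sub>\<alpha>_def cost\<^sub>\<beta>_def form\<^sub>\<alpha>_def form\<^sub>\<beta>_def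
  by (rule lq_form_nonneg(1)[OF weights_nonneg(1,7,4)], rule lq_form_nonneg(1)[OF weights_nonneg(2,8,5)])

end

section \<open>First variation of the total cost and the conclusion\<close>

context fbsde_solution
begin

lemma AE_running_integral_diff:
  fixes f g :: "real \<Rightarrow> 'w \<Rightarrow> 'e::euclidean_space"
  assumes "square_integrable_process T M f" "square_integrable_process T M g" "t \<in> {0..T}"
  shows "AE \<omega> in M. running_integral (\<lambda>s \<omega>. f s \<omega> - g s \<omega>) t \<omega> = running_integral f t \<omega> - running_integral g t \<omega>"
  using running_integral_diff[OF assms(1,2)] by eventually_elim (use assms(3) in blast)

text \<open>Both costs are expanded around the FBSDE controls: the linear parts add up to zero by
  duality, the quadratic parts dominate the control energies. Keeping these energies in the
  inequality serves optimality and uniqueness at once.\<close>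

lemma cost_difference:
  assumes resp: "response \<G> \<N> u\<^sub>\<alpha> u\<^sub>\<beta> x\<^sub>\<alpha> x\<^sub>\<beta> z\<^sub>P"
    and adm: "admissible_pair \<G> \<N> va vb" and resp_v: "response \<G> \<N> va vb ya yb zv"
  shows "(\<integral>z. (va (fst z) (snd z) - u\<^sub>\<alpha> (fst z) (snd z)) \<bullet> (R\<^sub>\<alpha> \<G> *v (va (fst z) (snd z) - u\<^sub>\<alpha> (fst z) (snd z))) \<partial>N)
      + (\<integral>z. (vb (fst z) (snd z) - u\<^sub>\<beta> (fst z) (snd z)) \<bullet> (R\<^sub>\<beta> \<G> *v (vb (fst z) (snd z) - u\<^sub>\<beta> (fst z) (snd z))) \<partial>N)
      + (cost\<^sub>\<alpha> u\<^sub>\<alpha> x\<^sub>\<alpha> x\<^sub>\<beta> z\<^sub>P + cost\<^sub>\<beta> u\<^sub>\<beta> x\<^sub>\<alpha> x\<^sub>\<beta> z\<^sub>P) \<le> cost\<^sub>\<alpha> va ya yb zv + cost\<^sub>\<beta> vb ya yb zv"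
proof -
  have adm_u: "admissible_pair \<G> \<N> u\<^sub>\<alpha> u\<^sub>\<beta>" unfolding admissible_pair_def using controls_adapted by simp
  obtain u1 x1 where u1: "L2_adapted T M \<G>\<^sub>1 u1" and x1: "L2_adapted T M \<G>\<^sub>1 x1" "square_integrable_state x1"
    and st: "follower_state \<G> \<N> u1 x\<^sub>\<alpha> x\<^sub>\<beta> z\<^sub>P x1" and foc: "follower_foc u1 x1 x\<^sub>\<alpha> x\<^sub>\<beta> z\<^sub>P"
    and o: "\<And>t. t \<in> {0..T} \<Longrightarrow> orthogonal_at \<F> t (\<lambda>\<omega>. x1 t \<omega> - z\<^sub>P t \<omega>)"
    by (rule response_elim[OF resp adm_u]) blast
  obtain v1 y1 where y: "L2_adapted T M \<F> ya" "L2_adapted T M \<F> yb" "L2_adapted T M \<F> zv"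
    and sy: "square_integrable_state ya" "square_integrable_state yb" "square_integrable_state zv"
    and v1: "L2_adapted T M \<G>\<^sub>1 v1" and y1: "L2_adapted T M \<G>\<^sub>1 y1" "square_integrable_state y1"
    and st_v: "follower_state \<G> \<N> v1 ya yb zv y1" and foc_v: "follower_foc v1 y1 ya yb zv"
    and o_v: "\<And>t. t \<in> {0..T} \<Longrightarrow> orthogonal_at \<F> t (\<lambda>\<omega>. y1 t \<omega> - zv t \<omega>)"
    by (rule response_elim[OF resp_v adm]) blast
  note lift = L2_adapted_mono[OF _ leader_in_follower]
  note sq = L2_adapted_sqi
  have va: "L2_adapted T M \<F> va" and vb: "L2_adapted T M \<F> vb" using adm unfolding admissible_pair_def by auto
  \<comment> \<open>Noise and initial values are the same for both pairs of controls, so the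
    differences of the leaders' and the follower's states solve noise-free linear equations started
    at 0, as the duality requires.\<close>
  define da db dz d1 where "da t \<omega> = ya t \<omega> - x\<^sub>\<alpha> t \<omega>" and "db t \<omega> = yb t \<omega> - x\<^sub>\<beta> t \<omega>"
    and "dz t \<omega> = zv t \<omega> - z\<^sub>P t \<omega>" and "d1 t \<omega> = y1 t \<omega> - x1 t \<omega>" for t \<omega>
  define wa wb w1 where "wa t \<omega> = va t \<omega> - u\<^sub>\<alpha> t \<omega>" and "wb t \<omega> = vb t \<omega> - u\<^sub>\<beta> t \<omega>"
    and "w1 t \<omega> = v1 t \<omega> - u1 t \<omega>" for t \<omega>
  note d_defs = da_def db_def dz_def d1_def wa_def wb_def w1_def
  have d: "L2_adapted T M \<F> da" "L2_adapted T M \<F> db" "L2_adapted T M \<F> dz" "L2_adapted T M \<G>\<^sub>1 d1"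
    "L2_adapted T M \<F> wa" "L2_adapted T M \<F> wb" "L2_adapted T M \<G>\<^sub>1 w1"
    unfolding d_defs by (intro L2_adapted_diff y y1(1) x1(1) blocks_adapted va vb controls_adapted v1 u1)+
  have at_T: "square_integrable_rv M (r T)" if "square_integrable_state r" for r :: "real \<Rightarrow> 'w \<Rightarrow> real ^ 'i"
    using that horizon_mem unfolding square_integrable_state_def by blast
  have dT: "square_integrable_rv M (da T)" "square_integrable_rv M (db T)" "square_integrable_rv M (dz T)" "square_integrable_rv M (d1 T)"
    unfolding d_defs by (intro sqi_diff at_T sy y1(2) x1(2) blocks_sqi)+
  let ?fa = "\<lambda>xa xb z v s \<omega>. A\<^sub>\<alpha> \<G> *v xa s \<omega> + B\<^sub>\<alpha> \<G> *v xb s \<omega> + C\<^sub>\<alpha> \<G> *v z s \<omega> + D\<^sub>\<alpha> \<G> *v v s \<omega>"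
  let ?fb = "\<lambda>xa xb z v s \<omega>. A\<^sub>\<beta> \<G> *v xa s \<omega> + B\<^sub>\<beta> \<G> *v xb s \<omega> + C\<^sub>\<beta> \<G> *v z s \<omega> + D\<^sub>\<beta> \<G> *v v s \<omega>"
  let ?f1 = "\<lambda>xa xb z x u s \<omega>. A\<^sub>1 \<G> *v x s \<omega> + B\<^sub>1 \<G> *v z s \<omega> + C\<^sub>1 \<G> *v xa s \<omega> + D\<^sub>1 \<G> *v xb s \<omega> + E\<^sub>1 \<G> *v u s \<omega>"
  have fd: "?fa da db dz wa = (\<lambda>s \<omega>. ?fa ya yb zv va s \<omega> - ?fa x\<^sub>\<alpha> x\<^sub>\<beta> z\<^sub>P u\<^sub>\<alpha> s \<omega>)"
    "?fb da db dz wb = (\<lambda>s \<omega>. ?fb ya yb zv vb s \<omega> - ?fb x\<^sub>\<alpha> x\<^sub>\<beta> z\<^sub>P u\<^sub>\<beta> s \<omega>)"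
    "?f1 da db dz d1 w1 = (\<lambda>s \<omega>. ?f1 ya yb zv y1 v1 s \<omega> - ?f1 x\<^sub>\<alpha> x\<^sub>\<beta> z\<^sub>P x1 u1 s \<omega>)"
    by (simp_all add: fun_eq_iff d_defs matrix_vector_mult_diff_distrib algebra_simps)
  have f: "L2_adapted T M \<F> (?fa da db dz wa)" "L2_adapted T M \<F> (?fb da db dz wb)" "L2_adapted T M \<G>\<^sub>1 (?f1 da db dz d1 w1)"
    by (intro L2_adapted_add L2_adapted_mult_vec d lift[OF d(1)] lift[OF d(2)] lift[OF d(3)])+
  have sf: "square_integrable_process T M (?fa ya yb zv va)" "square_integrable_process T M (?fa x\<^sub>\<alpha> x\<^sub>\<beta> z\<^sub>P u\<^sub>\<alpha>)"
    "square_integrable_process T M (?fb ya yb zv vb)" "square_integrable_process T M (?fb x\<^sub>\<alpha> x\<^sub>\<beta> z\<^sub>P u\<^sub>\<beta>)"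
    "square_integrable_process T M (?f1 ya yb zv y1 v1)" "square_integrable_process T M (?f1 x\<^sub>\<alpha> x\<^sub>\<beta> z\<^sub>P x1 u1)"
    by (intro sqi_add sqi_mult_vec sq[OF y(1)] sq[OF y(2)] sq[OF y(3)] sq[OF y1(1)] sq[OF x1(1)] sq[OF v1] sq[OF u1] sq[OF va] sq[OF vb]
        sq[OF blocks_adapted(1)] sq[OF blocks_adapted(2)] sq[OF blocks_adapted(3)] sq[OF controls_adapted(1)] sq[OF controls_adapted(2)])+
  have ls: "leader_states \<G> \<N> va vb ya yb zv" using resp_v unfolding response_def by simp
  have dyn: "AE \<omega> in M. da t \<omega> = running_integral (?fa da db dz wa) t \<omega>"
    "AE \<omega> in M. db t \<omega> = running_integral (?fb da db dz wb) t \<omega>"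
    "AE \<omega> in M. d1 t \<omega> = running_integral (?f1 da db dz d1 w1) t \<omega>" if t: "t \<in> {0..T}" for t
  proof -
    have "AE \<omega> in M. ya t \<omega> = \<eta>\<^sub>\<alpha> \<N> \<omega> + running_integral (?fa ya yb zv va) t \<omega> + \<sigma>\<^sub>\<alpha> \<G> *v W\<^sub>\<alpha> \<N> t \<omega>"
      using ls t unfolding leader_states_iff by blast
    with x\<^sub>\<alpha>_eq[OF t] AE_running_integral_diff[OF sf(1,2) t]
    show "AE \<omega> in M. da t \<omega> = running_integral (?fa da db dz wa) t \<omega>"
      unfolding fd(1) unfolding da_def by eventually_elim simp
    have "AE \<omega> in M. yb t \<omega> = \<eta>\<^sub>\<beta> \<N> \<omega> + running_integral (?fb ya yb zv vb) t \<omega> + \<sigma>\<^sub>\<beta> \<G> *v W\<^sub>\<beta> \<N> t \<omega>"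
      using ls t unfolding leader_states_iff by blast
    with x\<^sub>\<beta>_eq[OF t] AE_running_integral_diff[OF sf(3,4) t]
    show "AE \<omega> in M. db t \<omega> = running_integral (?fb da db dz wb) t \<omega>"
      unfolding fd(2) unfolding db_def by eventually_elim simp
    have "AE \<omega> in M. y1 t \<omega> = \<eta>\<^sub>1 \<N> \<omega> + running_integral (?f1 ya yb zv y1 v1) t \<omega> + \<sigma>\<^sub>1 \<G> *v W\<^sub>1 \<N> t \<omega>"
      "AE \<omega> in M. x1 t \<omega> = \<eta>\<^sub>1 \<N> \<omega> + running_integral (?f1 x\<^sub>\<alpha> x\<^sub>\<beta> z\<^sub>P x1 u1) t \<omega> + \<sigma>\<^sub>1 \<G> *v W\<^sub>1 \<N> t \<omega>"
      using st st_v t unfolding follower_state_iff by blast+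
    with AE_running_integral_diff[OF sf(5,6) t]
    show "AE \<omega> in M. d1 t \<omega> = running_integral (?f1 da db dz d1 w1) t \<omega>"
      unfolding fd(3) unfolding d1_def by eventually_elim simp
  qed
  \<comment> \<open>\<delta>x_1 enters twice because the last two adjoint blocks each carry one
    leader's share of the sensitivity to the follower.\<close>
  let ?Y = "\<lambda>t \<omega>. da t \<omega> \<sslash> db t \<omega> \<sslash> (0 :: real ^ 'n1) \<sslash> d1 t \<omega> \<sslash> d1 t \<omega>"
  let ?f = "\<lambda>t \<omega>. ?fa da db dz wa t \<omega> \<sslash> ?fb da db dz wb t \<omega> \<sslash> (0 :: real ^ 'n1) \<sslash> ?f1 da db dz d1 w1 t \<omega> \<sslash> ?f1 da db dz d1 w1 t \<omega>"
  have Y: "L2_adapted T M \<G>\<^sub>1 ?Y" by (intro L2_adapted_vstack L2_adapted_const lift[OF d(1)] lift[OF d(2)] d(4))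
  have fG: "L2_adapted T M \<G>\<^sub>1 ?f" by (intro L2_adapted_vstack L2_adapted_const lift[OF f(1)] lift[OF f(2)] f(3))
  note lv = L2_adapted_vstack
  have Y_eq: "AE \<omega> in M. ?Y t \<omega> = running_integral ?f t \<omega>" if t: "t \<in> {0..T}" for t
    using dyn[OF t]
      running_integral_vstack[OF sq[OF lift[OF f(1)]] sq[OF lv[OF lift[OF f(2)] lv[OF L2_adapted_const[where c = "0 :: real ^ 'n1"] lv[OF f(3) f(3)]]]]]
      running_integral_vstack[OF sq[OF lift[OF f(2)]] sq[OF lv[OF L2_adapted_const[where c = "0 :: real ^ 'n1"] lv[OF f(3) f(3)]]]]
      running_integral_vstack[OF sqi_const[OF finite_N, of "0 :: real ^ 'n1"] sq[OF lv[OF f(3) f(3)]]]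
      running_integral_vstack[OF sq[OF f(3)] sq[OF f(3)]]
    by eventually_elim (use t in \<open>simp add: running_integral_def[of "\<lambda>_ _. 0"]\<close>)
  define e\<alpha> e\<beta> e1 where "e\<alpha> = error\<^sub>\<alpha> x\<^sub>\<alpha> x\<^sub>\<beta> z\<^sub>P" and "e\<beta> = error\<^sub>\<beta> x\<^sub>\<alpha> x\<^sub>\<beta> z\<^sub>P"
    and "e1 t \<omega> = d1 t \<omega> - F\<^sub>1 \<G> *v dz t \<omega> - G\<^sub>1 \<G> *v da t \<omega> - H\<^sub>1 \<G> *v db t \<omega>" for t \<omega>
  define t\<alpha> t\<beta> t1 where "t\<alpha> = terminal_error\<^sub>\<alpha> x\<^sub>\<alpha> x\<^sub>\<beta> z\<^sub>P" and "t\<beta> = terminal_error\<^sub>\<beta> x\<^sub>\<alpha> x\<^sub>\<beta> z\<^sub>P"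
    and "t1 \<omega> = d1 T \<omega> - Fb\<^sub>1 \<G> *v dz T \<omega> - Gb\<^sub>1 \<G> *v da T \<omega> - Hb\<^sub>1 \<G> *v db T \<omega>" for \<omega>
  define k\<alpha> k\<beta> where "k\<alpha> t \<omega> = da t \<omega> - F\<^sub>\<alpha> \<G> *v dz t \<omega> - G\<^sub>\<alpha> \<G> *v db t \<omega>"
    and "k\<beta> t \<omega> = db t \<omega> - F\<^sub>\<beta> \<G> *v dz t \<omega> - G\<^sub>\<beta> \<G> *v da t \<omega>" for t \<omega>
  define l\<alpha> l\<beta> where "l\<alpha> \<omega> = da T \<omega> - Fb\<^sub>\<alpha> \<G> *v dz T \<omega> - Gb\<^sub>\<alpha> \<G> *v db T \<omega>"
    and "l\<beta> \<omega> = db T \<omega> - Fb\<^sub>\<beta> \<G> *v dz T \<omega> - Gb\<^sub>\<beta> \<G> *v da T \<omega>" for \<omega>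
  \<comment> \<open>Everything multiplied by \<open>dz - d1\<close>, from the drift and from the
    running weights. It is adapted to the leaders, hence its pairing with that difference is zero;
    \<open>\<Theta>T\<close> plays the same part at the horizon.\<close>
  define \<Theta> where "\<Theta> t \<omega> = transpose (C\<^sub>\<alpha> \<G>) *v blk1 (p t \<omega>) + transpose (C\<^sub>\<beta> \<G>) *v blk2 (p t \<omega>) + transpose (B\<^sub>1 \<G>) *v r\<^sub>P t \<omega>
    - (transpose (F\<^sub>\<alpha> \<G>) *v (Q\<^sub>\<alpha> \<G> *v e\<alpha> t \<omega>) + transpose (F\<^sub>\<beta> \<G>) *v (Q\<^sub>\<beta> \<G> *v e\<beta> t \<omega>) + transpose (F\<^sub>1 \<G>) *v (Q\<^sub>1 \<G> *v s\<^sub>P t \<omega>))" for t \<omega>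
  define \<Theta>T where "\<Theta>T \<omega> = transpose (Fb\<^sub>\<alpha> \<G>) *v (Qb\<^sub>\<alpha> \<G> *v t\<alpha> \<omega>) + transpose (Fb\<^sub>\<beta> \<G>) *v (Qb\<^sub>\<beta> \<G> *v t\<beta> \<omega>)
    + transpose (Fb\<^sub>1 \<G>) *v (Qb\<^sub>1 \<G> *v s\<^sub>P T \<omega>)" for \<omega>
  have e_ad: "L2_adapted T M \<F> e\<alpha>" "L2_adapted T M \<F> e\<beta>"
    unfolding e\<alpha>_def e\<beta>_def error\<^sub>\<alpha>_def error\<^sub>\<beta>_def
    by (intro L2_adapted_diff L2_adapted_mult_vec blocks_adapted L2_adapted_const)+
  have \<Theta>: "L2_adapted T M \<F> \<Theta>"
    unfolding \<Theta>_def by (intro L2_adapted_diff L2_adapted_add L2_adapted_mult_vec blocks_adapted e_ad)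
  have mT: "(\<lambda>\<omega>. blk1 (x T \<omega>)) \<in> borel_measurable (\<F> T)" "(\<lambda>\<omega>. blk2 (x T \<omega>)) \<in> borel_measurable (\<F> T)"
      "(\<lambda>\<omega>. blk3 (x T \<omega>)) \<in> borel_measurable (\<F> T)" "s\<^sub>P T \<in> borel_measurable (\<F> T)"
    using L2_adapted_at[OF blocks_adapted(1) horizon_mem] L2_adapted_at[OF blocks_adapted(2) horizon_mem]
      L2_adapted_at[OF blocks_adapted(3) horizon_mem] L2_adapted_at[OF blocks_adapted(4) horizon_mem] by simp_all
  have mv: "(\<lambda>\<omega>. A *v g \<omega>) \<in> borel_measurable (\<F> T)" if "g \<in> borel_measurable (\<F> T)"
    for A :: "real ^ 'i ^ 'j" and g
    by (rule measurable_compose[OF that borel_measurable_continuous_onI[OF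
          linear_continuous_on[OF matrix_vector_mul_bounded_linear]]])
  have st_T: "square_integrable_rv M t\<alpha>" "square_integrable_rv M t\<beta>" "square_integrable_rv M (s\<^sub>P T)"
    using leader_lq_space(1)[OF blocks_sqi(1-3) sq[OF controls_adapted(1)]]
      leader_lq_space(2)[OF blocks_sqi(1-3) sq[OF controls_adapted(2)]] at_T[OF blocks_sqi(4)]
    unfolding lq_space_def t\<alpha>_def t\<beta>_def by auto
  have mt: "t\<alpha> \<in> borel_measurable (\<F> T)" "t\<beta> \<in> borel_measurable (\<F> T)"
    unfolding t\<alpha>_def t\<beta>_def terminal_error\<^sub>\<alpha>_def terminal_error\<^sub>\<beta>_def
    by (intro borel_measurable_diff mv mT borel_measurable_const)+
  have \<Theta>T: "\<Theta>T \<in> borel_measurable (\<F> T)" "square_integrable_rv M \<Theta>T"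
    unfolding \<Theta>T_def by (intro borel_measurable_add mv mt mT, intro sqi_add sqi_mult_vec st_T)
  \<comment> \<open>\<open>dz - d1\<close> is the difference of two fluctuations, each orthogonal by
    its own mean field condition.\<close>
  have od: "orthogonal_at \<F> t (\<lambda>\<omega>. dz t \<omega> - d1 t \<omega>)" if t: "t \<in> {0..T}" for t
  proof -
    note oa = o[OF t, unfolded orthogonal_at_def] and ob = o_v[OF t, unfolded orthogonal_at_def]
    have e: "(\<lambda>\<omega>. dz t \<omega> - d1 t \<omega>) = (\<lambda>\<omega>. (x1 t \<omega> - z\<^sub>P t \<omega>) - (y1 t \<omega> - zv t \<omega>))"
      unfolding d_defs by (simp add: fun_eq_iff)
    show ?thesis unfolding orthogonal_at_def e
    proof (intro conjI allI impI)
      show "square_integrable_rv M (\<lambda>\<omega>. (x1 t \<omega> - z\<^sub>P t \<omega>) - (y1 t \<omega> - zv t \<omega>))"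
        by (rule sqi_diff[OF conjunct1[OF oa] conjunct1[OF ob]])
      fix V :: "'w \<Rightarrow> real ^ 'n1" assume V: "V \<in> borel_measurable (\<F> t)" "square_integrable_rv M V"
      show "(\<integral>\<omega>. V \<omega> \<bullet> ((x1 t \<omega> - z\<^sub>P t \<omega>) - (y1 t \<omega> - zv t \<omega>)) \<partial>M) = 0"
        unfolding inner_diff_right[of "V _" "x1 t _ - z\<^sub>P t _"]
        using sqi_inner_integrable[OF V(2) conjunct1[OF oa]] sqi_inner_integrable[OF V(2) conjunct1[OF ob]]
          oa[THEN conjunct2, rule_format, OF V] ob[THEN conjunct2, rule_format, OF V] by simp
    qed
  qed
  have od_N: "orthogonal_process \<F> (\<lambda>t \<omega>. dz t \<omega> - d1 t \<omega>)"
    by (rule orthogonal_process_pointwise[OF sqi_diff[OF sq[OF d(3)] sq[OF d(4)]] od])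
  have zero_N: "(\<integral>q. (dz (fst q) (snd q) - d1 (fst q) (snd q)) \<bullet> \<Theta> (fst q) (snd q) \<partial>N) = 0"
    using od_N[unfolded orthogonal_process_def, THEN conjunct2, rule_format, OF \<Theta>] by (simp add: inner_commute)
  have zero_T: "(\<integral>\<omega>. (dz T \<omega> - d1 T \<omega>) \<bullet> \<Theta>T \<omega> \<partial>M) = 0"
    using od[OF horizon_mem, unfolded orthogonal_at_def, THEN conjunct2, rule_format, OF \<Theta>T] by (simp add: inner_commute)
  have running: "?f t \<omega> \<bullet> p t \<omega> - ?Y t \<omega> \<bullet> (CP_mat \<G> *v p t \<omega>) - ?Y t \<omega> \<bullet> (DP_mat \<G> *v x t \<omega> + MP_vec \<G>)
      = (dz t \<omega> - d1 t \<omega>) \<bullet> \<Theta> t \<omega> - k\<alpha> t \<omega> \<bullet> (Q\<^sub>\<alpha> \<G> *v e\<alpha> t \<omega>) - wa t \<omega> \<bullet> (R\<^sub>\<alpha> \<G> *v u\<^sub>\<alpha> t \<omega>)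
        - k\<beta> t \<omega> \<bullet> (Q\<^sub>\<beta> \<G> *v e\<beta> t \<omega>) - wb t \<omega> \<bullet> (R\<^sub>\<beta> \<G> *v u\<^sub>\<beta> t \<omega>)
        - s\<^sub>P t \<omega> \<bullet> (Q\<^sub>1 \<G> *v e1 t \<omega>) - u\<^sub>r t \<omega> \<bullet> (R\<^sub>1 \<G> *v w1 t \<omega>)" for t \<omega>
  proof -
    \<comment> \<open>Stationarity of the Hamiltonian, paired with the control variation. For the
      follower symmetry of his control weight exchanges the slots, since \<open>u\<^sub>r\<close>
      belongs to the test direction and \<open>w1\<close> is the variation.\<close>
    have c: "wa t \<omega> \<bullet> (R\<^sub>\<alpha> \<G> *v u\<^sub>\<alpha> t \<omega>) = - ((D\<^sub>\<alpha> \<G> *v wa t \<omega>) \<bullet> blk1 (p t \<omega>))"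
      "wb t \<omega> \<bullet> (R\<^sub>\<beta> \<G> *v u\<^sub>\<beta> t \<omega>) = - ((D\<^sub>\<beta> \<G> *v wb t \<omega>) \<bullet> blk2 (p t \<omega>))"
      "u\<^sub>r t \<omega> \<bullet> (R\<^sub>1 \<G> *v w1 t \<omega>) = - ((E\<^sub>1 \<G> *v w1 t \<omega>) \<bullet> (blk4 (p t \<omega>) + blk5 (p t \<omega>)))"
      unfolding inner_symmetric_commute[OF sym(9), of "u\<^sub>r t \<omega>" "w1 t \<omega>"]
      unfolding u\<^sub>\<alpha>_def u\<^sub>\<beta>_def u\<^sub>r_def mult_vec_neg
        control_weight_mult[OF weights_definite(1)] control_weight_mult[OF weights_definite(2)]
        control_weight_mult[OF weights_definite(3)] inner_minus_right inner_transpose_mult by simp_all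
    show ?thesis
      unfolding c drift_duality[OF refl] DP_mat_def DN_mat_def MP_vec_def MN_vec_def
        weight_duality[OF sym(1-3), where z' = "dz t \<omega>"] \<Theta>_def k\<alpha>_def k\<beta>_def e1_def e\<alpha>_def e\<beta>_def error\<^sub>\<alpha>_def error\<^sub>\<beta>_def
      by (simp add: inner_diff_right[of "dz t \<omega> - d1 t \<omega>"] inner_add_right del: transpose_matrix_vector)
  qed
  have terminal: "?Y T \<omega> \<bullet> (EP_mat \<G> *v x T \<omega> + hP_vec \<G>)
      = (dz T \<omega> - d1 T \<omega>) \<bullet> \<Theta>T \<omega> + l\<alpha> \<omega> \<bullet> (Qb\<^sub>\<alpha> \<G> *v t\<alpha> \<omega>) + l\<beta> \<omega> \<bullet> (Qb\<^sub>\<beta> \<G> *v t\<beta> \<omega>)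
        + s\<^sub>P T \<omega> \<bullet> (Qb\<^sub>1 \<G> *v t1 \<omega>)" for \<omega>
    unfolding EP_mat_def EN_mat_def hP_vec_def hN_vec_def
      weight_duality[OF sym(4-6), where z' = "dz T \<omega>"] \<Theta>T_def l\<alpha>_def l\<beta>_def t1_def t\<alpha>_def t\<beta>_def terminal_error\<^sub>\<alpha>_def terminal_error\<^sub>\<beta>_def
    by simp
  have K\<alpha>: "lq_space k\<alpha> wa l\<alpha>" and K\<beta>: "lq_space k\<beta> wb l\<beta>" and K1: "lq_space e1 w1 t1"
    unfolding lq_space_def k\<alpha>_def k\<beta>_def l\<alpha>_def l\<beta>_def e1_def t1_def
    by (intro conjI sqi_diff sqi_mult_vec sq[OF d(1)] sq[OF d(2)] sq[OF d(3)] sq[OF d(4)] sq[OF d(5)] sq[OF d(6)] sq[OF d(7)] dT)+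
  have ks: "square_integrable_process T M k\<alpha>" "square_integrable_process T M wa" "square_integrable_rv M l\<alpha>"
    "square_integrable_process T M k\<beta>" "square_integrable_process T M wb" "square_integrable_rv M l\<beta>"
    "square_integrable_process T M e1" "square_integrable_process T M w1" "square_integrable_rv M t1"
    using K\<alpha> K\<beta> K1 unfolding lq_space_def by auto
  note ii = sqi_inner_integrable
  have iN: "integrable N (\<lambda>q. (dz (fst q) (snd q) - d1 (fst q) (snd q)) \<bullet> \<Theta> (fst q) (snd q))"
    "integrable N (\<lambda>q. k\<alpha> (fst q) (snd q) \<bullet> (Q\<^sub>\<alpha> \<G> *v e\<alpha> (fst q) (snd q)))"
    "integrable N (\<lambda>q. wa (fst q) (snd q) \<bullet> (R\<^sub>\<alpha> \<G> *v u\<^sub>\<alpha> (fst q) (snd q)))"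
    "integrable N (\<lambda>q. k\<beta> (fst q) (snd q) \<bullet> (Q\<^sub>\<beta> \<G> *v e\<beta> (fst q) (snd q)))"
    "integrable N (\<lambda>q. wb (fst q) (snd q) \<bullet> (R\<^sub>\<beta> \<G> *v u\<^sub>\<beta> (fst q) (snd q)))"
    "integrable N (\<lambda>q. s\<^sub>P (fst q) (snd q) \<bullet> (Q\<^sub>1 \<G> *v e1 (fst q) (snd q)))"
    "integrable N (\<lambda>q. u\<^sub>r (fst q) (snd q) \<bullet> (R\<^sub>1 \<G> *v w1 (fst q) (snd q)))"
    by (rule ii[OF sqi_diff[OF sq[OF d(3)] sq[OF d(4)]] sq[OF \<Theta>]],
        rule ii[OF ks(1) sqi_mult_vec[OF sq[OF e_ad(1)]]], rule ii[OF ks(2) sqi_mult_vec[OF sq[OF controls_adapted(1)]]],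
        rule ii[OF ks(4) sqi_mult_vec[OF sq[OF e_ad(2)]]], rule ii[OF ks(5) sqi_mult_vec[OF sq[OF controls_adapted(2)]]],
        rule ii[OF sq[OF blocks_adapted(4)] sqi_mult_vec[OF ks(7)]], rule ii[OF sq[OF controls_adapted(4)] sqi_mult_vec[OF ks(8)]])
  have iM: "integrable M (\<lambda>\<omega>. (dz T \<omega> - d1 T \<omega>) \<bullet> \<Theta>T \<omega>)" "integrable M (\<lambda>\<omega>. l\<alpha> \<omega> \<bullet> (Qb\<^sub>\<alpha> \<G> *v t\<alpha> \<omega>))"
    "integrable M (\<lambda>\<omega>. l\<beta> \<omega> \<bullet> (Qb\<^sub>\<beta> \<G> *v t\<beta> \<omega>))" "integrable M (\<lambda>\<omega>. s\<^sub>P T \<omega> \<bullet> (Qb\<^sub>1 \<G> *v t1 \<omega>))"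
    by (rule ii[OF sqi_diff[OF dT(3) dT(4)] \<Theta>T(2)], rule ii[OF ks(3) sqi_mult_vec[OF st_T(1)]],
        rule ii[OF ks(6) sqi_mult_vec[OF st_T(2)]], rule ii[OF st_T(3) sqi_mult_vec[OF ks(9)]])
  \<comment> \<open>Running and terminal parts of the duality are regrouped by player. The
    follower's summand, the multiplier paired with the change of his errors, is the contribution of
    the constraint.\<close>
  have cross: "form\<^sub>\<alpha> k\<alpha> wa l\<alpha> e\<alpha> u\<^sub>\<alpha> t\<alpha> + form\<^sub>\<beta> k\<beta> wb l\<beta> e\<beta> u\<^sub>\<beta> t\<beta> + follower_form s\<^sub>P u\<^sub>r (s\<^sub>P T) e1 w1 t1 = 0"
    using adjoint_duality[OF fG Y Y_eq] unfolding running terminal form\<^sub>\<alpha>_def form\<^sub>\<beta>_def follower_form_def lq_form_def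
    using iN iM zero_N zero_T by simp
  \<comment> \<open>The multiplier solves the follower's homogeneous equation, so his first-order
    conditions may be tested with it.\<close>
  have test: "follower_test u\<^sub>r s\<^sub>P"
    unfolding follower_test_def using lift[OF controls_adapted(4)] lift[OF blocks_adapted(4)] s\<^sub>P_eq by blast
  have S: "lq_space s\<^sub>P u\<^sub>r (s\<^sub>P T)"
    unfolding lq_space_def by (intro conjI sq[OF blocks_adapted(4)] sq[OF controls_adapted(4)] st_T(3))
  note X1 = follower_lq_space[OF blocks_sqi(1-3) x1(2) sq[OF u1]]
  \<comment> \<open>Errors are affine in the states, so \<open>e1\<close>, \<open>w1\<close>,
    \<open>t1\<close> are exactly the changes between the two responses. The first-order conditions
    at both of them make the form with the multiplier vanish.\<close>
  have "follower_error y1 ya yb zv = (\<lambda>t \<omega>. follower_error x1 x\<^sub>\<alpha> x\<^sub>\<beta> z\<^sub>P t \<omega> + e1 t \<omega>)" "v1 = (\<lambda>t \<omega>. u1 t \<omega> + w1 t \<omega>)"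
    "follower_terminal_error y1 ya yb zv = (\<lambda>\<omega>. follower_terminal_error x1 x\<^sub>\<alpha> x\<^sub>\<beta> z\<^sub>P \<omega> + t1 \<omega>)"
    by (simp_all add: fun_eq_iff follower_error_def follower_terminal_error_def e1_def t1_def d_defs
        matrix_vector_mult_diff_distrib algebra_simps)
  then have "follower_form s\<^sub>P u\<^sub>r (s\<^sub>P T) e1 w1 t1 = 0"
    using foc_v[unfolded follower_foc_def, rule_format, OF test] foc[unfolded follower_foc_def, rule_format, OF test]
      lq_form_add_right[OF S X1 K1, of "Q\<^sub>1 \<G>" "R\<^sub>1 \<G>" "Qb\<^sub>1 \<G>"]
    unfolding follower_form_def by simp
  with cross have cross0: "form\<^sub>\<alpha> k\<alpha> wa l\<alpha> e\<alpha> u\<^sub>\<alpha> t\<alpha> + form\<^sub>\<beta> k\<beta> wb l\<beta> e\<beta> u\<^sub>\<beta> t\<beta> = 0" by simp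
  have X\<alpha>: "lq_space e\<alpha> u\<^sub>\<alpha> t\<alpha>" and X\<beta>: "lq_space e\<beta> u\<^sub>\<beta> t\<beta>"
    unfolding e\<alpha>_def e\<beta>_def t\<alpha>_def t\<beta>_def
    by (rule leader_lq_space(1)[OF blocks_sqi(1-3) sq[OF controls_adapted(1)]],
        rule leader_lq_space(2)[OF blocks_sqi(1-3) sq[OF controls_adapted(2)]])
  have split: "error\<^sub>\<alpha> ya yb zv = (\<lambda>t \<omega>. e\<alpha> t \<omega> + 1 *\<^sub>R k\<alpha> t \<omega>)" "va = (\<lambda>t \<omega>. u\<^sub>\<alpha> t \<omega> + 1 *\<^sub>R wa t \<omega>)"
    "terminal_error\<^sub>\<alpha> ya yb zv = (\<lambda>\<omega>. t\<alpha> \<omega> + 1 *\<^sub>R l\<alpha> \<omega>)"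
    "error\<^sub>\<beta> ya yb zv = (\<lambda>t \<omega>. e\<beta> t \<omega> + 1 *\<^sub>R k\<beta> t \<omega>)" "vb = (\<lambda>t \<omega>. u\<^sub>\<beta> t \<omega> + 1 *\<^sub>R wb t \<omega>)"
    "terminal_error\<^sub>\<beta> ya yb zv = (\<lambda>\<omega>. t\<beta> \<omega> + 1 *\<^sub>R l\<beta> \<omega>)"
    by (simp_all add: fun_eq_iff error\<^sub>\<alpha>_def error\<^sub>\<beta>_def terminal_error\<^sub>\<alpha>_def terminal_error\<^sub>\<beta>_def e\<alpha>_def e\<beta>_def t\<alpha>_def t\<beta>_def
        k\<alpha>_def k\<beta>_def l\<alpha>_def l\<beta>_def d_defs matrix_vector_mult_diff_distrib algebra_simps)
  \<comment> \<open>The expansion is taken at c = 1; its linear term will cancel against that of the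
    other leader.\<close>
  have c\<alpha>: "cost\<^sub>\<alpha> va ya yb zv = cost\<^sub>\<alpha> u\<^sub>\<alpha> x\<^sub>\<alpha> x\<^sub>\<beta> z\<^sub>P + 2 * form\<^sub>\<alpha> k\<alpha> wa l\<alpha> e\<alpha> u\<^sub>\<alpha> t\<alpha> + form\<^sub>\<alpha> k\<alpha> wa l\<alpha> k\<alpha> wa l\<alpha>"
    using lq_form_expand[OF sym(1,7,4) X\<alpha> K\<alpha>, of 1, folded split(1-3)]
    unfolding cost\<^sub>\<alpha>_def form\<^sub>\<alpha>_def e\<alpha>_def t\<alpha>_def by simp
  have c\<beta>: "cost\<^sub>\<beta> vb ya yb zv = cost\<^sub>\<beta> u\<^sub>\<beta> x\<^sub>\<alpha> x\<^sub>\<beta> z\<^sub>P + 2 * form\<^sub>\<beta> k\<beta> wb l\<beta> e\<beta> u\<^sub>\<beta> t\<beta> + form\<^sub>\<beta> k\<beta> wb l\<beta> k\<beta> wb l\<beta>"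
    using lq_form_expand[OF sym(2,8,5) X\<beta> K\<beta>, of 1, folded split(4-6)]
    unfolding cost\<^sub>\<beta>_def form\<^sub>\<beta>_def e\<beta>_def t\<beta>_def by simp
  have n: "(\<integral>q. wa (fst q) (snd q) \<bullet> (R\<^sub>\<alpha> \<G> *v wa (fst q) (snd q)) \<partial>N) \<le> form\<^sub>\<alpha> k\<alpha> wa l\<alpha> k\<alpha> wa l\<alpha>"
    "(\<integral>q. wb (fst q) (snd q) \<bullet> (R\<^sub>\<beta> \<G> *v wb (fst q) (snd q)) \<partial>N) \<le> form\<^sub>\<beta> k\<beta> wb l\<beta> k\<beta> wb l\<beta>"
    unfolding form\<^sub>\<alpha>_def form\<^sub>\<beta>_def
    by (rule lq_form_nonneg(2)[OF weights_nonneg(1,7,4)], rule lq_form_nonneg(2)[OF weights_nonneg(2,8,5)])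
  show ?thesis using n cross0 unfolding c\<alpha> c\<beta> wa_def wb_def by linarith
qed

lemma positive_form_zero:
  fixes w :: "real \<Rightarrow> 'w \<Rightarrow> real ^ 'm"
  assumes R: "pos_definite R" and w: "square_integrable_process T M w"
    and z: "(\<integral>q. w (fst q) (snd q) \<bullet> (R *v w (fst q) (snd q)) \<partial>N) \<le> 0"
  shows "AE q in N. w (fst q) (snd q) = 0"
proof -
  have i: "integrable N (\<lambda>q. w (fst q) (snd q) \<bullet> (R *v w (fst q) (snd q)))"
    by (rule sqi_inner_integrable[OF w sqi_mult_vec[OF w]])
  have "0 \<le> (\<integral>q. w (fst q) (snd q) \<bullet> (R *v w (fst q) (snd q)) \<partial>N)"
    using pos_definite_D(2)[OF R] by simp
  then have "(\<integral>q. w (fst q) (snd q) \<bullet> (R *v w (fst q) (snd q)) \<partial>N) = 0" using z by simp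
  then have "AE q in N. w (fst q) (snd q) \<bullet> (R *v w (fst q) (snd q)) = 0"
    using integral_nonneg_eq_0_iff_AE[OF i] pos_definite_D(2)[OF R] by simp
  then show ?thesis by eventually_elim (rule pos_definite_D(3)[OF R])
qed

text \<open>One inequality gives both claims: the total cost of any pair exceeds that of the
  candidate by at least the control energy of the difference, which is nonnegative and vanishes only
  if the controls agree almost everywhere.\<close>

lemma pareto_characterisation:
  assumes wp: "well_posed \<G> \<N>"
  shows "pareto_optimal \<G> \<N> u\<^sub>\<alpha> u\<^sub>\<beta>"
    and "pareto_optimal \<G> \<N> va vb \<Longrightarrow> AE (t, \<omega>) in N. va t \<omega> = u\<^sub>\<alpha> t \<omega> \<and> vb t \<omega> = u\<^sub>\<beta> t \<omega>"
proof -
  have adm_u: "admissible_pair \<G> \<N> u\<^sub>\<alpha> u\<^sub>\<beta>" unfolding admissible_pair_def using controls_adapted by simp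
  have ex: "\<exists>xa xb z. response \<G> \<N> va vb xa xb z" if "admissible_pair \<G> \<N> va vb" for va vb
    using wp that unfolding well_posed_def by meson
  \<comment> \<open>Well-posedness supplies some response to these controls, whose follower
    fluctuation is then transplanted to the FBSDE.\<close>
  have resp: "response \<G> \<N> u\<^sub>\<alpha> u\<^sub>\<beta> x\<^sub>\<alpha> x\<^sub>\<beta> z\<^sub>P"
    using ex[OF adm_u] response_of_solution by blast
  let ?c = "cost\<^sub>\<alpha> u\<^sub>\<alpha> x\<^sub>\<alpha> x\<^sub>\<beta> z\<^sub>P + cost\<^sub>\<beta> u\<^sub>\<beta> x\<^sub>\<alpha> x\<^sub>\<beta> z\<^sub>P"
  have Ju: "J\<^sub>\<alpha> \<G> \<N> u\<^sub>\<alpha> u\<^sub>\<beta> + J\<^sub>\<beta> \<G> \<N> u\<^sub>\<beta> u\<^sub>\<alpha> = ennreal ?c"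
    unfolding leader_costs_eq[OF wp adm_u resp] by (rule ennreal_plus[symmetric, OF costs_nonneg])
  let ?qa = "\<lambda>va. \<integral>z. (va (fst z) (snd z) - u\<^sub>\<alpha> (fst z) (snd z)) \<bullet> (R\<^sub>\<alpha> \<G> *v (va (fst z) (snd z) - u\<^sub>\<alpha> (fst z) (snd z))) \<partial>N"
  let ?qb = "\<lambda>vb. \<integral>z. (vb (fst z) (snd z) - u\<^sub>\<beta> (fst z) (snd z)) \<bullet> (R\<^sub>\<beta> \<G> *v (vb (fst z) (snd z) - u\<^sub>\<beta> (fst z) (snd z))) \<partial>N"
  have nn: "0 \<le> ?qa va" "0 \<le> ?qb vb" for va vb using weights_nonneg(7,8) by simp_all
  have Jv: "\<exists>c. J\<^sub>\<alpha> \<G> \<N> va vb + J\<^sub>\<beta> \<G> \<N> vb va = ennreal c \<and> 0 \<le> c \<and> ?qa va + ?qb vb + ?c \<le> c"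
    if adm: "admissible_pair \<G> \<N> va vb" for va vb
  proof -
    obtain ya yb zv where r: "response \<G> \<N> va vb ya yb zv" using ex[OF adm] by blast
    have "J\<^sub>\<alpha> \<G> \<N> va vb + J\<^sub>\<beta> \<G> \<N> vb va = ennreal (cost\<^sub>\<alpha> va ya yb zv + cost\<^sub>\<beta> vb ya yb zv)"
      unfolding leader_costs_eq[OF wp adm r] by (rule ennreal_plus[symmetric, OF costs_nonneg])
    then show ?thesis using cost_difference[OF resp adm r] add_nonneg_nonneg[OF costs_nonneg] by blast
  qed
  show opt: "pareto_optimal \<G> \<N> u\<^sub>\<alpha> u\<^sub>\<beta>"
    unfolding pareto_optimal_def
  proof (intro conjI adm_u allI impI)
    fix va vb assume "admissible_pair \<G> \<N> va vb"
    then obtain c where c: "J\<^sub>\<alpha> \<G> \<N> va vb + J\<^sub>\<beta> \<G> \<N> vb va = ennreal c" "?qa va + ?qb vb + ?c \<le> c" using Jv by blast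
    show "J\<^sub>\<alpha> \<G> \<N> u\<^sub>\<alpha> u\<^sub>\<beta> + J\<^sub>\<beta> \<G> \<N> u\<^sub>\<beta> u\<^sub>\<alpha> \<le> J\<^sub>\<alpha> \<G> \<N> va vb + J\<^sub>\<beta> \<G> \<N> vb va"
      unfolding Ju c(1) by (rule ennreal_leI) (use c(2) nn(1)[of va] nn(2)[of vb] in linarith)
  qed
  assume v: "pareto_optimal \<G> \<N> va vb"
  then have adm: "admissible_pair \<G> \<N> va vb" unfolding pareto_optimal_def by simp
  then have sv: "square_integrable_process T M va" "square_integrable_process T M vb"
    unfolding admissible_pair_def by (auto intro: L2_adapted_sqi)
  obtain c where c: "J\<^sub>\<alpha> \<G> \<N> va vb + J\<^sub>\<beta> \<G> \<N> vb va = ennreal c" "?qa va + ?qb vb + ?c \<le> c" using Jv[OF adm] by blast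
  have "J\<^sub>\<alpha> \<G> \<N> va vb + J\<^sub>\<beta> \<G> \<N> vb va \<le> J\<^sub>\<alpha> \<G> \<N> u\<^sub>\<alpha> u\<^sub>\<beta> + J\<^sub>\<beta> \<G> \<N> u\<^sub>\<beta> u\<^sub>\<alpha>"
    using v adm_u unfolding pareto_optimal_def by blast
  then have "ennreal c \<le> ennreal ?c" unfolding Ju c(1) .
  then have "c \<le> ?c" by (subst (asm) ennreal_le_iff) (rule add_nonneg_nonneg[OF costs_nonneg])
  \<comment> \<open>Equal total costs leave no room for the two energies, and both are nonnegative,
    so each of them is zero.\<close>
  then have "?qa va \<le> 0" "?qb vb \<le> 0" using c(2) nn(1)[of va] nn(2)[of vb] by linarith+
  then have "AE q in N. va (fst q) (snd q) - u\<^sub>\<alpha> (fst q) (snd q) = 0" "AE q in N. vb (fst q) (snd q) - u\<^sub>\<beta> (fst q) (snd q) = 0"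
    using positive_form_zero[OF weights_definite(1), where w = "\<lambda>t \<omega>. va t \<omega> - u\<^sub>\<alpha> t \<omega>"]
      positive_form_zero[OF weights_definite(2), where w = "\<lambda>t \<omega>. vb t \<omega> - u\<^sub>\<beta> t \<omega>"]
      sqi_diff[OF sv(1) L2_adapted_sqi[OF controls_adapted(1)]] sqi_diff[OF sv(2) L2_adapted_sqi[OF controls_adapted(2)]]
    by blast+
  then show "AE (t, \<omega>) in N. va t \<omega> = u\<^sub>\<alpha> t \<omega> \<and> vb t \<omega> = u\<^sub>\<beta> t \<omega>"
    unfolding case_prod_beta by eventually_elim simp
qed

end

theorem theorem3p4:
  fixes \<G> :: "('na::finite, 'nb::finite, 'n1::finite, 'ma::finite, 'mb::finite, 'm1::finite,
                'da::finite, 'db::finite, 'd1::finite) game"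
    and \<N> :: "('w, 'na, 'nb, 'n1, 'da, 'db, 'd1) noise"
    and x p :: "real \<Rightarrow> 'w \<Rightarrow> real ^ ('na + 'nb + 'n1 + 'n1 + 'n1)"
    and Z :: "real \<Rightarrow> 'w \<Rightarrow> real ^ ('da + 'db) ^ ('na + 'nb + 'n1 + 'n1 + 'n1)"
  assumes coefficients: "game_coefficients \<G>"
    and noise: "driving_noise \<N>"
    and well_posed: "well_posed \<G> \<N>"
    and solution: "pareto_fbsde \<G> \<N> x p Z"
    and unique: "\<And>x' p' Z'. pareto_fbsde \<G> \<N> x' p' Z' \<Longrightarrow>
           modification (horizon \<G>) (prob_measure \<N>) x' x \<and>
           modification (horizon \<G>) (prob_measure \<N>) p' p \<and>
           (AE (t, \<omega>) in time_prob (horizon \<G>) (prob_measure \<N>). Z' t \<omega> = Z t \<omega>)"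
  shows "let u\<^sub>\<alpha> = (\<lambda>t \<omega>. - ((matrix_inv (R\<^sub>\<alpha> \<G>) ** transpose (D\<^sub>\<alpha> \<G>)) *v head_block (p t \<omega>)));
             u\<^sub>\<beta> = (\<lambda>t \<omega>. - ((matrix_inv (R\<^sub>\<beta> \<G>) ** transpose (D\<^sub>\<beta> \<G>)) *v head_block (tail_block (p t \<omega>))))
         in pareto_optimal \<G> \<N> u\<^sub>\<alpha> u\<^sub>\<beta> \<and>
            (\<forall>v\<^sub>\<alpha> v\<^sub>\<beta>. pareto_optimal \<G> \<N> v\<^sub>\<alpha> v\<^sub>\<beta> \<longrightarrow>
               (AE (t, \<omega>) in time_prob (horizon \<G>) (prob_measure \<N>).
                  v\<^sub>\<alpha> t \<omega> = u\<^sub>\<alpha> t \<omega> \<and> v\<^sub>\<beta> t \<omega> = u\<^sub>\<beta> t \<omega>))"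
proof -
  interpret fbsde_solution \<G> \<N> x p Z
    by unfold_locales (fact coefficients noise solution)+
  show ?thesis
    using pareto_characterisation[OF well_posed] unfolding Let_def u\<^sub>\<alpha>_def[abs_def] u\<^sub>\<beta>_def[abs_def] by blast
qed

end
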